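(* Let $\Omega\subseteq\mathbb R^n$ be an open, bounded, connected, polytopal Lipschitz domain and let $\mathcal T$ be a partition of $\overline\Omega$ into convex polytopes with maximal element diameter $h=\max_{T\in\mathcal T}\operatorname{diam}(T)$. Let $A$ be a symmetric $n\times n$ matrix field with $L^\infty(\Omega)$ entries and $\gamma\in L^\infty(\Omega)$, both piecewise constant with respect to $\mathcal T$, such that a.e. in $\Omega$ $$a_0|\xi|^2\le\xi^TA\xi\le a_1|\xi|^2\ \ \forall\xi\in\mathbb R^n,\qquad 0\le\gamma_0\le\gamma\le\gamma_1,$$ with real numbers $0<a_0\le a_1<\infty$ and $\gamma_0,\gamma_1$. Let $\Sigma=H(\operatorname{div},\Omega)$, $U=L^2(\Omega)$, and let $\Sigma_h\subseteq\Sigma$ and $U_h\subseteq U$ be finite-dimensional subspaces that are inf-sup stable, i.e. $$0<\inf_{v_h\in U_h\setminus\{0\}}\sup_{\tau_h\in\Sigma_h\setminus\{0\}}\frac{(\operatorname{div}\tau_h,v_h)_{L^2(\Omega)}}{\|\tau_h\|_{H(\operatorname{div},\Omega)}\|v_h\|_{L^2(\Omega)}},$$ with $P_0(\mathcal T)\subseteq U_h$ and $\operatorname{div}\Sigma_h\subseteq U_h$, and such that $U_h=\prod_{T\in\mathcal T}V_T$ with subspaces $V_T\subseteq L^2(T)$ (where $L^2(T)\subseteq L^2(\Omega)$ through extension by zero). Then, for every $J\in\{1,\dots,\dim U_h\}$, the $J$th eigenvalue $\lambda_J$ and the $J$th discrete eigenvalue $\lambda_{J,h}$ (defined in the context) satisfy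 $$\frac{\lambda_{J,h}}{1+\lambda_{J,h}h^2/(a_0\pi^2)}\le\lambda_J .$$
   Context: $H(\operatorname{div},\Omega)$ is the space of vector fields in $[L^2(\Omega)]^n$ with distributional divergence in $L^2(\Omega)$. $P_0(\mathcal T)$ is the space of functions that are constant on each $T\in\mathcal T$. Continuous problem: find $(\lambda,u)\in\mathbb R\times U$, $u\ne0$, such that with $\sigma\in\Sigma$ $$(\sigma,A^{-1}\tau)_{L^2(\Omega)}+(\operatorname{div}\tau,u)_{L^2(\Omega)}=0\ \ \forall\tau\in\Sigma,\qquad(\operatorname{div}\sigma,v)_{L^2(\Omega)}-(u,\gamma v)_{L^2(\Omega)}=-\lambda(u,v)_{L^2(\Omega)}\ \ \forall v\in U.$$ Its eigenvalues, enumerated with multiplicity as $0<\lambda_1\le\lambda_2\le\cdots$, are those of $-\operatorname{div}(A\nabla u)+\gamma u=\lambda u$ in $\Omega$, $u=0$ on $\partial\Omega$ (with $\sigma=A\nabla u$). Discrete problem: find $(\lambda_h,u_h)\in\mathbb R\times U_h$, $\|u_h\|_{L^2(\Omega)}=1$, such that with $\sigma_h\in\Sigma_h$ $$(\sigma_h,A^{-1}\tau_h)_{L^2(\Omega)}+(\operatorname{div}\tau_h,u_h)_{L^2(\Omega)}=0\ \ \forall\tau_h\in\Sigma_h,\qquad(\operatorname{div}\sigma_h,v_h)_{L^2(\Omega)}-(u_h,\gamma v_h)_{L^2(\Omega)}=-\lambda_h(u_h,v_h)_{L^2(\Omega)}\ \ \forall v_h\in U_h.$$ Its eigenvalues are enumerated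 with multiplicity as $0<\lambda_{1,h}\le\lambda_{2,h}\le\cdots$. *)

theory Defs
  imports "HOL-Analysis.Analysis"
begin

section \<open>Square-integrable functions modulo null sets\<close>

definition sq_integrable :: "('a::euclidean_space \<Rightarrow> 'b::euclidean_space) \<Rightarrow> bool" where
  "sq_integrable f \<longleftrightarrow>
     f \<in> borel_measurable lebesgue \<and> integrable lebesgue (\<lambda>x. (norm (f x))\<^sup>2)"

lemma sq_integrable_0: "sq_integrable (\<lambda>x. 0)"
  by (simp add: sq_integrable_def)

lemma sq_integrable_scaleR:
  assumes "sq_integrable f"
  shows "sq_integrable (\<lambda>x. c *\<^sub>R f x)"
  using assms by (auto simp: sq_integrable_def power_mult_distrib)

lemma sq_integrable_add:
  assumes "sq_integrable f" "sq_integrable g"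
  shows "sq_integrable (\<lambda>x. f x + g x)"
proof -
  have m [measurable]: "f \<in> borel_measurable lebesgue" "g \<in> borel_measurable lebesgue"
    using assms by (auto simp: sq_integrable_def)
  have "integrable lebesgue (\<lambda>x. (norm (f x + g x))\<^sup>2)"
  proof (rule Bochner_Integration.integrable_bound)
    show "integrable lebesgue (\<lambda>x. 2 * (norm (f x))\<^sup>2 + 2 * (norm (g x))\<^sup>2)"
      using assms by (auto simp: sq_integrable_def)
    show "AE x in lebesgue. norm ((norm (f x + g x))\<^sup>2)
            \<le> norm (2 * (norm (f x))\<^sup>2 + 2 * (norm (g x))\<^sup>2)"
    proof (rule AE_I2)
      fix x
      have "(norm (f x + g x))\<^sup>2 \<le> (norm (f x) + norm (g x))\<^sup>2"
        by (simp add: norm_triangle_ineq power_mono)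
      also have "\<dots> \<le> 2 * (norm (f x))\<^sup>2 + 2 * (norm (g x))\<^sup>2"
        using sum_squares_bound[of "norm (f x)" "norm (g x)"] by (simp add: power2_sum)
      finally show "norm ((norm (f x + g x))\<^sup>2) \<le> norm (2 * (norm (f x))\<^sup>2 + 2 * (norm (g x))\<^sup>2)"
        by simp
    qed
  qed measurable
  then show ?thesis by (simp add: sq_integrable_def)
qed

lemma sq_integrable_inner:
  assumes "sq_integrable f" "sq_integrable g"
  shows "integrable lebesgue (\<lambda>x. f x \<bullet> g x)"
proof -
  have m [measurable]: "f \<in> borel_measurable lebesgue" "g \<in> borel_measurable lebesgue"
    using assms by (auto simp: sq_integrable_def)
  show ?thesis
  proof (rule Bochner_Integration.integrable_bound)
    show "integrable lebesgue (\<lambda>x. (norm (f x))\<^sup>2 + (norm (g x))\<^sup>2)"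
      using assms by (auto simp: sq_integrable_def)
    show "AE x in lebesgue. norm (f x \<bullet> g x) \<le> norm ((norm (f x))\<^sup>2 + (norm (g x))\<^sup>2)"
    proof (rule AE_I2)
      fix x
      have "norm (f x \<bullet> g x) \<le> norm (f x) * norm (g x)"
        by (simp add: Cauchy_Schwarz_ineq2)
      also have "\<dots> \<le> (norm (f x))\<^sup>2 + (norm (g x))\<^sup>2"
        using sum_squares_bound[of "norm (f x)" "norm (g x)"]
          mult_nonneg_nonneg[OF norm_ge_zero[of "f x"] norm_ge_zero[of "g x"]] by linarith
      finally show "norm (f x \<bullet> g x) \<le> norm ((norm (f x))\<^sup>2 + (norm (g x))\<^sup>2)"
        by simp
    qed
  qed measurable
qed

text \<open>The type \<open>('a, 'b) lsq\<close> is the space of square-integrable functions from all of \<open>'a\<close> to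
  \<open>'b\<close>, modulo equality almost everywhere.  The space over a subset \<open>S\<close> is the subspace
  \<open>L2_on S\<close> below, i.e. functions on \<open>S\<close> are identified with their extension by zero.\<close>

quotient_type (overloaded) ('a, 'b) lsq = "'a::euclidean_space \<Rightarrow> 'b::euclidean_space" / partial:
  "\<lambda>f g. sq_integrable f \<and> sq_integrable g \<and> (AE x in lebesgue. f x = g x)"
proof (rule part_equivpI)
  show "\<exists>f::'a \<Rightarrow> 'b. sq_integrable f \<and> sq_integrable f \<and> (AE x in lebesgue. f x = f x)"
    using sq_integrable_0 by auto
  show "symp (\<lambda>f g::'a \<Rightarrow> 'b. sq_integrable f \<and> sq_integrable g \<and> (AE x in lebesgue. f x = g x))"
    by (auto intro!: sympI)
  show "transp (\<lambda>f g::'a \<Rightarrow> 'b. sq_integrable f \<and> sq_integrable g \<and> (AE x in lebesgue. f x = g x))"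
    by (auto intro!: transpI)
qed

instantiation lsq :: (euclidean_space, euclidean_space) real_vector
begin

lift_definition zero_lsq :: "('a, 'b) lsq" is "\<lambda>x. 0"
  by (simp add: sq_integrable_0)

lift_definition plus_lsq :: "('a, 'b) lsq \<Rightarrow> ('a, 'b) lsq \<Rightarrow> ('a, 'b) lsq"
  is "\<lambda>f g x. f x + g x"
  by (auto intro: sq_integrable_add)

lift_definition scaleR_lsq :: "real \<Rightarrow> ('a, 'b) lsq \<Rightarrow> ('a, 'b) lsq"
  is "\<lambda>c f x. c *\<^sub>R f x"
  by (auto intro: sq_integrable_scaleR)

definition uminus_lsq :: "('a, 'b) lsq \<Rightarrow> ('a, 'b) lsq" where
  "uminus_lsq u = (-1) *\<^sub>R u"

definition minus_lsq :: "('a, 'b) lsq \<Rightarrow> ('a, 'b) lsq \<Rightarrow> ('a, 'b) lsq" where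
  "minus_lsq u v = u + (- v)"

instance
proof
  fix u v w :: "('a, 'b) lsq" and a b :: real
  show "u + v + w = u + (v + w)"
    by transfer (auto intro!: sq_integrable_add simp: add.assoc)
  show "u + v = v + u"
    by transfer (auto intro!: sq_integrable_add simp: add.commute)
  show "0 + u = u"
    by transfer (auto intro!: sq_integrable_add)
  show "- u + u = 0"
    unfolding uminus_lsq_def
    by transfer (auto intro!: sq_integrable_add sq_integrable_0
        sq_integrable_scaleR[where c = "-1", simplified])
  show "u - v = u + (- v)"
    by (simp add: minus_lsq_def)
  show "a *\<^sub>R (u + v) = a *\<^sub>R u + a *\<^sub>R v"
    by transfer (auto intro!: sq_integrable_add sq_integrable_scaleR simp: scaleR_add_right)
  show "(a + b) *\<^sub>R u = a *\<^sub>R u + b *\<^sub>R u"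
    by transfer (auto intro!: sq_integrable_add sq_integrable_scaleR simp: scaleR_add_left)
  show "a *\<^sub>R b *\<^sub>R u = (a * b) *\<^sub>R u"
    by transfer (auto intro!: sq_integrable_scaleR sq_integrable_scaleR[where c = "a * b" for a b, simplified])
  show "1 *\<^sub>R u = u"
    by transfer auto
qed

end

instantiation lsq :: (euclidean_space, euclidean_space) real_inner
begin

lift_definition inner_lsq :: "('a, 'b) lsq \<Rightarrow> ('a, 'b) lsq \<Rightarrow> real"
  is "\<lambda>f g. LINT x|lebesgue. f x \<bullet> g x"
proof -
  fix f f' g g' :: "'a \<Rightarrow> 'b"
  assume *: "sq_integrable f \<and> sq_integrable f' \<and> (AE x in lebesgue. f x = f' x)"
    "sq_integrable g \<and> sq_integrable g' \<and> (AE x in lebesgue. g x = g' x)"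
  show "(LINT x|lebesgue. f x \<bullet> g x) = (LINT x|lebesgue. f' x \<bullet> g' x)"
  proof (rule integral_cong_AE)
    show "AE x in lebesgue. f x \<bullet> g x = f' x \<bullet> g' x"
      using * by auto
  qed (use * in \<open>auto intro!: borel_measurable_integrable sq_integrable_inner\<close>)
qed

definition norm_lsq :: "('a, 'b) lsq \<Rightarrow> real" where
  "norm_lsq u = sqrt (u \<bullet> u)"

definition sgn_lsq :: "('a, 'b) lsq \<Rightarrow> ('a, 'b) lsq" where
  "sgn_lsq u = u /\<^sub>R norm u"

definition dist_lsq :: "('a, 'b) lsq \<Rightarrow> ('a, 'b) lsq \<Rightarrow> real" where
  "dist_lsq u v = norm (u - v)"

definition uniformity_lsq :: "(('a, 'b) lsq \<times> ('a, 'b) lsq) filter" where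
  "uniformity_lsq = (INF e\<in>{0<..}. principal {(u, v). dist u v < e})"

definition open_lsq :: "('a, 'b) lsq set \<Rightarrow> bool" where
  "open_lsq S \<longleftrightarrow> (\<forall>u\<in>S. \<forall>\<^sub>F (u', v) in uniformity. u' = u \<longrightarrow> v \<in> S)"

instance
proof
  fix u v w :: "('a, 'b) lsq" and a :: real and S :: "('a, 'b) lsq set"
  show "dist u v = norm (u - v)" by (simp add: dist_lsq_def)
  show "sgn u = u /\<^sub>R norm u" by (simp add: sgn_lsq_def)
  show "uniformity = (INF e\<in>{0<..}. principal {(u, v :: ('a, 'b) lsq). dist u v < e})"
    by (simp add: uniformity_lsq_def)
  show "open S \<longleftrightarrow> (\<forall>u\<in>S. \<forall>\<^sub>F (u', v) in uniformity. u' = u \<longrightarrow> v \<in> S)"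
    by (simp add: open_lsq_def)
  show "u \<bullet> v = v \<bullet> u" by transfer (simp add: inner_commute)
  show "(u + v) \<bullet> w = u \<bullet> w + v \<bullet> w"
    by transfer (simp add: inner_add_left sq_integrable_inner)
  show "(a *\<^sub>R u) \<bullet> v = a * (u \<bullet> v)"
    by transfer simp
  show "0 \<le> u \<bullet> u" by transfer simp
  show "(u \<bullet> u = 0) = (u = 0)"
  proof transfer
    fix f :: "'a \<Rightarrow> 'b"
    assume *: "sq_integrable f \<and> sq_integrable f \<and> (AE x in lebesgue. f x = f x)"
    have "((LINT x|lebesgue. f x \<bullet> f x) = 0) \<longleftrightarrow> (AE x in lebesgue. f x \<bullet> f x = 0)"
      using * by (intro integral_nonneg_eq_0_iff_AE) (auto intro: sq_integrable_inner)
    then show "((LINT x|lebesgue. f x \<bullet> f x) = 0) =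
        (sq_integrable f \<and> sq_integrable (\<lambda>x. 0 :: 'b) \<and> (AE x in lebesgue. f x = 0))"
      using * by (simp add: sq_integrable_0)
  qed
  show "norm u = sqrt (u \<bullet> u)" by (simp add: norm_lsq_def)
qed

end

definition L2_on :: "'a::euclidean_space set \<Rightarrow> ('a, 'b::euclidean_space) lsq set" where
  "L2_on S = {u. AE x in lebesgue. x \<notin> S \<longrightarrow> rep_lsq u x = 0}"

definition Linf_on :: "'a::euclidean_space set \<Rightarrow> ('a \<Rightarrow> real) \<Rightarrow> bool" where
  "Linf_on S f \<longleftrightarrow> f \<in> borel_measurable (lebesgue_on S) \<and>
     (\<exists>C. AE x in lebesgue_on S. \<bar>f x\<bar> \<le> C)"

definition fin_dim :: "'v::real_vector set \<Rightarrow> bool" where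
  "fin_dim V \<longleftrightarrow> (\<exists>B. finite B \<and> V \<subseteq> span B)"

section \<open>Distributional divergence\<close>

primrec C_k :: "nat \<Rightarrow> ('a::euclidean_space \<Rightarrow> real) \<Rightarrow> bool" where
  "C_k 0 f \<longleftrightarrow> continuous_on UNIV f"
| "C_k (Suc k) f \<longleftrightarrow> (\<forall>x. f differentiable at x) \<and>
     (\<forall>b\<in>Basis. C_k k (\<lambda>x. frechet_derivative f (at x) b))"

definition test_function :: "'a::euclidean_space set \<Rightarrow> ('a \<Rightarrow> real) \<Rightarrow> bool" where
  "test_function \<Omega> \<phi> \<longleftrightarrow> (\<forall>k. C_k k \<phi>) \<and>
     compact (closure {x. \<phi> x \<noteq> 0}) \<and> closure {x. \<phi> x \<noteq> 0} \<subseteq> \<Omega>"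

definition grad :: "('a::euclidean_space \<Rightarrow> real) \<Rightarrow> 'a \<Rightarrow> 'a" where
  "grad \<phi> x = (\<Sum>b\<in>Basis. frechet_derivative \<phi> (at x) b *\<^sub>R b)"

definition has_weak_div ::
  "'a::euclidean_space set \<Rightarrow> ('a, 'a) lsq \<Rightarrow> ('a, real) lsq \<Rightarrow> bool" where
  "has_weak_div \<Omega> \<tau> w \<longleftrightarrow> w \<in> L2_on \<Omega> \<and>
     (\<forall>\<phi>. test_function \<Omega> \<phi> \<longrightarrow>
        (LINT x|lebesgue_on \<Omega>. rep_lsq \<tau> x \<bullet> grad \<phi> x)
          = - (LINT x|lebesgue_on \<Omega>. rep_lsq w x * \<phi> x))"

definition Hdiv :: "'a::euclidean_space set \<Rightarrow> ('a, 'a) lsq set" where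
  "Hdiv \<Omega> = {\<tau> \<in> L2_on \<Omega>. \<exists>w. has_weak_div \<Omega> \<tau> w}"

text \<open>For open \<open>\<Omega>\<close> and \<open>\<tau> \<in> Hdiv \<Omega>\<close> the description is well defined, as an element of
  \<open>L2_on \<Omega>\<close> is determined by its integrals against test functions.\<close>

definition weak_div :: "'a::euclidean_space set \<Rightarrow> ('a, 'a) lsq \<Rightarrow> ('a, real) lsq" where
  "weak_div \<Omega> \<tau> = (THE w. has_weak_div \<Omega> \<tau> w)"

definition Hdiv_norm :: "'a::euclidean_space set \<Rightarrow> ('a, 'a) lsq \<Rightarrow> real" where
  "Hdiv_norm \<Omega> \<tau> = sqrt ((norm \<tau>)\<^sup>2 + (norm (weak_div \<Omega> \<tau>))\<^sup>2)"

text \<open>Suprema and infima are taken in the extended reals, where they always exist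
  (and the supremum over the empty set is \<open>-\<infinity>\<close>).\<close>

definition inf_sup_stable ::
  "'a::euclidean_space set \<Rightarrow> ('a, 'a) lsq set \<Rightarrow> ('a, real) lsq set \<Rightarrow> bool" where
  "inf_sup_stable \<Omega> \<Sigma>\<^sub>h U\<^sub>h \<longleftrightarrow>
     0 < (INF v \<in> U\<^sub>h - {0}. SUP \<tau> \<in> \<Sigma>\<^sub>h - {0}.
            ereal ((weak_div \<Omega> \<tau> \<bullet> v) / (Hdiv_norm \<Omega> \<tau> * norm v)))"

section \<open>Domains and partitions\<close>

text \<open>Near each boundary point, \<open>\<Omega>\<close> is the strict epigraph (in some direction \<open>e\<close>) of a
  Lipschitz function \<open>g\<close> on the hyperplane orthogonal to \<open>e\<close>.\<close>

definition lipschitz_boundary :: "'a::euclidean_space set \<Rightarrow> bool" where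
  "lipschitz_boundary \<Omega> \<longleftrightarrow> (\<forall>z\<in>frontier \<Omega>. \<exists>e g L N.
     norm e = 1 \<and> L-lipschitz_on {y. y \<bullet> e = 0} g \<and> open N \<and> z \<in> N \<and>
     \<Omega> \<inter> N = {y \<in> N. g (y - (y \<bullet> e) *\<^sub>R e) < y \<bullet> e})"

definition polytopal :: "'a::euclidean_space set \<Rightarrow> bool" where
  "polytopal \<Omega> \<longleftrightarrow> (\<exists>P. finite P \<and> (\<forall>p\<in>P. polytope p) \<and> closure \<Omega> = \<Union>P)"

definition polytopal_lipschitz_domain :: "'a::euclidean_space set \<Rightarrow> bool" where
  "polytopal_lipschitz_domain \<Omega> \<longleftrightarrow> open \<Omega> \<and> bounded \<Omega> \<and> connected \<Omega> \<and> \<Omega> \<noteq> {} \<and>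
     polytopal \<Omega> \<and> lipschitz_boundary \<Omega>"

text \<open>The cells cover \<open>S\<close> and overlap at most in their boundaries; no further compatibility of
  faces (conformity) is required.\<close>

definition polytopal_partition :: "'a::euclidean_space set set \<Rightarrow> 'a set \<Rightarrow> bool" where
  "polytopal_partition \<T> S \<longleftrightarrow> finite \<T> \<and>
     (\<forall>T\<in>\<T>. polytope T \<and> interior T \<noteq> {}) \<and>
     (\<forall>T\<in>\<T>. \<forall>T'\<in>\<T>. T \<noteq> T' \<longrightarrow> interior T \<inter> interior T' = {}) \<and>
     \<Union>\<T> = S"

definition mesh_size :: "'a::euclidean_space set set \<Rightarrow> real" where
  "mesh_size \<T> = Max (diameter ` \<T>)"

definition piecewise_const :: "'a::euclidean_space set \<Rightarrow> 'a set set \<Rightarrow> ('a \<Rightarrow> 'c) \<Rightarrow> bool" where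
  "piecewise_const \<Omega> \<T> f \<longleftrightarrow> (\<forall>T\<in>\<T>. \<exists>c. AE x in lebesgue_on \<Omega>. x \<in> T \<longrightarrow> f x = c)"

definition P0 :: "'a::euclidean_space set \<Rightarrow> 'a set set \<Rightarrow> ('a, real) lsq set" where
  "P0 \<Omega> \<T> = {u \<in> L2_on \<Omega>. piecewise_const \<Omega> \<T> (rep_lsq u)}"

text \<open>Through extension by zero, the product of the local spaces is the space of all sums of local
  contributions.\<close>

definition broken_product ::
  "'a::euclidean_space set set \<Rightarrow> ('a set \<Rightarrow> ('a, real) lsq set) \<Rightarrow> ('a, real) lsq set" where
  "broken_product \<T> V = {(\<Sum>T\<in>\<T>. v T) | v. \<forall>T\<in>\<T>. v T \<in> V T}"

section \<open>The mixed eigenvalue problem\<close>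

text \<open>Continuous and discrete problem are the same variational problem, posed on the pairs
  \<open>(Hdiv \<Omega>, L2_on \<Omega>)\<close> and \<open>(\<Sigma>\<^sub>h, U\<^sub>h)\<close>.  The eigenspace of \<open>\<mu>\<close> contains \<open>0\<close>; \<open>\<mu>\<close> is an
  eigenvalue iff it contains a nonzero (equivalently, a normalized) element.\<close>

definition mixed_eigenspace ::
  "(real^'n) set \<Rightarrow> (real^'n \<Rightarrow> real^'n^'n) \<Rightarrow> (real^'n \<Rightarrow> real) \<Rightarrow>
   (real^'n, real^'n) lsq set \<Rightarrow> (real^'n, real) lsq set \<Rightarrow> real \<Rightarrow> (real^'n, real) lsq set" where
  "mixed_eigenspace \<Omega> A \<gamma> S U \<mu> = {u \<in> U. \<exists>\<sigma>\<in>S.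
     (\<forall>\<tau>\<in>S. (LINT x|lebesgue_on \<Omega>. rep_lsq \<sigma> x \<bullet> (matrix_inv (A x) *v rep_lsq \<tau> x))
              + weak_div \<Omega> \<tau> \<bullet> u = 0) \<and>
     (\<forall>v\<in>U. weak_div \<Omega> \<sigma> \<bullet> v - (LINT x|lebesgue_on \<Omega>. rep_lsq u x * (\<gamma> x * rep_lsq v x))
              = - \<mu> * (u \<bullet> v))}"

text \<open>\<open>\<lambda>\<^sub>i\<close> (\<open>i \<in> I\<close>) is a nondecreasing enumeration of the eigenvalues with multiplicity: every
  real \<open>\<mu>\<close> occurs exactly as many times as the dimension of its eigenspace.  In particular,
  non-eigenvalues do not occur.\<close>

definition enumerates_eigenvalues ::
  "nat set \<Rightarrow> (real \<Rightarrow> 'v::real_vector set) \<Rightarrow> (nat \<Rightarrow> real) \<Rightarrow> bool" where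
  "enumerates_eigenvalues I E lam \<longleftrightarrow> mono_on I lam \<and>
     (\<forall>\<mu>. finite {i \<in> I. lam i = \<mu>} \<and> fin_dim (E \<mu>) \<and> card {i \<in> I. lam i = \<mu>} = dim (E \<mu>))"

end

theory Submission
  imports Defs
begin

text \<open>
  Among the combinations of eigenfunctions for the first \<open>J\<close> eigenvalues there is a nonzero \<open>u\<close>
  orthogonal to all discrete eigenspaces below the \<open>J\<close>th discrete eigenvalue.  Its energy is at most
  \<open>\<lambda>\<^sub>J\<close> times its squared norm, and its \<open>L\<^sup>2\<close> projection \<open>v\<close> onto \<open>U\<^sub>h\<close> is admissible in the discrete
  Rayleigh quotient.  Since \<open>div \<Sigma>\<^sub>h \<subseteq> U\<^sub>h\<close>, the discrete flux of \<open>v\<close> is the projection of the flux of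
  \<open>u\<close> in the \<open>A\<^sup>-\<^sup>1\<close> inner product, so projecting does not increase the energy; the product structure
  of \<open>U\<^sub>h\<close> gives the same for the \<open>\<gamma>\<close> term.  As \<open>P0 \<subseteq> U\<^sub>h\<close>, the norm lost by projecting is controlled
  by the Poincare inequality on convex cells with the Payne--Weinberger constant \<open>h / \<pi>\<close>.

  That inequality is obtained by needle decomposition: bisecting a cell repeatedly while keeping
  the mean zero leaves sets close to a segment, on which the cross-sectional volume is a log-concave
  weight (Prekopa--Leindler), so that the one-dimensional weighted Wirtinger inequality applies.
  Mollification passes from continuously differentiable functions to weak gradients.
\<close>

section \<open>Mixed forms and the min-max argument\<close>

text \<open>The two eigenvalue problems are handled asymmetrically. For the continuous one the
  enumeration hands over eigenfunctions, whose combinations need an upper energy bound. For the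
  discrete one a lower bound is needed on everything orthogonal to the small eigenspaces; it holds
  because a Rayleigh minimiser there is itself an eigenfunction. With \<open>l\<close> and
  \<open>L\<close> the continuous and the discrete eigenvalue, the argument ends in
  \<open>L * (1 - \<kappa> * l) <= l\<close>, which is the claim solved for \<open>l\<close>. In
  \<open>\<kappa> = h^2 / (a0 * pi^2)\<close> the factor \<open>1 / a0\<close> enters because the
  weak gradient of \<open>u\<close> is \<open>A^-1 \<sigma>\<close>, whose squared norm is at most
  \<open>1 / a0\<close> times the energy of \<sigma>. The sharp \<open>pi\<close> is the main
  obstacle: it is a one-dimensional constant, and convexity of the cells makes it independent of
  their shape by forcing log-concave weights in dimension one. A second obstacle is that
  \<open>u\<close> is known merely as an L2 function tested against H(div) fields. Fields supported
  inside a single cell reveal its weak gradient there, so smoothing takes place on slightly shrunken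
  copies of the cell.\<close>

text \<open>Adding one generator takes a continuous image of the product with
  \<open>{-1..1}\<close>, so compactness survives although the ambient space may be
  infinite-dimensional. This supplies the compact set on which the Rayleigh quotient is
  minimised.\<close>

lemma compact_Minkowski_segments:
  fixes B :: "'v::real_normed_vector set"
  assumes "finite B"
  shows "compact {x. \<exists>c. (\<forall>b\<in>B. \<bar>c b\<bar> \<le> (1::real)) \<and> x = (\<Sum>b\<in>B. c b *\<^sub>R b)}"
  using assms
proof (induction B rule: finite_induct)
  case empty
  show ?case by simp
next
  case (insert a B)
  let ?S = "\<lambda>B. {x. \<exists>c. (\<forall>b\<in>B. \<bar>c b\<bar> \<le> (1::real)) \<and> x = (\<Sum>b\<in>B. c b *\<^sub>R b)}"
  have "?S (insert a B) = (\<lambda>(t,x). t *\<^sub>R a + x) ` ({-1..1} \<times> ?S B)"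
  proof (intro equalityI subsetI)
    fix x assume "x \<in> ?S (insert a B)"
    then obtain c where c: "\<forall>b\<in>insert a B. \<bar>c b\<bar> \<le> 1" "x = (\<Sum>b\<in>insert a B. c b *\<^sub>R b)" by auto
    then have "x = (\<lambda>(t,x). t *\<^sub>R a + x) (c a, \<Sum>b\<in>B. c b *\<^sub>R b)" "c a \<in> {-1..1}"
      using insert by (auto simp: abs_le_iff)
    moreover have "(\<Sum>b\<in>B. c b *\<^sub>R b) \<in> ?S B" using c by auto
    ultimately show "x \<in> (\<lambda>(t,x). t *\<^sub>R a + x) ` ({-1..1} \<times> ?S B)" by blast
  next
    fix x assume "x \<in> (\<lambda>(t,x). t *\<^sub>R a + x) ` ({-1..1} \<times> ?S B)"
    then obtain t c where c: "t \<in> {-1..1}" "\<forall>b\<in>B. \<bar>c b\<bar> \<le> 1" "x = t *\<^sub>R a + (\<Sum>b\<in>B. c b *\<^sub>R b)"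
      by auto
    have "(\<Sum>b\<in>B. (c(a:=t)) b *\<^sub>R b) = (\<Sum>b\<in>B. c b *\<^sub>R b)"
      using insert by (intro sum.cong) auto
    then show "x \<in> ?S (insert a B)"
      using c insert by (auto intro!: exI[of _ "c(a:=t)"])
  qed
  moreover have "compact ((\<lambda>(t,x). t *\<^sub>R a + x) ` ({-1..1} \<times> ?S B))"
    by (intro compact_continuous_image compact_Times insert compact_Icc)
       (auto simp: split_beta intro!: continuous_intros)
  ultimately show ?case by simp
qed

lemma orthonormal_basis_exists:
  fixes V :: "'v::real_inner set"
  assumes "subspace V" "fin_dim V"
  obtains B where "finite B" "span B = V" "pairwise orthogonal B" "\<And>b. b \<in> B \<Longrightarrow> norm b = 1"
proof -
  obtain B0 where B0: "finite B0" "V \<subseteq> span B0" using assms(2) by (auto simp: fin_dim_def)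
  obtain B1 where B1: "B1 \<subseteq> V" "independent B1" "V \<subseteq> span B1" by (rule maximal_independent_subset)
  have "finite B1" using independent_span_bound[OF B0(1) B1(2)] B0(2) B1(1) by auto
  then obtain C where C: "finite C" "span C = span B1" "pairwise orthogonal C"
    using basis_orthogonal by metis
  \<comment> \<open>Orthogonalisation may produce the zero vector, which has to be dropped before
    normalising.\<close>
  define B where "B = (\<lambda>x. x /\<^sub>R norm x) ` (C - {0})"
  have sV: "span C = V" using C(2) B1 assms(1) by (metis span_eq_iff span_mono subset_antisym)
  have "span B = span C"
  proof (intro antisym span_minimal subspace_span subsetI)
    fix b assume "b \<in> B" then show "b \<in> span C" unfolding B_def by (auto intro: span_mul span_base)
  next
    fix c assume c: "c \<in> C"
    show "c \<in> span B"
    proof (cases "c = 0")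
      case False
      then have "c /\<^sub>R norm c \<in> B" using c by (auto simp: B_def)
      from span_mul[OF span_base[OF this], of "norm c"] False show ?thesis by simp
    qed (simp add: span_zero)
  qed
  moreover have "pairwise orthogonal B"
    using C(3) unfolding B_def pairwise_def by (auto simp: orthogonal_def)
  moreover have "norm b = 1" if "b \<in> B" for b
    using that unfolding B_def by (clarsimp, metis left_inverse norm_eq_zero)
  moreover have "finite B" using C(1) by (simp add: B_def)
  ultimately show ?thesis using that[of B] sV by blast
qed

text \<open>The defect of the expansion lies in the span and is orthogonal to all of it, hence to
  itself.\<close>

lemma orthonormal_expansion:
  fixes B :: "'v::real_inner set"
  assumes "finite B" "pairwise orthogonal B" "\<And>b. b \<in> B \<Longrightarrow> norm b = 1" "x \<in> span B"
  shows "x = (\<Sum>b\<in>B. (x \<bullet> b) *\<^sub>R b)"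
proof -
  let ?d = "x - (\<Sum>b\<in>B. (x \<bullet> b) *\<^sub>R b)"
  have "(\<Sum>b\<in>B. (x \<bullet> b) *\<^sub>R b) \<in> span B" by (intro span_sum span_mul span_base)
  then have sp: "?d \<in> span B" using assms(4) by (rule span_diff[rotated])
  have orth: "?d \<bullet> c = 0" if "c \<in> B" for c
  proof -
    have "(\<Sum>b\<in>B. (x \<bullet> b) *\<^sub>R b) \<bullet> c = (\<Sum>b\<in>B. if b = c then x \<bullet> c else 0)"
      unfolding inner_sum_left
    proof (rule sum.cong)
      fix b assume b: "b \<in> B"
      have "c \<bullet> c = 1" using assms(3)[OF that] by (simp add: norm_eq_1)
      then show "((x \<bullet> b) *\<^sub>R b) \<bullet> c = (if b = c then x \<bullet> c else 0)"
        using assms(2) b that by (auto simp: pairwise_def orthogonal_def)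
    qed simp
    then show ?thesis using assms(1) that by (simp add: inner_diff_left)
  qed
  have "?d \<bullet> y = 0" if "y \<in> span B" for y
    using that orth
    by (induction rule: span_induct_alt) (auto simp: inner_add_right)
  from this[OF sp] have "?d = 0" unfolding inner_eq_zero_iff .
  then show ?thesis using right_minus_eq by blast
qed

text \<open>Restricted bilinear forms are determined on finitely many coordinates, which makes
  the Rayleigh quotient continuous although no topology enters the hypotheses.\<close>

lemma Rayleigh_minimizer:
  fixes V :: "'v::real_inner set" and q :: "'v \<Rightarrow> 'v \<Rightarrow> real"
  assumes V: "subspace V" "fin_dim V" and nz: "v1 \<in> V" "v1 \<noteq> 0"
    and addl: "\<And>x y z. x \<in> V \<Longrightarrow> y \<in> V \<Longrightarrow> z \<in> V \<Longrightarrow> q (x + y) z = q x z + q y z"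
    and scl: "\<And>c x z. x \<in> V \<Longrightarrow> z \<in> V \<Longrightarrow> q (c *\<^sub>R x) z = c * q x z"
    and sym: "\<And>x y. x \<in> V \<Longrightarrow> y \<in> V \<Longrightarrow> q x y = q y x"
  obtains v0 m where "v0 \<in> V" "norm v0 = 1" "\<And>v. v \<in> V \<Longrightarrow> m * (norm v)\<^sup>2 \<le> q v v"
    "\<And>w. w \<in> V \<Longrightarrow> q v0 w = m * (v0 \<bullet> w)"
proof -
  obtain B where B: "finite B" "span B = V" "pairwise orthogonal B" "\<And>b. b \<in> B \<Longrightarrow> norm b = 1"
    using orthonormal_basis_exists[OF V] by metis
  have BV: "B \<subseteq> V" using B(2) span_superset by blast
  have ex: "x = (\<Sum>b\<in>B. (x \<bullet> b) *\<^sub>R b)" if "x \<in> V" for x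
    using orthonormal_expansion[OF B(1,3,4)] that B(2) by blast
  have suml: "q (\<Sum>b\<in>S. c b *\<^sub>R b) z = (\<Sum>b\<in>S. c b * q b z)" if "finite S" "S \<subseteq> B" "z \<in> V" for S c z
    using that
  proof (induction S rule: finite_induct)
    case empty
    have "q (0 *\<^sub>R z) z = 0" using scl[of z z 0] that by simp
    then show ?case by simp
  next
    case (insert a S)
    have "(\<Sum>b\<in>S. c b *\<^sub>R b) \<in> V"
      using insert BV V(1) by (intro subspace_sum) (auto intro!: subspace_scale)
    moreover have "a \<in> V" using insert BV by auto
    ultimately show ?case using insert addl[of "c a *\<^sub>R a" "\<Sum>b\<in>S. c b *\<^sub>R b" z] scl[of a z]
      by (auto simp: subspace_scale V(1))
  qed
  \<comment> \<open>The quadratic form in coordinates: continuous on the whole space, while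
    \<open>q\<close> is controlled on \<open>V\<close> only.\<close>
  define Q where "Q x = (\<Sum>b\<in>B. \<Sum>b'\<in>B. (x \<bullet> b) * (x \<bullet> b') * q b b')" for x
  have Q: "q x x = Q x" if x: "x \<in> V" for x
  proof -
    have "q x x = (\<Sum>b\<in>B. (x \<bullet> b) * q b x)"
      using suml[OF B(1) order_refl x, of "\<lambda>b. x \<bullet> b"] ex[OF x] by simp
    also have "\<dots> = (\<Sum>b\<in>B. (x \<bullet> b) * (\<Sum>b'\<in>B. (x \<bullet> b') * q b b'))"
    proof (rule sum.cong[OF refl])
      fix b assume b: "b \<in> B"
      then have bV: "b \<in> V" using BV by auto
      have "q b x = q x b" using sym bV x by auto
      also have "\<dots> = (\<Sum>b'\<in>B. (x \<bullet> b') * q b' b)"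
        using suml[OF B(1) order_refl bV, of "\<lambda>b. x \<bullet> b"] ex[OF x] by simp
      also have "\<dots> = (\<Sum>b'\<in>B. (x \<bullet> b') * q b b')"
        using sym bV BV by (intro sum.cong) auto
      finally show "(x \<bullet> b) * q b x = (x \<bullet> b) * (\<Sum>b'\<in>B. (x \<bullet> b') * q b b')" by simp
    qed
    finally show ?thesis by (simp add: Q_def sum_distrib_left mult.assoc)
  qed
  \<comment> \<open>By Cauchy-Schwarz the coordinates of a unit vector lie in [-1, 1], so this
    compact set is the whole unit sphere of \<open>V\<close>.\<close>
  define K where "K = {x. \<exists>c. (\<forall>b\<in>B. \<bar>c b\<bar> \<le> (1::real)) \<and> x = (\<Sum>b\<in>B. c b *\<^sub>R b)} \<inter> {x. norm x = 1}"
  have K: "compact K" unfolding K_def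
    by (intro compact_Int_closed compact_Minkowski_segments B closed_Collect_eq continuous_intros)
  have KV: "K = {x \<in> V. norm x = 1}"
  proof (intro equalityI subsetI)
    fix x assume "x \<in> K"
    then show "x \<in> {x \<in> V. norm x = 1}" unfolding K_def
      using BV V(1) by (auto intro!: subspace_sum subspace_scale)
  next
    fix x assume x: "x \<in> {x \<in> V. norm x = 1}"
    have "\<bar>x \<bullet> b\<bar> \<le> 1" if "b \<in> B" for b
      using Cauchy_Schwarz_ineq2[of x b] x B(4)[OF that] by simp
    then show "x \<in> K" unfolding K_def using ex[of x] x by auto
  qed
  have "v1 /\<^sub>R norm v1 \<in> K" unfolding KV using nz V(1) by (auto intro: subspace_scale)
  then obtain v0 where v0: "v0 \<in> K" "\<And>y. y \<in> K \<Longrightarrow> Q v0 \<le> Q y"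
    using continuous_attains_inf[OF K, of Q] unfolding Q_def by (force intro!: continuous_intros)
  have v0V: "v0 \<in> V" "norm v0 = 1" using v0 KV by auto
  have min: "Q v0 * (norm v)\<^sup>2 \<le> q v v" if v: "v \<in> V" for v
  proof (cases "v = 0")
    case True
    have "q (0 *\<^sub>R v1) v1 = 0" using scl[of v1 v1 0] nz by simp
    moreover have "q (0 *\<^sub>R v1) (0 *\<^sub>R v1) = 0" using scl[of v1 "0 *\<^sub>R v1" 0] nz V(1) by (auto simp: subspace_0)
    ultimately show ?thesis using True by simp
  next
    case False
    let ?w = "v /\<^sub>R norm v"
    have wV: "?w \<in> V" using v V(1) by (auto intro: subspace_scale)
    have "?w \<in> K" unfolding KV using False wV by auto
    then have "Q v0 \<le> q ?w ?w" using v0(2) Q wV by auto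
    also have "\<dots> = q v v / (norm v)\<^sup>2"
    proof -
      have "q ?w ?w = inverse (norm v) * q v ?w" using scl[OF v wV] .
      also have "q v ?w = q ?w v" using sym v wV by auto
      also have "\<dots> = inverse (norm v) * q v v" using scl[OF v v] .
      finally show ?thesis by (simp add: power2_eq_square divide_simps)
    qed
    finally show ?thesis using False by (simp add: pos_le_divide_eq)
  qed
  have stat: "q v0 w = Q v0 * (v0 \<bullet> w)" if w: "w \<in> V" for w
  proof (rule ccontr)
    define d where "d = q v0 w - Q v0 * (v0 \<bullet> w)"
    assume "q v0 w \<noteq> Q v0 * (v0 \<bullet> w)"
    then have d: "d \<noteq> 0" by (simp add: d_def)
    define E where "E = q w w - Q v0 * (norm w)\<^sup>2"
    have E: "E \<ge> 0" using min[OF w] by (simp add: E_def)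
    have key: "0 \<le> 2 * t * d + t\<^sup>2 * E" for t
    proof -
      have tw: "t *\<^sub>R w \<in> V" using w V(1) by (auto intro: subspace_scale)
      have "v0 + t *\<^sub>R w \<in> V" using v0V tw V(1) by (auto intro: subspace_add)
      note min[OF this]
      moreover have "q (v0 + t *\<^sub>R w) (v0 + t *\<^sub>R w) = q v0 v0 + 2 * t * q v0 w + t\<^sup>2 * q w w"
      proof -
        let ?z = "v0 + t *\<^sub>R w"
        have zV: "?z \<in> V" by fact
        have "q ?z ?z = q v0 ?z + t * q w ?z" using addl[OF v0V(1) tw zV] scl[OF w zV] by simp
        also have "q v0 ?z = q v0 v0 + t * q v0 w"
          using sym[OF v0V(1) zV] addl[OF v0V(1) tw v0V(1)] scl[OF w v0V(1)] sym[OF w v0V(1)] by simp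
        also have "q w ?z = q v0 w + t * q w w"
          using sym[OF w zV] addl[OF v0V(1) tw w] scl[OF w w] by simp
        finally show ?thesis by (simp add: algebra_simps power2_eq_square)
      qed
      moreover have "(norm (v0 + t *\<^sub>R w))\<^sup>2 = 1 + 2 * t * (v0 \<bullet> w) + t\<^sup>2 * (norm w)\<^sup>2"
        using v0V(2) unfolding norm_eq_1 power2_norm_eq_inner
        by (simp add: inner_add_left inner_add_right inner_commute algebra_simps power2_eq_square)
      ultimately show ?thesis using Q[OF v0V(1)] unfolding d_def E_def
        by (simp add: algebra_simps)
    qed
    \<comment> \<open>Near its vertex \<open>t = - d / E\<close> the parabola
      \<open>2 * t * d + t^2 * E\<close> is negative; \<open>E + 1\<close> replaces \<open>E\<close>
      in the denominator so that the choice also works for \<open>E = 0\<close>.\<close>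
    have "0 \<le> 2 * (- d / (E + 1)) * d + (- d / (E + 1))\<^sup>2 * E" by (rule key)
    also have "\<dots> = (d\<^sup>2 / (E+1)\<^sup>2) * (E - 2 * (E + 1))"
    proof -
      have "E + 1 \<noteq> 0" using E by simp
      then show ?thesis by (simp add: divide_simps power2_eq_square) (simp add: algebra_simps)
    qed
    also have "\<dots> < 0" using d E by (intro mult_pos_neg) auto
    finally show False by simp
  qed
  show ?thesis using that[OF v0V min stat] by blast
qed

lemma inner_span_eq_0:
  fixes u :: "'v::real_inner"
  assumes "y \<in> span B" "\<And>b. b \<in> B \<Longrightarrow> u \<bullet> b = 0"
  shows "u \<bullet> y = 0"
  using assms by (induction rule: span_induct_alt) (auto simp: inner_add_right)

text \<open>The dimension count behind min-max: projecting \<open>span C\<close> onto the smaller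
  \<open>span D\<close> cannot be injective, and a nonzero kernel vector is orthogonal to
  \<open>D\<close>.\<close>

lemma exists_orthogonal_in_span:
  fixes C D :: "'v::real_inner set"
  assumes C: "independent C" "finite C" and D: "finite D" "card D < card C"
  obtains u where "u \<in> span C" "u \<noteq> 0" "\<And>d. d \<in> D \<Longrightarrow> u \<bullet> d = 0"
proof -
  have "fin_dim (span D)" using D(1) by (auto simp: fin_dim_def)
  then obtain B where B: "finite B" "span B = span D" "pairwise orthogonal B" "\<And>b. b \<in> B \<Longrightarrow> norm b = 1"
    using orthonormal_basis_exists[of "span D"] by auto
  have "independent B"
    using B(3,4) by (intro pairwise_orthogonal_independent) force+
  have cB: "card B \<le> card D"
    using independent_span_bound[OF D(1) \<open>independent B\<close>] B(2) span_superset by blast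
  define f where "f x = (\<Sum>b\<in>B. (x \<bullet> b) *\<^sub>R b)" for x
  have lin: "linear f"
    by (intro linearI) (auto simp: f_def inner_add_left scaleR_add_left sum.distrib scaleR_sum_right)
  have "\<not> inj_on f (span C)"
  proof
    assume inj: "inj_on f (span C)"
    then have "independent (f ` C)" using linear_independent_injective_image[OF lin C(1)] by simp
    moreover have "f ` C \<subseteq> span B" unfolding f_def by (auto intro!: span_sum intro: span_mul span_base)
    ultimately have "card (f ` C) \<le> card B" using independent_span_bound[OF B(1)] by blast
    moreover have "card (f ` C) = card C"
      using inj_on_subset[OF inj span_superset] by (rule card_image)
    ultimately show False using cB D(2) by simp
  qed
  then obtain u where u: "u \<in> span C" "u \<noteq> 0" "f u = 0"
    using linear_inj_on_iff_eq_0[OF lin, of "span C"] by (auto simp: subspace_span)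
  have "u \<bullet> b = 0" if b: "b \<in> B" for b
  proof -
    have "f u \<bullet> b = (\<Sum>b'\<in>B. if b' = b then u \<bullet> b else 0)"
      unfolding inner_sum_left f_def
    proof (rule sum.cong)
      fix b' assume b': "b' \<in> B"
      have "b \<bullet> b = 1" using B(4)[OF b] by (simp add: norm_eq_1)
      then show "((u \<bullet> b') *\<^sub>R b') \<bullet> b = (if b' = b then u \<bullet> b else 0)"
        using B(3) b b' by (auto simp: pairwise_def orthogonal_def)
    qed simp
    then show ?thesis using u(3) B(1) b by simp
  qed
  then have "u \<bullet> y = 0" if "y \<in> span B" for y
    using inner_span_eq_0 that by blast
  then show ?thesis using that[OF u(1,2)] B(2) span_superset by blast
qed

lemma orthogonal_projection_exists:
  fixes V :: "'v::real_inner set"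
  assumes "subspace V" "fin_dim V"
  obtains v where "v \<in> V" "\<And>w. w \<in> V \<Longrightarrow> (u - v) \<bullet> w = 0"
proof -
  obtain B where B: "finite B" "span B = V" "pairwise orthogonal B" "\<And>b. b \<in> B \<Longrightarrow> norm b = 1"
    using orthonormal_basis_exists[OF assms] by metis
  define v where "v = (\<Sum>b\<in>B. (u \<bullet> b) *\<^sub>R b)"
  have vV: "v \<in> V" using B(2) unfolding v_def by (auto intro!: span_sum intro: span_mul span_base)
  have "(u - v) \<bullet> b = 0" if b: "b \<in> B" for b
  proof -
    have "v \<bullet> b = (\<Sum>b'\<in>B. if b' = b then u \<bullet> b else 0)"
      unfolding inner_sum_left v_def
    proof (rule sum.cong)
      fix b' assume b': "b' \<in> B"
      have "b \<bullet> b = 1" using B(4)[OF b] by (simp add: norm_eq_1)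
      then show "((u \<bullet> b') *\<^sub>R b') \<bullet> b = (if b' = b then u \<bullet> b else 0)"
        using B(3) b b' by (auto simp: pairwise_def orthogonal_def)
    qed simp
    then show ?thesis using B(1) b by (simp add: inner_diff_left)
  qed
  then have "(u - v) \<bullet> y = 0" if "y \<in> span B" for y
    using inner_span_eq_0 that by blast
  then show ?thesis using that[OF vV] B(2) by blast
qed

text \<open>Gram-Schmidt in the inner product \<open>a\<close>, one generator at a time. The
  induction hypothesis is used twice, for the functional \<open>a b\<close>, to make the new
  generator orthogonal to the old span, and for \<open>l\<close>; the representer is then corrected
  along the orthogonal remainder. In use it produces the discrete flux that belongs to a discrete
  function.\<close>

lemma Riesz_finite:
  fixes a :: "'y::real_vector \<Rightarrow> 'y \<Rightarrow> real"
  assumes "finite B"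
    and addl: "\<And>x y z. x \<in> span B \<Longrightarrow> y \<in> span B \<Longrightarrow> z \<in> span B \<Longrightarrow> a (x + y) z = a x z + a y z"
    and scl: "\<And>c x z. x \<in> span B \<Longrightarrow> z \<in> span B \<Longrightarrow> a (c *\<^sub>R x) z = c * a x z"
    and sym: "\<And>x y. x \<in> span B \<Longrightarrow> y \<in> span B \<Longrightarrow> a x y = a y x"
    and def: "\<And>x. x \<in> span B \<Longrightarrow> a x x = 0 \<Longrightarrow> x = 0"
    and l_add: "\<And>x y. x \<in> span B \<Longrightarrow> y \<in> span B \<Longrightarrow> l (x + y) = l x + (l y :: real)"
    and l_scl: "\<And>c x. x \<in> span B \<Longrightarrow> l (c *\<^sub>R x) = c * l x"
  shows "\<exists>s\<in>span B. \<forall>t\<in>span B. a s t = l t"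
  using assms
proof (induction B arbitrary: l rule: finite_induct)
  case empty
  have "l 0 = 0" using empty(6)[of 0 0] by (simp add: span_zero)
  moreover have "a 0 0 = 0" using empty(2)[of 0 0 0] by simp
  ultimately show ?case by simp
next
  case (insert b B)
  have sub: "x \<in> span (insert b B)" if "x \<in> span B" for x
    using that span_mono[of B "insert b B"] by blast
  have bI: "b \<in> span (insert b B)" by (simp add: span_base)
  note addl = insert.prems(1) and scl = insert.prems(2) and sym = insert.prems(3) and
    def = insert.prems(4) and l_add = insert.prems(5) and l_scl = insert.prems(6)
  have addr: "a z (x + y) = a z x + a z y"
    if "x \<in> span (insert b B)" "y \<in> span (insert b B)" "z \<in> span (insert b B)" for x y z
    using addl[OF that] sym[OF that(3), of "x + y"] sym[OF that(1,3)] sym[OF that(2,3)] that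
    by (simp add: span_add)
  have scr: "a z (c *\<^sub>R x) = c * a z x"
    if "x \<in> span (insert b B)" "z \<in> span (insert b B)" for x z c
    using scl[OF that, of c] sym[OF that(2), of "c *\<^sub>R x"] sym[OF that(1,2)] that by (simp add: span_mul)
  have IH: "\<exists>s\<in>span B. \<forall>t\<in>span B. a s t = l t"
    if "\<And>x y. x \<in> span B \<Longrightarrow> y \<in> span B \<Longrightarrow> l (x + y) = l x + (l y :: real)"
      "\<And>c x. x \<in> span B \<Longrightarrow> l (c *\<^sub>R x) = c * l x" for l
    by (rule insert.IH) (auto intro: addl scl sym def sub that)
  have "\<exists>p\<in>span B. \<forall>t\<in>span B. a p t = a b t"
    by (rule IH) (auto simp: addr scr sub bI)
  then obtain p where p: "p \<in> span B" "\<And>t. t \<in> span B \<Longrightarrow> a p t = a b t" by blast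
  have "\<exists>s\<in>span B. \<forall>t\<in>span B. a s t = l t"
    by (rule IH) (auto simp: l_add l_scl sub)
  then obtain s where s: "s \<in> span B" "\<And>t. t \<in> span B \<Longrightarrow> a s t = l t" by blast
  define e where "e = b + (-1) *\<^sub>R p"
  have eI: "e \<in> span (insert b B)" unfolding e_def by (intro span_add span_mul bI sub p)
  have e_orth: "a e t = 0" if "t \<in> span B" for t
    unfolding e_def using p(2)[OF that] addl[OF bI span_mul[OF sub[OF p(1)], of "-1"] sub[OF that]]
      scl[OF sub[OF p(1)] sub[OF that], of "-1"] by simp
  \<comment> \<open>The generators need not be independent: if \<open>a e e = 0\<close>, then
    \<open>e = 0\<close> and \<open>l e = 0\<close>, so any \<open>k\<close> serves and 0 avoids the
    division.\<close>
  define k where "k = (if a e e = 0 then 0 else l e / a e e)"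
  have ke: "k * a e e = l e"
  proof (cases "a e e = 0")
    case True
    then have "e = 0" using def eI by blast
    then have "l e = 0" using l_scl[OF bI, of 0] by simp
    then show ?thesis using True by simp
  qed (simp add: k_def)
  let ?s = "s + k *\<^sub>R e"
  have sI: "?s \<in> span (insert b B)" by (intro span_add span_mul eI sub s)
  have "a ?s t = l t" if t: "t \<in> span (insert b B)" for t
  proof -
    obtain r where r: "t - r *\<^sub>R b \<in> span B" using span_breakdown_eq[of t b B] t by blast
    define t0 where "t0 = (t - r *\<^sub>R b) + r *\<^sub>R p"
    have t0: "t0 \<in> span B" unfolding t0_def by (intro span_add span_mul r p)
    have tt: "t = t0 + r *\<^sub>R e" unfolding t0_def e_def by (simp add: algebra_simps)
    have reI: "r *\<^sub>R e \<in> span (insert b B)" "k *\<^sub>R e \<in> span (insert b B)" by (intro span_mul eI)+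
    have "a ?s t = a ?s t0 + r * a ?s e"
      unfolding tt using addr[OF sub[OF t0] reI(1) sI] scr[OF eI sI] by simp
    also have "a ?s t0 = l t0"
      using addl[OF sub[OF s(1)] reI(2) sub[OF t0]] scl[OF eI sub[OF t0]] s(2)[OF t0] e_orth[OF t0] by simp
    also have "a ?s e = l e"
      using addl[OF sub[OF s(1)] reI(2) eI] scl[OF eI eI] ke sym[OF sub[OF s(1)] eI] e_orth[OF s(1)] by simp
    also have "l t0 + r * l e = l t"
      unfolding tt using l_add[OF sub[OF t0] reI(1)] l_scl[OF eI] by simp
    finally show ?thesis .
  qed
  then show ?case using sI by blast
qed

section \<open>Abstract mixed eigenproblems and their energies\<close>

text \<open>The abstract shape of \<open>mixed_eigenspace\<close>: \<open>a\<close> stands for the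
  product of fluxes weighted by the inverse of \<open>A\<close>, \<open>D\<close> for the divergence
  and \<open>c\<close> for the product weighted by \<gamma>. With \<open>S\<close> and
  \<open>U\<close> as sets, the continuous and the discrete problem share the same three
  maps.\<close>

definition mixed_eig ::
  "('y \<Rightarrow> 'y \<Rightarrow> real) \<Rightarrow> ('y \<Rightarrow> 'x) \<Rightarrow> ('x \<Rightarrow> 'x \<Rightarrow> real) \<Rightarrow> 'y set \<Rightarrow> 'x set \<Rightarrow> real \<Rightarrow> 'x::real_inner set" where
  "mixed_eig a D c S U \<mu> = {u \<in> U. \<exists>\<sigma>\<in>S. (\<forall>\<tau>\<in>S. a \<sigma> \<tau> + D \<tau> \<bullet> u = 0) \<and>
     (\<forall>v\<in>U. D \<sigma> \<bullet> v - c u v = - \<mu> * (u \<bullet> v))}"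

text \<open>The laws are relative to \<open>S\<close> and \<open>U\<close>, since the weak
  divergence is specified on \<open>Hdiv\<close> only; they pass to subspaces, which makes the
  discrete problem an instance as soon as the continuous one is.\<close>

locale mixed_form =
  fixes a :: "'y::real_vector \<Rightarrow> 'y \<Rightarrow> real" and D :: "'y \<Rightarrow> 'x::real_inner"
    and c :: "'x \<Rightarrow> 'x \<Rightarrow> real" and S :: "'y set" and U :: "'x set"
  assumes S: "subspace S" and U: "subspace U"
    and a_add: "\<And>x y z. x \<in> S \<Longrightarrow> y \<in> S \<Longrightarrow> z \<in> S \<Longrightarrow> a (x + y) z = a x z + a y z"
    and a_scale: "\<And>r x z. x \<in> S \<Longrightarrow> z \<in> S \<Longrightarrow> a (r *\<^sub>R x) z = r * a x z"
    and a_sym: "\<And>x y. x \<in> S \<Longrightarrow> y \<in> S \<Longrightarrow> a x y = a y x"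
    and a_nonneg: "\<And>x. x \<in> S \<Longrightarrow> 0 \<le> a x x"
    and a_def: "\<And>x. x \<in> S \<Longrightarrow> a x x = 0 \<Longrightarrow> x = 0"
    and D_add: "\<And>x y. x \<in> S \<Longrightarrow> y \<in> S \<Longrightarrow> D (x + y) = D x + D y"
    and D_scale: "\<And>r x. x \<in> S \<Longrightarrow> D (r *\<^sub>R x) = r *\<^sub>R D x"
    and c_add: "\<And>x y z. x \<in> U \<Longrightarrow> y \<in> U \<Longrightarrow> z \<in> U \<Longrightarrow> c (x + y) z = c x z + c y z"
    and c_scale: "\<And>r x z. x \<in> U \<Longrightarrow> z \<in> U \<Longrightarrow> c (r *\<^sub>R x) z = r * c x z"
    and c_sym: "\<And>x y. x \<in> U \<Longrightarrow> y \<in> U \<Longrightarrow> c x y = c y x"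
    and c_nonneg: "\<And>x. x \<in> U \<Longrightarrow> 0 \<le> c x x"
begin

lemma sub_form:
  assumes "subspace S'" "S' \<subseteq> S" "subspace U'" "U' \<subseteq> U"
  shows "mixed_form a D c S' U'"
  using assms S U by unfold_locales (blast intro: a_add a_scale a_sym a_nonneg a_def D_add D_scale
      c_add c_scale c_sym c_nonneg)+

lemma a_Cauchy_Schwarz:
  assumes "x \<in> S" "y \<in> S" shows "(a x y)\<^sup>2 \<le> a x x * a y y"
proof (cases "y = 0")
  case True
  then have "a y x = 0" "a y y = 0" using a_scale[OF assms(2,1), of 0] a_scale[OF assms(2,2), of 0] by auto
  then show ?thesis using a_sym assms by simp
next
  case False
  then have p: "a y y > 0" using a_def a_nonneg assms(2) by force
  define t where "t = a x y / a y y"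
  have ty: "(-t) *\<^sub>R y \<in> S" using assms S by (auto intro: subspace_scale simp del: scaleR_minus_left)
  have z: "x + (-t) *\<^sub>R y \<in> S" using assms ty S by (auto intro: subspace_add simp del: scaleR_minus_left)
  have "0 \<le> a (x + (-t) *\<^sub>R y) (x + (-t) *\<^sub>R y)" using a_nonneg[OF z] .
  also have "\<dots> = a x (x + (-t) *\<^sub>R y) - t * a y (x + (-t) *\<^sub>R y)"
    using a_add[OF assms(1) ty z] a_scale[OF assms(2) z, of "-t"] by simp
  also have "a x (x + (-t) *\<^sub>R y) = a x x - t * a x y"
    using a_sym[OF assms(1) z] a_add[OF assms(1) ty assms(1)] a_scale[OF assms(2,1), of "-t"] a_sym[OF assms] by simp
  also have "a y (x + (-t) *\<^sub>R y) = a x y - t * a y y"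
    using a_sym[OF assms(2) z] a_add[OF assms(1) ty assms(2)] a_scale[OF assms(2,2), of "-t"] by simp
  finally have "0 \<le> a x x - t * a x y - t * (a x y - t * a y y)" .
  also have "\<dots> = a x x - (a x y)\<^sup>2 / a y y" using p by (simp add: t_def field_simps power2_eq_square)
  finally show ?thesis using p by (simp add: pos_divide_le_eq)
qed

lemma subspace_mixed_eig: "subspace (mixed_eig a D c S U \<mu>)"
proof (rule subspaceI)
  have "D 0 = 0" using D_scale[of 0 0] S by (simp add: subspace_0)
  moreover have "a 0 t = 0" if "t \<in> S" for t using a_scale[OF that that, of 0] by simp
  moreover have "c 0 v = 0" if "v \<in> U" for v using c_scale[OF that that, of 0] by simp
  ultimately show "0 \<in> mixed_eig a D c S U \<mu>"
    unfolding mixed_eig_def using S U by (auto simp: subspace_0 intro!: bexI[of _ 0])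
next
  fix u v assume "u \<in> mixed_eig a D c S U \<mu>" "v \<in> mixed_eig a D c S U \<mu>"
  then obtain s t where s: "s \<in> S" "\<And>\<tau>. \<tau> \<in> S \<Longrightarrow> a s \<tau> + D \<tau> \<bullet> u = 0"
      "\<And>v. v \<in> U \<Longrightarrow> D s \<bullet> v - c u v = - \<mu> * (u \<bullet> v)" "u \<in> U"
    and t: "t \<in> S" "\<And>\<tau>. \<tau> \<in> S \<Longrightarrow> a t \<tau> + D \<tau> \<bullet> v = 0"
      "\<And>w. w \<in> U \<Longrightarrow> D t \<bullet> w - c v w = - \<mu> * (v \<bullet> w)" "v \<in> U"
    unfolding mixed_eig_def by blast
  have "a (s + t) \<tau> + D \<tau> \<bullet> (u + v) = 0" if "\<tau> \<in> S" for \<tau>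
    using a_add[OF s(1) t(1) that] s(2)[OF that] t(2)[OF that] by (simp add: inner_add_right)
  moreover have "D (s + t) \<bullet> w - c (u + v) w = - \<mu> * ((u + v) \<bullet> w)" if "w \<in> U" for w
    using D_add[OF s(1) t(1)] c_add[OF s(4) t(4) that] s(3)[OF that] t(3)[OF that]
    by (simp add: inner_add_left algebra_simps)
  ultimately show "u + v \<in> mixed_eig a D c S U \<mu>"
    unfolding mixed_eig_def using S U s(1,4) t(1,4)
    by (auto simp: subspace_add intro!: bexI[of _ "s + t"])
next
  fix r u assume "u \<in> mixed_eig a D c S U \<mu>"
  then obtain s where s: "s \<in> S" "\<And>\<tau>. \<tau> \<in> S \<Longrightarrow> a s \<tau> + D \<tau> \<bullet> u = 0"
      "\<And>v. v \<in> U \<Longrightarrow> D s \<bullet> v - c u v = - \<mu> * (u \<bullet> v)" "u \<in> U"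
    unfolding mixed_eig_def by blast
  have "a (r *\<^sub>R s) \<tau> + D \<tau> \<bullet> (r *\<^sub>R u) = 0" if "\<tau> \<in> S" for \<tau>
    using a_scale[OF s(1) that, of r] s(2)[OF that] by (simp flip: distrib_left)
  moreover have "D (r *\<^sub>R s) \<bullet> w - c (r *\<^sub>R u) w = - \<mu> * ((r *\<^sub>R u) \<bullet> w)" if "w \<in> U" for w
  proof -
    have "D (r *\<^sub>R s) \<bullet> w - c (r *\<^sub>R u) w = r * (D s \<bullet> w - c u w)"
      using D_scale[OF s(1)] c_scale[OF s(4) that] by (simp add: algebra_simps)
    then show ?thesis using s(3)[OF that] by (simp add: algebra_simps)
  qed
  ultimately show "r *\<^sub>R u \<in> mixed_eig a D c S U \<mu>"
    unfolding mixed_eig_def using S U s(1,4)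
    by (auto simp: subspace_scale intro!: bexI[of _ "r *\<^sub>R s"])
qed

text \<open>Testing the flux equation of \<open>u\<close> with the flux of \<open>u'\<close>, and
  the balance equation of \<open>u'\<close> with \<open>u\<close>, produces the same divergence term
  with opposite roles. Eliminating it leaves an energy identity, from which orthogonality and
  nonnegativity of eigenvalues follow.\<close>

lemma eig_energy:
  assumes "\<sigma> \<in> S" "\<sigma>' \<in> S" "u \<in> U" "u' \<in> U"
    and "\<And>\<tau>. \<tau> \<in> S \<Longrightarrow> a \<sigma> \<tau> + D \<tau> \<bullet> u = 0"
    and "\<And>v. v \<in> U \<Longrightarrow> D \<sigma>' \<bullet> v - c u' v = - \<mu>' * (u' \<bullet> v)"
  shows "a \<sigma> \<sigma>' + c u u' = \<mu>' * (u \<bullet> u')"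
  using assms(5)[OF assms(2)] assms(6)[OF assms(3)] c_sym[OF assms(3,4)] by (simp add: inner_commute)

lemma mixed_eig_orthogonal:
  assumes "u \<in> mixed_eig a D c S U \<mu>" "v \<in> mixed_eig a D c S U \<nu>" "\<mu> \<noteq> \<nu>"
  shows "u \<bullet> v = 0"
proof -
  obtain s where s: "s \<in> S" "\<And>\<tau>. \<tau> \<in> S \<Longrightarrow> a s \<tau> + D \<tau> \<bullet> u = 0"
      "\<And>v. v \<in> U \<Longrightarrow> D s \<bullet> v - c u v = - \<mu> * (u \<bullet> v)" "u \<in> U"
    using assms(1) unfolding mixed_eig_def by blast
  obtain t where t: "t \<in> S" "\<And>\<tau>. \<tau> \<in> S \<Longrightarrow> a t \<tau> + D \<tau> \<bullet> v = 0"
      "\<And>w. w \<in> U \<Longrightarrow> D t \<bullet> w - c v w = - \<nu> * (v \<bullet> w)" "v \<in> U"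
    using assms(2) unfolding mixed_eig_def by blast
  have "a s t + c u v = \<nu> * (u \<bullet> v)" "a t s + c v u = \<mu> * (v \<bullet> u)"
    using eig_energy[OF s(1) t(1) s(4) t(4) s(2) t(3)] eig_energy[OF t(1) s(1) t(4) s(4) t(2) s(3)] by auto
  then have "\<nu> * (u \<bullet> v) = \<mu> * (u \<bullet> v)"
    using a_sym[OF s(1) t(1)] c_sym[OF s(4) t(4)] inner_commute[of u v] by metis
  then show ?thesis using assms(3) by simp
qed

lemma eig_nonneg:
  assumes "u \<in> mixed_eig a D c S U \<mu>" "u \<noteq> 0" shows "\<mu> \<ge> 0"
proof -
  obtain s where s: "s \<in> S" "\<And>\<tau>. \<tau> \<in> S \<Longrightarrow> a s \<tau> + D \<tau> \<bullet> u = 0"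
      "\<And>v. v \<in> U \<Longrightarrow> D s \<bullet> v - c u v = - \<mu> * (u \<bullet> v)" "u \<in> U"
    using assms(1) unfolding mixed_eig_def by blast
  have "0 \<le> \<mu> * (u \<bullet> u)"
    using eig_energy[OF s(1) s(1) s(4) s(4) s(2) s(3)] a_nonneg[OF s(1)] c_nonneg[OF s(4)] by simp
  moreover have "u \<bullet> u > 0" using assms(2) by simp
  ultimately show ?thesis by (simp add: zero_le_mult_iff)
qed

text \<open>The last conjunct carries the induction: the eigenfunction of a new eigenvalue is
  orthogonal to the partial sum, so by the energy identity the mixed energy vanishes too, and both
  energies and squared norms simply add. The flux of the sum is kept as a witness because the
  projection argument later tests with it.\<close>

lemma eig_sum_energy:
  assumes "finite M" "\<And>\<mu>. \<mu> \<in> M \<Longrightarrow> w \<mu> \<in> mixed_eig a D c S U \<mu>" "\<And>\<mu>. \<mu> \<in> M \<Longrightarrow> \<mu> \<le> \<Lambda>"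
  shows "\<exists>\<sigma>\<in>S. (\<forall>\<tau>\<in>S. a \<sigma> \<tau> + D \<tau> \<bullet> (\<Sum>\<mu>\<in>M. w \<mu>) = 0) \<and> (\<Sum>\<mu>\<in>M. w \<mu>) \<in> U \<and>
     a \<sigma> \<sigma> + c (\<Sum>\<mu>\<in>M. w \<mu>) (\<Sum>\<mu>\<in>M. w \<mu>) \<le> \<Lambda> * (norm (\<Sum>\<mu>\<in>M. w \<mu>))\<^sup>2 \<and>
     (\<forall>\<nu>. \<nu> \<notin> M \<longrightarrow> (\<forall>u \<in> mixed_eig a D c S U \<nu>. u \<bullet> (\<Sum>\<mu>\<in>M. w \<mu>) = 0))"
  using assms
proof (induction M rule: finite_induct)
  case empty
  have "D 0 = 0" using D_scale[of 0 0] S by (simp add: subspace_0)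
  moreover have "a 0 t = 0" if "t \<in> S" for t using a_scale[OF that that, of 0] by simp
  moreover have "c 0 v = 0" if "v \<in> U" for v using c_scale[OF that that, of 0] by simp
  ultimately show ?case using S U by (auto simp: subspace_0 intro!: bexI[of _ 0])
next
  case (insert \<mu> M)
  let ?w = "\<Sum>\<mu>\<in>M. w \<mu>"
  obtain s where s: "s \<in> S" "\<And>\<tau>. \<tau> \<in> S \<Longrightarrow> a s \<tau> + D \<tau> \<bullet> ?w = 0" "?w \<in> U"
    "a s s + c ?w ?w \<le> \<Lambda> * (norm ?w)\<^sup>2"
    "\<And>\<nu> u. \<nu> \<notin> M \<Longrightarrow> u \<in> mixed_eig a D c S U \<nu> \<Longrightarrow> u \<bullet> ?w = 0"
    using insert.IH insert.prems by blast
  have wm: "w \<mu> \<in> mixed_eig a D c S U \<mu>" using insert.prems by auto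
  then obtain t where t: "t \<in> S" "\<And>\<tau>. \<tau> \<in> S \<Longrightarrow> a t \<tau> + D \<tau> \<bullet> w \<mu> = 0"
      "\<And>v. v \<in> U \<Longrightarrow> D t \<bullet> v - c (w \<mu>) v = - \<mu> * (w \<mu> \<bullet> v)" "w \<mu> \<in> U"
    unfolding mixed_eig_def by blast
  have orth: "w \<mu> \<bullet> ?w = 0" using s(5)[OF insert.hyps(2) wm] .
  have cross: "a s t + c ?w (w \<mu>) = 0"
    using eig_energy[OF s(1) t(1) s(3) t(4) s(2) t(3)] orth by (simp add: inner_commute)
  have self: "a t t + c (w \<mu>) (w \<mu>) = \<mu> * (w \<mu> \<bullet> w \<mu>)"
    using eig_energy[OF t(1) t(1) t(4) t(4) t(2) t(3)] .
  have st: "t + s \<in> S" "w \<mu> + ?w \<in> U" using S U s t by (auto intro: subspace_add)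
  have "a (t + s) (t + s) = a t (t+s) + a s (t+s)" using a_add[OF t(1) s(1) st(1)] .
  also have "\<dots> = a t t + 2 * a s t + a s s"
    using a_sym[OF t(1) st(1)] a_sym[OF s(1) st(1)] a_add[OF t(1) s(1) t(1)] a_add[OF t(1) s(1) s(1)]
      a_sym[OF s(1) t(1)] by simp
  finally have A: "a (t + s) (t + s) = a t t + 2 * a s t + a s s" .
  have "c (w \<mu> + ?w) (w \<mu> + ?w) = c (w \<mu>) (w \<mu>+?w) + c ?w (w \<mu>+?w)" using c_add[OF t(4) s(3) st(2)] .
  also have "\<dots> = c (w \<mu>) (w \<mu>) + 2 * c ?w (w \<mu>) + c ?w ?w"
    using c_sym[OF t(4) st(2)] c_sym[OF s(3) st(2)] c_add[OF t(4) s(3) t(4)] c_add[OF t(4) s(3) s(3)]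
      c_sym[OF s(3) t(4)] by simp
  finally have C: "c (w \<mu> + ?w) (w \<mu> + ?w) = c (w \<mu>) (w \<mu>) + 2 * c ?w (w \<mu>) + c ?w ?w" .
  have N: "(norm (w \<mu> + ?w))\<^sup>2 = w \<mu> \<bullet> w \<mu> + (norm ?w)\<^sup>2"
    using orth by (simp add: power2_norm_eq_inner inner_add_left inner_add_right inner_commute)
  have "\<mu> * (w \<mu> \<bullet> w \<mu>) \<le> \<Lambda> * (w \<mu> \<bullet> w \<mu>)"
    using insert.prems(2)[of \<mu>] by (intro mult_right_mono) auto
  then have E: "a (t + s) (t + s) + c (w \<mu> + ?w) (w \<mu> + ?w) \<le> \<Lambda> * (norm (w \<mu> + ?w))\<^sup>2"
    unfolding A C N using s(4) cross self by (simp add: algebra_simps)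
  have "a (t + s) \<tau> + D \<tau> \<bullet> (w \<mu> + ?w) = 0" if "\<tau> \<in> S" for \<tau>
    using a_add[OF t(1) s(1) that] s(2)[OF that] t(2)[OF that] by (simp add: inner_add_right)
  moreover have "u \<bullet> (w \<mu> + ?w) = 0" if "\<nu> \<notin> insert \<mu> M" "u \<in> mixed_eig a D c S U \<nu>" for \<nu> u
    using s(5)[OF _ that(2)] that mixed_eig_orthogonal[OF that(2) wm] by (auto simp: inner_add_right)
  ultimately show ?case using insert.hyps st E by (auto intro!: bexI[of _ "t + s"])
qed

end

section \<open>Counting eigenvalues and the min-max comparison\<close>

text \<open>Different eigenspaces are orthogonal, so orthonormal bases of them can be united without
  losing independence; the enumeration turns the sum of the dimensions into a number of
  indices.\<close>

lemma independent_union_eigenspaces: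
  fixes E :: "real \<Rightarrow> 'x::real_inner set"
  assumes en: "\<And>\<mu>. \<mu> \<in> M \<Longrightarrow> finite {i \<in> I. lam i = \<mu>} \<and> fin_dim (E \<mu>) \<and> card {i \<in> I. lam i = \<mu>} = dim (E \<mu>)"
    and sub: "\<And>\<mu>. subspace (E \<mu>)"
    and orth: "\<And>\<mu> \<nu> u v. u \<in> E \<mu> \<Longrightarrow> v \<in> E \<nu> \<Longrightarrow> \<mu> \<noteq> \<nu> \<Longrightarrow> u \<bullet> v = 0"
    and M: "finite M"
  obtains C where "finite C" "independent C" "card C = card {i \<in> I. lam i \<in> M}"
    "C \<subseteq> (\<Union>\<mu>\<in>M. E \<mu>)" "\<And>\<mu>. \<mu> \<in> M \<Longrightarrow> E \<mu> \<subseteq> span C"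
proof -
  have "\<exists>B. finite B \<and> span B = E \<mu> \<and> pairwise orthogonal B \<and> (\<forall>b\<in>B. norm b = 1)" if "\<mu> \<in> M" for \<mu>
    using orthonormal_basis_exists[OF sub, of \<mu>] en[OF that] by metis
  then obtain B where B: "\<And>\<mu>. \<mu> \<in> M \<Longrightarrow> finite (B \<mu>) \<and> span (B \<mu>) = E \<mu> \<and> pairwise orthogonal (B \<mu>) \<and> (\<forall>b\<in>B \<mu>. norm b = 1)"
    by metis
  define C where "C = (\<Union>\<mu>\<in>M. B \<mu>)"
  have BE: "B \<mu> \<subseteq> E \<mu>" if "\<mu> \<in> M" for \<mu> using B[OF that] span_superset by blast
  have nz: "0 \<notin> B \<mu>" if "\<mu> \<in> M" for \<mu> using B[OF that] by force
  have disj: "B \<mu> \<inter> B \<nu> = {}" if "\<mu> \<in> M" "\<nu> \<in> M" "\<mu> \<noteq> \<nu>" for \<mu> \<nu>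
  proof -
    have "b \<bullet> b = 0" if "b \<in> B \<mu>" "b \<in> B \<nu>" for b
      using orth[of b \<mu> b \<nu>] BE \<open>\<mu> \<in> M\<close> \<open>\<nu> \<in> M\<close> that \<open>\<mu> \<noteq> \<nu>\<close> by blast
    then show ?thesis using nz[OF that(1)] by fastforce
  qed
  have ind: "independent (B \<mu>)" if "\<mu> \<in> M" for \<mu>
    using B[OF that] nz[OF that] by (intro pairwise_orthogonal_independent) auto
  have cB: "card (B \<mu>) = card {i \<in> I. lam i = \<mu>}" if "\<mu> \<in> M" for \<mu>
    using dim_span_eq_card_independent[OF ind[OF that]] B[OF that] en[OF that] by simp
  have fC: "finite C" unfolding C_def using B M by blast
  have "pairwise orthogonal C"
    unfolding pairwise_def
  proof (intro ballI impI)
    fix x y assume x: "x \<in> C" and y: "y \<in> C" and ne: "x \<noteq> y"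
    obtain \<mu> \<nu> where m: "\<mu> \<in> M" "x \<in> B \<mu>" "\<nu> \<in> M" "y \<in> B \<nu>" using x y by (auto simp: C_def)
    show "orthogonal x y"
    proof (cases "\<mu> = \<nu>")
      case True then show ?thesis using B[OF m(1)] m ne by (auto simp: pairwise_def)
    next
      case False then show ?thesis using orth[of x \<mu> y \<nu>] BE m by (auto simp: orthogonal_def)
    qed
  qed
  moreover have "0 \<notin> C" using nz by (auto simp: C_def)
  ultimately have "independent C" by (rule pairwise_orthogonal_independent)
  moreover have "card C = (\<Sum>\<mu>\<in>M. card (B \<mu>))" unfolding C_def
    using M B disj by (intro card_UN_disjoint) auto
  moreover have "(\<Sum>\<mu>\<in>M. card (B \<mu>)) = (\<Sum>\<mu>\<in>M. card {i \<in> I. lam i = \<mu>})" using cB by simp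
  moreover have "\<dots> = card (\<Union>\<mu>\<in>M. {i \<in> I. lam i = \<mu>})"
    using M en by (intro card_UN_disjoint[symmetric]) auto
  moreover have "(\<Union>\<mu>\<in>M. {i \<in> I. lam i = \<mu>}) = {i \<in> I. lam i \<in> M}" by auto
  moreover have "C \<subseteq> (\<Union>\<mu>\<in>M. E \<mu>)" unfolding C_def using BE by blast
  moreover have "E \<mu> \<subseteq> span C" if "\<mu> \<in> M" for \<mu>
    using B[OF that] span_mono[of "B \<mu>" C] that unfolding C_def by blast
  ultimately show ?thesis using that[of C] fC by simp
qed

lemma span_union_subspaces_sum:
  fixes E :: "'m \<Rightarrow> 'x::real_vector set"
  assumes "finite M" "\<And>\<mu>. \<mu> \<in> M \<Longrightarrow> subspace (E \<mu>)" "u \<in> span (\<Union>\<mu>\<in>M. E \<mu>)"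
  obtains w where "\<And>\<mu>. \<mu> \<in> M \<Longrightarrow> w \<mu> \<in> E \<mu>" "u = (\<Sum>\<mu>\<in>M. w \<mu>)"
proof -
  have "\<exists>w. (\<forall>\<mu>\<in>M. w \<mu> \<in> E \<mu>) \<and> u = (\<Sum>\<mu>\<in>M. w \<mu>)"
    using assms(3)
  proof (induction rule: span_induct_alt)
    case base
    show ?case using assms by (intro exI[of _ "\<lambda>_. 0"]) (auto simp: subspace_0)
  next
    case (step r x y)
    then obtain w \<nu> where w: "\<And>\<mu>. \<mu> \<in> M \<Longrightarrow> w \<mu> \<in> E \<mu>" "y = (\<Sum>\<mu>\<in>M. w \<mu>)" "\<nu> \<in> M" "x \<in> E \<nu>" by blast
    let ?w = "\<lambda>\<mu>. (if \<mu> = \<nu> then r *\<^sub>R x else 0) + w \<mu>"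
    have "(\<Sum>\<mu>\<in>M. ?w \<mu>) = r *\<^sub>R x + y"
      using w(2,3) assms(1) by (simp add: sum.distrib)
    moreover have "?w \<mu> \<in> E \<mu>" if "\<mu> \<in> M" for \<mu>
      using w(1)[OF that] w(4) assms(2)[OF that] by (auto intro!: subspace_add subspace_scale)
    ultimately show ?case by (metis (no_types, lifting))
  qed
  then show ?thesis using that by blast
qed

text \<open>The orthogonal complement of \<open>C\<close> is invariant for the problem, so a
  minimiser \<open>v0\<close> of the Rayleigh quotient on it solves the full eigenvalue problem with
  the minimum \<open>m\<close> as eigenvalue. If \<open>m\<close> were below \<Lambda>, then
  \<open>v0\<close> would lie in \<open>span C\<close> while being orthogonal to it. Hence \<Lambda>
  bounds the quotient from below, in particular at \<open>v\<close>.\<close>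

lemma (in mixed_form) fin_dim_Rayleigh:
  assumes fS: "fin_dim S" and fU: "fin_dim U"
    and en: "enumerates_eigenvalues I (mixed_eig a D c S U) lam"
    and C: "\<And>\<mu>. \<mu> < \<Lambda> \<Longrightarrow> mixed_eig a D c S U \<mu> \<subseteq> span C" "C \<subseteq> U" "finite C"
      "C \<subseteq> (\<Union>\<mu>\<in>{..<\<Lambda>}. mixed_eig a D c S U \<mu>)"
    and v: "v \<in> U" "\<And>d. d \<in> C \<Longrightarrow> v \<bullet> d = 0"
    and s: "\<sigma> \<in> S" "\<And>\<tau>. \<tau> \<in> S \<Longrightarrow> a \<sigma> \<tau> + D \<tau> \<bullet> v = 0"
  shows "\<Lambda> * (norm v)\<^sup>2 \<le> a \<sigma> \<sigma> + c v v"
proof (cases "v = 0")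
  case True
  then have "a \<sigma> \<sigma> = 0" using s(2)[OF s(1)] by simp
  moreover have "c v v = 0" using c_scale[OF v(1) v(1), of 0] True by simp
  ultimately show ?thesis using True by simp
next
  case False
  obtain B where B: "finite B" "S = span B"
    using orthonormal_basis_exists[OF U fU] fS S
  proof -
    obtain B0 where B0: "finite B0" "S \<subseteq> span B0" using fS by (auto simp: fin_dim_def)
    obtain B1 where B1: "B1 \<subseteq> S" "independent B1" "S \<subseteq> span B1" by (rule maximal_independent_subset)
    have "finite B1" using independent_span_bound[OF B0(1) B1(2)] B0(2) B1(1) by auto
    moreover have "span B1 = S" using B1 S by (metis span_eq_iff span_mono subset_antisym)
    ultimately show ?thesis using that by blast
  qed
  have "\<exists>s\<in>S. \<forall>\<tau>\<in>S. a s \<tau> + D \<tau> \<bullet> w = 0" for w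
  proof -
    have "\<exists>s\<in>span B. \<forall>t\<in>span B. a s t = - (D t \<bullet> w)"
      by (rule Riesz_finite[OF B(1)]; (fold B(2))?)
         (simp_all add: a_add a_scale a_sym a_def D_add D_scale inner_add_left)
    then show ?thesis unfolding B(2) by force
  qed
  \<comment> \<open>\<open>g w\<close> is the flux determined by \<open>w\<close>; inserting it
    turns the mixed problem into one symmetric form \<open>q\<close> on \<open>U\<close>.\<close>
  then obtain g where g: "\<And>w. g w \<in> S" "\<And>w \<tau>. \<tau> \<in> S \<Longrightarrow> a (g w) \<tau> + D \<tau> \<bullet> w = 0" by metis
  define q where "q x y = a (g x) (g y) + c x y" for x y
  have aD: "a (g x) (g y) = - (D (g y) \<bullet> x)" for x y using g(2)[OF g(1), of x y] by simp
  define V where "V = {x \<in> U. \<forall>d\<in>C. x \<bullet> d = 0}"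
  have V: "subspace V" unfolding V_def using U
    by (auto simp: subspace_def inner_add_left)
  have fV: "fin_dim V" using fU unfolding fin_dim_def V_def by blast
  have VU: "V \<subseteq> U" by (auto simp: V_def)
  have qadd: "q (x + y) z = q x z + q y z" if "x \<in> U" "y \<in> U" "z \<in> U" for x y z
    unfolding q_def aD using c_add[OF that] by (simp add: inner_add_right)
  have qscale: "q (r *\<^sub>R x) z = r * q x z" if "x \<in> U" "z \<in> U" for r x z
    unfolding q_def aD using c_scale[OF that] by (simp add: algebra_simps)
  have qsym: "q x y = q y x" if "x \<in> U" "y \<in> U" for x y
    unfolding q_def using a_sym[OF g(1) g(1)] c_sym[OF that] by simp
  have vV: "v \<in> V" using v by (auto simp: V_def)
  obtain v0 m where v0: "v0 \<in> V" "norm v0 = 1" "\<And>v. v \<in> V \<Longrightarrow> m * (norm v)\<^sup>2 \<le> q v v"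
    "\<And>w. w \<in> V \<Longrightarrow> q v0 w = m * (v0 \<bullet> w)"
  proof (rule Rayleigh_minimizer[OF V fV vV False, of q])
    show "q (x + y) z = q x z + q y z" if "x \<in> V" "y \<in> V" "z \<in> V" for x y z
      using that VU by (intro qadd) auto
    show "q (r *\<^sub>R x) z = r * q x z" if "x \<in> V" "z \<in> V" for r x z
      using that VU by (intro qscale) auto
    show "q x y = q y x" if "x \<in> V" "y \<in> V" for x y
      using that VU by (intro qsym) auto
  qed (rule that)
  have v0U: "v0 \<in> U" using v0 VU by auto
  \<comment> \<open>Against an eigenfunction \<open>q\<close> is a multiple of the inner product, so
    being orthogonal to \<open>C\<close> in the inner product entails the same for
    \<open>q\<close>.\<close>
  have q0: "q v0 w = 0" if "w \<in> C" for w
  proof -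
    have "w \<in> (\<Union>\<mu>\<in>{..<\<Lambda>}. mixed_eig a D c S U \<mu>)" using C(4) \<open>w \<in> C\<close> by (rule subsetD)
    then obtain \<mu> where "w \<in> mixed_eig a D c S U \<mu>" by (rule UN_E)
    then obtain t where t: "t \<in> S" "\<And>\<tau>. \<tau> \<in> S \<Longrightarrow> a t \<tau> + D \<tau> \<bullet> w = 0"
      "\<And>v. v \<in> U \<Longrightarrow> D t \<bullet> v - c w v = - \<mu> * (w \<bullet> v)" "w \<in> U"
      unfolding mixed_eig_def by blast
    have "a (g w) (g v0) = a t (g v0)" using t(2)[OF g(1), of v0] g(2)[OF g(1), of w v0] by simp
    also have "\<dots> = a (g v0) t" using a_sym[OF t(1) g(1)] .
    also have "\<dots> = - (D t \<bullet> v0)" using g(2)[OF t(1), of v0] by simp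
    finally have "q v0 w = - (D t \<bullet> v0) + c w v0"
      using qsym[OF t(4) v0U] unfolding q_def by simp
    also have "\<dots> = \<mu> * (w \<bullet> v0)" using t(3)[OF v0U] by simp
    also have "v0 \<bullet> w = 0" using v0(1) \<open>w \<in> C\<close> unfolding V_def by blast
    then have "\<mu> * (w \<bullet> v0) = 0" by (simp add: inner_commute)
    finally show ?thesis by simp
  qed
  have qspan: "q v0 w = 0" if "w \<in> span C" for w
  proof -
    have "w \<in> U \<and> q v0 w = 0" using that
    proof (induction rule: span_induct_alt)
      case base
      show ?case using U qscale[OF v0U v0U, of 0] qsym[of v0 0] v0U by (auto simp: subspace_0)
    next
      case (step r x y)
      then have xU: "x \<in> U" "r *\<^sub>R x \<in> U" "r *\<^sub>R x + y \<in> U"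
        using C(2) U by (auto intro!: subspace_scale subspace_add)
      have "q v0 (r *\<^sub>R x + y) = q (r *\<^sub>R x + y) v0" using qsym xU v0U by auto
      also have "\<dots> = r * q x v0 + q y v0" using qadd[of "r *\<^sub>R x" y v0] qscale[OF xU(1) v0U] xU step v0U by simp
      also have "\<dots> = 0" using qsym xU v0U step q0[OF step.hyps] by auto
      finally show ?case using xU by simp
    qed
    then show ?thesis by simp
  qed
  \<comment> \<open>So far stationarity is known for variations in \<open>V\<close>. A general
    variation is the sum of one in \<open>V\<close> and of its projection onto
    \<open>span C\<close>, where both sides vanish.\<close>
  have stat: "q v0 w = m * (v0 \<bullet> w)" if w: "w \<in> U" for w
  proof -
    have "subspace (span C)" "fin_dim (span C)" using C(3) by (auto simp: fin_dim_def)
    then obtain p where p: "p \<in> span C" "\<And>d. d \<in> span C \<Longrightarrow> (w - p) \<bullet> d = 0"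
      using orthogonal_projection_exists by metis
    have pU: "p \<in> U" using p(1) C(2) U by (meson span_minimal subsetD)
    have wV: "w - p \<in> V" unfolding V_def using w pU U p(2) span_base by (auto intro!: subspace_diff)
    have "q v0 w = q ((w - p) + p) v0" using qsym[OF v0U w] by simp
    also have "\<dots> = q v0 (w - p) + q v0 p"
      using qadd[of "w - p" p v0] wV VU pU v0U qsym by (metis subsetD)
    also have "\<dots> = m * (v0 \<bullet> (w - p))" using qspan[OF p(1)] v0(4)[OF wV] by simp
    also have "v0 \<bullet> p = 0" using inner_span_eq_0[OF p(1), of v0] v0(1) by (auto simp: V_def)
    then have "m * (v0 \<bullet> (w - p)) = m * (v0 \<bullet> w)" by (simp add: inner_diff_right)
    finally show ?thesis .
  qed
  have "v0 \<in> mixed_eig a D c S U m"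
  proof -
    have "D (g v0) \<bullet> w - c v0 w = - m * (v0 \<bullet> w)" if w: "w \<in> U" for w
      using stat[OF w] aD[of w v0] a_sym[OF g(1) g(1), of v0 w] unfolding q_def by simp
    then show ?thesis unfolding mixed_eig_def using v0U g by blast
  qed
  moreover have "v0 \<notin> span C"
  proof
    assume "v0 \<in> span C"
    then have "v0 \<bullet> v0 = 0" using inner_span_eq_0[of v0 C v0] v0(1) by (auto simp: V_def)
    then show False using v0(2) by simp
  qed
  ultimately have "\<Lambda> \<le> m" using C(1)[of m] by force
  then have "\<Lambda> * (norm v)\<^sup>2 \<le> m * (norm v)\<^sup>2" by (intro mult_right_mono) auto
  also have "\<dots> \<le> q v v" using v0(3)[OF vV] .
  \<comment> \<open>Both \<open>g v\<close> and \<open>\<sigma>\<close> represent the functional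
    given by \<open>v\<close>, so each may replace the other in one slot at a time.\<close>
  also have "a (g v) (g v) = a \<sigma> \<sigma>"
  proof -
    have "a (g v) (g v) = a \<sigma> (g v)" using g(2)[OF g(1), of v v] s(2)[OF g(1), of v] by simp
    also have "\<dots> = a (g v) \<sigma>" using a_sym[OF s(1) g(1)] .
    also have "\<dots> = a \<sigma> \<sigma>" using g(2)[OF s(1), of v] s(2)[OF s(1)] by simp
    finally show ?thesis .
  qed
  then have "q v v = a \<sigma> \<sigma> + c v v" by (simp add: q_def)
  finally show ?thesis .
qed

text \<open>Write \<open>E\<close> for the energy of a function, flux part plus \<open>c\<close>
  part. With \<open>v\<close> the projection of \<open>u\<close>, two facts meet:
  \<open>lamh J * |v|^2 <= E v <= E u <= lam J * |u|^2\<close>, and the projection loses at most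
  \<open>|u|^2 - |v|^2 <= \<kappa> * lam J * |u|^2\<close>. Eliminating \<open>|v|\<close> and
  dividing by \<open>|u|^2\<close> gives the quotient.\<close>

theorem (in mixed_form) abstract_lower_bound:
  assumes Sh: "subspace Sh" "fin_dim Sh" "Sh \<subseteq> S" and Uh: "subspace Uh" "fin_dim Uh" "Uh \<subseteq> U"
    and DSh: "D ` Sh \<subseteq> Uh"
    and c_proj: "\<And>u v. u \<in> U \<Longrightarrow> v \<in> Uh \<Longrightarrow> (\<And>w. w \<in> Uh \<Longrightarrow> (u - v) \<bullet> w = 0) \<Longrightarrow> c v v \<le> c u u"
    and approx: "\<And>u \<sigma>. u \<in> U \<Longrightarrow> \<sigma> \<in> S \<Longrightarrow> (\<And>\<tau>. \<tau> \<in> S \<Longrightarrow> a \<sigma> \<tau> + D \<tau> \<bullet> u = 0) \<Longrightarrow>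
       \<exists>w\<in>Uh. (norm (u - w))\<^sup>2 \<le> \<kappa> * a \<sigma> \<sigma>"
    and \<kappa>: "\<kappa> \<ge> 0"
    and lam: "enumerates_eigenvalues {1..} (mixed_eig a D c S U) lam"
    and lamh: "enumerates_eigenvalues {1..N} (mixed_eig a D c Sh Uh) lamh"
    and J: "J \<in> {1..N}"
  shows "lamh J / (1 + lamh J * \<kappa>) \<le> lam J"
proof -
  interpret h: mixed_form a D c Sh Uh by (rule sub_form) (use Sh Uh in auto)
  have en: "finite {i \<in> {1..}. lam i = \<mu>} \<and> fin_dim (mixed_eig a D c S U \<mu>) \<and>
      card {i \<in> {1..}. lam i = \<mu>} = dim (mixed_eig a D c S U \<mu>)" for \<mu>
    using lam unfolding enumerates_eigenvalues_def by blast
  have enh: "finite {i \<in> {1..N}. lamh i = \<mu>} \<and> fin_dim (mixed_eig a D c Sh Uh \<mu>) \<and>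
      card {i \<in> {1..N}. lamh i = \<mu>} = dim (mixed_eig a D c Sh Uh \<mu>)" for \<mu>
    using lamh unfolding enumerates_eigenvalues_def by blast
  define M where "M = lam ` {1..J}"
  \<comment> \<open>Only eigenvalues strictly below \<open>lamh J\<close> are taken: by monotonicity
    they occupy at most \<open>J - 1\<close> indices, one fewer than the dimension available on the
    continuous side.\<close>
  define Mh where "Mh = lamh ` {1..N} \<inter> {..<lamh J}"
  have M: "finite M" "finite Mh" by (auto simp: M_def Mh_def)
  obtain C where C: "finite C" "independent C" "card C = card {i \<in> {1..}. lam i \<in> M}"
    "C \<subseteq> (\<Union>\<mu>\<in>M. mixed_eig a D c S U \<mu>)"
    by (rule independent_union_eigenspaces[OF en subspace_mixed_eig _ M(1)])
       (rule mixed_eig_orthogonal, assumption, assumption, assumption, rule that)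
  obtain Ch where Ch: "finite Ch" "independent Ch" "card Ch = card {i \<in> {1..N}. lamh i \<in> Mh}"
    "Ch \<subseteq> (\<Union>\<mu>\<in>Mh. mixed_eig a D c Sh Uh \<mu>)" "\<And>\<mu>. \<mu> \<in> Mh \<Longrightarrow> mixed_eig a D c Sh Uh \<mu> \<subseteq> span Ch"
    by (rule independent_union_eigenspaces[OF enh h.subspace_mixed_eig _ M(2)])
       (rule h.mixed_eig_orthogonal, assumption, assumption, assumption, rule that)
  have "finite {i \<in> {1..}. lam i \<in> M}"
  proof -
    have "{i \<in> {1..}. lam i \<in> M} = (\<Union>\<mu>\<in>M. {i \<in> {1..}. lam i = \<mu>})" by auto
    then show ?thesis using M(1) en by auto
  qed
  \<comment> \<open>Only an inequality: if \<open>lam J\<close> is multiple, its eigenspace may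
    contribute indices beyond \<open>J\<close>.\<close>
  then have "card {1..J} \<le> card C" unfolding C(3) M_def by (intro card_mono) auto
  then have cC: "J \<le> card C" by simp
  have "{i \<in> {1..N}. lamh i \<in> Mh} \<subseteq> {1..<J}"
  proof
    fix i assume i: "i \<in> {i \<in> {1..N}. lamh i \<in> Mh}"
    have "i < J"
    proof (rule ccontr)
      assume "\<not> i < J"
      then have "lamh J \<le> lamh i"
        using lamh i J unfolding enumerates_eigenvalues_def mono_on_def by auto
      then show False using i by (auto simp: Mh_def)
    qed
    then show "i \<in> {1..<J}" using i by auto
  qed
  then have "card Ch \<le> card {1..<J}" unfolding Ch(3) by (intro card_mono) auto
  then have cCh: "card Ch < card C" using cC J by auto
  obtain u where u: "u \<in> span C" "u \<noteq> 0" "\<And>d. d \<in> Ch \<Longrightarrow> u \<bullet> d = 0"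
    by (rule exists_orthogonal_in_span[OF C(2,1) Ch(1) cCh]) (rule that)
  have "u \<in> span (\<Union>\<mu>\<in>M. mixed_eig a D c S U \<mu>)" using u(1) span_mono[OF C(4)] by blast
  then obtain w where w: "\<And>\<mu>. \<mu> \<in> M \<Longrightarrow> w \<mu> \<in> mixed_eig a D c S U \<mu>" "u = (\<Sum>\<mu>\<in>M. w \<mu>)"
    by (rule span_union_subspaces_sum[OF M(1) subspace_mixed_eig]) (rule that)
  have "\<mu> \<le> lam J" if "\<mu> \<in> M" for \<mu>
    using that J lam unfolding M_def enumerates_eigenvalues_def mono_on_def by auto
  then obtain \<sigma> where \<sigma>: "\<sigma> \<in> S" "\<And>\<tau>. \<tau> \<in> S \<Longrightarrow> a \<sigma> \<tau> + D \<tau> \<bullet> u = 0" "u \<in> U"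
     "a \<sigma> \<sigma> + c u u \<le> lam J * (norm u)\<^sup>2"
    using eig_sum_energy[of M w "lam J", OF M(1) w(1)] unfolding w(2)[symmetric] by blast
  obtain v where v: "v \<in> Uh" "\<And>w. w \<in> Uh \<Longrightarrow> (u - v) \<bullet> w = 0"
    using orthogonal_projection_exists[OF Uh(1,2)] by metis
  have ChU: "Ch \<subseteq> Uh" using Ch(4) unfolding mixed_eig_def by blast
  have v_orth: "v \<bullet> d = 0" if "d \<in> Ch" for d
    using v(2)[of d] u(3)[OF that] ChU that by (auto simp: inner_diff_left)
  obtain B where B: "finite B" "Sh = span B"
  proof -
    obtain B0 where B0: "finite B0" "Sh \<subseteq> span B0" using Sh by (auto simp: fin_dim_def)
    obtain B1 where B1: "B1 \<subseteq> Sh" "independent B1" "Sh \<subseteq> span B1" by (rule maximal_independent_subset)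
    have "finite B1" using independent_span_bound[OF B0(1) B1(2)] B0(2) B1(1) by auto
    moreover have "span B1 = Sh" using B1 Sh by (metis span_eq_iff span_mono subset_antisym)
    ultimately show ?thesis using that by blast
  qed
  have "\<exists>s\<in>span B. \<forall>t\<in>span B. a s t = - (D t \<bullet> v)"
    by (rule Riesz_finite[OF B(1)]; (fold B(2))?)
       (simp_all add: h.a_add h.a_scale h.a_sym h.a_def h.D_add h.D_scale inner_add_left)
  then obtain s where s: "s \<in> Sh" "\<And>t. t \<in> Sh \<Longrightarrow> a s t + D t \<bullet> v = 0"
    unfolding B(2) by force
  have energy: "lamh J * (norm v)\<^sup>2 \<le> a s s + c v v"
  proof (rule h.fin_dim_Rayleigh[OF Sh(2) Uh(2) lamh _ ChU Ch(1) _ v(1) v_orth s])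
    fix \<mu> assume \<mu>: "\<mu> < lamh J"
    show "mixed_eig a D c Sh Uh \<mu> \<subseteq> span Ch"
    proof (cases "\<mu> \<in> lamh ` {1..N}")
      case True
      then show ?thesis using Ch(5) \<mu> by (auto simp: Mh_def)
    next
      case False
      then have e0: "{i \<in> {1..N}. lamh i = \<mu>} = {}" by auto
      have d0: "dim (mixed_eig a D c Sh Uh \<mu>) = 0" using enh[of \<mu>] unfolding e0 by simp
      obtain X where X: "X \<subseteq> mixed_eig a D c Sh Uh \<mu>" "independent X"
          "mixed_eig a D c Sh Uh \<mu> \<subseteq> span X" "card X = dim (mixed_eig a D c Sh Uh \<mu>)"
        using basis_exists[of "mixed_eig a D c Sh Uh \<mu>"] by metis
      \<comment> \<open>A zero \<open>dim\<close> would also fit an infinite basis, whose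
        \<open>card\<close> is 0 by convention; finite dimension excludes this, so the eigenspace is
        trivial.\<close>
      obtain X0 where X0: "finite X0" "mixed_eig a D c Sh Uh \<mu> \<subseteq> span X0"
        using enh[of \<mu>] by (auto simp: fin_dim_def)
      have "finite X" using independent_span_bound[OF X0(1) X(2)] X(1) X0(2) by auto
      then have "X = {}" using X(4) d0 by simp
      then show ?thesis using X(3) by (auto simp: span_zero)
    qed
  qed (use Ch(4) in \<open>auto simp: Mh_def\<close>)
  have as: "a s s \<le> a \<sigma> \<sigma>"
  proof -
    have sS: "s \<in> S" using s Sh by auto
    \<comment> \<open>\<open>D s\<close> lies in \<open>Uh\<close> and does not see
      \<open>u - v\<close>, so \<open>s\<close> and \<open>\<sigma>\<close> agree when tested with
      \<open>s\<close>; Cauchy-Schwarz for \<open>a\<close> then compares their energies.\<close>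
    have "(D s) \<bullet> (u - v) = 0" using v(2)[of "D s"] DSh s(1) by (auto simp: inner_commute)
    then have eq: "a s s = a \<sigma> s"
      using \<sigma>(2)[OF sS] s(2)[OF s(1)] by (simp add: inner_diff_right)
    have "(a s s)\<^sup>2 \<le> a \<sigma> \<sigma> * a s s" using a_Cauchy_Schwarz[OF \<sigma>(1) sS] eq by simp
    then show ?thesis using a_nonneg[OF sS] a_nonneg[OF \<sigma>(1)]
      by (cases "a s s = 0") (auto simp: power2_eq_square mult_le_cancel_right)
  qed
  have cv: "c v v \<le> c u u" using c_proj[OF \<sigma>(3) v(1) v(2)] .
  have pyth: "(norm u)\<^sup>2 = (norm v)\<^sup>2 + (norm (u - v))\<^sup>2"
  proof -
    have "(u - v) \<bullet> v = 0" using v by auto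
    then show ?thesis by (simp add: power2_norm_eq_inner inner_diff_left inner_diff_right inner_commute)
  qed
  have appr: "(norm (u - v))\<^sup>2 \<le> \<kappa> * a \<sigma> \<sigma>"
  proof -
    obtain w where w: "w \<in> Uh" "(norm (u - w))\<^sup>2 \<le> \<kappa> * a \<sigma> \<sigma>" using approx[OF \<sigma>(3,1,2)] by blast
    have "v - w \<in> Uh" using v(1) w(1) Uh(1) by (rule subspace_diff[rotated])
    then have "(u - v) \<bullet> (v - w) = 0" using v(2) by blast
    then have "(norm (u - w))\<^sup>2 = (norm (u - v))\<^sup>2 + (norm (v - w))\<^sup>2"
      by (simp add: power2_norm_eq_inner inner_diff_left inner_diff_right inner_commute)
    then show ?thesis using w(2) zero_le_power2[of "norm (v - w)"] by linarith
  qed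
  have lamh0: "lamh J \<ge> 0"
  proof -
    \<comment> \<open>The index \<open>J\<close> itself is counted, so the eigenspace of
      \<open>lamh J\<close> contains a nonzero vector and the sign of eigenvalues applies.\<close>
    have "card {i \<in> {1..N}. lamh i = lamh J} \<noteq> 0" using J by auto
    then have "dim (mixed_eig a D c Sh Uh (lamh J)) \<noteq> 0" using enh[of "lamh J"] by metis
    then have "\<not> mixed_eig a D c Sh Uh (lamh J) \<subseteq> {0}"
      using dim_le_card[of "mixed_eig a D c Sh Uh (lamh J)" "{}"] by auto
    then show ?thesis using h.eig_nonneg by blast
  qed
  let ?L = "lamh J" and ?l = "lam J" and ?n = "(norm u)\<^sup>2"
  have n: "?n > 0" using u(2) by simp
  have c0: "c u u \<ge> 0" using c_nonneg[OF \<sigma>(3)] .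
  have a0: "a \<sigma> \<sigma> \<le> ?l * ?n" using \<sigma>(4) c0 by simp
  have "?L * (?n - \<kappa> * (?l * ?n)) \<le> ?L * (norm v)\<^sup>2"
  proof (rule mult_left_mono[OF _ lamh0])
    have "\<kappa> * a \<sigma> \<sigma> \<le> \<kappa> * (?l * ?n)" using a0 \<kappa> by (intro mult_left_mono)
    then show "?n - \<kappa> * (?l * ?n) \<le> (norm v)\<^sup>2" using pyth appr by linarith
  qed
  also have "\<dots> \<le> ?l * ?n" using energy as cv \<sigma>(4) by linarith
  finally have "?n * ?L \<le> ?n * (?l * (1 + ?L * \<kappa>))" by (simp add: algebra_simps)
  then have "?L \<le> ?l * (1 + ?L * \<kappa>)" using n by (simp add: mult_le_cancel_left)
  moreover have "1 + ?L * \<kappa> > 0" using lamh0 \<kappa> by (simp add: add_pos_nonneg)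
  ultimately show ?thesis by (simp add: pos_divide_le_eq)
qed

section \<open>The weighted Wirtinger inequality\<close>

text \<open>With \<open>\<tau>\<close> the primitive of \<open>F exp (- 2 \<psi>)\<close>, which vanishes at both ends, and \<open>c\<close> a solution of
  the Riccati equation \<open>c' = - \<kappa>\<^sup>2 - c\<^sup>2\<close> (a cotangent, regular as \<open>\<kappa> (\<beta> - \<alpha>) < \<pi>\<close>), the integrand
  of the difference is the exact derivative \<open>\<Phi>'\<close> plus a sum of squares.\<close>

lemma weighted_Wirtinger_smooth:
  fixes F F' \<psi> \<psi>' \<psi>'' :: "real \<Rightarrow> real"
  assumes ab: "\<alpha> < \<beta>" and k: "0 < \<kappa>" "\<kappa> * (\<beta> - \<alpha>) < pi"
    and d1: "\<And>x. x \<in> {\<alpha>..\<beta>} \<Longrightarrow> (\<psi> has_real_derivative \<psi>' x) (at x)"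
    and d2: "\<And>x. x \<in> {\<alpha>..\<beta>} \<Longrightarrow> (\<psi>' has_real_derivative \<psi>'' x) (at x)"
    and convex: "\<And>x. x \<in> {\<alpha>..\<beta>} \<Longrightarrow> 0 \<le> \<psi>'' x"
    and dF: "\<And>x. x \<in> {\<alpha>..\<beta>} \<Longrightarrow> (F has_real_derivative F' x) (at x)"
    and F'_cont: "continuous_on {\<alpha>..\<beta>} F'"
    and mean0: "integral {\<alpha>..\<beta>} (\<lambda>x. F x * exp (- 2 * \<psi> x)) = 0"
  shows "\<kappa>\<^sup>2 * integral {\<alpha>..\<beta>} (\<lambda>x. (F x)\<^sup>2 * exp (- 2 * \<psi> x))
     \<le> integral {\<alpha>..\<beta>} (\<lambda>x. (F' x)\<^sup>2 * exp (- 2 * \<psi> x))"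
proof -
  \<comment> \<open>Centres the argument of the cotangent: \<open>y\<close> runs from
    \<open>\<theta>\<close> to \<open>pi - \<theta>\<close>, symmetric about \<open>pi / 2\<close>,
    so the sine stays positive.\<close>
  define \<theta> where "\<theta> = (pi - \<kappa> * (\<beta> - \<alpha>)) / 2"
  define p where "p x = exp (- 2 * \<psi> x)" for x
  define q where "q x = exp (2 * \<psi> x)" for x
  define \<tau> where "\<tau> x = integral {\<alpha>..x} (\<lambda>x. F x * p x)" for x
  define y where "y x = \<kappa> * (x - \<alpha>) + \<theta>" for x
  define c where "c x = \<kappa> * (cos (y x) / sin (y x))" for x
  define R where "R x = c x - \<psi>' x" for x
  define \<Phi> where "\<Phi> x = \<kappa>\<^sup>2 * (R x * q x * (\<tau> x)\<^sup>2 - 2 * (F x * \<tau> x))" for x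
  have pq: "p x * q x = 1" for x by (simp add: p_def q_def flip: exp_add)
  have contF: "continuous_on {\<alpha>..\<beta>} F" "continuous_on {\<alpha>..\<beta>} \<psi>"
    using dF d1 by (meson DERIV_isCont continuous_at_imp_continuous_on)+
  have contp: "continuous_on {\<alpha>..\<beta>} p" unfolding p_def by (intro continuous_intros contF)
  have sin_pos: "sin (y x) > 0" if "x \<in> {\<alpha>..\<beta>}" for x
  proof (rule sin_gt_zero)
    have "\<kappa> * (x - \<alpha>) \<ge> 0" using that k by auto
    moreover have "\<theta> > 0" using k by (simp add: \<theta>_def)
    ultimately show "0 < y x" by (simp add: y_def)
    have "\<kappa> * (x - \<alpha>) \<le> \<kappa> * (\<beta> - \<alpha>)" using that k by (intro mult_left_mono) auto
    then have "y x \<le> \<kappa> * (\<beta> - \<alpha>) + \<theta>" by (simp add: y_def)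
    also have "\<dots> < pi" using k by (simp add: \<theta>_def field_simps)
    finally show "y x < pi" .
  qed
  have dc: "(c has_real_derivative - \<kappa>\<^sup>2 - (c x)\<^sup>2) (at x)" if "x \<in> {\<alpha>..\<beta>}" for x
  proof -
    have "sin (y x) \<noteq> 0" using sin_pos[OF that] by simp
    then have "(c has_real_derivative \<kappa> * ((- sin (y x) * \<kappa> * sin (y x) - cos (y x) * (cos (y x) * \<kappa>)) / (sin (y x) * sin (y x)))) (at x)"
      unfolding c_def y_def by (auto intro!: derivative_eq_intros simp: algebra_simps)
    moreover have "\<kappa> * ((- sin (y x) * \<kappa> * sin (y x) - cos (y x) * (cos (y x) * \<kappa>)) / (sin (y x) * sin (y x)))
       = - \<kappa>\<^sup>2 - (c x)\<^sup>2"
      using \<open>sin (y x) \<noteq> 0\<close> by (simp add: c_def field_simps power2_eq_square)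
    ultimately show ?thesis by simp
  qed
  have d\<tau>: "(\<tau> has_real_derivative F x * p x) (at x within {\<alpha>..\<beta>})" if "x \<in> {\<alpha>..\<beta>}" for x
    unfolding \<tau>_def by (rule integral_has_real_derivative[OF _ that]) (intro continuous_intros contF contp)
  have dq: "(q has_real_derivative 2 * \<psi>' x * q x) (at x)" if "x \<in> {\<alpha>..\<beta>}" for x
    unfolding q_def using d1[OF that] by (auto intro!: derivative_eq_intros)
  define \<Phi>' where "\<Phi>' x = \<kappa>\<^sup>2 * (((- \<kappa>\<^sup>2 - (c x)\<^sup>2 - \<psi>'' x) * q x + R x * (2 * \<psi>' x * q x)) * (\<tau> x)\<^sup>2
      + R x * q x * (2 * \<tau> x * (F x * p x)) - 2 * (F' x * \<tau> x + F x * (F x * p x)))" for x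
  have d\<Phi>: "(\<Phi> has_vector_derivative \<Phi>' x) (at x within {\<alpha>..\<beta>})" if x: "x \<in> {\<alpha>..\<beta>}" for x
  proof -
    have dR: "(R has_real_derivative - \<kappa>\<^sup>2 - (c x)\<^sup>2 - \<psi>'' x) (at x within {\<alpha>..\<beta>})"
      unfolding R_def by (intro DERIV_diff DERIV_subset[OF dc[OF x]] DERIV_subset[OF d2[OF x]]) auto
    have "(\<Phi> has_real_derivative \<Phi>' x) (at x within {\<alpha>..\<beta>})"
      unfolding \<Phi>_def \<Phi>'_def
      by (rule derivative_eq_intros refl dR d\<tau>[OF x] DERIV_subset[OF dq[OF x]] DERIV_subset[OF dF[OF x]] subset_UNIV)+
         (simp add: algebra_simps power2_eq_square)
    then show ?thesis by (simp add: has_real_derivative_iff_has_vector_derivative)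
  qed
  have ft: "(\<Phi>' has_integral (\<Phi> \<beta> - \<Phi> \<alpha>)) {\<alpha>..\<beta>}"
    using fundamental_theorem_of_calculus[of \<alpha> \<beta> \<Phi> \<Phi>'] d\<Phi> ab by simp
  have "\<tau> \<alpha> = 0" "\<tau> \<beta> = 0" using mean0 by (auto simp: \<tau>_def p_def)
  then have ft0: "(\<Phi>' has_integral 0) {\<alpha>..\<beta>}" using ft by (simp add: \<Phi>_def)
  have pw: "\<Phi>' x \<le> (F' x)\<^sup>2 * p x - \<kappa>\<^sup>2 * ((F x)\<^sup>2 * p x)" if x: "x \<in> {\<alpha>..\<beta>}" for x
  proof -
    have q0: "q x > 0" "p x > 0" by (auto simp: q_def p_def)
    define P Q T where "P = p x" and "Q = q x" and "T = \<tau> x"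
    have PQ: "P * Q = 1" using pq by (simp add: P_def Q_def)
    \<comment> \<open>Convexity of the potential enters here, through the sign of
      \<open>\<psi>'' x\<close>; the relation \<open>P * Q = 1\<close> cancels the weights in the
      mixed terms.\<close>
    have id: "(F' x)\<^sup>2 * P - \<kappa>\<^sup>2 * ((F x)\<^sup>2 * P) - \<Phi>' x =
       P * (F' x + \<kappa>\<^sup>2 * Q * T)\<^sup>2 + \<kappa>\<^sup>2 * Q * ((\<psi>'' x + (\<psi>' x)\<^sup>2) * T\<^sup>2 + (R x * T - F x * P)\<^sup>2)"
    proof -
      have e1: "P * (F' x + \<kappa>\<^sup>2 * Q * T)\<^sup>2 = (F' x)\<^sup>2 * P + 2 * \<kappa>\<^sup>2 * T * F' x + \<kappa>^4 * Q * T\<^sup>2"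
        using PQ by algebra
      have e2: "Q * (R x * T - F x * P)\<^sup>2 = Q * (R x)\<^sup>2 * T\<^sup>2 - 2 * R x * T * F x + (F x)\<^sup>2 * P"
        using PQ by algebra
      have e3: "R x * Q * (2 * T * (F x * P)) = 2 * R x * T * F x * (P * Q)" by simp
      have "\<Phi>' x = \<kappa>\<^sup>2 * ((- \<kappa>\<^sup>2 - (c x)\<^sup>2 - \<psi>'' x + 2 * R x * \<psi>' x) * Q * T\<^sup>2
         + 2 * R x * T * F x - 2 * F' x * T - 2 * (F x)\<^sup>2 * P)"
        using e3 unfolding \<Phi>'_def P_def[symmetric] Q_def[symmetric] T_def[symmetric]
        by (simp add: PQ algebra_simps power2_eq_square)
      then have e4: "\<Phi>' x = \<kappa>\<^sup>2 * ((- \<kappa>\<^sup>2 - (R x + \<psi>' x)\<^sup>2 - \<psi>'' x + 2 * R x * \<psi>' x) * Q * T\<^sup>2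
         + 2 * R x * T * F x - 2 * F' x * T - 2 * (F x)\<^sup>2 * P)"
        by (simp add: R_def)
      have "\<kappa>\<^sup>2 * Q * ((\<psi>'' x + (\<psi>' x)\<^sup>2) * T\<^sup>2 + (R x * T - F x * P)\<^sup>2)
        = \<kappa>\<^sup>2 * (Q * (\<psi>'' x + (\<psi>' x)\<^sup>2) * T\<^sup>2 + Q * (R x * T - F x * P)\<^sup>2)"
        by (simp add: distrib_left mult.assoc)
      then show ?thesis unfolding e1 e2 e4 by algebra
    qed
    have "0 \<le> P * (F' x + \<kappa>\<^sup>2 * Q * T)\<^sup>2 + \<kappa>\<^sup>2 * Q * ((\<psi>'' x + (\<psi>' x)\<^sup>2) * T\<^sup>2 + (R x * T - F x * P)\<^sup>2)"
      using q0 convex[OF x] by (intro add_nonneg_nonneg mult_nonneg_nonneg) (auto simp: P_def Q_def)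
    then show ?thesis using id unfolding P_def by linarith
  qed
  have i1: "(\<lambda>x. (F' x)\<^sup>2 * p x) integrable_on {\<alpha>..\<beta>}" "(\<lambda>x. (F x)\<^sup>2 * p x) integrable_on {\<alpha>..\<beta>}"
    by (intro integrable_continuous_real continuous_intros F'_cont contF contp)+
  have i2: "(\<lambda>x. \<kappa>\<^sup>2 * ((F x)\<^sup>2 * p x)) integrable_on {\<alpha>..\<beta>}"
    by (intro integrable_continuous_real continuous_intros F'_cont contF contp)
  have "0 \<le> integral {\<alpha>..\<beta>} (\<lambda>x. (F' x)\<^sup>2 * p x - \<kappa>\<^sup>2 * ((F x)\<^sup>2 * p x))"
    by (rule has_integral_le[OF ft0 integrable_integral[OF integrable_diff[OF i1(1) i2]]]) (use pw in auto)
  also have "\<dots> = integral {\<alpha>..\<beta>} (\<lambda>x. (F' x)\<^sup>2 * p x) - \<kappa>\<^sup>2 * integral {\<alpha>..\<beta>} (\<lambda>x. (F x)\<^sup>2 * p x)"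
    using i1 i2 by (subst integral_diff) (auto simp: integral_mult_right)
  finally show ?thesis by (simp add: p_def)
qed

section \<open>Log-concave weights by smoothing convex potentials\<close>

text \<open>The multiplicative form with \<open>powr\<close> admits zeros, so compactly supported
  weights are covered without assigning minus infinity to a logarithm.\<close>

definition log_concave :: "(real \<Rightarrow> real) \<Rightarrow> bool" where
  "log_concave p \<longleftrightarrow> (\<forall>x. 0 \<le> p x) \<and>
     (\<forall>x y u v. 0 < u \<longrightarrow> 0 < v \<longrightarrow> u + v = 1 \<longrightarrow> p x powr u * p y powr v \<le> p (u * x + v * y))"

text \<open>The smoothed potential is the second difference quotient of a second antiderivative;
  by the mean value theorem it takes values of the original potential.\<close>

lemma convex_smoothing:
  fixes \<psi> :: "real \<Rightarrow> real"
  assumes conv: "convex_on {a<..<b} \<psi>" and ab: "a < a'" "a' < \<alpha>" "\<alpha> < \<beta>" "\<beta> + 2 * \<eta> < b'" "b' < b" "0 < \<eta>"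
  obtains \<phi> \<phi>' \<phi>'' where "\<And>x. x \<in> {\<alpha>..\<beta>} \<Longrightarrow> (\<phi> has_real_derivative \<phi>' x) (at x)"
    "\<And>x. x \<in> {\<alpha>..\<beta>} \<Longrightarrow> (\<phi>' has_real_derivative \<phi>'' x) (at x)"
    "\<And>x. x \<in> {\<alpha>..\<beta>} \<Longrightarrow> 0 \<le> \<phi>'' x"
    "\<And>x. x \<in> {\<alpha>..\<beta>} \<Longrightarrow> \<exists>\<xi>. x < \<xi> \<and> \<xi> < x + 2 * \<eta> \<and> \<phi> x = \<psi> \<xi>"
proof -
  have cont: "continuous_on {a<..<b} \<psi>" using conv by (intro convex_on_continuous) auto
  have "continuous_on {a'..b'} \<psi>" using cont ab by (auto intro: continuous_on_subset)
  then obtain \<Psi> where 1: "\<And>x. x \<in> {a'..b'} \<Longrightarrow> (\<Psi> has_vector_derivative \<psi> x) (at x within {a'..b'})"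
    using antiderivative_continuous by blast
  then have "continuous_on {a'..b'} \<Psi>"
    by (meson continuous_on_vector_derivative)
  then obtain \<Theta> where 2: "\<And>x. x \<in> {a'..b'} \<Longrightarrow> (\<Theta> has_vector_derivative \<Psi> x) (at x within {a'..b'})"
    using antiderivative_continuous by blast
  have d\<Psi>: "(\<Psi> has_real_derivative \<psi> x) (at x)" if "a' < x" "x < b'" for x
    using 1[of x] that by (simp add: has_real_derivative_iff_has_vector_derivative at_within_Icc_at)
  have d\<Theta>: "(\<Theta> has_real_derivative \<Psi> x) (at x)" if "a' < x" "x < b'" for x
    using 2[of x] that by (simp add: has_real_derivative_iff_has_vector_derivative at_within_Icc_at)
  define \<phi> where "\<phi> x = (\<Theta> (x + 2 * \<eta>) - 2 * \<Theta> (x + \<eta>) + \<Theta> x) / \<eta>\<^sup>2" for x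
  define \<phi>' where "\<phi>' x = (\<Psi> (x + 2 * \<eta>) - 2 * \<Psi> (x + \<eta>) + \<Psi> x) / \<eta>\<^sup>2" for x
  \<comment> \<open>Differentiation commutes with differences, so the second derivative is the
    second difference of \<psi> itself, nonnegative by midpoint convexity.\<close>
  define \<phi>'' where "\<phi>'' x = (\<psi> (x + 2 * \<eta>) - 2 * \<psi> (x + \<eta>) + \<psi> x) / \<eta>\<^sup>2" for x
  have sh: "((\<lambda>x. f (x + t)) has_real_derivative f' (x + t)) (at x)"
    if "(f has_real_derivative f' (x + t)) (at (x + t))" for f f' x and t :: real
    using that by (simp add: DERIV_shift)
  show ?thesis
  proof (rule that[of \<phi> \<phi>' \<phi>''])
    fix x assume x: "x \<in> {\<alpha>..\<beta>}"
    show "(\<phi> has_real_derivative \<phi>' x) (at x)"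
      unfolding \<phi>_def \<phi>'_def using x ab
      by (intro DERIV_cdivide DERIV_add DERIV_diff DERIV_cmult sh d\<Theta>) auto
    show "(\<phi>' has_real_derivative \<phi>'' x) (at x)"
      unfolding \<phi>'_def \<phi>''_def using x ab
      by (intro DERIV_cdivide DERIV_add DERIV_diff DERIV_cmult sh d\<Psi>) auto
    have "\<psi> ((1 - 1/2) *\<^sub>R x + (1/2) *\<^sub>R (x + 2 * \<eta>)) \<le> (1 - 1/2) * \<psi> x + (1/2) * \<psi> (x + 2 * \<eta>)"
      using x ab by (intro convex_onD[OF conv]) auto
    moreover have "(1 - 1/2) *\<^sub>R x + (1/2) *\<^sub>R (x + 2 * \<eta>) = x + \<eta>" by (simp add: field_simps)
    ultimately have "2 * \<psi> (x + \<eta>) \<le> \<psi> x + \<psi> (x + 2 * \<eta>)" by simp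
    then show "0 \<le> \<phi>'' x" by (simp add: \<phi>''_def)
    have "\<exists>z>x. z < x + \<eta> \<and> (\<Theta> (x + \<eta> + \<eta>) - \<Theta> (x + \<eta>)) - (\<Theta> (x + \<eta>) - \<Theta> x) = (x + \<eta> - x) * (\<Psi> (z + \<eta>) - \<Psi> z)"
      using x ab by (intro MVT2[of x "x + \<eta>" "\<lambda>x. \<Theta> (x + \<eta>) - \<Theta> x"]) (auto intro!: DERIV_diff sh d\<Theta>)
    then obtain z where z: "x < z" "z < x + \<eta>" "(\<Theta> (x + \<eta> + \<eta>) - \<Theta> (x + \<eta>)) - (\<Theta> (x + \<eta>) - \<Theta> x) = \<eta> * (\<Psi> (z + \<eta>) - \<Psi> z)"
      by auto
    obtain w where w: "z < w" "w < z + \<eta>" "\<Psi> (z + \<eta>) - \<Psi> z = (z + \<eta> - z) * \<psi> w"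
      using MVT2[of z "z + \<eta>" \<Psi> \<psi>] x ab z d\<Psi> by auto
    have "\<phi> x = \<psi> w" using z(3) w(3) ab by (simp add: \<phi>_def field_simps power2_eq_square)
    then show "\<exists>\<xi>. x < \<xi> \<and> \<xi> < x + 2 * \<eta> \<and> \<phi> x = \<psi> \<xi>" using z w by (intro exI[of _ w]) auto
  qed
qed

text \<open>Subtracting the weighted mean reduces this to functions of mean zero. The variance is
  written multiplied by the total mass: this form contains no division and is therefore stable under
  limits of weights.\<close>

lemma weighted_Wirtinger_smooth_variance:
  fixes F F' \<psi> \<psi>' \<psi>'' :: "real \<Rightarrow> real"
  assumes ab: "\<alpha> < \<beta>" and k: "0 < \<kappa>" "\<kappa> * (\<beta> - \<alpha>) < pi"
    and d1: "\<And>x. x \<in> {\<alpha>..\<beta>} \<Longrightarrow> (\<psi> has_real_derivative \<psi>' x) (at x)"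
    and d2: "\<And>x. x \<in> {\<alpha>..\<beta>} \<Longrightarrow> (\<psi>' has_real_derivative \<psi>'' x) (at x)"
    and convex: "\<And>x. x \<in> {\<alpha>..\<beta>} \<Longrightarrow> 0 \<le> \<psi>'' x"
    and dF: "\<And>x. x \<in> {\<alpha>..\<beta>} \<Longrightarrow> (F has_real_derivative F' x) (at x)"
    and F'_cont: "continuous_on {\<alpha>..\<beta>} F'"
  defines "p \<equiv> \<lambda>x. indicator {\<alpha>..\<beta>} x * exp (- 2 * \<psi> x)"
  shows "\<kappa>\<^sup>2 * ((\<integral>x. (F x)\<^sup>2 * p x \<partial>lborel) * (\<integral>x. p x \<partial>lborel) - (\<integral>x. F x * p x \<partial>lborel)\<^sup>2)
     \<le> (\<integral>x. (F' x)\<^sup>2 * p x \<partial>lborel) * (\<integral>x. p x \<partial>lborel)"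
proof -
  have contF: "continuous_on {\<alpha>..\<beta>} F" "continuous_on {\<alpha>..\<beta>} \<psi>"
    using dF d1 by (meson DERIV_isCont continuous_at_imp_continuous_on)+
  define e where "e x = exp (- 2 * \<psi> x)" for x
  have conte: "continuous_on {\<alpha>..\<beta>} e" unfolding e_def by (intro continuous_intros contF)
  have I: "(\<integral>x. g x * p x \<partial>lborel) = integral {\<alpha>..\<beta>} (\<lambda>x. g x * e x)" if "continuous_on {\<alpha>..\<beta>} g" for g
  proof -
    have "set_integrable lborel {\<alpha>..\<beta>} (\<lambda>x. g x * e x)"
      by (rule borel_integrable_atLeastAtMost') (intro continuous_intros that conte)
    from set_borel_integral_eq_integral(2)[OF this] show ?thesis
      unfolding set_lebesgue_integral_def p_def e_def by (simp add: mult_ac)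
  qed
  define m where "m = (\<integral>x. p x \<partial>lborel)"
  have m: "m = integral {\<alpha>..\<beta>} e" using I[of "\<lambda>_. 1"] by (simp add: m_def)
  have int: "(\<lambda>x. g x * e x) integrable_on {\<alpha>..\<beta>}" if "continuous_on {\<alpha>..\<beta>} g" for g
    by (intro integrable_continuous_real continuous_intros that conte)
  have m0: "m > 0"
  proof -
    have "integral {\<alpha>..\<beta>} e \<ge> 0" by (intro integral_nonneg integrable_continuous_real conte) (simp add: e_def)
    moreover have "integral {\<alpha>..\<beta>} e \<noteq> 0"
    proof
      assume "integral {\<alpha>..\<beta>} e = 0"
      then have "e \<alpha> = 0"
        using integral_eq_0_iff[OF conte ab] ab by (auto simp: e_def)
      then show False by (simp add: e_def)
    qed
    ultimately show ?thesis using m by simp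
  qed
  define s where "s = integral {\<alpha>..\<beta>} (\<lambda>x. F x * e x)"
  define t where "t = integral {\<alpha>..\<beta>} (\<lambda>x. (F x)\<^sup>2 * e x)"
  define F0 where "F0 x = F x - s / m" for x
  have eint: "e integrable_on {\<alpha>..\<beta>}" using int[of "\<lambda>_. 1"] by simp
  have c2: "continuous_on {\<alpha>..\<beta>} (\<lambda>x. (F x)\<^sup>2)" by (intro continuous_intros contF)
  have "integral {\<alpha>..\<beta>} (\<lambda>x. F0 x * e x) = integral {\<alpha>..\<beta>} (\<lambda>x. F x * e x - (s/m) * e x)"
    by (simp add: F0_def algebra_simps)
  also have "\<dots> = s - (s/m) * m"
    using int[OF contF(1)] integrable_continuous_real[OF continuous_on_mult[OF continuous_on_const conte], of "s/m"]
    by (subst integral_diff) (auto simp: integral_mult_right s_def m)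
  also have "\<dots> = 0" using m0 by simp
  finally have mean: "integral {\<alpha>..\<beta>} (\<lambda>x. F0 x * exp (- 2 * \<psi> x)) = 0" unfolding e_def .
  have dF0: "(F0 has_real_derivative F' x) (at x)" if "x \<in> {\<alpha>..\<beta>}" for x
    unfolding F0_def using dF[OF that] by (auto intro!: derivative_eq_intros)
  have "integral {\<alpha>..\<beta>} (\<lambda>x. (F0 x)\<^sup>2 * e x) = integral {\<alpha>..\<beta>} (\<lambda>x. ((F x)\<^sup>2 * e x - (2 * s/m) * (F x * e x)) + (s/m)\<^sup>2 * e x)"
    by (rule integral_cong) (simp add: F0_def algebra_simps power2_eq_square)
  also have "\<dots> = t - (2 * s/m) * s + (s/m)\<^sup>2 * m"
  proof -
    have i1: "(\<lambda>x. (2 * s/m) * (F x * e x)) integrable_on {\<alpha>..\<beta>}" "(\<lambda>x. (s/m)\<^sup>2 * e x) integrable_on {\<alpha>..\<beta>}"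
      by (intro integrable_continuous_real continuous_intros conte contF)+
    show ?thesis
      by (subst integral_add[OF integrable_diff[OF int[OF c2] i1(1)] i1(2)], subst integral_diff[OF int[OF c2] i1(1)])
         (simp add: integral_mult_right t_def s_def m)
  qed
  also have "\<dots> = t - s\<^sup>2 / m" using m0 by (simp add: field_simps power2_eq_square)
  finally have v: "integral {\<alpha>..\<beta>} (\<lambda>x. (F0 x)\<^sup>2 * e x) = t - s\<^sup>2 / m" .
  have "\<kappa>\<^sup>2 * (t - s\<^sup>2 / m) \<le> integral {\<alpha>..\<beta>} (\<lambda>x. (F' x)\<^sup>2 * e x)"
    using weighted_Wirtinger_smooth[OF ab k d1 d2 convex dF0 F'_cont mean] v unfolding e_def by simp
  then have "\<kappa>\<^sup>2 * (t - s\<^sup>2 / m) * m \<le> integral {\<alpha>..\<beta>} (\<lambda>x. (F' x)\<^sup>2 * e x) * m"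
    using m0 by (intro mult_right_mono) auto
  moreover have "(t - s\<^sup>2 / m) * m = t * m - s\<^sup>2" using m0 by (simp add: field_simps)
  ultimately show ?thesis
    using I[OF contF(1)] I[OF c2] I[of "\<lambda>x. (F' x)\<^sup>2"] F'_cont
    unfolding m_def[symmetric] s_def[symmetric] t_def[symmetric]
    by (simp add: continuous_intros mult.assoc)
qed

text \<open>Inside its support the weight is \<open>exp (- 2 * \<psi>)\<close> with \<psi> convex;
  smoothing \<psi> on slightly smaller intervals and passing to the limit by dominated convergence
  transfers the inequality. The smaller intervals are strictly shorter, which is how the borderline
  \<open>\<kappa> * (B - A) = pi\<close> is reached from the strict smooth case.\<close>

lemma weighted_Wirtinger:
  fixes F F' p :: "real \<Rightarrow> real"
  assumes lc: "log_concave p" and pm [measurable]: "p \<in> borel_measurable borel"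
    and supp: "\<And>x. p x \<noteq> 0 \<Longrightarrow> A \<le> x \<and> x \<le> B" and bd: "\<And>x. p x \<le> C"
    and k: "0 < \<kappa>" "\<kappa> * (B - A) \<le> pi"
    and dF: "\<And>x. (F has_real_derivative F' x) (at x)" and F'_cont: "continuous_on UNIV F'"
  shows "\<kappa>\<^sup>2 * ((\<integral>x. (F x)\<^sup>2 * p x \<partial>lborel) * (\<integral>x. p x \<partial>lborel) - (\<integral>x. F x * p x \<partial>lborel)\<^sup>2)
     \<le> (\<integral>x. (F' x)\<^sup>2 * p x \<partial>lborel) * (\<integral>x. p x \<partial>lborel)"
proof (cases "\<exists>x y. x < y \<and> p x \<noteq> 0 \<and> p y \<noteq> 0")
  case False
  \<comment> \<open>A weight carried by at most one point vanishes almost everywhere, so both sides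
    are zero.\<close>
  then obtain z where z: "\<And>x. x \<noteq> z \<Longrightarrow> p x = 0" by (metis linorder_neq_iff)
  have "AE x in lborel. x \<noteq> z" by (rule AE_lborel_singleton)
  then have ae: "AE x in lborel. p x = 0" using z by (auto elim: eventually_mono)
  have "(\<integral>x. g x * p x \<partial>lborel) = 0" for g
    using ae by (intro integral_eq_zero_AE) auto
  then show ?thesis by simp
next
  case True
  have nonneg: "0 \<le> p x" for x using lc by (simp add: log_concave_def)
  have lcD: "p x powr u * p y powr v \<le> p (u * x + v * y)" if "0 < u" "0 < v" "u + v = 1" for x y u v
    using lc that by (auto simp: log_concave_def)
  define P where "P = {x. p x \<noteq> 0}"
  have P: "P \<subseteq> {A..B}" using supp by (auto simp: P_def)
  have Pconv: "convex P"
  proof (rule convexI)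
    fix x y u v :: real assume xy: "x \<in> P" "y \<in> P" and uv: "0 \<le> u" "0 \<le> v" "u + v = 1"
    show "u *\<^sub>R x + v *\<^sub>R y \<in> P"
    proof (cases "u = 0 \<or> v = 0")
      case True then show ?thesis using xy uv by auto
    next
      case False
      then have "p x powr u * p y powr v \<le> p (u * x + v * y)" using uv by (intro lcD) auto
      moreover have "p x powr u * p y powr v > 0" using xy by (auto simp: P_def)
      ultimately show ?thesis by (simp add: P_def)
    qed
  qed
  define a b where "a = Inf P" and "b = Sup P"
  have bdd: "bdd_below P" "bdd_above P" using P by (auto intro: bdd_below_mono bdd_above_mono)
  have Pab: "P \<subseteq> {a..b}" using bdd by (auto simp: a_def b_def intro: cInf_lower cSup_upper)
  obtain x1 x2 where x12: "x1 < x2" "x1 \<in> P" "x2 \<in> P" using True by (auto simp: P_def)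
  have "x1 \<in> {a..b}" "x2 \<in> {a..b}" using x12 Pab by blast+
  then have ab: "a < b" using x12(1) by simp
  have abAB: "A \<le> a" "b \<le> B" using P x12 by (auto simp: a_def b_def intro!: cInf_greatest cSup_least)
  have sub: "{a<..<b} \<subseteq> P"
  proof
    fix x assume x: "x \<in> {a<..<b}"
    obtain y where y: "y \<in> P" "y < x" using x cInf_less_iff[of P x] x12 bdd by (auto simp: a_def)
    obtain z where z: "z \<in> P" "x < z" using x less_cSup_iff[of P x] x12 bdd by (auto simp: b_def)
    show "x \<in> P" using Pconv y z by (meson is_interval_convex_1 mem_is_interval_1_I less_imp_le)
  qed
  have pos: "p x > 0" if "x \<in> {a<..<b}" for x using sub that nonneg[of x] by (auto simp: P_def)
  \<comment> \<open>The factor 1/2 matches the weights \<open>exp (- 2 * \<psi>)\<close> of the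
    smooth case.\<close>
  define \<psi> where "\<psi> x = - ln (p x) / 2" for x
  have conv: "convex_on {a<..<b} \<psi>"
  proof (rule convex_onI)
    fix t x y :: real assume t: "0 < t" "t < 1" and x: "x \<in> {a<..<b}" and y: "y \<in> {a<..<b}"
    have "p x powr (1-t) * p y powr t \<le> p ((1-t) * x + t * y)" using t by (intro lcD) auto
    moreover have "p x powr (1-t) * p y powr t > 0" using pos x y by (auto simp: less_le)
    ultimately have "ln (p x powr (1-t) * p y powr t) \<le> ln (p ((1-t) * x + t * y))" by simp
    also have "ln (p x powr (1-t) * p y powr t) = (1-t) * ln (p x) + t * ln (p y)"
      using pos[OF x] pos[OF y] by (simp add: ln_mult ln_powr)
    finally show "\<psi> ((1 - t) *\<^sub>R x + t *\<^sub>R y) \<le> (1 - t) * \<psi> x + t * \<psi> y"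
      by (simp add: \<psi>_def field_simps)
  qed auto
  have pe: "p x = exp (- 2 * \<psi> x)" if "x \<in> {a<..<b}" for x using pos[OF that] by (simp add: \<psi>_def)
  have cont: "continuous_on {a<..<b} \<psi>" using conv by (intro convex_on_continuous) auto
  \<comment> \<open>The bound \<open>(b - a) / 4\<close> keeps the interval from
    \<open>a + d n\<close> to \<open>b - d n\<close> nondegenerate. Smoothing with step
    \<open>d n / 8\<close> samples the potential less than \<open>d n / 4\<close> to the right,
    hence still inside the support.\<close>
  define d where "d n = (b - a) / 4 * inverse (real (Suc n))" for n
  have d0: "d n > 0" for n using ab by (simp add: d_def)
  have dle: "d n \<le> (b - a) / 4" for n
    using ab mult_left_mono[of "inverse (real (Suc n))" 1 "(b - a) / 4"] by (simp add: d_def field_simps)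
  have dlim: "d \<longlonglongrightarrow> 0" unfolding d_def
    using tendsto_mult_right_zero[OF LIMSEQ_inverse_real_of_nat, of "(b - a) / 4"] by simp
  have "\<exists>\<phi> \<phi>' \<phi>''. (\<forall>x\<in>{a + d n..b - d n}. (\<phi> has_real_derivative \<phi>' x) (at x) \<and>
     (\<phi>' has_real_derivative \<phi>'' x) (at x) \<and> 0 \<le> \<phi>'' x \<and> (\<exists>\<xi>. x < \<xi> \<and> \<xi> < x + 2 * (d n / 8) \<and> \<phi> x = \<psi> \<xi>))" for n
  proof -
    obtain \<phi> \<phi>' \<phi>'' where "\<And>x. x \<in> {a + d n..b - d n} \<Longrightarrow> (\<phi> has_real_derivative \<phi>' x) (at x)"
      "\<And>x. x \<in> {a + d n..b - d n} \<Longrightarrow> (\<phi>' has_real_derivative \<phi>'' x) (at x)"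
      "\<And>x. x \<in> {a + d n..b - d n} \<Longrightarrow> 0 \<le> \<phi>'' x"
      "\<And>x. x \<in> {a + d n..b - d n} \<Longrightarrow> \<exists>\<xi>. x < \<xi> \<and> \<xi> < x + 2 * (d n / 8) \<and> \<phi> x = \<psi> \<xi>"
      by (rule convex_smoothing[OF conv, of "a + d n / 2" "a + d n" "b - d n" "d n / 8" "b - d n / 2"])
         (use d0[of n] dle[of n] ab in \<open>auto simp: field_simps\<close>)
    then show ?thesis by blast
  qed
  then obtain \<phi> \<phi>' \<phi>'' where \<phi>: "\<And>n x. x \<in> {a + d n..b - d n} \<Longrightarrow> (\<phi> n has_real_derivative \<phi>' n x) (at x)"
      "\<And>n x. x \<in> {a + d n..b - d n} \<Longrightarrow> (\<phi>' n has_real_derivative \<phi>'' n x) (at x)"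
      "\<And>n x. x \<in> {a + d n..b - d n} \<Longrightarrow> 0 \<le> \<phi>'' n x"
      "\<And>n x. x \<in> {a + d n..b - d n} \<Longrightarrow> \<exists>\<xi>. x < \<xi> \<and> \<xi> < x + 2 * (d n / 8) \<and> \<phi> n x = \<psi> \<xi>"
    by metis
  define r where "r n x = indicator {a + d n..b - d n} x * exp (- 2 * \<phi> n x)" for n x
  have r_bd: "0 \<le> r n x \<and> r n x \<le> C * indicator {a..b} x" for n x
  proof (cases "x \<in> {a + d n..b - d n}")
    case True
    then obtain \<xi> where xi: "x < \<xi>" "\<xi> < x + 2 * (d n / 8)" "\<phi> n x = \<psi> \<xi>" using \<phi>(4) by blast
    have "\<xi> \<in> {a<..<b}" using xi True d0[of n] by (auto simp: field_simps)
    then have "exp (- 2 * \<phi> n x) = p \<xi>" using pe xi(3) by simp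
    then show ?thesis using True d0[of n] bd[of \<xi>] nonneg[of \<xi>] by (auto simp: r_def indicator_def)
  next
    case False
    then show ?thesis using nonneg[of x] bd[of x] by (auto simp: r_def indicator_def)
  qed
  \<comment> \<open>A log-concave weight may jump at the ends of its support, so convergence is
    claimed off these two points, which form a null set.\<close>
  have r_lim: "(\<lambda>n. r n x) \<longlonglongrightarrow> p x" if x: "x \<noteq> a" "x \<noteq> b" for x
  proof (cases "x \<in> {a<..<b}")
    case True
    have "\<forall>\<^sub>F n in sequentially. d n < min (x - a) (b - x)"
      using order_tendstoD(2)[OF dlim, of "min (x - a) (b - x)"] True by auto
    then have ev: "\<forall>\<^sub>F n in sequentially. x \<in> {a + d n..b - d n}"
      by (rule eventually_mono) auto
    define \<xi> where "\<xi> n = (if x \<in> {a + d n..b - d n} then (SOME \<xi>. x < \<xi> \<and> \<xi> < x + 2 * (d n / 8) \<and> \<phi> n x = \<psi> \<xi>) else x)" for n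
    have xi: "x < \<xi> n \<and> \<xi> n < x + 2 * (d n / 8) \<and> \<phi> n x = \<psi> (\<xi> n)" if "x \<in> {a + d n..b - d n}" for n
      using someI_ex[OF \<phi>(4)[OF that]] that by (simp add: \<xi>_def)
    have "\<xi> \<longlonglongrightarrow> x"
    proof (rule tendsto_sandwich)
      show "(\<lambda>_. x) \<longlonglongrightarrow> x" by simp
      show "(\<lambda>n. x + 2 * (d n / 8)) \<longlonglongrightarrow> x" by (auto intro!: tendsto_eq_intros dlim)
      show "\<forall>\<^sub>F n in sequentially. x \<le> \<xi> n" using ev by (rule eventually_mono) (use xi in force)
      show "\<forall>\<^sub>F n in sequentially. \<xi> n \<le> x + 2 * (d n / 8)" using ev by (rule eventually_mono) (use xi in force)
    qed
    moreover have "isCont \<psi> x" using cont True by (simp add: continuous_on_eq_continuous_at)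
    ultimately have "(\<lambda>n. \<psi> (\<xi> n)) \<longlonglongrightarrow> \<psi> x" by (rule isCont_tendsto_compose[rotated])
    then have "(\<lambda>n. exp (- 2 * \<psi> (\<xi> n))) \<longlonglongrightarrow> exp (- 2 * \<psi> x)" by (intro tendsto_intros)
    moreover have "\<forall>\<^sub>F n in sequentially. exp (- 2 * \<psi> (\<xi> n)) = r n x"
      using ev by (rule eventually_mono) (use xi in \<open>auto simp: r_def\<close>)
    ultimately show ?thesis unfolding pe[OF True] by (rule Lim_transform_eventually)
  next
    case False
    then have "x < a \<or> b < x" using x by auto
    then have "p x = 0" using Pab by (force simp: P_def)
    moreover have "r n x = 0" for n using \<open>x < a \<or> b < x\<close> d0[of n] by (auto simp: r_def)
    ultimately show ?thesis by simp
  qed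
  have r_meas: "r n \<in> borel_measurable borel" for n
  proof -
    have "continuous_on {a + d n..b - d n} (\<phi> n)"
      using \<phi>(1) by (meson DERIV_isCont continuous_at_imp_continuous_on)
    then have "(\<lambda>x. indicator {a + d n..b - d n} x *\<^sub>R exp (- 2 * \<phi> n x)) \<in> borel_measurable borel"
      by (intro borel_measurable_continuous_on_indicator continuous_intros) auto
    then show ?thesis by (simp add: r_def[abs_def])
  qed
  have lim: "(\<lambda>n. \<integral>x. g x * r n x \<partial>lborel) \<longlonglongrightarrow> (\<integral>x. g x * p x \<partial>lborel)" if g: "continuous_on UNIV g" for g
  proof (rule integral_dominated_convergence[where w = "\<lambda>x. indicator {a..b} x *\<^sub>R (\<bar>g x\<bar> * C)"])
    have [measurable]: "g \<in> borel_measurable borel" using g by (rule borel_measurable_continuous_onI)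
    show "(\<lambda>x. g x * p x) \<in> borel_measurable lborel" by simp
    show "(\<lambda>x. g x * r n x) \<in> borel_measurable lborel" for n using r_meas[of n] by simp
    show "integrable lborel (\<lambda>x. indicator {a..b} x *\<^sub>R (\<bar>g x\<bar> * C))"
    proof -
      have "continuous_on {a..b} (\<lambda>x. \<bar>g x\<bar> * C)"
        by (intro continuous_intros continuous_on_subset[OF g]) auto
      from borel_integrable_atLeastAtMost'[OF this] show ?thesis by (simp add: set_integrable_def)
    qed
    have "AE x in lborel. x \<noteq> a \<and> x \<noteq> b" using AE_lborel_singleton[of a] AE_lborel_singleton[of b] by auto
    then show "AE x in lborel. (\<lambda>n. g x * r n x) \<longlonglongrightarrow> g x * p x"
      by (rule eventually_mono) (auto intro!: tendsto_intros r_lim)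
    show "AE x in lborel. norm (g x * r n x) \<le> indicator {a..b} x *\<^sub>R (\<bar>g x\<bar> * C)" for n
    proof (rule AE_I2)
      fix x
      have "\<bar>g x\<bar> * r n x \<le> \<bar>g x\<bar> * (C * indicator {a..b} x)" using r_bd[of n x] by (intro mult_left_mono) auto
      then show "norm (g x * r n x) \<le> indicator {a..b} x *\<^sub>R (\<bar>g x\<bar> * C)" using r_bd[of n x] by (simp add: abs_mult mult_ac)
    qed
  qed
  have contF: "continuous_on UNIV F" using dF by (meson DERIV_isCont continuous_at_imp_continuous_on)
  have main: "\<kappa>\<^sup>2 * ((\<integral>x. (F x)\<^sup>2 * r n x \<partial>lborel) * (\<integral>x. r n x \<partial>lborel) - (\<integral>x. F x * r n x \<partial>lborel)\<^sup>2)
     \<le> (\<integral>x. (F' x)\<^sup>2 * r n x \<partial>lborel) * (\<integral>x. r n x \<partial>lborel)" for n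
    unfolding r_def
  proof (rule weighted_Wirtinger_smooth_variance)
    show ab': "a + d n < b - d n" using dle[of n] d0[of n] ab by (simp add: field_simps)
    have "\<kappa> * (b - d n - (a + d n)) < \<kappa> * (B - A)" using d0[of n] abAB k by (intro mult_strict_left_mono) auto
    also note k(2)
    finally show "\<kappa> * (b - d n - (a + d n)) < pi" .
    show "continuous_on {a + d n..b - d n} F'" using F'_cont continuous_on_subset by blast
  qed (use \<phi> dF k in auto)
  have l1: "(\<lambda>n. \<integral>x. r n x \<partial>lborel) \<longlonglongrightarrow> (\<integral>x. p x \<partial>lborel)" using lim[of "\<lambda>_. 1"] by simp
  have l2: "(\<lambda>n. \<kappa>\<^sup>2 * ((\<integral>x. (F x)\<^sup>2 * r n x \<partial>lborel) * (\<integral>x. r n x \<partial>lborel) - (\<integral>x. F x * r n x \<partial>lborel)\<^sup>2))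
    \<longlonglongrightarrow> \<kappa>\<^sup>2 * ((\<integral>x. (F x)\<^sup>2 * p x \<partial>lborel) * (\<integral>x. p x \<partial>lborel) - (\<integral>x. F x * p x \<partial>lborel)\<^sup>2)"
    by (intro tendsto_intros lim l1 continuous_intros contF)
  have l3: "(\<lambda>n. (\<integral>x. (F' x)\<^sup>2 * r n x \<partial>lborel) * (\<integral>x. r n x \<partial>lborel))
    \<longlonglongrightarrow> (\<integral>x. (F' x)\<^sup>2 * p x \<partial>lborel) * (\<integral>x. p x \<partial>lborel)"
    by (intro tendsto_intros lim l1 continuous_intros F'_cont)
  show ?thesis by (rule LIMSEQ_le[OF l2 l3]) (use main in blast)
qed

section \<open>Log-concave marginals of convex bodies\<close>

lemma convex_real_between:
  fixes S :: "real set"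
  assumes "convex S" "S \<noteq> {}" "bounded S"
  shows "{Inf S<..<Sup S} \<subseteq> S" "S \<subseteq> {Inf S..Sup S}"
proof -
  have bdd: "bdd_below S" "bdd_above S" using assms(3) by (auto simp: bounded_imp_bdd_above bounded_imp_bdd_below)
  show "{Inf S<..<Sup S} \<subseteq> S"
  proof
    fix x assume x: "x \<in> {Inf S<..<Sup S}"
    obtain y where y: "y \<in> S" "y < x" using x cInf_less_iff[of S x] assms(2) bdd by auto
    obtain z where z: "z \<in> S" "x < z" using x less_cSup_iff[of S x] assms(2) bdd by auto
    show "x \<in> S" using assms(1) y z by (meson is_interval_convex_1 mem_is_interval_1_I less_imp_le)
  qed
  show "S \<subseteq> {Inf S..Sup S}" using bdd by (auto intro: cInf_lower cSup_upper)
qed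

text \<open>An interval differs from its open core by at most two points.\<close>

lemma bounded_convex_real_borel:
  fixes S :: "real set"
  assumes "convex S" "bounded S"
  shows "S \<in> sets borel"
proof (cases "S = {}")
  case False
  note b = convex_real_between[OF assms(1) False assms(2)]
  have eqS: "S = {Inf S<..<Sup S} \<union> (S \<inter> {Inf S, Sup S})"
  proof (intro equalityI subsetI)
    fix x assume x: "x \<in> S"
    then have "Inf S \<le> x" "x \<le> Sup S" using b(2) by auto
    then show "x \<in> {Inf S<..<Sup S} \<union> (S \<inter> {Inf S, Sup S})"
      using x by (cases "x = Inf S \<or> x = Sup S") auto
  qed (use b(1) in blast)
  have "finite (S \<inter> {Inf S, Sup S})" by simp
  then have "S \<inter> {Inf S, Sup S} \<in> sets borel"
    by (metis borel_closed finite_imp_closed)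
  then have "{Inf S<..<Sup S} \<union> (S \<inter> {Inf S, Sup S}) \<in> sets borel" by (intro sets.Un) auto
  then show ?thesis by (subst eqS)
qed simp

text \<open>The measure of an interval is the difference of its supremum and infimum, and the
  inclusion of the combined points compares these endpoints separately.\<close>

lemma Brunn_Minkowski_interval:
  fixes A A0 A1 :: "real set"
  assumes c: "convex A" "convex A0" "convex A1" and ne: "A0 \<noteq> {}" "A1 \<noteq> {}"
    and b: "bounded A" "bounded A0" "bounded A1"
    and uv: "0 < u" "0 < v" and sub: "\<And>x y. x \<in> A0 \<Longrightarrow> y \<in> A1 \<Longrightarrow> u * x + v * y \<in> A"
  shows "ennreal u * emeasure lborel A0 + ennreal v * emeasure lborel A1 \<le> emeasure lborel A"
proof -
  have neA: "A \<noteq> {}" using ne sub by blast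
  note bA = convex_real_between[OF c(1) neA b(1)] and b0 = convex_real_between[OF c(2) ne(1) b(2)]
    and b1 = convex_real_between[OF c(3) ne(2) b(3)]
  have bdd: "bdd_below A" "bdd_above A" using b by (auto simp: bounded_imp_bdd_above bounded_imp_bdd_below)
  have le: "Inf A0 \<le> Sup A0" "Inf A1 \<le> Sup A1" "Inf A \<le> Sup A" using b0(2) b1(2) bA(2) ne neA by fastforce+
  have "u * x + v * y \<le> Sup A" if "x \<in> A0" "y \<in> A1" for x y
    using cSup_upper[OF sub[OF that] bdd(2)] .
  then have "x \<le> (Sup A - v * y) / u" if "x \<in> A0" "y \<in> A1" for x y
    using that uv by (fastforce simp: field_simps)
  then have "Sup A0 \<le> (Sup A - v * y) / u" if "y \<in> A1" for y
    using ne that by (intro cSup_least) auto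
  then have "y \<le> (Sup A - u * Sup A0) / v" if "y \<in> A1" for y
    using that uv by (fastforce simp: field_simps)
  then have "Sup A1 \<le> (Sup A - u * Sup A0) / v" using ne by (intro cSup_least) auto
  then have S: "u * Sup A0 + v * Sup A1 \<le> Sup A" using uv by (simp add: pos_le_divide_eq mult.commute)
  have "Inf A \<le> u * x + v * y" if "x \<in> A0" "y \<in> A1" for x y
    using cInf_lower[OF sub[OF that] bdd(1)] .
  then have "(Inf A - v * y) / u \<le> x" if "x \<in> A0" "y \<in> A1" for x y
    using that uv by (fastforce simp: field_simps)
  then have "(Inf A - v * y) / u \<le> Inf A0" if "y \<in> A1" for y
    using ne that by (intro cInf_greatest) auto
  then have "(Inf A - u * Inf A0) / v \<le> y" if "y \<in> A1" for y
    using that uv by (fastforce simp: field_simps)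
  then have "(Inf A - u * Inf A0) / v \<le> Inf A1" using ne by (intro cInf_greatest) auto
  then have I: "Inf A \<le> u * Inf A0 + v * Inf A1" using uv by (simp add: pos_divide_le_eq mult.commute)
  have "emeasure lborel A0 \<le> emeasure lborel {Inf A0..Sup A0}" by (intro emeasure_mono b0) auto
  then have 0: "emeasure lborel A0 \<le> ennreal (Sup A0 - Inf A0)" using le by simp
  have "emeasure lborel A1 \<le> emeasure lborel {Inf A1..Sup A1}" by (intro emeasure_mono b1) auto
  then have 1: "emeasure lborel A1 \<le> ennreal (Sup A1 - Inf A1)" using le by simp
  have "emeasure lborel {Inf A<..<Sup A} \<le> emeasure lborel A"
    using bounded_convex_real_borel[OF c(1) b(1)] by (intro emeasure_mono bA) auto
  then have 2: "ennreal (Sup A - Inf A) \<le> emeasure lborel A" using le by simp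
  have "ennreal u * emeasure lborel A0 + ennreal v * emeasure lborel A1
     \<le> ennreal u * ennreal (Sup A0 - Inf A0) + ennreal v * ennreal (Sup A1 - Inf A1)"
    by (intro add_mono mult_left_mono 0 1) auto
  also have "\<dots> = ennreal (u * (Sup A0 - Inf A0) + v * (Sup A1 - Inf A1))"
    using uv le by (simp add: ennreal_mult ennreal_plus)
  also have "\<dots> \<le> ennreal (Sup A - Inf A)" using S I by (intro ennreal_leI) (simp add: algebra_simps)
  finally show ?thesis using 2 by simp
qed

text \<open>Only levels between 0 and 1 are counted. This is exact for a function bounded by 1 and
  truncates a larger one, which is harmless where the integral serves as a lower bound.\<close>

lemma layer_cake_unit:
  fixes f :: "real \<Rightarrow> real"
  assumes [measurable]: "f \<in> borel_measurable borel" and nn: "\<And>x. 0 \<le> f x"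
  shows "(\<integral>\<^sup>+s. indicator {0<..<1} s * emeasure lborel {y. s < f y} \<partial>lborel) = (\<integral>\<^sup>+y. ennreal (min 1 (f y)) \<partial>lborel)"
proof -
  have "(\<integral>\<^sup>+s. indicator {0<..<1} s * emeasure lborel {y. s < f y} \<partial>lborel)
      = (\<integral>\<^sup>+s. (\<integral>\<^sup>+y. indicator {0<..<1} s * indicator {y. s < f y} y \<partial>lborel) \<partial>lborel)"
    by (intro nn_integral_cong) (simp add: nn_integral_cmult)
  also have "\<dots> = (\<integral>\<^sup>+y. (\<integral>\<^sup>+s. indicator {0<..<1} s * indicator {y. s < f y} y \<partial>lborel) \<partial>lborel)"
    by (intro lborel_pair.Fubini') (simp add: case_prod_unfold indicator_def)
  also have "\<dots> = (\<integral>\<^sup>+y. ennreal (min 1 (f y)) \<partial>lborel)"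
  proof (intro nn_integral_cong)
    fix y
    have "(\<lambda>s. indicator {0<..<1} s * indicator {y. s < f y} y) = (indicator {0<..<min 1 (f y)} :: real \<Rightarrow> ennreal)"
      by (auto simp: indicator_def fun_eq_iff)
    then show "(\<integral>\<^sup>+s. indicator {0<..<1} s * indicator {y. s < f y} y \<partial>lborel) = ennreal (min 1 (f y))"
      using nn[of y] by simp
  qed
  finally show ?thesis .
qed

lemma log_concave_superlevel:
  assumes "log_concave p" "0 \<le> s" shows "convex {x. s < p x}"
proof (rule convexI)
  fix x y u v :: real assume xy: "x \<in> {x. s < p x}" "y \<in> {x. s < p x}" and uv: "0 \<le> u" "0 \<le> v" "u + v = 1"
  show "u *\<^sub>R x + v *\<^sub>R y \<in> {x. s < p x}"
  proof (cases "u = 0 \<or> v = 0")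
    case True then show ?thesis using xy uv by auto
  next
    case False
    define m where "m = min (p x) (p y)"
    have m: "s < m" "m > 0" using xy assms(2) by (auto simp: m_def)
    have "m = m powr u * m powr v" using m uv by (simp flip: powr_add)
    also have "\<dots> \<le> p x powr u * p y powr v" using m uv
      by (intro mult_mono powr_mono2) (auto simp: m_def)
    also have "\<dots> \<le> p (u * x + v * y)" using assms(1) uv False unfolding log_concave_def by auto
    finally show ?thesis using m by simp
  qed
qed

text \<open>Superlevel sets at nonnegative heights are bounded intervals and those at negative
  heights are everything. Slices of multivariate functions thus become measurable through
  log-concavity.\<close>

lemma log_concave_measurable:
  assumes "log_concave p" "\<And>x. p x \<noteq> 0 \<Longrightarrow> \<bar>x\<bar> \<le> R"
  shows "p \<in> borel_measurable borel"
proof (rule borel_measurableI_greater)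
  fix s
  show "{x \<in> space borel. s < p x} \<in> sets borel"
  proof (cases "0 \<le> s")
    case True
    have "{x. s < p x} \<subseteq> {-R..R}"
    proof
      fix x assume "x \<in> {x. s < p x}"
      then have "\<bar>x\<bar> \<le> R" using True by (intro assms(2)) auto
      then show "x \<in> {-R..R}" by (simp add: abs_le_iff)
    qed
    then have "bounded {x. s < p x}" by (rule bounded_subset[OF bounded_closed_interval])
    then show ?thesis using bounded_convex_real_borel[OF log_concave_superlevel[OF assms(1) True]] by simp
  next
    case False
    have "s < p x" for x
    proof -
      have "0 \<le> p x" using assms(1) by (simp add: log_concave_def)
      then show ?thesis using False by simp
    qed
    then have "{x. s < p x} = UNIV" by blast
    then show ?thesis by simp
  qed
qed

lemma log_concave_scale:
  assumes "log_concave p" "0 \<le> c" shows "log_concave (\<lambda>x. c * p x)"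
  unfolding log_concave_def
proof (intro conjI allI impI)
  show "0 \<le> c * p x" for x using assms by (simp add: log_concave_def)
  fix x y u v :: real assume uv: "0 < u" "0 < v" "u + v = 1"
  have "(c * p x) powr u * (c * p y) powr v = (c powr u * c powr v) * (p x powr u * p y powr v)"
    using assms by (simp add: powr_mult log_concave_def)
  also have "c powr u * c powr v = c" using assms(2) uv by (simp flip: powr_add)
  also have "c * (p x powr u * p y powr v) \<le> c * p (u * x + v * y)"
    using assms uv by (intro mult_left_mono) (auto simp: log_concave_def)
  finally show "(c * p x) powr u * (c * p y) powr v \<le> c * p (u * x + v * y)" .
qed

lemma log_concave_integrable:
  assumes "log_concave p" "\<And>x. p x \<noteq> 0 \<Longrightarrow> \<bar>x\<bar> \<le> R" "\<And>x. p x \<le> C"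
  shows "integrable lborel p"
proof (rule Bochner_Integration.integrable_bound[where f = "\<lambda>x. C * indicator {-R..R} x"])
  show "integrable lborel (\<lambda>x. C * indicator {-R..R} x)"
    by (intro integrable_mult_right integrable_real_indicator) (auto simp: emeasure_lborel_Icc_eq)
  show "p \<in> borel_measurable lborel" using log_concave_measurable[OF assms(1,2)] by simp
  show "AE x in lborel. norm (p x) \<le> norm (C * indicator {- R..R} x)"
  proof (rule AE_I2)
    fix x
    have nn: "0 \<le> p x" using assms(1) by (simp add: log_concave_def)
    show "norm (p x) \<le> norm (C * indicator {- R..R} x)"
    proof (cases "p x = 0")
      case False
      then have "x \<in> {-R..R}" using assms(2)[of x] by (simp add: abs_le_iff)
      then show ?thesis using nn assms(3)[of x] by simp
    qed simp
  qed
qed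

text \<open>The condition with the minimum says that superlevel sets at equal height combine.
  Normalising both suprema to 1 makes these sets nonempty at every height below 1, so
  Brunn-Minkowski holds at each height and can be integrated over the heights.\<close>

lemma Prekopa_Leindler_unit:
  fixes f f0 f1 :: "real \<Rightarrow> real"
  assumes lc: "log_concave f" "log_concave f0" "log_concave f1"
    and supp: "\<And>x. f x \<noteq> 0 \<Longrightarrow> \<bar>x\<bar> \<le> R" "\<And>x. f0 x \<noteq> 0 \<Longrightarrow> \<bar>x\<bar> \<le> R" "\<And>x. f1 x \<noteq> 0 \<Longrightarrow> \<bar>x\<bar> \<le> R"
    and sup: "\<And>s. s < 1 \<Longrightarrow> \<exists>x. s < f0 x" "\<And>s. s < 1 \<Longrightarrow> \<exists>x. s < f1 x"
    and le1: "\<And>x. f0 x \<le> 1" "\<And>x. f1 x \<le> 1"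
    and uv: "0 < u" "0 < v" and min: "\<And>x y. min (f0 x) (f1 y) \<le> f (u * x + v * y)"
  shows "ennreal u * (\<integral>\<^sup>+x. f0 x \<partial>lborel) + ennreal v * (\<integral>\<^sup>+x. f1 x \<partial>lborel) \<le> (\<integral>\<^sup>+x. f x \<partial>lborel)"
proof -
  have [measurable]: "f \<in> borel_measurable borel" "f0 \<in> borel_measurable borel" "f1 \<in> borel_measurable borel"
    using log_concave_measurable lc supp by blast+
  have nn: "0 \<le> f x" "0 \<le> f0 x" "0 \<le> f1 x" for x using lc by (auto simp: log_concave_def)
  have bdd: "bounded {x. s < g x}" if "0 \<le> s" "\<And>x. g x \<noteq> 0 \<Longrightarrow> \<bar>x\<bar> \<le> R" for g :: "real \<Rightarrow> real" and s
  proof -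
    have "{x. s < g x} \<subseteq> {-R..R}"
    proof
      fix x assume "x \<in> {x. s < g x}"
      then have "\<bar>x\<bar> \<le> R" using that(1) by (intro that(2)) auto
      then show "x \<in> {-R..R}" by (simp add: abs_le_iff)
    qed
    then show ?thesis by (rule bounded_subset[OF bounded_closed_interval])
  qed
  let ?L = "\<lambda>f. \<integral>\<^sup>+s. indicator {0<..<1} s * emeasure lborel {y. s < f y} \<partial>lborel"
  have "ennreal u * (\<integral>\<^sup>+x. f0 x \<partial>lborel) + ennreal v * (\<integral>\<^sup>+x. f1 x \<partial>lborel) = ennreal u * ?L f0 + ennreal v * ?L f1"
    using le1 by (simp add: layer_cake_unit nn min_absorb2)
  also have "\<dots> = (\<integral>\<^sup>+s. ennreal u * (indicator {0<..<1} s * emeasure lborel {y. s < f0 y})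
       + ennreal v * (indicator {0<..<1} s * emeasure lborel {y. s < f1 y}) \<partial>lborel)"
    by (subst nn_integral_add) (simp_all add: nn_integral_cmult)
  also have "\<dots> \<le> ?L f"
  proof (rule nn_integral_mono)
    fix s :: real
    show "ennreal u * (indicator {0<..<1} s * emeasure lborel {y. s < f0 y})
       + ennreal v * (indicator {0<..<1} s * emeasure lborel {y. s < f1 y})
      \<le> indicator {0<..<1} s * emeasure lborel {y. s < f y}"
    proof (cases "s \<in> {0<..<1}")
      case True
      then have s: "0 \<le> s" "s < 1" by auto
      have "ennreal u * emeasure lborel {y. s < f0 y} + ennreal v * emeasure lborel {y. s < f1 y} \<le> emeasure lborel {y. s < f y}"
      proof (rule Brunn_Minkowski_interval)
        show "u * x + v * y \<in> {y. s < f y}" if "x \<in> {y. s < f0 y}" "y \<in> {y. s < f1 y}" for x y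
          using min[of x y] that by auto
      qed (use log_concave_superlevel[OF _ s(1)] lc bdd[OF s(1)] supp sup[OF s(2)] uv in auto)
      then show ?thesis using True by simp
    qed simp
  qed
  also have "\<dots> = (\<integral>\<^sup>+y. ennreal (min 1 (f y)) \<partial>lborel)" by (rule layer_cake_unit) (auto simp: nn)
  also have "\<dots> \<le> (\<integral>\<^sup>+y. ennreal (f y) \<partial>lborel)" by (intro nn_integral_mono ennreal_leI) auto
  finally show ?thesis .
qed

lemma powr_mult_le_convex_comb:
  fixes a b u v :: real
  assumes "0 \<le> a" "0 \<le> b" "0 < u" "0 < v" "u + v = 1"
  shows "a powr u * b powr v \<le> u * a + v * b"
proof (cases "a = 0 \<or> b = 0")
  case False
  then show ?thesis using assms Youngs_inequality_0[of u v a b] by auto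
qed (use assms in auto)

text \<open>Dividing \<open>h0\<close> and \<open>h1\<close> by their suprema and \<open>h\<close>
  by the matching geometric mean leads to the normalised case, because a weighted geometric mean
  dominates the minimum. That case bounds a weighted sum of integrals, and the arithmetic-geometric
  inequality returns to the product.\<close>

lemma Prekopa_Leindler_1D:
  fixes h h0 h1 :: "real \<Rightarrow> real"
  assumes lc: "log_concave h" "log_concave h0" "log_concave h1"
    and supp: "\<And>x. h x \<noteq> 0 \<Longrightarrow> \<bar>x\<bar> \<le> R" "\<And>x. h0 x \<noteq> 0 \<Longrightarrow> \<bar>x\<bar> \<le> R" "\<And>x. h1 x \<noteq> 0 \<Longrightarrow> \<bar>x\<bar> \<le> R"
    and bd: "\<And>x. h x \<le> C" "\<And>x. h0 x \<le> C" "\<And>x. h1 x \<le> C"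
    and uv: "0 < u" "0 < v" "u + v = 1" and le: "\<And>x y. h0 x powr u * h1 y powr v \<le> h (u * x + v * y)"
  shows "(\<integral>x. h0 x \<partial>lborel) powr u * (\<integral>x. h1 x \<partial>lborel) powr v \<le> (\<integral>x. h x \<partial>lborel)"
proof -
  have nn: "0 \<le> h x" "0 \<le> h0 x" "0 \<le> h1 x" for x using lc by (auto simp: log_concave_def)
  define M0 M1 where "M0 = Sup (range h0)" and "M1 = Sup (range h1)"
  have bda: "bdd_above (range h0)" "bdd_above (range h1)" using bd by (auto intro!: bdd_aboveI2)
  have M: "h0 x \<le> M0" "h1 x \<le> M1" for x using bda by (auto simp: M0_def M1_def intro: cSup_upper)
  have Mnn: "0 \<le> M0" "0 \<le> M1" using M[of 0] nn[of 0] by linarith+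
  have Inn: "0 \<le> (\<integral>x. h x \<partial>lborel)" using nn by simp
  show ?thesis
  proof (cases "M0 = 0 \<or> M1 = 0")
    case True
    \<comment> \<open>A vanishing supremum makes one function identically zero, and
      \<open>0 powr u = 0\<close> kills the left-hand side.\<close>
    then have "(\<forall>x. h0 x = 0) \<or> (\<forall>x. h1 x = 0)" using M nn by (metis order_antisym)
    then show ?thesis using Inn by auto
  next
    case False
    then have M_pos: "M0 > 0" "M1 > 0" using Mnn by auto
    define K where "K = M0 powr u * M1 powr v"
    have K: "K > 0" using M_pos by (simp add: K_def)
    define f f0 f1 where "f x = (1/K) * h x" and "f0 x = (1/M0) * h0 x" and "f1 x = (1/M1) * h1 x" for x
    have lcf: "log_concave f" "log_concave f0" "log_concave f1"
      unfolding f_def f0_def f1_def using K M_pos by (intro log_concave_scale lc; simp)+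
    have suppf: "f x \<noteq> 0 \<Longrightarrow> \<bar>x\<bar> \<le> R" "f0 x \<noteq> 0 \<Longrightarrow> \<bar>x\<bar> \<le> R" "f1 x \<noteq> 0 \<Longrightarrow> \<bar>x\<bar> \<le> R" for x
      using supp[of x] by (auto simp: f_def f0_def f1_def)
    have le1: "f0 x \<le> 1" "f1 x \<le> 1" for x using M[of x] M_pos by (auto simp: f0_def f1_def)
    have intg: "integrable lborel h" "integrable lborel h0" "integrable lborel h1"
      using log_concave_integrable lc supp bd by blast+
    then have intf: "integrable lborel f" "integrable lborel f0" "integrable lborel f1"
      unfolding f_def[abs_def] f0_def[abs_def] f1_def[abs_def] by (auto intro!: integrable_mult_right)
    have nnf: "0 \<le> f x" "0 \<le> f0 x" "0 \<le> f1 x" for x using lcf by (auto simp: log_concave_def)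
    have "ennreal u * (\<integral>\<^sup>+x. f0 x \<partial>lborel) + ennreal v * (\<integral>\<^sup>+x. f1 x \<partial>lborel) \<le> (\<integral>\<^sup>+x. f x \<partial>lborel)"
    proof (rule Prekopa_Leindler_unit[OF lcf suppf])
      show "\<exists>x. s < f0 x" if "s < 1" for s
      proof -
        have "s * M0 < M0" using that M_pos by simp
        then obtain x where "s * M0 < h0 x"
          using less_cSup_iff[of "range h0" "s * M0"] bda by (auto simp: M0_def)
        then show ?thesis using M_pos by (auto simp: f0_def pos_less_divide_eq intro!: exI[of _ x])
      qed
      show "\<exists>x. s < f1 x" if "s < 1" for s
      proof -
        have "s * M1 < M1" using that M_pos by simp
        then obtain x where "s * M1 < h1 x"
          using less_cSup_iff[of "range h1" "s * M1"] bda by (auto simp: M1_def)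
        then show ?thesis using M_pos by (auto simp: f1_def pos_less_divide_eq intro!: exI[of _ x])
      qed
      fix x y
      define m where "m = min (f0 x) (f1 y)"
      have m0: "m \<ge> 0" using nnf by (auto simp: m_def)
      have "m = m powr u * m powr v" using m0 uv by (simp flip: powr_add)
      also have "\<dots> \<le> f0 x powr u * f1 y powr v" using m0 uv
        by (intro mult_mono powr_mono2) (auto simp: m_def)
      also have "\<dots> = (1/K) * (h0 x powr u * h1 y powr v)"
        using M_pos nn by (simp add: f0_def f1_def K_def powr_divide)
      also have "\<dots> \<le> f (u * x + v * y)" unfolding f_def using le[of x y] K by (intro mult_left_mono) auto
      finally show "min (f0 x) (f1 y) \<le> f (u * x + v * y)" by (simp add: m_def)
    qed (use le1 uv in auto)
    then have "ennreal (u * (\<integral>x. f0 x \<partial>lborel) + v * (\<integral>x. f1 x \<partial>lborel)) \<le> ennreal (\<integral>x. f x \<partial>lborel)"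
      using intf nnf uv by (simp add: nn_integral_eq_integral ennreal_mult ennreal_plus)
    then have main: "u * (\<integral>x. f0 x \<partial>lborel) + v * (\<integral>x. f1 x \<partial>lborel) \<le> (\<integral>x. f x \<partial>lborel)"
      using nnf by (subst (asm) ennreal_le_iff) auto
    have "(\<integral>x. h0 x \<partial>lborel) = M0 * (\<integral>x. f0 x \<partial>lborel)" "(\<integral>x. h1 x \<partial>lborel) = M1 * (\<integral>x. f1 x \<partial>lborel)"
      using M_pos by (auto simp: f0_def f1_def)
    then have "(\<integral>x. h0 x \<partial>lborel) powr u * (\<integral>x. h1 x \<partial>lborel) powr v
       = K * ((\<integral>x. f0 x \<partial>lborel) powr u * (\<integral>x. f1 x \<partial>lborel) powr v)"
      using M_pos nnf by (simp add: powr_mult K_def)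
    also have "\<dots> \<le> K * (\<integral>x. f x \<partial>lborel)"
      using powr_mult_le_convex_comb[of "\<integral>x. f0 x \<partial>lborel" "\<integral>x. f1 x \<partial>lborel" u v] nnf uv main K
      by (intro mult_left_mono) auto
    also have "\<dots> = (\<integral>x. h x \<partial>lborel)" using K by (simp add: f_def)
    finally show ?thesis .
  qed
qed

section \<open>Integrating out coordinates\<close>

text \<open>The arguments are coordinate families, as in product measures, so that a single
  coordinate can be isolated by the update \<open>x(j := y)\<close>.\<close>

definition log_concave_fun :: "(('i \<Rightarrow> real) \<Rightarrow> real) \<Rightarrow> bool" where
  "log_concave_fun F \<longleftrightarrow> (\<forall>x. 0 \<le> F x) \<and> (\<forall>x y u v. 0 < u \<longrightarrow> 0 < v \<longrightarrow> u + v = 1 \<longrightarrow>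
     F x powr u * F y powr v \<le> F (\<lambda>i. u * x i + v * y i))"

lemma log_concave_fun_slice:
  assumes "log_concave_fun F" shows "log_concave (\<lambda>y. F (x(j := y)))"
  unfolding log_concave_def
proof (intro conjI allI impI)
  show "0 \<le> F (x(j := y))" for y using assms by (simp add: log_concave_fun_def)
  fix y z u v :: real assume uv: "0 < u" "0 < v" "u + v = 1"
  have "u * x i + v * x i = x i" for i using uv by (simp flip: distrib_right)
  then have "(\<lambda>i. u * (x(j := y)) i + v * (x(j := z)) i) = x(j := u * y + v * z)" by auto
  then show "F (x(j := y)) powr u * F (x(j := z)) powr v \<le> F (x(j := u * y + v * z))"
    using assms uv unfolding log_concave_fun_def by metis
qed

text \<open>Coordinates are integrated out one at a time; the one-dimensional Prekopa-Leindler
  inequality, applied to the slices, says that each integration preserves log-concavity.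
  Characterising the marginal by arbitrary test functions of the surviving coordinate lets Fubini
  carry the identity through the induction.\<close>

lemma log_concave_marginal:
  fixes F :: "('i \<Rightarrow> real) \<Rightarrow> real"
  assumes "finite J" "b0 \<notin> J" "log_concave_fun F"
    and "F \<in> borel_measurable (Pi\<^sub>M (insert b0 J) (\<lambda>_. lborel))"
    and "\<And>x i. F x \<noteq> 0 \<Longrightarrow> i \<in> insert b0 J \<Longrightarrow> \<bar>x i\<bar> \<le> R" "\<And>x. F x \<le> C"
  shows "\<exists>p D. log_concave p \<and> (\<forall>x. p x \<noteq> 0 \<longrightarrow> \<bar>x\<bar> \<le> R) \<and> (\<forall>x. p x \<le> D) \<and>
     (\<forall>\<phi> \<in> borel_measurable borel. (\<integral>\<^sup>+x. \<phi> (x b0) * ennreal (F x) \<partial>Pi\<^sub>M (insert b0 J) (\<lambda>_. lborel))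
        = (\<integral>\<^sup>+t. \<phi> t * ennreal (p t) \<partial>lborel))"
  using assms
proof (induction J arbitrary: F C rule: finite_induct)
  case empty
  interpret product_sigma_finite "\<lambda>_::'i. lborel :: real measure" ..
  \<comment> \<open>Points of the product over \<open>{b0}\<close> have the value
    \<open>undefined\<close> at all other indices, so this choice makes
    \<open>F x = p (x b0)\<close> exact.\<close>
  define p where "p t = F ((\<lambda>_. undefined)(b0 := t))" for t
  have lc: "log_concave p" unfolding p_def by (rule log_concave_fun_slice) fact
  have supp: "\<bar>x\<bar> \<le> R" if "p x \<noteq> 0" for x    using empty(4)[OF that[unfolded p_def], of b0] by simp
  have [measurable]: "p \<in> borel_measurable borel" using log_concave_measurable[OF lc supp] .
  have "(\<integral>\<^sup>+x. \<phi> (x b0) * ennreal (F x) \<partial>Pi\<^sub>M {b0} (\<lambda>_. lborel)) = (\<integral>\<^sup>+t. \<phi> t * ennreal (p t) \<partial>lborel)"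
    if [measurable]: "\<phi> \<in> borel_measurable borel" for \<phi>
  proof -
    have "(\<integral>\<^sup>+x. \<phi> (x b0) * ennreal (F x) \<partial>Pi\<^sub>M {b0} (\<lambda>_. lborel))
       = (\<integral>\<^sup>+x. \<phi> (x b0) * ennreal (p (x b0)) \<partial>Pi\<^sub>M {b0} (\<lambda>_. lborel))"
    proof (intro nn_integral_cong)
      fix x assume "x \<in> space (Pi\<^sub>M {b0} (\<lambda>_. lborel :: real measure))"
      then have "x = (\<lambda>_. undefined)(b0 := x b0)"
        by (auto simp: space_PiM PiE_def extensional_def fun_eq_iff)
      then have "F x = p (x b0)" unfolding p_def by simp
      then show "\<phi> (x b0) * ennreal (F x) = \<phi> (x b0) * ennreal (p (x b0))" by simp
    qed
    also have "\<dots> = (\<integral>\<^sup>+t. \<phi> t * ennreal (p t) \<partial>lborel)"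
      by (subst product_nn_integral_singleton[of "\<lambda>t. \<phi> t * ennreal (p t)"]) auto
    finally show ?thesis .
  qed
  moreover have "p x \<le> C" for x unfolding p_def by (rule empty)
  ultimately show ?case using lc supp by blast
next
  case (insert j J)
  interpret product_sigma_finite "\<lambda>_::'i. lborel :: real measure" ..
  have nj: "b0 \<noteq> j" "j \<notin> insert b0 J" "finite (insert b0 J)" "b0 \<notin> J" using insert by auto
  have eq: "insert b0 (insert j J) = insert j (insert b0 J)" by auto
  note lcF = insert.prems(2) and supp = insert.prems(4) and bd = insert.prems(5)
  have Fm [measurable]: "F \<in> borel_measurable (Pi\<^sub>M (insert j (insert b0 J)) (\<lambda>_. lborel))"
    using insert.prems(3) unfolding eq .
  define G where "G x = (\<integral>y. F (x(j := y)) \<partial>lborel)" for x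
  have sl: "log_concave (\<lambda>y. F (x(j := y)))" for x using log_concave_fun_slice[OF lcF] .
  have sls: "\<bar>y\<bar> \<le> R" if "F (x(j := y)) \<noteq> 0" for x y using supp[OF that, of j] by simp
  have int: "integrable lborel (\<lambda>y. F (x(j := y)))" for x
    using log_concave_integrable[OF sl sls bd] .
  have nn: "0 \<le> F x" for x using lcF by (simp add: log_concave_fun_def)
  have lcG: "log_concave_fun G" unfolding log_concave_fun_def
  proof (intro conjI allI impI)
    show "0 \<le> G x" for x unfolding G_def using nn by simp
    fix x y :: "'i \<Rightarrow> real" and u v :: real assume uv: "0 < u" "0 < v" "u + v = 1"
    show "G x powr u * G y powr v \<le> G (\<lambda>i. u * x i + v * y i)"
      unfolding G_def
    proof (rule Prekopa_Leindler_1D[OF sl sl sl sls sls sls bd bd bd uv])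
      fix a b
      have "(\<lambda>i. u * x i + v * y i)(j := u * a + v * b) = (\<lambda>i. u * (x(j := a)) i + v * (y(j := b)) i)" by auto
      then show "F (x(j := a)) powr u * F (y(j := b)) powr v \<le> F ((\<lambda>i. u * x i + v * y i)(j := u * a + v * b))"
        using lcF uv unfolding log_concave_fun_def by metis
    qed
  qed
  have Gm: "G \<in> borel_measurable (Pi\<^sub>M (insert b0 J) (\<lambda>_. lborel))"
    unfolding G_def
  proof (rule lborel.borel_measurable_lebesgue_integral)
    have "(\<lambda>(x, y). x(j := y)) \<in> (Pi\<^sub>M (insert b0 J) (\<lambda>_. lborel) \<Otimes>\<^sub>M lborel) \<rightarrow>\<^sub>M Pi\<^sub>M (insert j (insert b0 J)) (\<lambda>_. lborel :: real measure)"
      by (rule measurable_add_dim)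
    from measurable_compose[OF this Fm]
    show "(\<lambda>(x, y). F (x(j := y))) \<in> borel_measurable (Pi\<^sub>M (insert b0 J) (\<lambda>_. lborel) \<Otimes>\<^sub>M lborel)"
      by (simp add: case_prod_unfold)
  qed
  have Gs: "\<bar>x i\<bar> \<le> R" if "G x \<noteq> 0" "i \<in> insert b0 J" for x i
  proof -
    have "\<exists>y. F (x(j := y)) \<noteq> 0"
    proof (rule ccontr)
      assume "\<not> ?thesis" then show False using that(1) by (simp add: G_def)
    qed
    then obtain y where "F (x(j := y)) \<noteq> 0" by blast
    from supp[OF this, of i] that(2) nj show ?thesis by (auto split: if_splits)
  qed
  have C0: "0 \<le> C" using nn[of "\<lambda>_. 0"] bd[of "\<lambda>_. 0"] by simp
  have Gb: "G x \<le> (\<integral>y. C * indicator {-R..R} y \<partial>lborel)" for x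
    unfolding G_def
  proof (rule integral_mono[OF int])
    show "F (x(j := y)) \<le> C * indicator {- R..R} y" for y
    proof (cases "F (x(j := y)) = 0")
      case False
      then have "y \<in> {-R..R}" using sls[of x y] by (simp add: abs_le_iff)
      then show ?thesis by (simp del: fun_upd_apply) (rule bd)
    qed (use C0 in simp)
  qed (intro integrable_mult_right integrable_real_indicator, auto simp: emeasure_lborel_Icc_eq)
  obtain p D where p: "log_concave p" "\<forall>x. p x \<noteq> 0 \<longrightarrow> \<bar>x\<bar> \<le> R" "\<forall>x. p x \<le> D"
    "\<forall>\<phi> \<in> borel_measurable borel. (\<integral>\<^sup>+x. \<phi> (x b0) * ennreal (G x) \<partial>Pi\<^sub>M (insert b0 J) (\<lambda>_. lborel))
        = (\<integral>\<^sup>+t. \<phi> t * ennreal (p t) \<partial>lborel)"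
    using insert.IH[of G, OF nj(4) lcG Gm] Gs Gb by blast
  have step: "(\<integral>\<^sup>+x. \<phi> (x b0) * ennreal (F x) \<partial>Pi\<^sub>M (insert b0 (insert j J)) (\<lambda>_. lborel))
      = (\<integral>\<^sup>+x. \<phi> (x b0) * ennreal (G x) \<partial>Pi\<^sub>M (insert b0 J) (\<lambda>_. lborel))"
    if [measurable]: "\<phi> \<in> borel_measurable borel" for \<phi>
  proof -
    have "(\<integral>\<^sup>+x. \<phi> (x b0) * ennreal (F x) \<partial>Pi\<^sub>M (insert j (insert b0 J)) (\<lambda>_. lborel))
       = (\<integral>\<^sup>+x. (\<integral>\<^sup>+y. \<phi> ((x(j := y)) b0) * ennreal (F (x(j := y))) \<partial>lborel) \<partial>Pi\<^sub>M (insert b0 J) (\<lambda>_. lborel))"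
      by (rule product_nn_integral_insert[OF nj(3,2)]) simp
    also have "\<dots> = (\<integral>\<^sup>+x. \<phi> (x b0) * ennreal (G x) \<partial>Pi\<^sub>M (insert b0 J) (\<lambda>_. lborel))"
    proof (intro nn_integral_cong)
      fix x
      have [measurable]: "(\<lambda>y. F (x(j := y))) \<in> borel_measurable borel" using log_concave_measurable[OF sl sls] .
      show "(\<integral>\<^sup>+y. \<phi> ((x(j := y)) b0) * ennreal (F (x(j := y))) \<partial>lborel) = \<phi> (x b0) * ennreal (G x)"
        using nj(1) nn int[of x] by (simp add: nn_integral_cmult nn_integral_eq_integral G_def)
    qed
    finally show ?thesis unfolding eq .
  qed
  show ?case
  proof (intro exI[of _ p] exI[of _ D] conjI ballI)
    fix \<phi> :: "real \<Rightarrow> ennreal" assume \<phi>: "\<phi> \<in> borel_measurable borel"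
    show "(\<integral>\<^sup>+x. \<phi> (x b0) * ennreal (F x) \<partial>Pi\<^sub>M (insert b0 (insert j J)) (\<lambda>_. lborel))
      = (\<integral>\<^sup>+t. \<phi> t * ennreal (p t) \<partial>lborel)"
      using step[OF \<phi>] p(4)[rule_format, OF \<phi>] by (rule trans)
  qed (use p in auto)
qed

text \<open>The indicator of a convex set is log-concave. Its marginal \<open>p\<close> in the
  direction \<open>b0\<close> is the cross-sectional volume of the body, up to a null set.\<close>

lemma convex_body_marginal:
  fixes K :: "'a::euclidean_space set"
  assumes K: "convex K" "compact K" and b0: "b0 \<in> Basis"
  obtains p R D where "log_concave p" "\<And>x. p x \<noteq> 0 \<Longrightarrow> \<bar>x\<bar> \<le> R" "\<And>x. p x \<le> D"
    "\<And>\<phi>. \<phi> \<in> borel_measurable borel \<Longrightarrow>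
       (\<integral>\<^sup>+x. \<phi> (x \<bullet> b0) * indicator K x \<partial>lborel) = (\<integral>\<^sup>+t. \<phi> t * ennreal (p t) \<partial>lborel)"
proof -
  obtain R where R: "\<And>x. x \<in> K \<Longrightarrow> norm x \<le> R"
    using compact_imp_bounded[OF K(2)] by (auto simp: bounded_iff)
  define g where "g x = (\<Sum>b\<in>Basis. x b *\<^sub>R b)" for x :: "'a \<Rightarrow> real"
  define F where "F x = (indicator K (g x) :: real)" for x
  have gb: "g x \<bullet> b = x b" if "b \<in> Basis" for x b
    using that unfolding g_def by (simp add: inner_sum_left inner_Basis if_distrib sum.delta cong: if_cong)
  have Kb [measurable]: "K \<in> sets borel" using K(2) by (simp add: borel_compact)
  have gm [measurable]: "g \<in> Pi\<^sub>M Basis (\<lambda>_. lborel) \<rightarrow>\<^sub>M borel" unfolding g_def by measurable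
  have eq: "insert b0 (Basis - {b0}) = (Basis :: 'a set)" using b0 by auto
  have "log_concave_fun F"
    unfolding log_concave_fun_def
  proof (intro conjI allI impI)
    fix x y :: "'a \<Rightarrow> real" and u v :: real assume uv: "0 < u" "0 < v" "u + v = 1"
    have "g (\<lambda>i. u * x i + v * y i) = u *\<^sub>R g x + v *\<^sub>R g y"
      by (simp add: g_def scaleR_add_left sum.distrib scaleR_sum_right)
    then show "F x powr u * F y powr v \<le> F (\<lambda>i. u * x i + v * y i)"
      using convexD[OF K(1), of "g x" "g y" u v] uv by (auto simp: F_def indicator_def)
  qed (simp add: F_def)
  moreover have "F \<in> borel_measurable (Pi\<^sub>M (insert b0 (Basis - {b0})) (\<lambda>_. lborel))"
    unfolding eq F_def by measurable
  moreover have "\<bar>x i\<bar> \<le> R" if "F x \<noteq> 0" "i \<in> insert b0 (Basis - {b0})" for x i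
  proof -
    have "g x \<in> K" using that(1) by (auto simp: F_def indicator_def split: if_splits)
    moreover have "\<bar>g x \<bullet> i\<bar> \<le> norm (g x)" using that(2) unfolding eq by (rule Basis_le_norm)
    ultimately show ?thesis using R[of "g x"] gb[of i x] that(2) unfolding eq by auto
  qed
  moreover have "F x \<le> 1" for x by (simp add: F_def indicator_def)
  ultimately obtain p D where p: "log_concave p" "\<forall>x. p x \<noteq> 0 \<longrightarrow> \<bar>x\<bar> \<le> R" "\<forall>x. p x \<le> D"
     "\<forall>\<phi> \<in> borel_measurable borel. (\<integral>\<^sup>+x. \<phi> (x b0) * ennreal (F x) \<partial>Pi\<^sub>M (insert b0 (Basis - {b0})) (\<lambda>_. lborel))
        = (\<integral>\<^sup>+t. \<phi> t * ennreal (p t) \<partial>lborel)"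
    using log_concave_marginal[of "Basis - {b0}" b0 F R 1] by auto
  have "(\<integral>\<^sup>+x. \<phi> (x \<bullet> b0) * indicator K x \<partial>lborel) = (\<integral>\<^sup>+t. \<phi> t * ennreal (p t) \<partial>lborel)"
    if [measurable]: "\<phi> \<in> borel_measurable borel" for \<phi>
  proof -
    have "(\<integral>\<^sup>+x. \<phi> (x \<bullet> b0) * indicator K x \<partial>lborel)
      = (\<integral>\<^sup>+x. \<phi> (g x \<bullet> b0) * indicator K (g x) \<partial>Pi\<^sub>M Basis (\<lambda>_. lborel))"
      using gm by (subst lborel_eq) (simp add: nn_integral_distr flip: g_def)
    also have "\<dots> = (\<integral>\<^sup>+x. \<phi> (x b0) * ennreal (F x) \<partial>Pi\<^sub>M Basis (\<lambda>_. lborel))"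
      using b0 by (intro nn_integral_cong) (simp add: gb F_def ennreal_indicator)
    also have "\<dots> = (\<integral>\<^sup>+t. \<phi> t * ennreal (p t) \<partial>lborel)" using p(4) that unfolding eq by blast
    finally show ?thesis .
  qed
  then show ?thesis using that[OF p(1)] p(2,3) by blast
qed

text \<open>For continuous integrands the marginal identity extends from nonnegative to signed functions
  since everything lives on a compact set.\<close>

lemma needle_Wirtinger:
  fixes K :: "'a::euclidean_space set" and F F' :: "real \<Rightarrow> real"
  assumes K: "convex K" "compact K" and b0: "b0 \<in> Basis"
    and width: "\<And>x. x \<in> K \<Longrightarrow> s0 \<le> x \<bullet> b0 \<and> x \<bullet> b0 \<le> s1"
    and k: "0 < \<kappa>" "\<kappa> * (s1 - s0) \<le> pi"
    and dF: "\<And>x. (F has_real_derivative F' x) (at x)" and F'_cont: "continuous_on UNIV F'"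
  shows "\<kappa>\<^sup>2 * ((LINT x:K|lborel. (F (x \<bullet> b0))\<^sup>2) * measure lborel K - (LINT x:K|lborel. F (x \<bullet> b0))\<^sup>2)
     \<le> (LINT x:K|lborel. (F' (x \<bullet> b0))\<^sup>2) * measure lborel K"
proof -
  obtain p R D where p: "log_concave p" "\<And>x. p x \<noteq> 0 \<Longrightarrow> \<bar>x\<bar> \<le> R" "\<And>x. p x \<le> D"
    and marg: "\<And>\<phi>. \<phi> \<in> borel_measurable borel \<Longrightarrow>
       (\<integral>\<^sup>+x. \<phi> (x \<bullet> b0) * indicator K x \<partial>lborel) = (\<integral>\<^sup>+t. \<phi> t * ennreal (p t) \<partial>lborel)"
    by (rule convex_body_marginal[OF K b0]) (rule that)
  have nn: "0 \<le> p x" for x using p(1) by (simp add: log_concave_def)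
  have [measurable]: "p \<in> borel_measurable borel" using log_concave_measurable[OF p(1,2)] .
  have Kb [measurable]: "K \<in> sets borel" using K(2) by (simp add: borel_compact)
  have I1: "(LINT x:K|lborel. g (x \<bullet> b0)) = (\<integral>t. g t * p t \<partial>lborel)"
    if g: "continuous_on UNIV g" "\<And>x. 0 \<le> g x" for g :: "real \<Rightarrow> real"
  proof -
    have [measurable]: "g \<in> borel_measurable borel" using g(1) by (rule borel_measurable_continuous_onI)
    have "(LINT x:K|lborel. g (x \<bullet> b0)) = enn2real (\<integral>\<^sup>+x. ennreal (indicator K x * g (x \<bullet> b0)) \<partial>lborel)"
      unfolding set_lebesgue_integral_def using g(2) by (subst integral_eq_nn_integral) (auto simp: indicator_def)
    also have "(\<integral>\<^sup>+x. ennreal (indicator K x * g (x \<bullet> b0)) \<partial>lborel) = (\<integral>\<^sup>+x. ennreal (g (x \<bullet> b0)) * indicator K x \<partial>lborel)"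
      by (intro nn_integral_cong) (auto simp: indicator_def)
    also have "\<dots> = (\<integral>\<^sup>+t. ennreal (g t) * ennreal (p t) \<partial>lborel)" by (rule marg) simp
    also have "\<dots> = (\<integral>\<^sup>+t. ennreal (g t * p t) \<partial>lborel)" using g(2) nn by (simp add: ennreal_mult)
    also have "enn2real \<dots> = (\<integral>t. g t * p t \<partial>lborel)"
      using g(2) nn by (subst integral_eq_nn_integral) auto
    finally show ?thesis .
  qed
  have intK: "set_integrable lborel K (\<lambda>x. g (x \<bullet> b0))" if "continuous_on UNIV g" for g :: "real \<Rightarrow> real"
    unfolding set_integrable_def
    by (rule borel_integrable_compact[OF K(2)]) (intro continuous_on_compose2[OF that] continuous_intros, auto)
  have intp: "integrable lborel (\<lambda>t. g t * p t)" if g: "continuous_on UNIV g" for g :: "real \<Rightarrow> real"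
  proof (rule Bochner_Integration.integrable_bound)
    have [measurable]: "g \<in> borel_measurable borel" using g(1) by (rule borel_measurable_continuous_onI)
    have "continuous_on {-R..R} (\<lambda>t. \<bar>g t\<bar> * D)" by (intro continuous_intros continuous_on_subset[OF g]) auto
    from borel_integrable_compact[OF compact_Icc this]
    show "integrable lborel (\<lambda>t. indicator {-R..R} t *\<^sub>R (\<bar>g t\<bar> * D))" .
    show "(\<lambda>t. g t * p t) \<in> borel_measurable lborel" by simp
    show "AE x in lborel. norm (g x * p x) \<le> norm (indicat_real {- R..R} x *\<^sub>R (\<bar>g x\<bar> * D))"
    proof (rule AE_I2)
      fix x
      show "norm (g x * p x) \<le> norm (indicat_real {- R..R} x *\<^sub>R (\<bar>g x\<bar> * D))"
      proof (cases "p x = 0")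
        case False
        then have "x \<in> {-R..R}" using p(2)[of x] by (simp add: abs_le_iff)
        moreover have "\<bar>g x\<bar> * p x \<le> \<bar>g x\<bar> * \<bar>D\<bar>"
          using p(3)[of x] by (intro mult_left_mono) auto
        ultimately show ?thesis using nn[of x] by (simp add: abs_mult)
      qed simp
    qed
  qed
  have I: "(LINT x:K|lborel. g (x \<bullet> b0)) = (\<integral>t. g t * p t \<partial>lborel)"
    if g: "continuous_on UNIV g" for g :: "real \<Rightarrow> real"
  proof -
    \<comment> \<open>A signed integrand is the difference of two nonnegative continuous ones, to
      which the previous case applies.\<close>
    have c: "continuous_on UNIV (\<lambda>t. \<bar>g t\<bar> + g t)" "continuous_on UNIV (\<lambda>t. \<bar>g t\<bar>)"
      by (intro continuous_intros g)+
    have "(LINT x:K|lborel. g (x \<bullet> b0)) = (LINT x:K|lborel. (\<bar>g (x \<bullet> b0)\<bar> + g (x \<bullet> b0)) - \<bar>g (x \<bullet> b0)\<bar>)" by simp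
    also have "\<dots> = (LINT x:K|lborel. \<bar>g (x \<bullet> b0)\<bar> + g (x \<bullet> b0)) - (LINT x:K|lborel. \<bar>g (x \<bullet> b0)\<bar>)"
      by (intro set_integral_diff(2) intK c)
    also have "(LINT x:K|lborel. \<bar>g (x \<bullet> b0)\<bar> + g (x \<bullet> b0)) = (\<integral>t. (\<bar>g t\<bar> + g t) * p t \<partial>lborel)"
      by (rule I1[OF c(1)]) simp
    also have "(LINT x:K|lborel. \<bar>g (x \<bullet> b0)\<bar>) = (\<integral>t. \<bar>g t\<bar> * p t \<partial>lborel)"
      by (rule I1[OF c(2)]) simp
    also have "(\<integral>t. (\<bar>g t\<bar> + g t) * p t \<partial>lborel) - (\<integral>t. \<bar>g t\<bar> * p t \<partial>lborel) = (\<integral>t. (\<bar>g t\<bar> + g t) * p t - \<bar>g t\<bar> * p t \<partial>lborel)"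
      by (intro Bochner_Integration.integral_diff[symmetric] intp c)
    finally show ?thesis by (simp add: algebra_simps)
  qed
  \<comment> \<open>The support bound \<open>R\<close> is too crude for the Wirtinger constant. By
    the marginal identity for the indicator of the complement, cutting \<open>p\<close> to the
    actual width of \<open>K\<close> changes it on a null set only, and an interval cut preserves
    log-concavity.\<close>
  define P where "P x = p x * indicator {s0..s1} x" for x
  have pP: "AE x in lborel. p x = P x"
  proof -
    have "(\<integral>\<^sup>+x. indicator (- {s0..s1}) (x \<bullet> b0) * indicator K x \<partial>lborel) = (\<integral>\<^sup>+t. indicator (-{s0..s1}) t * ennreal (p t) \<partial>lborel)"
      by (rule marg) simp
    moreover have "(\<integral>\<^sup>+x. indicator (- {s0..s1}) (x \<bullet> b0) * indicator K x \<partial>lborel) = (\<integral>\<^sup>+(x::'a). 0 \<partial>lborel)"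
      using width by (intro nn_integral_cong) (auto simp: indicator_def)
    ultimately have "(\<integral>\<^sup>+t. indicator (-{s0..s1}) t * ennreal (p t) \<partial>lborel) = 0" by simp
    then have "AE t in lborel. indicator (-{s0..s1}) t * ennreal (p t) = 0"
      by (subst (asm) nn_integral_0_iff_AE) auto
    then show ?thesis
      by (rule eventually_mono) (use nn in \<open>auto simp: P_def indicator_def ennreal_eq_0_iff intro: order_antisym split: if_splits\<close>)
  qed
  have Pm [measurable]: "P \<in> borel_measurable borel" unfolding P_def by measurable
  have lcP: "log_concave P"
    unfolding log_concave_def
  proof (intro conjI allI impI)
    show "0 \<le> P x" for x using nn by (simp add: P_def)
    fix x y u v :: real assume uv: "0 < u" "0 < v" "u + v = 1"
    show "P x powr u * P y powr v \<le> P (u * x + v * y)"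
    proof (cases "x \<in> {s0..s1} \<and> y \<in> {s0..s1}")
      case True
      then have "u * x + v * y \<in> {s0..s1}" using convexD[of "{s0..s1}" x y u v] uv by auto
      then show ?thesis using True p(1) uv by (auto simp: P_def log_concave_def)
    next
      case False
      then have "P x = 0 \<or> P y = 0" by (auto simp: P_def)
      then show ?thesis using nn by (auto simp: P_def)
    qed
  qed
  have J: "(LINT x:K|lborel. g (x \<bullet> b0)) = (\<integral>t. g t * P t \<partial>lborel)"
    if g: "continuous_on UNIV g" for g :: "real \<Rightarrow> real"
  proof -
    have [measurable]: "g \<in> borel_measurable borel" using g(1) by (rule borel_measurable_continuous_onI)
    have "(\<integral>t. g t * p t \<partial>lborel) = (\<integral>t. g t * P t \<partial>lborel)"
      using pP by (intro integral_cong_AE) (auto elim: eventually_mono)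
    then show ?thesis using I[OF g] by simp
  qed
  have cF: "continuous_on UNIV F" using dF by (meson DERIV_isCont continuous_at_imp_continuous_on)
  have one: "measure lborel K = (\<integral>t. P t \<partial>lborel)"
    using J[of "\<lambda>_. 1"] by (simp add: set_lebesgue_integral_def)
  have D0: "0 \<le> D" using nn[of 0] p(3)[of 0] by linarith
  have "\<kappa>\<^sup>2 * ((\<integral>x. (F x)\<^sup>2 * P x \<partial>lborel) * (\<integral>x. P x \<partial>lborel) - (\<integral>x. F x * P x \<partial>lborel)\<^sup>2)
     \<le> (\<integral>x. (F' x)\<^sup>2 * P x \<partial>lborel) * (\<integral>x. P x \<partial>lborel)"
    using D0 p(3) by (intro weighted_Wirtinger[OF lcP Pm _ _ k dF F'_cont, of D])
      (auto simp: P_def indicator_def split: if_splits)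
  then show ?thesis
    unfolding one J[OF cF] J[OF continuous_on_power[OF cF]] J[OF continuous_on_power[OF F'_cont]] .
qed

section \<open>Needle decomposition and the Payne--Weinberger inequality\<close>

lemma hyperplane_null_sets:
  fixes n :: "'a::euclidean_space"
  assumes "n \<noteq> 0" shows "{x. n \<bullet> x = c} \<in> null_sets lborel"
proof -
  have "negligible {x. n \<bullet> x = c}" using assms by (intro negligible_hyperplane) auto
  moreover have "{x. n \<bullet> x = c} \<in> sets lborel" by (simp add: borel_closed closed_hyperplane)
  ultimately show ?thesis by (simp add: negligible_iff_null_sets null_sets_completion_iff)
qed

lemma set_integral_halfspaces:
  fixes g :: "'a::euclidean_space \<Rightarrow> real"
  assumes C: "compact C" and g: "continuous_on UNIV g" and n: "n \<noteq> 0"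
  shows "(LINT x:C|lborel. g x) = (LINT x:C \<inter> {x. n \<bullet> x \<ge> c}|lborel. g x) + (LINT x:C \<inter> {x. n \<bullet> x \<le> c}|lborel. g x)"
proof -
  have int: "integrable lborel (\<lambda>x. indicator K x *\<^sub>R g x)" if "compact K" for K
    using borel_integrable_compact[OF that] g continuous_on_subset by blast
  have c: "compact (C \<inter> {x. n \<bullet> x \<ge> c})" "compact (C \<inter> {x. n \<bullet> x \<le> c})"
    using C closed_halfspace_ge closed_halfspace_le by (blast intro: compact_Int_closed)+
  have "AE x in lborel. n \<bullet> x \<noteq> c"
    using AE_not_in[OF hyperplane_null_sets[OF n, of c]] by simp
  then have "(LINT x:C|lborel. g x) = (\<integral>x. indicator (C \<inter> {x. n \<bullet> x \<ge> c}) x *\<^sub>R g x + indicator (C \<inter> {x. n \<bullet> x \<le> c}) x *\<^sub>R g x \<partial>lborel)"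
    unfolding set_lebesgue_integral_def
    using int[OF c(1)] int[OF c(2)] int[OF C]
    by (intro integral_cong_AE) (auto elim!: eventually_mono simp: indicator_def)
  also have "\<dots> = (LINT x:C \<inter> {x. n \<bullet> x \<ge> c}|lborel. g x) + (LINT x:C \<inter> {x. n \<bullet> x \<le> c}|lborel. g x)"
    unfolding set_lebesgue_integral_def by (intro Bochner_Integration.integral_add int c)
  finally show ?thesis .
qed

text \<open>Turning the half-space through \<open>p\<close> by the angle \<open>\<pi>\<close> swaps the two sides, so an intermediate
  angle splits \<open>f\<close> evenly; one of the two halves keeps \<open>H\<close> positive.\<close>

lemma zero_mean_bisection:
  fixes f H :: "'a::euclidean_space \<Rightarrow> real"
  assumes C: "compact C" "convex C" and f: "continuous_on UNIV f" and H: "continuous_on UNIV H"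
    and f0: "(LINT x:C|lborel. f x) = 0" and H0: "(LINT x:C|lborel. H x) > 0"
    and ij: "i \<in> Basis" "j \<in> Basis" "i \<noteq> j"
  shows "\<exists>C' \<alpha> \<beta>. C' \<subseteq> C \<and> compact C' \<and> convex C' \<and> (LINT x:C'|lborel. f x) = 0 \<and> (LINT x:C'|lborel. H x) > 0
     \<and> \<not> (\<alpha> = 0 \<and> \<beta> = 0) \<and> (\<forall>x\<in>C'. 0 \<le> (\<alpha> *\<^sub>R i + \<beta> *\<^sub>R j) \<bullet> (x - p))"
proof -
  define n where "n \<theta> = cos \<theta> *\<^sub>R i + sin \<theta> *\<^sub>R j" for \<theta>
  define S where "S \<theta> = C \<inter> {x. n \<theta> \<bullet> x \<ge> n \<theta> \<bullet> p}" for \<theta>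
  define \<phi> where "\<phi> \<theta> = (LINT x:S \<theta>|lborel. f x)" for \<theta>
  have ni: "n \<theta> \<bullet> i = cos \<theta>" "n \<theta> \<bullet> j = sin \<theta>" for \<theta>
    using ij by (auto simp: n_def inner_add_left inner_Basis)
  have n0: "n \<theta> \<noteq> 0" for \<theta>
  proof
    assume "n \<theta> = 0"
    then have "cos \<theta> = 0" "sin \<theta> = 0" using ni[of \<theta>] by auto
    then show False using sin_cos_squared_add[of \<theta>] by simp
  qed
  have S: "compact (S \<theta>)" "convex (S \<theta>)" for \<theta>
    unfolding S_def using C by (auto intro: compact_Int_closed closed_halfspace_ge convex_Int convex_halfspace_ge)
  have int: "integrable lborel (\<lambda>x. indicator K x *\<^sub>R f x)" if "compact K" for K
    using borel_integrable_compact[OF that] f continuous_on_subset by blast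
  have npi: "n (\<theta> + pi) = - n \<theta>" for \<theta> by (simp add: n_def)
  have Spi: "S (\<theta> + pi) = C \<inter> {x. n \<theta> \<bullet> x \<le> n \<theta> \<bullet> p}" for \<theta>
    unfolding S_def npi by auto
  have half: "(LINT x:C|lborel. g x) = (LINT x:S \<theta>|lborel. g x) + (LINT x:S (\<theta> + pi)|lborel. g x)"
    if "continuous_on UNIV g" for g :: "'a \<Rightarrow> real" and \<theta>
    unfolding Spi unfolding S_def by (rule set_integral_halfspaces[OF C(1) that n0])
  \<comment> \<open>When the half-space turns, its indicator converges at every point off the
    limiting hyperplane, a null set; dominated convergence gives continuity in the angle.\<close>
  have cont: "isCont \<phi> \<theta>" for \<theta>
    unfolding continuous_at_sequentially
  proof (intro allI impI)
    fix t assume t: "t \<longlonglongrightarrow> \<theta>"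
    show "(\<phi> \<circ> t) \<longlonglongrightarrow> \<phi> \<theta>"
      unfolding \<phi>_def comp_def set_lebesgue_integral_def
    proof (rule integral_dominated_convergence)
      show "integrable lborel (\<lambda>x. \<bar>indicator C x *\<^sub>R f x\<bar>)" using int[OF C(1)] by (rule integrable_abs)
      show "(\<lambda>x. indicat_real (S \<theta>) x *\<^sub>R f x) \<in> borel_measurable lborel" using int[OF S(1)] by auto
      show "(\<lambda>x. indicat_real (S (t i)) x *\<^sub>R f x) \<in> borel_measurable lborel" for i using int[OF S(1)] by auto
      show "AE x in lborel. norm (indicat_real (S (t i)) x *\<^sub>R f x) \<le> \<bar>indicat_real C x *\<^sub>R f x\<bar>" for i
        by (intro AE_I2) (auto simp: S_def indicator_def)
      have "AE x in lborel. n \<theta> \<bullet> x \<noteq> n \<theta> \<bullet> p" using AE_not_in[OF hyperplane_null_sets[OF n0]] by simp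
      then show "AE x in lborel. (\<lambda>i. indicat_real (S (t i)) x *\<^sub>R f x) \<longlonglongrightarrow> indicat_real (S \<theta>) x *\<^sub>R f x"
      proof (rule eventually_mono)
        fix x assume x: "n \<theta> \<bullet> x \<noteq> n \<theta> \<bullet> p"
        have lim: "(\<lambda>k. n (t k) \<bullet> (x - p)) \<longlonglongrightarrow> n \<theta> \<bullet> (x - p)"
          unfolding n_def by (intro tendsto_intros t)
        have "\<forall>\<^sub>F k in sequentially. (n (t k) \<bullet> x \<ge> n (t k) \<bullet> p) = (n \<theta> \<bullet> x \<ge> n \<theta> \<bullet> p)"
        proof (cases "n \<theta> \<bullet> (x - p) > 0")
          case True
          from order_tendstoD(1)[OF lim this] show ?thesis
            by (rule eventually_mono) (use True in \<open>auto simp: inner_diff_right\<close>)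
        next
          case False
          then have "n \<theta> \<bullet> (x - p) < 0" using x by (simp add: inner_diff_right)
          from order_tendstoD(2)[OF lim this] show ?thesis
            by (rule eventually_mono) (use False x in \<open>auto simp: inner_diff_right\<close>)
        qed
        then have "\<forall>\<^sub>F k in sequentially. indicat_real (S \<theta>) x *\<^sub>R f x = indicat_real (S (t k)) x *\<^sub>R f x"
          by (rule eventually_mono) (auto simp: S_def indicator_def)
        then show "(\<lambda>i. indicat_real (S (t i)) x *\<^sub>R f x) \<longlonglongrightarrow> indicat_real (S \<theta>) x *\<^sub>R f x"
          by (rule Lim_transform_eventually[OF tendsto_const])
      qed
    qed
  qed
  have anti: "\<phi> (\<theta> + pi) = - \<phi> \<theta>" for \<theta> using half[OF f, of \<theta>] f0 by (simp add: \<phi>_def)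
  have "\<exists>\<theta>. \<phi> \<theta> = 0"
  proof (cases "\<phi> 0 \<le> 0")
    case True
    then have "\<phi> pi \<ge> 0" using anti[of 0] by simp
    then show ?thesis using IVT[of \<phi> 0 0 pi] True cont by auto
  next
    case False
    then have "\<phi> pi \<le> 0" using anti[of 0] by simp
    then show ?thesis using IVT2[of \<phi> pi 0 0] False cont by auto
  qed
  then obtain \<theta> where \<theta>: "\<phi> \<theta> = 0" by blast
  have "(LINT x:S \<theta>|lborel. H x) > 0 \<or> (LINT x:S (\<theta> + pi)|lborel. H x) > 0"
    using half[OF H, of \<theta>] H0 by linarith
  then obtain t where t: "\<phi> t = 0" "(LINT x:S t|lborel. H x) > 0" using \<theta> anti[of \<theta>] by auto
  show ?thesis
  proof (intro exI conjI)
    show "S t \<subseteq> C" by (auto simp: S_def)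
    show "compact (S t)" "convex (S t)" by (fact S)+
    show "(LINT x:S t|lborel. f x) = 0" using t(1) by (simp add: \<phi>_def)
    show "(LINT x:S t|lborel. H x) > 0" by (fact t)
    show "\<not> (cos t = 0 \<and> sin t = 0)" using n0[of t] by (auto simp: n_def)
    show "\<forall>x\<in>S t. 0 \<le> (cos t *\<^sub>R i + sin t *\<^sub>R j) \<bullet> (x - p)"
      unfolding S_def n_def[symmetric] by (auto simp: inner_diff_right)
  qed
qed

lemma collinear_if_minors_vanish:
  fixes a b c :: "'a::euclidean_space"
  assumes "\<And>i j. i \<in> Basis \<Longrightarrow> j \<in> Basis \<Longrightarrow> i \<noteq> j \<Longrightarrow>
     ((b - a) \<bullet> i) * ((c - a) \<bullet> j) = ((b - a) \<bullet> j) * ((c - a) \<bullet> i)" and "a \<noteq> b"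
  obtains t where "c = a + t *\<^sub>R (b - a)"
proof -
  obtain i where i: "i \<in> Basis" "(b - a) \<bullet> i \<noteq> 0"
    using assms(2) by (metis euclidean_all_zero_iff right_minus_eq)
  define t where "t = ((c - a) \<bullet> i) / ((b - a) \<bullet> i)"
  have "c - a = t *\<^sub>R (b - a)"
  proof (rule euclidean_eqI)
    fix j :: 'a assume j: "j \<in> Basis"
    have "(t *\<^sub>R (b - a)) \<bullet> j = t * ((b - a) \<bullet> j)" by (rule inner_scaleR_left)
    also have "\<dots> = (c - a) \<bullet> j"
      using assms(1)[OF i(1) j] i(2) by (cases "i = j") (auto simp: t_def field_simps)
    finally show "(c - a) \<bullet> j = (t *\<^sub>R (b - a)) \<bullet> j" ..
  qed
  then have "c = a + t *\<^sub>R (b - a)" by (metis add.commute diff_add_cancel)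
  then show ?thesis by (rule that)
qed

text \<open>The hypothesis on the minor says that the triangle stays nondegenerate when projected to
  the coordinates \<open>i\<close> and \<open>j\<close>. If \<open>p\<close> projects into its
  interior, then \<open>p\<close> is a positive combination of the vertices there, so a functional
  of these coordinates that is nonnegative at all three vertices relative to \<open>p\<close> must
  vanish at each, and then altogether. A dense set meets the open set of such points.\<close>

lemma nonneg_functional_on_triangle:
  fixes a b c :: "'a::euclidean_space"
  assumes ij: "i \<in> Basis" "j \<in> Basis"
    and d: "((b - a) \<bullet> i) * ((c - a) \<bullet> j) \<noteq> ((b - a) \<bullet> j) * ((c - a) \<bullet> i)"
    and D: "closure D = UNIV"
  obtains p where "p \<in> D" "\<And>\<alpha> \<beta>. \<not> (\<alpha> = 0 \<and> \<beta> = 0) \<Longrightarrow>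
     \<not> (\<forall>x\<in>{a,b,c}. 0 \<le> (\<alpha> *\<^sub>R i + \<beta> *\<^sub>R j) \<bullet> (x - p))"
proof -
  define m where "m u w = (u \<bullet> i) * (w \<bullet> j) - (u \<bullet> j) * (w \<bullet> i)" for u w :: 'a
  define d where "d = m (b - a) (c - a)"
  have d0: "d \<noteq> 0" using d by (simp add: d_def m_def)
  \<comment> \<open>Unnormalised barycentric coordinates of the projected point; the factor
    \<open>d\<close> makes their sign independent of the orientation of the triangle.\<close>
  define A B C where "A p = m (b - p) (c - p) * d" and "B p = m (c - p) (a - p) * d" and "C p = m (a - p) (b - p) * d" for p
  define p0 where "p0 = (1/3) *\<^sub>R (a + b + c)"
  define W where "W = {p. 0 < A p} \<inter> {p. 0 < B p} \<inter> {p. 0 < C p}"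
  have "open W" unfolding W_def A_def B_def C_def m_def
    by (intro open_Int open_Collect_less continuous_intros)
  have p0i: "p0 \<bullet> k = (a \<bullet> k + b \<bullet> k + c \<bullet> k) / 3" for k by (simp add: p0_def inner_add_left)
  have "A p0 = d * d / 3" "B p0 = d * d / 3" "C p0 = d * d / 3"
    unfolding A_def B_def C_def d_def m_def inner_diff_left p0i by (simp_all add: field_simps)
  moreover have "d * d > 0" using d0 by (metis not_real_square_gt_zero)
  ultimately have "p0 \<in> W" by (auto simp: W_def)
  have "W \<inter> D \<noteq> {}"
    using open_Int_closure_eq_empty[OF \<open>open W\<close>, of D] D \<open>p0 \<in> W\<close> by auto
  then obtain p where p: "p \<in> D" "p \<in> W" by blast
  show ?thesis
  proof (rule that[OF p(1)])
    fix \<alpha> \<beta> :: real assume ab: "\<not> (\<alpha> = 0 \<and> \<beta> = 0)"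
    show "\<not> (\<forall>x\<in>{a,b,c}. 0 \<le> (\<alpha> *\<^sub>R i + \<beta> *\<^sub>R j) \<bullet> (x - p))"
    proof
      assume nn: "\<forall>x\<in>{a,b,c}. 0 \<le> (\<alpha> *\<^sub>R i + \<beta> *\<^sub>R j) \<bullet> (x - p)"
      define L where "L x = \<alpha> * ((x - p) \<bullet> i) + \<beta> * ((x - p) \<bullet> j)" for x
      have Leq: "(\<alpha> *\<^sub>R i + \<beta> *\<^sub>R j) \<bullet> (x - p) = L x" for x
        by (simp add: L_def inner_add_left inner_commute[of i "x - p"] inner_commute[of j "x - p"])
      have L: "0 \<le> L a" "0 \<le> L b" "0 \<le> L c" using nn unfolding Leq by auto
      have ABC: "0 < A p" "0 < B p" "0 < C p" using p(2) by (auto simp: W_def)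
      have "A p * L a + B p * L b + C p * L c = 0"
        unfolding A_def B_def C_def m_def L_def inner_diff_left by (simp add: algebra_simps)
      moreover have "0 \<le> A p * L a" "0 \<le> B p * L b" "0 \<le> C p * L c" using L ABC by simp_all
      ultimately have "A p * L a = 0" "B p * L b = 0" "C p * L c = 0" by linarith+
      then have z: "L a = 0" "L b = 0" "L c = 0" using ABC by simp_all
      \<comment> \<open>Cramer's rule for the two coefficients, arranged so that the right-hand side
        vanishes together with the values at the vertices.\<close>
      have "\<alpha> * d = L b * ((c - a) \<bullet> j) - L c * ((b - a) \<bullet> j) - L a * ((c - b) \<bullet> j)"
        unfolding d_def m_def L_def inner_diff_left by (simp add: algebra_simps)
      moreover have "\<beta> * d = L c * ((b - a) \<bullet> i) - L b * ((c - a) \<bullet> i) + L a * ((c - b) \<bullet> i)"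
        unfolding d_def m_def L_def inner_diff_left by (simp add: algebra_simps)
      ultimately show False using z d0 ab by simp
    qed
  qed
qed

text \<open>Cutting through a dense family of codimension-two subspaces leaves a limit set without
  three affinely independent points.\<close>

lemma needle_sequence:
  fixes f H :: "'a::euclidean_space \<Rightarrow> real"
  assumes K: "compact K" "convex K" and f: "continuous_on UNIV f" and H: "continuous_on UNIV H"
    and f0: "(LINT x:K|lborel. f x) = 0" and H0: "(LINT x:K|lborel. H x) > 0"
  obtains C :: "nat \<Rightarrow> 'a set" where "\<And>n. compact (C n)" "\<And>n. convex (C n)" "\<And>n. C n \<subseteq> K"
    "\<And>n. (LINT x:C n|lborel. f x) = 0" "\<And>n. (LINT x:C n|lborel. H x) > 0"
    "\<And>m n. m \<le> n \<Longrightarrow> C n \<subseteq> C m"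
    "\<And>a b c. a \<in> (\<Inter>n. C n) \<Longrightarrow> b \<in> (\<Inter>n. C n) \<Longrightarrow> c \<in> (\<Inter>n. C n) \<Longrightarrow> a \<noteq> b \<Longrightarrow> \<exists>t. c = a + t *\<^sub>R (b - a)"
proof -
  obtain D :: "'a set" where D: "countable D" "\<And>X. open X \<Longrightarrow> X \<noteq> {} \<Longrightarrow> \<exists>d\<in>D. d \<in> X"
    using countable_dense_exists[where 'a='a] by blast
  have "closure D = UNIV"
  proof (rule ccontr)
    assume "closure D \<noteq> UNIV"
    then have "- closure D \<noteq> {}" "open (- closure D)" by auto
    then show False using D(2)[of "- closure D"] closure_subset[of D] by blast
  qed
  note D = D(1) this
  \<comment> \<open>One triple prescribes one cut. Countability allows every point of the dense set,
    paired with every two coordinates, to have its turn.\<close>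
  define Q where "Q = D \<times> (Basis :: 'a set) \<times> (Basis :: 'a set)"
  have Q: "countable Q" "Q \<noteq> {}" unfolding Q_def using D by (auto simp: countable_finite)
  define e where "e = from_nat_into Q"
  have e: "range e = Q" unfolding e_def by (rule range_from_nat_into[OF Q(2,1)])
  define P where "P n C \<longleftrightarrow> compact C \<and> convex C \<and> C \<subseteq> K \<and> (LINT x:C|lborel. f x) = 0 \<and> (LINT x:C|lborel. H x) > 0" for n :: nat and C
  define T where "T n C C' \<longleftrightarrow> C' \<subseteq> C \<and> (case e n of (p,i,j) \<Rightarrow> i \<noteq> j \<longrightarrow> (\<exists>\<alpha> \<beta>. \<not> (\<alpha> = 0 \<and> \<beta> = 0)
      \<and> (\<forall>x\<in>C'. 0 \<le> (\<alpha> *\<^sub>R i + \<beta> *\<^sub>R j) \<bullet> (x - p))))" for n and C C' :: "'a set"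
  have "\<exists>C. \<forall>n. P n (C n) \<and> T n (C n) (C (Suc n))"
  proof (rule dependent_nat_choice)
    show "\<exists>C. P 0 C" using K f0 H0 by (auto simp: P_def)
    fix C n assume C: "P n C"
    obtain p i j where pij: "e n = (p,i,j)" by (cases "e n")
    have "e n \<in> Q" using e by blast
    then have ij: "i \<in> Basis" "j \<in> Basis" using pij by (auto simp: Q_def)
    show "\<exists>C'. P (Suc n) C' \<and> T n C C'"
    proof (cases "i = j")
      case True then show ?thesis using C pij by (auto simp: T_def P_def)
    next
      case False
      have "\<exists>C' \<alpha> \<beta>. C' \<subseteq> C \<and> compact C' \<and> convex C' \<and> (LINT x:C'|lborel. f x) = 0 \<and> (LINT x:C'|lborel. H x) > 0
         \<and> \<not> (\<alpha> = 0 \<and> \<beta> = 0) \<and> (\<forall>x\<in>C'. 0 \<le> (\<alpha> *\<^sub>R i + \<beta> *\<^sub>R j) \<bullet> (x - p))"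
        using C f H ij False unfolding P_def by (intro zero_mean_bisection) auto
      then obtain C' \<alpha> \<beta> where "C' \<subseteq> C" "compact C'" "convex C'" "(LINT x:C'|lborel. f x) = 0" "(LINT x:C'|lborel. H x) > 0"
        "\<not> (\<alpha> = 0 \<and> \<beta> = 0)" "\<forall>x\<in>C'. 0 \<le> (\<alpha> *\<^sub>R i + \<beta> *\<^sub>R j) \<bullet> (x - p)" by blast
      then show ?thesis using C pij unfolding P_def T_def by (intro exI[of _ C']) auto
    qed
  qed
  then obtain C where C: "\<And>n. P n (C n)" "\<And>n. T n (C n) (C (Suc n))" by blast
  show ?thesis
  proof (rule that[of C])
    show "C n \<subseteq> C m" if "m \<le> n" for m n
      using lift_Suc_antimono_le[of C m n] C(2) that by (auto simp: T_def)
    fix a b c assume abc: "a \<in> (\<Inter>n. C n)" "b \<in> (\<Inter>n. C n)" "c \<in> (\<Inter>n. C n)" "a \<noteq> b"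
    show "\<exists>t. c = a + t *\<^sub>R (b - a)"
    proof (rule ccontr)
      assume no: "\<nexists>t. c = a + t *\<^sub>R (b - a)"
      \<comment> \<open>Non-collinear points keep a nondegenerate shadow on some coordinate plane. A
        cut through a point inside that shadow excludes at least one of the three, although all of
        them lie in every set of the sequence.\<close>
      obtain i j where ij: "i \<in> Basis" "j \<in> Basis" "i \<noteq> j"
        "((b - a) \<bullet> i) * ((c - a) \<bullet> j) \<noteq> ((b - a) \<bullet> j) * ((c - a) \<bullet> i)"
        using collinear_if_minors_vanish[of b a c] abc(4) no by metis
      obtain p where p: "p \<in> D" "\<And>\<alpha> \<beta>. \<not> (\<alpha> = 0 \<and> \<beta> = 0) \<Longrightarrow>
          \<not> (\<forall>x\<in>{a,b,c}. 0 \<le> (\<alpha> *\<^sub>R i + \<beta> *\<^sub>R j) \<bullet> (x - p))"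
        using nonneg_functional_on_triangle[OF ij(1,2,4) D(2)] by blast
      have "(p,i,j) \<in> range e" unfolding e Q_def using p ij by auto
      then obtain n where n: "e n = (p,i,j)" by (metis rangeE)
      obtain \<alpha> \<beta> where "\<not> (\<alpha> = 0 \<and> \<beta> = 0)" "\<forall>x\<in>C (Suc n). 0 \<le> (\<alpha> *\<^sub>R i + \<beta> *\<^sub>R j) \<bullet> (x - p)"
        using C(2)[of n] n ij(3) unfolding T_def by auto
      moreover have "{a,b,c} \<subseteq> C (Suc n)" using abc by auto
      ultimately show False using p(2) by blast
    qed
  qed (use C in \<open>auto simp: P_def\<close>)
qed

section \<open>The limit needle and the sharp constant for smooth functions\<close>

text \<open>On a thin body \<open>f\<close> and \<open>G\<close> are replaced by their values at
  \<open>l x\<close>, the point of the line through \<open>a\<close> in direction \<open>e\<close>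
  with the same \<open>b0\<close> coordinate. There the problem depends on one coordinate and the
  marginal inequality applies. Dividing the width in \<open>b0\<close> by
  \<open>e \<bullet> b0\<close> gives the length along the line; the replacement costs an error
  proportional to the volume that vanishes with \<eta>.\<close>

lemma needle_estimate:
  fixes f :: "'a::euclidean_space \<Rightarrow> real" and G :: "'a \<Rightarrow> 'a"
  assumes C: "compact C" "convex C" and df: "\<And>x. (f has_derivative (\<lambda>v. G x \<bullet> v)) (at x)"
    and G: "continuous_on UNIV G" and f0: "(LINT x:C|lborel. f x) = 0"
    and b0: "b0 \<in> Basis" and e: "norm e = 1" "e \<bullet> b0 > 0"
    and k: "0 < \<kappa>" "\<kappa> * ((s1 - s0) / (e \<bullet> b0)) \<le> pi"
    and width: "\<And>x. x \<in> C \<Longrightarrow> s0 \<le> x \<bullet> b0 \<and> x \<bullet> b0 \<le> s1"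
    and B: "0 \<le> B" "0 \<le> \<eta>"
    and l: "\<And>x. l x = a + ((x \<bullet> b0 - a \<bullet> b0) / (e \<bullet> b0)) *\<^sub>R e"
    and near: "\<And>x. x \<in> C \<Longrightarrow> \<bar>f x - f (l x)\<bar> \<le> \<eta> \<and> norm (G x - G (l x)) \<le> \<eta> \<and>
        \<bar>f x\<bar> \<le> B \<and> \<bar>f (l x)\<bar> \<le> B \<and> norm (G x) \<le> B \<and> norm (G (l x)) \<le> B"
  shows "\<kappa>\<^sup>2 * (LINT x:C|lborel. (f x)\<^sup>2) \<le> (LINT x:C|lborel. (norm (G x))\<^sup>2)
    + (\<kappa>\<^sup>2 * \<eta>\<^sup>2 + 2 * \<kappa>\<^sup>2 * B * \<eta> + 2 * B * \<eta>) * measure lborel C"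
proof (cases "measure lborel C = 0")
  \<comment> \<open>Bodies of volume zero are treated apart because the main case divides by the
    volume.\<close>
  case True
  have "emeasure lborel C = 0"
    using True emeasure_bounded_finite[OF compact_imp_bounded[OF C(1)]] by (auto simp: measure_def enn2real_eq_0_iff)
  then have "AE x in lborel. x \<notin> C" using C(1) by (intro AE_not_in) (auto simp: null_sets_def borel_compact)
  then have "(LINT x:C|lborel. g x) = 0" for g :: "'a \<Rightarrow> real"
    unfolding set_lebesgue_integral_def by (intro integral_eq_zero_AE) (auto elim: eventually_mono)
  then show ?thesis using True by simp
next
  case False
  then have V: "measure lborel C > 0" by (simp add: zero_less_measure_iff)
  let ?V = "measure lborel C"
  define t where "t = e \<bullet> b0"
  have t: "t > 0" using e by (simp add: t_def)
  define L where "L s = a + ((s - a \<bullet> b0) / t) *\<^sub>R e" for s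
  define F where "F s = f (L s)" for s
  \<comment> \<open>Parametrising the line by the \<open>b0\<close> coordinate multiplies
    derivatives by \<open>1 / t\<close>. The one-dimensional inequality is therefore used with
    \<open>\<kappa> / t\<close>, and the powers of \<open>t\<close> cancel.\<close>
  define F' where "F' s = (G (L s) \<bullet> e) / t" for s
  have lL: "l x = L (x \<bullet> b0)" for x by (simp add: l L_def t_def)
  have cL: "continuous_on UNIV L" unfolding L_def using t by (intro continuous_intros) auto
  have cf: "continuous_on UNIV f"
    using df by (meson has_derivative_continuous continuous_at_imp_continuous_on)
  have dF: "(F has_real_derivative F' s) (at s)" for s
  proof -
    have "(L has_derivative (\<lambda>h. (h / t) *\<^sub>R e)) (at s)"
      unfolding L_def using t by (auto intro!: derivative_eq_intros)
    from diff_chain_at[OF this df]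
    have "(F has_derivative (\<lambda>h. G (L s) \<bullet> ((h / t) *\<^sub>R e))) (at s)" by (simp add: F_def[abs_def] o_def)
    moreover have "(\<lambda>h. G (L s) \<bullet> ((h / t) *\<^sub>R e)) = (*) (F' s)" by (auto simp: F'_def)
    ultimately show ?thesis by (simp add: has_field_derivative_def)
  qed
  have cF': "continuous_on UNIV F'"
    unfolding F'_def using t by (intro continuous_intros continuous_on_compose2[OF G cL]) auto
  have cF: "continuous_on UNIV F" unfolding F_def by (intro continuous_on_compose2[OF cf cL]) auto
  have cb: "continuous_on UNIV (\<lambda>x. g (x \<bullet> b0))" if "continuous_on UNIV g" for g :: "real \<Rightarrow> real"
    by (intro continuous_on_compose2[OF that] continuous_intros) auto
  have int: "set_integrable lborel C g" if "continuous_on UNIV g" for g :: "'a \<Rightarrow> real"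
    unfolding set_integrable_def using borel_integrable_compact[OF C(1)] that continuous_on_subset by blast
  have Kle: "(\<kappa> / t) * (s1 - s0) \<le> pi" using k(2) by (simp add: t_def)
  have "(\<kappa> / t)\<^sup>2 * ((LINT x:C|lborel. (F (x \<bullet> b0))\<^sup>2) * ?V - (LINT x:C|lborel. F (x \<bullet> b0))\<^sup>2)
     \<le> (LINT x:C|lborel. (F' (x \<bullet> b0))\<^sup>2) * ?V"
    using needle_Wirtinger[OF C(2,1) b0 width _ Kle dF cF'] k(1) t by simp
  also have "(LINT x:C|lborel. (F' (x \<bullet> b0))\<^sup>2) = (LINT x:C|lborel. (G (l x) \<bullet> e)\<^sup>2) / t\<^sup>2"
    unfolding F'_def lL by (simp add: power_divide)
  finally have "\<kappa>\<^sup>2 * ((LINT x:C|lborel. (F (x \<bullet> b0))\<^sup>2) * ?V - (LINT x:C|lborel. F (x \<bullet> b0))\<^sup>2)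
     \<le> (LINT x:C|lborel. (G (l x) \<bullet> e)\<^sup>2) * ?V"
    using t by (simp add: power_divide divide_right_mono pos_divide_le_eq)
  then have w: "\<kappa>\<^sup>2 * ((LINT x:C|lborel. (f (l x))\<^sup>2) * ?V - (LINT x:C|lborel. f (l x))\<^sup>2)
     \<le> (LINT x:C|lborel. (G (l x) \<bullet> e)\<^sup>2) * ?V"
    by (simp add: F_def lL)
  have cl: "continuous_on UNIV l" unfolding lL[abs_def] by (intro continuous_on_compose2[OF cL] continuous_intros) auto
  have cfl: "continuous_on UNIV (\<lambda>x. f (l x))" by (intro continuous_on_compose2[OF cf cl]) auto
  have cGl: "continuous_on UNIV (\<lambda>x. G (l x))" by (intro continuous_on_compose2[OF G cl]) auto
  have const: "(LINT x:C|lborel. c) = c * ?V" for c :: real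
    by (simp add: set_lebesgue_integral_def)
  have finC: "set_integrable lborel C (\<lambda>x. c)" for c :: real by (rule int) simp
  have mono: "(LINT x:C|lborel. g x) \<le> (LINT x:C|lborel. g' x) + c * ?V"
    if "continuous_on UNIV g" "continuous_on UNIV g'" "\<And>x. x \<in> C \<Longrightarrow> g x \<le> g' x + c" for g g' c
  proof -
    have "(LINT x:C|lborel. g x) \<le> (LINT x:C|lborel. g' x + c)"
      using that by (intro set_integral_mono int continuous_intros) auto
    also have "\<dots> = (LINT x:C|lborel. g' x) + c * ?V"
      using that by (subst set_integral_add(2)) (auto intro: int simp: const)
    finally show ?thesis .
  qed
  have a1: "(LINT x:C|lborel. (f x)\<^sup>2) \<le> (LINT x:C|lborel. (f (l x))\<^sup>2) + (2 * B * \<eta>) * ?V"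
  proof (rule mono)
    fix x assume x: "x \<in> C"
    have "(f x)\<^sup>2 - (f (l x))\<^sup>2 = (f x - f (l x)) * (f x + f (l x))" by (simp add: algebra_simps power2_eq_square)
    also have "\<dots> \<le> \<bar>f x - f (l x)\<bar> * \<bar>f x + f (l x)\<bar>" by (simp flip: abs_mult)
    also have "\<dots> \<le> \<eta> * (2 * B)" using near[OF x] B by (intro mult_mono) auto
    finally show "(f x)\<^sup>2 \<le> (f (l x))\<^sup>2 + 2 * B * \<eta>" by (simp add: algebra_simps)
  qed (intro continuous_intros cf cfl)+
  have a2: "(LINT x:C|lborel. (G (l x) \<bullet> e)\<^sup>2) \<le> (LINT x:C|lborel. (norm (G x))\<^sup>2) + (2 * B * \<eta>) * ?V"
  proof (rule mono)
    fix x assume x: "x \<in> C"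
    have 1: "(G (l x) \<bullet> e)\<^sup>2 \<le> (norm (G (l x)))\<^sup>2"
      using Cauchy_Schwarz_ineq2[of "G (l x)" e] e by (metis abs_ge_zero mult.right_neutral power2_abs power_mono)
    have "(norm (G (l x)))\<^sup>2 - (norm (G x))\<^sup>2 = (norm (G (l x)) - norm (G x)) * (norm (G (l x)) + norm (G x))"
      by (simp add: algebra_simps power2_eq_square)
    also have "\<dots> \<le> \<eta> * (2 * B)"
    proof (rule mult_mono)
      have "norm (G (l x)) - norm (G x) \<le> norm (G (l x) - G x)" by (rule norm_triangle_ineq2)
      then show "norm (G (l x)) - norm (G x) \<le> \<eta>" using near[OF x] by (simp add: norm_minus_commute)
    qed (use near[OF x] B in auto)
    finally show "(G (l x) \<bullet> e)\<^sup>2 \<le> (norm (G x))\<^sup>2 + 2 * B * \<eta>" using 1 by (simp add: algebra_simps)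
  qed (intro continuous_intros G cGl)+
  \<comment> \<open>As \<open>f\<close> has mean zero on \<open>C\<close>, its replacement has mean
    at most \<open>\<eta>\<close>; this produces the term with \<open>\<eta>^2\<close>.\<close>
  have "\<bar>LINT x:C|lborel. f (l x)\<bar> \<le> \<eta> * ?V"
  proof -
    have "(LINT x:C|lborel. f (l x)) \<le> (LINT x:C|lborel. f x) + \<eta> * ?V"
      using near by (intro mono cf cfl) force
    moreover have "(LINT x:C|lborel. f x) \<le> (LINT x:C|lborel. f (l x)) + \<eta> * ?V"
      using near by (intro mono cf cfl) force
    ultimately show ?thesis using f0 by (simp add: abs_le_iff)
  qed
  then have a3: "(LINT x:C|lborel. f (l x))\<^sup>2 \<le> (\<eta> * ?V)\<^sup>2" by (metis abs_ge_zero power2_abs power_mono)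
  let ?X = "LINT x:C|lborel. (f (l x))\<^sup>2" and ?Y = "LINT x:C|lborel. (G (l x) \<bullet> e)\<^sup>2"
  have "\<kappa>\<^sup>2 * (?X * ?V) \<le> ?Y * ?V + \<kappa>\<^sup>2 * (LINT x:C|lborel. f (l x))\<^sup>2" using w by (simp add: algebra_simps)
  also have "\<dots> \<le> ?Y * ?V + \<kappa>\<^sup>2 * (\<eta> * ?V)\<^sup>2" using a3 by (intro add_left_mono mult_left_mono) auto
  finally have "(\<kappa>\<^sup>2 * ?X) * ?V \<le> (?Y + \<kappa>\<^sup>2 * \<eta>\<^sup>2 * ?V) * ?V" by (simp add: algebra_simps power2_eq_square)
  then have x: "\<kappa>\<^sup>2 * ?X \<le> ?Y + \<kappa>\<^sup>2 * \<eta>\<^sup>2 * ?V" using V by (simp add: mult_le_cancel_right)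
  have "\<kappa>\<^sup>2 * (LINT x:C|lborel. (f x)\<^sup>2) \<le> \<kappa>\<^sup>2 * (?X + (2 * B * \<eta>) * ?V)"
    using a1 by (intro mult_left_mono) auto
  then show ?thesis using x a2 by (simp add: algebra_simps)
qed

text \<open>A violation is kept alive through all bisections as positivity of the integral of
  \<open>H\<close>, until the body is thin enough for the needle estimate to refute it. Subtracting
  \<open>\<epsilon>\<close> in \<open>H\<close> pays for the error of that estimate, and the strict
  bound on \<open>\<kappa> * diameter K\<close> pays for replacing the limit segment by a body
  slightly longer than it.\<close>

lemma Poincare_convex_C1_strict:
  fixes f :: "'a::euclidean_space \<Rightarrow> real" and G :: "'a \<Rightarrow> 'a"
  assumes K: "compact K" "convex K" and df: "\<And>x. (f has_derivative (\<lambda>v. G x \<bullet> v)) (at x)"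
    and G: "continuous_on UNIV G" and f0: "(LINT x:K|lborel. f x) = 0"
    and k: "0 < \<kappa>" "\<kappa> * diameter K < pi"
  shows "\<kappa>\<^sup>2 * (LINT x:K|lborel. (f x)\<^sup>2) \<le> (LINT x:K|lborel. (norm (G x))\<^sup>2)"
proof (rule ccontr)
  define V where "V = measure lborel K"
  define d where "d = \<kappa>\<^sup>2 * (LINT x:K|lborel. (f x)\<^sup>2) - (LINT x:K|lborel. (norm (G x))\<^sup>2)"
  assume "\<not> ?thesis"
  then have d: "d > 0" by (simp add: d_def)
  \<comment> \<open>Small enough that \<open>\<epsilon> * V <= d / 2\<close>, so \<open>H\<close>
    still has positive integral over \<open>K\<close>; the summand 1 covers
    \<open>V = 0\<close>.\<close>
  define \<epsilon> where "\<epsilon> = d / (2 * (V + 1))"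
  have V0: "V \<ge> 0" by (simp add: V_def)
  have \<epsilon>: "\<epsilon> > 0" using d V0 by (simp add: \<epsilon>_def)
  define H where "H x = \<kappa>\<^sup>2 * (f x)\<^sup>2 - (norm (G x))\<^sup>2 - \<epsilon>" for x
  have cf: "continuous_on UNIV f"
    using df by (meson has_derivative_continuous continuous_at_imp_continuous_on)
  have cH: "continuous_on UNIV H" unfolding H_def by (intro continuous_intros cf G)
  have int: "set_integrable lborel C g" if "compact C" "continuous_on UNIV g" for C and g :: "'a \<Rightarrow> real"
    unfolding set_integrable_def using borel_integrable_compact[OF that(1)] that(2) continuous_on_subset by blast
  have IH: "(LINT x:C|lborel. H x) = \<kappa>\<^sup>2 * (LINT x:C|lborel. (f x)\<^sup>2) - (LINT x:C|lborel. (norm (G x))\<^sup>2) - \<epsilon> * measure lborel C"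
    if "compact C" for C
  proof -
    have 1: "set_integrable lborel C (\<lambda>x. \<kappa>\<^sup>2 * (f x)\<^sup>2)" "set_integrable lborel C (\<lambda>x. (norm (G x))\<^sup>2)"
      "set_integrable lborel C (\<lambda>x. \<epsilon>)" "set_integrable lborel C (\<lambda>x. \<kappa>\<^sup>2 * (f x)\<^sup>2 - (norm (G x))\<^sup>2)"
      by (intro int that continuous_intros cf G)+
    have "(LINT x:C|lborel. \<epsilon>) = \<epsilon> * measure lborel C" by (simp add: set_lebesgue_integral_def)
    then show ?thesis
      unfolding H_def using 1 by (simp add: set_integral_diff(2))
  qed
  have "\<epsilon> * V \<le> d / 2" using V0 d by (simp add: \<epsilon>_def field_simps)
  then have H0: "(LINT x:K|lborel. H x) > 0" unfolding IH[OF K(1)] using d by (simp add: d_def V_def)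
  obtain C :: "nat \<Rightarrow> 'a set" where C: "\<And>n. compact (C n)" "\<And>n. convex (C n)" "\<And>n. C n \<subseteq> K"
    "\<And>n. (LINT x:C n|lborel. f x) = 0" "\<And>n. (LINT x:C n|lborel. H x) > 0"
    "\<And>m n. m \<le> n \<Longrightarrow> C n \<subseteq> C m"
    "\<And>a b c. a \<in> (\<Inter>n. C n) \<Longrightarrow> b \<in> (\<Inter>n. C n) \<Longrightarrow> c \<in> (\<Inter>n. C n) \<Longrightarrow> a \<noteq> b \<Longrightarrow> \<exists>t. c = a + t *\<^sub>R (b - a)"
    by (rule needle_sequence[OF K cf cH f0 H0]) (rule that)
  define N where "N = (\<Inter>n. C n)"
  have Cne: "C n \<noteq> {}" for n using C(5)[of n] by (auto simp: set_lebesgue_integral_def)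
  have "N \<noteq> {}" unfolding N_def using compact_nest[of C] C(1,6) Cne by blast
  then obtain a where a: "a \<in> N" by blast
  have NK: "N \<subseteq> K" using C(3) by (auto simp: N_def)
  have cN: "compact N" unfolding N_def using C(1) by (intro compact_Inter) auto
  obtain e where e: "norm e = 1" "\<And>y. y \<in> N \<Longrightarrow> \<exists>t. y = a + t *\<^sub>R e"
  proof (cases "N = {a}")
    case True
    \<comment> \<open>If the bodies shrink to a single point, any unit vector serves as
      direction.\<close>
    obtain b :: 'a where "b \<in> Basis" using nonempty_Basis by blast
    then show ?thesis using that[of b] True by (auto intro: exI[of _ 0])
  next
    case False
    then obtain b where b: "b \<in> N" "b \<noteq> a" using a by blast
    have "\<exists>t. y = a + t *\<^sub>R ((b - a) /\<^sub>R norm (b - a))" if y: "y \<in> N" for y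
    proof -
      have "\<exists>t. y = a + t *\<^sub>R (b - a)" using C(7)[of a b y] a b y unfolding N_def by blast
      then obtain t where "y = a + t *\<^sub>R (b - a)" by blast
      then show ?thesis using b by (intro exI[of _ "t * norm (b - a)"]) simp
    qed
    then show ?thesis using that[of "(b - a) /\<^sub>R norm (b - a)"] b by simp
  qed
  obtain b0 e where b0: "b0 \<in> Basis" and e: "norm e = 1" "e \<bullet> b0 > 0" "\<And>y. y \<in> N \<Longrightarrow> \<exists>t. y = a + t *\<^sub>R e"
  proof -
    have "e \<noteq> 0" using e(1) by auto
    then obtain b where b: "b \<in> Basis" "e \<bullet> b \<noteq> 0" by (metis euclidean_all_zero_iff)
    show ?thesis
    proof (cases "e \<bullet> b > 0")
      case True then show ?thesis using that[of b e] b e by blast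
    next
      case False
      have "\<exists>t. y = a + t *\<^sub>R (- e)" if "y \<in> N" for y
        using e(2)[OF that] by (metis scaleR_minus_left scaleR_minus_right minus_minus)
      then show ?thesis using that[of b "-e"] b e(1) False by auto
    qed
  qed
  define t where "t = e \<bullet> b0"
  have t: "t > 0" "t \<le> 1" using e Basis_le_norm[OF b0, of e] by (auto simp: t_def)
  define l where "l x = a + ((x \<bullet> b0 - a \<bullet> b0) / t) *\<^sub>R e" for x
  have lN: "l y = y" if "y \<in> N" for y
  proof -
    obtain s where "y = a + s *\<^sub>R e" using e(3)[OF \<open>y \<in> N\<close>] by blast
    then show ?thesis using t by (simp add: l_def inner_add_left t_def[symmetric])
  qed
  have ldiff: "norm (l x - l y) \<le> norm (x - y) / t" for x y
  proof -
    have "l x - l y = (((x - y) \<bullet> b0) / t) *\<^sub>R e"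
      by (simp add: l_def inner_diff_left diff_divide_distrib scaleR_diff_left algebra_simps)
    then have "norm (l x - l y) = \<bar>(x - y) \<bullet> b0\<bar> / t" using e t by simp
    also have "\<dots> \<le> norm (x - y) / t" using Basis_le_norm[OF b0] t by (intro divide_right_mono) auto
    finally show ?thesis .
  qed
  obtain y0 where y0: "y0 \<in> N" "\<And>y. y \<in> N \<Longrightarrow> y0 \<bullet> b0 \<le> y \<bullet> b0"
    using continuous_attains_inf[OF cN \<open>N \<noteq> {}\<close>, of "\<lambda>y. y \<bullet> b0"] by (force intro: continuous_intros)
  obtain y1 where y1: "y1 \<in> N" "\<And>y. y \<in> N \<Longrightarrow> y \<bullet> b0 \<le> y1 \<bullet> b0"
    using continuous_attains_sup[OF cN \<open>N \<noteq> {}\<close>, of "\<lambda>y. y \<bullet> b0"] by (force intro: continuous_intros)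
  have ydist: "(y1 \<bullet> b0 - y0 \<bullet> b0) / t \<le> diameter K"
  proof -
    have "y1 - y0 = ((y1 \<bullet> b0 - y0 \<bullet> b0) / t) *\<^sub>R e"
    proof -
      obtain r s where "y0 = a + r *\<^sub>R e" "y1 = a + s *\<^sub>R e" using e(3) y0(1) y1(1) by meson
      then show ?thesis using t by (simp add: inner_add_left t_def[symmetric] algebra_simps diff_divide_distrib)
    qed
    then have "norm (y1 - y0) = (y1 \<bullet> b0 - y0 \<bullet> b0) / t" using e(1) t y0(2)[OF y1(1)] by simp
    moreover have "dist y1 y0 \<le> diameter K"
      using y0(1) y1(1) NK compact_imp_bounded[OF K(1)] by (intro diameter_bounded_bound) auto
    ultimately show ?thesis by (simp add: dist_norm)
  qed
  obtain R where R: "\<And>x. x \<in> K \<Longrightarrow> norm x \<le> R"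
    using compact_imp_bounded[OF K(1)] by (auto simp: bounded_iff)
  \<comment> \<open>Large enough for a point \<open>x\<close> of \<open>K\<close> and for
    \<open>l x\<close>, since their distance will be at most \<open>1 / t\<close>.\<close>
  define Z where "Z = cball (0::'a) (R + 1 + 1 / t)"
  have cZ: "compact Z" by (simp add: Z_def)
  obtain B0 where B0: "\<And>x. x \<in> Z \<Longrightarrow> norm (f x) \<le> B0"
    using compact_imp_bounded[OF compact_continuous_image[OF continuous_on_subset[OF cf] cZ]]
    by (auto simp: bounded_iff)
  obtain B1 where B1: "\<And>x. x \<in> Z \<Longrightarrow> norm (G x) \<le> B1"
    using compact_imp_bounded[OF compact_continuous_image[OF continuous_on_subset[OF G] cZ]]
    by (auto simp: bounded_iff)
  define B where "B = max 0 (max B0 B1)"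
  have B: "0 \<le> B" "\<And>x. x \<in> Z \<Longrightarrow> \<bar>f x\<bar> \<le> B \<and> norm (G x) \<le> B"
  proof -
    show "0 \<le> B" by (simp add: B_def)
    show "\<bar>f x\<bar> \<le> B \<and> norm (G x) \<le> B" if "x \<in> Z" for x
      using B0[OF that] B1[OF that] by (auto simp: B_def)
  qed
  define M where "M = \<kappa>\<^sup>2 + 2 * \<kappa>\<^sup>2 * B + 2 * B"
  have M: "M > 0" using k B(1) by (auto simp: M_def intro!: add_pos_nonneg)
  \<comment> \<open>For \<open>\<eta> <= 1\<close> the error per unit volume is at most
    \<open>\<eta> * M\<close>, which this choice puts below \<open>\<epsilon>\<close>.\<close>
  define \<eta> where "\<eta> = min 1 (\<epsilon> / (2 * M))"
  have \<eta>: "0 < \<eta>" "\<eta> \<le> 1" "\<eta> * M < \<epsilon>"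
  proof -
    show "0 < \<eta>" "\<eta> \<le> 1" using \<epsilon> M by (auto simp: \<eta>_def)
    have "\<eta> * M \<le> (\<epsilon> / (2 * M)) * M" using M by (intro mult_right_mono) (auto simp: \<eta>_def)
    also have "\<dots> < \<epsilon>" using M \<epsilon> by simp
    finally show "\<eta> * M < \<epsilon>" .
  qed
  have "uniformly_continuous_on Z f" "uniformly_continuous_on Z G"
    by (intro compact_uniformly_continuous continuous_on_subset[OF cf] continuous_on_subset[OF G] cZ subset_UNIV)+
  then have uc: "\<exists>d>0. \<forall>x\<in>Z. \<forall>y\<in>Z. dist y x < d \<longrightarrow> dist (f y) (f x) < \<eta>"
    "\<exists>d>0. \<forall>x\<in>Z. \<forall>y\<in>Z. dist y x < d \<longrightarrow> dist (G y) (G x) < \<eta>"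
    using \<eta>(1) unfolding uniformly_continuous_on_def by simp_all
  obtain d1 where d1: "d1 > 0" "\<And>x y. x \<in> Z \<Longrightarrow> y \<in> Z \<Longrightarrow> dist y x < d1 \<Longrightarrow> dist (f y) (f x) < \<eta>"
    using uc(1) by meson
  obtain d2 where d2: "d2 > 0" "\<And>x y. x \<in> Z \<Longrightarrow> y \<in> Z \<Longrightarrow> dist y x < d2 \<Longrightarrow> dist (G y) (G x) < \<eta>"
    using uc(2) by meson
  define gap where "gap = pi / \<kappa> - diameter K"
  have gap: "gap > 0" using k by (simp add: gap_def field_simps)
  define dm where "dm = min d1 d2"
  have dm: "dm > 0" "dm \<le> d1" "dm \<le> d2" using d1 d2 by (auto simp: dm_def)
  \<comment> \<open>The three bounds serve three purposes: 1/2 keeps \<open>l x\<close> in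
    \<open>Z\<close>, \<open>t * gap / 2\<close> keeps the lengthened needle within
    \<open>pi / \<kappa>\<close>, and \<open>t * dm / 4\<close> keeps \<open>x\<close> and
    \<open>l x\<close> within the moduli of continuity.\<close>
  define \<delta> where "\<delta> = min (1/2) (min (t * gap / 2) (t * dm / 4))"
  have \<delta>: "\<delta> > 0" "\<delta> < 1" using t gap dm by (auto simp: \<delta>_def)
  define U where "U = (\<Union>y\<in>N. ball y \<delta>)"
  \<comment> \<open>Otherwise the nested compact sets \<open>C n - U\<close> would have a common
    point, which would lie in \<open>N\<close> but outside its neighbourhood
    \<open>U\<close>.\<close>
  have "\<exists>n. C n \<subseteq> U"
  proof (rule ccontr)
    assume no: "\<nexists>n. C n \<subseteq> U"
    have "open U" by (auto simp: U_def)
    have "(\<Inter>n. C n - U) \<noteq> {}"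
    proof (rule compact_nest)
      show "compact (C n - U)" "C n - U \<noteq> {}" for n
        using no C(1)[of n] \<open>open U\<close> by (auto intro: compact_diff)
      show "C n - U \<subseteq> C m - U" if "m \<le> n" for m n using C(6)[OF that] by blast
    qed
    then obtain x where "x \<in> N" "x \<notin> U" by (auto simp: N_def)
    then show False using \<delta> by (auto simp: U_def)
  qed
  then obtain n where n: "C n \<subseteq> U" by blast
  have near: "\<exists>y\<in>N. norm (x - y) < \<delta>" if "x \<in> C n" for x
    using n that by (force simp: U_def dist_norm norm_minus_commute)
  have est: "\<kappa>\<^sup>2 * (LINT x:C n|lborel. (f x)\<^sup>2) \<le> (LINT x:C n|lborel. (norm (G x))\<^sup>2)
    + (\<kappa>\<^sup>2 * \<eta>\<^sup>2 + 2 * \<kappa>\<^sup>2 * B * \<eta> + 2 * B * \<eta>) * measure lborel (C n)"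
  proof (rule needle_estimate[OF C(1,2) df G C(4) b0 e(1,2) k(1), where l = l and a = a and ?s0.0 = "y0 \<bullet> b0 - \<delta>" and ?s1.0 = "y1 \<bullet> b0 + \<delta>"])
    have "(y1 \<bullet> b0 + \<delta> - (y0 \<bullet> b0 - \<delta>)) / t = (y1 \<bullet> b0 - y0 \<bullet> b0) / t + 2 * \<delta> / t"
      by (simp add: add_divide_distrib diff_divide_distrib)
    also have "\<dots> \<le> diameter K + gap"
    proof -
      have "\<delta> \<le> t * gap / 2" by (simp add: \<delta>_def)
      then have "2 * \<delta> / t \<le> gap" using t by (simp add: field_simps)
      then show ?thesis using ydist by simp
    qed
    also have "\<dots> = pi / \<kappa>" by (simp add: gap_def)
    finally show "\<kappa> * ((y1 \<bullet> b0 + \<delta> - (y0 \<bullet> b0 - \<delta>)) / (e \<bullet> b0)) \<le> pi"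
      using k(1) by (simp add: t_def pos_le_divide_eq mult.commute)
    show "l x = a + ((x \<bullet> b0 - a \<bullet> b0) / (e \<bullet> b0)) *\<^sub>R e" for x by (simp add: l_def t_def)
    show "0 \<le> B" "0 \<le> \<eta>" using B \<eta> by auto
    fix x assume x: "x \<in> C n"
    obtain y where y: "y \<in> N" "norm (x - y) < \<delta>" using near[OF x] by blast
    have "\<bar>(x - y) \<bullet> b0\<bar> < \<delta>" using Basis_le_norm[OF b0, of "x - y"] y(2) by simp
    then show "y0 \<bullet> b0 - \<delta> \<le> x \<bullet> b0 \<and> x \<bullet> b0 \<le> y1 \<bullet> b0 + \<delta>"
      using y0(2)[OF y(1)] y1(2)[OF y(1)] by (auto simp: inner_diff_left abs_less_iff)
    have "norm (x - l x) \<le> norm (x - y) + norm (l y - l x)"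
      using norm_triangle_ineq[of "x - y" "l y - l x"] lN[OF y(1)] by simp
    also have "\<dots> \<le> norm (x - y) + norm (y - x) / t" using ldiff by simp
    also have "\<dots> < \<delta> + \<delta> / t"
      using y(2) t by (intro add_strict_mono divide_strict_right_mono) (auto simp: norm_minus_commute)
    also have "\<dots> \<le> 2 * (\<delta> / t)" using t \<delta> by (simp add: field_simps)
    finally have dl: "norm (x - l x) < 2 * (\<delta> / t)" .
    have "\<delta> \<le> t * dm / 4" by (simp add: \<delta>_def)
    then have "2 * (\<delta> / t) \<le> dm / 2" using t by (simp add: field_simps)
    then have dd: "dist x (l x) < d1" "dist x (l x) < d2" using dl dm by (auto simp: dist_norm)
    have "2 * (\<delta> / t) \<le> 1 / t" using t by (simp add: \<delta>_def divide_simps)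
    then have "norm (x - l x) \<le> 1 / t" using dl by simp
    then have "norm (l x) \<le> norm x + 1 / t"
      using norm_triangle_ineq2[of "l x" x] by (simp add: norm_minus_commute)
    moreover have "norm x \<le> R" using R C(3) x by blast
    moreover have "0 < 1 / t" using t by simp
    ultimately have Z: "x \<in> Z" "l x \<in> Z" unfolding Z_def mem_cball_0 by linarith+
    show "\<bar>f x - f (l x)\<bar> \<le> \<eta> \<and> norm (G x - G (l x)) \<le> \<eta> \<and>
        \<bar>f x\<bar> \<le> B \<and> \<bar>f (l x)\<bar> \<le> B \<and> norm (G x) \<le> B \<and> norm (G (l x)) \<le> B"
      using d1(2)[OF Z(2,1) dd(1)] d2(2)[OF Z(2,1) dd(2)] B(2)[OF Z(1)] B(2)[OF Z(2)]
      by (auto simp: dist_norm)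
  qed
  have "\<kappa>\<^sup>2 * \<eta>\<^sup>2 + 2 * \<kappa>\<^sup>2 * B * \<eta> + 2 * B * \<eta> \<le> \<eta> * M"
  proof -
    have "\<kappa>\<^sup>2 * \<eta>\<^sup>2 \<le> \<kappa>\<^sup>2 * \<eta>" using \<eta> by (intro mult_left_mono) (auto simp: power2_eq_square)
    then show ?thesis by (simp add: M_def algebra_simps)
  qed
  then have "\<kappa>\<^sup>2 * \<eta>\<^sup>2 + 2 * \<kappa>\<^sup>2 * B * \<eta> + 2 * B * \<eta> \<le> \<epsilon>" using \<eta>(3) by simp
  then have "(\<kappa>\<^sup>2 * \<eta>\<^sup>2 + 2 * \<kappa>\<^sup>2 * B * \<eta> + 2 * B * \<eta>) * measure lborel (C n) \<le> \<epsilon> * measure lborel (C n)"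
    by (intro mult_right_mono) auto
  then show False using est C(5)[of n] IH[OF C(1), of n] by simp
qed

text \<open>Subtracting the mean gives the strict case for every \<open>\<kappa> < pi / d\<close>;
  letting \<open>\<kappa>\<close> increase to \<open>pi / d\<close> closes the gap.\<close>

theorem Poincare_convex_C1:
  fixes f :: "'a::euclidean_space \<Rightarrow> real" and G :: "'a \<Rightarrow> 'a"
  assumes K: "compact K" "convex K" and df: "\<And>x. (f has_derivative (\<lambda>v. G x \<bullet> v)) (at x)"
    and G: "continuous_on UNIV G" and d: "diameter K \<le> d" "0 < d"
    and m: "(LINT x:K|lborel. f x) = m * measure lborel K"
  shows "pi\<^sup>2 * (LINT x:K|lborel. (f x - m)\<^sup>2) \<le> d\<^sup>2 * (LINT x:K|lborel. (norm (G x))\<^sup>2)"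
proof -
  let ?X = "LINT x:K|lborel. (f x - m)\<^sup>2" and ?Y = "LINT x:K|lborel. (norm (G x))\<^sup>2"
  have cf: "continuous_on UNIV f"
    using df by (meson has_derivative_continuous continuous_at_imp_continuous_on)
  have int: "set_integrable lborel K g" if "continuous_on UNIV g" for g :: "'a \<Rightarrow> real"
    unfolding set_integrable_def using borel_integrable_compact[OF K(1)] that continuous_on_subset by blast
  have "(LINT x:K|lborel. f x - m) = (LINT x:K|lborel. f x) - (LINT x:K|lborel. m)"
    by (intro set_integral_diff(2) int cf) simp
  also have "(LINT x:K|lborel. m) = m * measure lborel K" by (simp add: set_lebesgue_integral_def)
  finally have z: "(LINT x:K|lborel. f x - m) = 0" using m by simp
  have dfm: "((\<lambda>x. f x - m) has_derivative (\<lambda>v. G x \<bullet> v)) (at x)" for x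
    using has_derivative_diff[OF df has_derivative_const[of m]] by simp
  have main: "\<kappa>\<^sup>2 * ?X \<le> ?Y" if "0 < \<kappa>" "\<kappa> < pi / d" for \<kappa>
  proof (rule Poincare_convex_C1_strict[OF K dfm G z that(1)])
    have "\<kappa> * diameter K \<le> \<kappa> * d" using that d by (intro mult_left_mono) auto
    also have "\<dots> < pi" using that d by (simp add: field_simps)
    finally show "\<kappa> * diameter K < pi" .
  qed
  have lim: "((\<lambda>\<kappa>. \<kappa>\<^sup>2 * ?X) \<longlongrightarrow> (pi / d)\<^sup>2 * ?X) (at_left (pi / d))"
    by (intro tendsto_intros)
  have "\<forall>\<^sub>F \<kappa> in at_left (pi / d). \<kappa> \<in> {0<..<pi / d}"
    using d(2) by (intro eventually_at_left_real) simp
  then have "\<forall>\<^sub>F \<kappa> in at_left (pi / d). \<kappa>\<^sup>2 * ?X \<le> ?Y"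
    by (rule eventually_mono) (use main in auto)
  then have "(pi / d)\<^sup>2 * ?X \<le> ?Y" by (intro tendsto_upperbound[OF lim]) auto
  then show ?thesis using d(2) by (simp add: power_divide field_simps)
qed

section \<open>Bump functions and mollification\<close>

text \<open>Allows an explicit derivative in place of \<open>frechet_derivative\<close>, in terms of
  which the smoothness classes are defined.\<close>

lemma C_k_SucI:
  assumes "\<And>x. (f has_derivative f' x) (at x)" "\<And>b. b \<in> Basis \<Longrightarrow> C_k k (\<lambda>x. f' x b)"
  shows "C_k (Suc k) f"
proof -
  have "frechet_derivative f (at x) = f' x" for x using frechet_derivative_at[OF assms(1)] by simp
  then show ?thesis using assms by (auto simp: differentiable_def)
qed

lemma C_k_Suc_imp: "C_k (Suc k) f \<Longrightarrow> C_k k f"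
proof (induction k arbitrary: f)
  case 0
  then show ?case by (auto intro!: continuous_at_imp_continuous_on differentiable_imp_continuous_within)
next
  case (Suc k)
  then show ?case by auto
qed

lemma C_k_deriv:
  assumes "C_k (Suc k) f"
  shows "(f has_derivative frechet_derivative f (at x)) (at x)"
    and "b \<in> Basis \<Longrightarrow> C_k k (\<lambda>x. frechet_derivative f (at x) b)"
  using assms by (auto simp: frechet_derivative_works)

lemma C_k_const: "C_k k (\<lambda>x. c)"
  by (induction k arbitrary: c) auto

lemma C_k_add: "C_k k f \<Longrightarrow> C_k k g \<Longrightarrow> C_k k (\<lambda>x. f x + g x)"
proof (induction k arbitrary: f g)
  case 0
  then show ?case by (auto intro: continuous_intros)
next
  case (Suc k)
  show ?case
  proof (rule C_k_SucI)
    show "((\<lambda>x. f x + g x) has_derivative (\<lambda>v. frechet_derivative f (at x) v + frechet_derivative g (at x) v)) (at x)" for x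
      by (intro has_derivative_add C_k_deriv(1)[OF Suc.prems(1)] C_k_deriv(1)[OF Suc.prems(2)])
    show "C_k k (\<lambda>x. frechet_derivative f (at x) b + frechet_derivative g (at x) b)" if "b \<in> Basis" for b
      by (intro Suc.IH C_k_deriv(2)[OF Suc.prems(1)] C_k_deriv(2)[OF Suc.prems(2)] that)
  qed
qed

lemma C_k_mult: "C_k k f \<Longrightarrow> C_k k g \<Longrightarrow> C_k k (\<lambda>x. f x * g x)"
proof (induction k arbitrary: f g)
  case 0
  then show ?case by (auto intro: continuous_intros)
next
  case (Suc k)
  show ?case
  proof (rule C_k_SucI)
    show "((\<lambda>x. f x * g x) has_derivative (\<lambda>v. f x * frechet_derivative g (at x) v + frechet_derivative f (at x) v * g x)) (at x)" for x
      by (intro has_derivative_mult C_k_deriv(1)[OF Suc.prems(1)] C_k_deriv(1)[OF Suc.prems(2)])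
    show "C_k k (\<lambda>x. f x * frechet_derivative g (at x) b + frechet_derivative f (at x) b * g x)" if "b \<in> Basis" for b
      by (intro C_k_add Suc.IH C_k_deriv(2)[OF Suc.prems(1)] C_k_deriv(2)[OF Suc.prems(2)] that
          C_k_Suc_imp[OF Suc.prems(1)] C_k_Suc_imp[OF Suc.prems(2)])
  qed
qed

lemma C_k_inner: "C_k k (\<lambda>x. (x - a) \<bullet> c)"
proof (cases k)
  case 0
  then show ?thesis by (auto intro!: continuous_intros)
next
  case (Suc l)
  have "C_k (Suc l) (\<lambda>x. (x - a) \<bullet> c)"
    by (rule C_k_SucI[where f' = "\<lambda>x v. v \<bullet> c"]) (auto intro!: derivative_eq_intros C_k_const)
  then show ?thesis using Suc by simp
qed

text \<open>The power \<open>m\<close> makes the family closed under differentiation, up to linear combinations.\<close>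

definition flat_exp :: "nat \<Rightarrow> real \<Rightarrow> real" where
  "flat_exp m r = (if r > 0 then exp (- (1 / r)) / r ^ m else 0)"

lemma flat_exp_tendsto_0: "(flat_exp m \<longlongrightarrow> 0) (at 0)"
proof (rule filterlim_split_at)
  show "(flat_exp m \<longlongrightarrow> 0) (at_left 0)"
    by (rule tendsto_eventually) (auto simp: flat_exp_def eventually_at_filter)
  have "((\<lambda>r. (inverse r) ^ m / exp (inverse r)) \<longlongrightarrow> (0::real)) (at_right 0)"
    by (rule filterlim_compose[OF tendsto_power_div_exp_0 filterlim_inverse_at_top_right])
  moreover have "\<forall>\<^sub>F r in at_right (0::real). (inverse r) ^ m / exp (inverse r) = flat_exp m r"
    by (auto simp: flat_exp_def eventually_at_filter exp_minus field_simps power_divide)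
  ultimately show "(flat_exp m \<longlongrightarrow> 0) (at_right 0)" by (rule Lim_transform_eventually)
qed

lemma DERIV_flat_exp: "(flat_exp m has_real_derivative flat_exp (m + 2) r - real m * flat_exp (m + 1) r) (at r)"
proof (cases r "0::real" rule: linorder_cases)
  case less
  then have "\<forall>\<^sub>F x in nhds r. flat_exp m x = 0"
    using eventually_nhds_in_open[of "{..<0}" r] by (auto simp: flat_exp_def elim: eventually_mono)
  then have "(flat_exp m has_real_derivative 0) (at r)"
    by (subst DERIV_cong_ev[OF refl _ refl, of _ "\<lambda>_. 0"]) auto
  then show ?thesis using less by (simp add: flat_exp_def)
next
  case equal
  \<comment> \<open>At 0 the difference quotient of \<open>flat_exp m\<close> is
    \<open>flat_exp (m + 1)\<close>, whose limit is already known to be 0.\<close>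
  have "((\<lambda>h. (flat_exp m (0 + h) - flat_exp m 0) / h) \<longlongrightarrow> 0) (at 0)"
  proof (rule Lim_transform_eventually[OF flat_exp_tendsto_0[of "m + 1"]])
    show "\<forall>\<^sub>F h in at 0. flat_exp (m + 1) h = (flat_exp m (0 + h) - flat_exp m 0) / h"
      by (auto simp: flat_exp_def eventually_at_filter)
  qed
  then show ?thesis using equal by (simp add: DERIV_def flat_exp_def)
next
  case greater
  have "((\<lambda>r. exp (- (1 / r)) / r ^ m) has_real_derivative flat_exp (m + 2) r - real m * flat_exp (m + 1) r) (at r)"
  proof (cases m)
    case 0
    then show ?thesis using greater
      by (auto intro!: derivative_eq_intros simp: flat_exp_def field_simps power2_eq_square)
  next
    case (Suc l)
    have e: "((\<lambda>r. exp (- (1 / r))) has_real_derivative exp (- (1 / r)) * (1 / r\<^sup>2)) (at r)"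
      using greater by (auto intro!: derivative_eq_intros simp: power2_eq_square)
    have p: "((\<lambda>r. r ^ Suc l) has_real_derivative real (Suc l) * r ^ l) (at r)"
      using DERIV_pow[of "Suc l" r] by simp
    have "((\<lambda>r. exp (- (1 / r)) / r ^ Suc l) has_real_derivative
      (exp (- (1 / r)) * (1 / r\<^sup>2) * r ^ Suc l - exp (- (1 / r)) * (real (Suc l) * r ^ l)) / (r ^ Suc l * r ^ Suc l)) (at r)"
      by (rule DERIV_divide[OF e p]) (use greater in simp)
    moreover have "(exp (- (1 / r)) * (1 / r\<^sup>2) * r ^ Suc l - exp (- (1 / r)) * (real (Suc l) * r ^ l)) / (r ^ Suc l * r ^ Suc l)
      = flat_exp (m + 2) r - real m * flat_exp (m + 1) r"
      using greater Suc by (simp add: flat_exp_def field_simps power2_eq_square)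
    ultimately show ?thesis using Suc by simp
  qed
  moreover have "\<forall>\<^sub>F x in nhds r. exp (- (1 / x)) / x ^ m = flat_exp m x"
    using eventually_nhds_in_open[of "{0<..}" r] greater by (auto simp: flat_exp_def elim: eventually_mono)
  ultimately show ?thesis using DERIV_cong_ev[OF refl _ refl] by fast
qed

text \<open>The argument \<open>\<epsilon>^2 - |y - a|^2\<close> is a polynomial in \<open>y\<close>
  and positive exactly in the ball of radius \<open>\<epsilon>\<close>, for positive
  \<open>\<epsilon>\<close>. The index \<open>m\<close> is needed because differentiation raises
  it.\<close>

definition bump :: "nat \<Rightarrow> real \<Rightarrow> 'a::euclidean_space \<Rightarrow> 'a \<Rightarrow> real" where
  "bump m \<epsilon> a y = flat_exp m (\<epsilon>\<^sup>2 - (y - a) \<bullet> (y - a))"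

text \<open>The gradient of \<open>bump 0\<close>: for \<open>m = 0\<close> the derivative formula
  retains only the term of index 2.\<close>

definition bump_grad :: "real \<Rightarrow> 'a::euclidean_space \<Rightarrow> 'a \<Rightarrow> 'a" where
  "bump_grad \<epsilon> a y = (- 2 * bump 2 \<epsilon> a y) *\<^sub>R (y - a)"

lemma has_derivative_bump:
  "(bump m \<epsilon> a has_derivative (\<lambda>v. (bump (m + 2) \<epsilon> a y - real m * bump (m + 1) \<epsilon> a y) * (- 2 * ((y - a) \<bullet> v)))) (at y)"
proof -
  have "((\<lambda>y. \<epsilon>\<^sup>2 - (y - a) \<bullet> (y - a)) has_derivative (\<lambda>v. - 2 * ((y - a) \<bullet> v))) (at y)"
    by (auto intro!: derivative_eq_intros simp: inner_commute)
  from DERIV_compose_FDERIV[OF DERIV_flat_exp this, of m]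
  show ?thesis unfolding bump_def by (simp add: mult.commute)
qed

lemma C_k_bump: "C_k k (bump m \<epsilon> a)"
proof (induction k arbitrary: m)
  case 0
  show ?case
    using has_derivative_bump[of m \<epsilon> a] by (auto intro!: continuous_at_imp_continuous_on has_derivative_continuous)
next
  case (Suc k)
  show ?case
  proof (rule C_k_SucI[OF has_derivative_bump])
    fix b :: 'a assume "b \<in> Basis"
    have "C_k k (\<lambda>y. (bump (m + 2) \<epsilon> a y + (- real m) * bump (m + 1) \<epsilon> a y) * ((- 2) * ((y - a) \<bullet> b)))"
      by (intro C_k_mult C_k_add C_k_const C_k_inner Suc)
    then show "C_k k (\<lambda>y. (bump (m + 2) \<epsilon> a y - real m * bump (m + 1) \<epsilon> a y) * (- 2 * ((y - a) \<bullet> b)))"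
      by simp
  qed
qed

lemma bump_support: "bump m \<epsilon> a y \<noteq> 0 \<Longrightarrow> \<epsilon> > 0 \<Longrightarrow> y \<in> ball a \<epsilon>"
proof -
  assume a: "bump m \<epsilon> a y \<noteq> 0" "\<epsilon> > 0"
  then have "(norm (y - a))\<^sup>2 < \<epsilon>\<^sup>2" by (auto simp: bump_def flat_exp_def power2_norm_eq_inner split: if_splits)
  then have "norm (y - a) < \<epsilon>" using a(2) by (simp add: power2_less_imp_less)
  then show ?thesis by (simp add: dist_norm norm_minus_commute)
qed

lemma bump_grad_derivative:
  "(bump 0 \<epsilon> a has_derivative (\<lambda>v. bump_grad \<epsilon> a y \<bullet> v)) (at y)"
  using has_derivative_bump[of 0 \<epsilon> a y] by (simp add: bump_grad_def numeral_2_eq_2 mult_ac)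

lemma continuous_bump: "continuous_on UNIV (bump m \<epsilon> a)"
  using C_k_bump[of 0 m \<epsilon> a] by simp

lemma continuous_bump_grad: "continuous_on UNIV (bump_grad \<epsilon> a)"
  unfolding bump_grad_def by (intro continuous_intros continuous_bump)

lemma bump_nonneg: "0 \<le> bump m \<epsilon> a y"
  by (simp add: bump_def flat_exp_def)

lemma test_function_bump:
  assumes "\<epsilon> > 0" "cball a \<epsilon> \<subseteq> \<Omega>"
  shows "test_function \<Omega> (bump 0 \<epsilon> a)"
proof -
  have "{x. bump 0 \<epsilon> a x \<noteq> 0} \<subseteq> cball a \<epsilon>" using bump_support[OF _ assms(1)] by fastforce
  then have "closure {x. bump 0 \<epsilon> a x \<noteq> 0} \<subseteq> cball a \<epsilon>" by (intro closure_minimal) auto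
  then show ?thesis
    unfolding test_function_def using C_k_bump assms(2)
    by (auto simp: compact_eq_bounded_closed intro: bounded_subset[OF bounded_cball])
qed

section \<open>Integration by parts and continuity of translations in L1\<close>

text \<open>By translation invariance the integral of \<open>f (x + h b) - f x\<close> is zero.
  Uniform continuity of \<open>G\<close> makes \<open>h (G x \<bullet> b)\<close> approximate this
  difference up to \<open>h\<close> times an arbitrarily small constant on a fixed compact set, so
  division by \<open>h\<close> leaves nothing. Applied to products it is integration by
  parts.\<close>

lemma integral_deriv_compact_support:
  fixes f :: "'a::euclidean_space \<Rightarrow> real" and G :: "'a \<Rightarrow> 'a"
  assumes df: "\<And>x. (f has_derivative (\<lambda>v. G x \<bullet> v)) (at x)" and G: "continuous_on UNIV G"
    and supp: "\<And>x. f x \<noteq> 0 \<or> G x \<noteq> 0 \<Longrightarrow> norm x \<le> R"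
  shows "(\<integral>x. G x \<bullet> b \<partial>lborel) = 0"
proof -
  \<comment> \<open>Enlarged by the norm of \<open>b\<close> so that it also contains the supports
    shifted by \<open>h b\<close> with \<open>h <= 1\<close>.\<close>
  define K where "K = cball (0::'a) (R + norm b)"
  have K: "compact K" by (simp add: K_def)
  have cf: "continuous_on UNIV f"
    using df by (meson has_derivative_continuous continuous_at_imp_continuous_on)
  have ucG: "uniformly_continuous_on K G"
    using compact_uniformly_continuous[OF continuous_on_subset[OF G] K] by simp
  have intK: "integrable lborel g" if g: "continuous_on UNIV g" "\<And>x. g x \<noteq> 0 \<Longrightarrow> x \<in> K" for g :: "'a \<Rightarrow> real"
  proof -
    have "integrable lborel (\<lambda>x. indicator K x *\<^sub>R g x)"
      using borel_integrable_compact[OF K] g(1) continuous_on_subset by blast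
    also have "(\<lambda>x. indicator K x *\<^sub>R g x) = g" using g(2) by (auto simp: indicator_def fun_eq_iff)
    finally show ?thesis .
  qed
  have suppK: "x \<in> K" if "G x \<noteq> 0 \<or> f x \<noteq> 0" for x
  proof -
    have "norm x \<le> R" using supp[of x] that by blast
    then show ?thesis using norm_ge_zero[of b] unfolding K_def mem_cball_0 by linarith
  qed
  have intGb: "integrable lborel (\<lambda>x. G x \<bullet> b)"
    by (intro intK continuous_intros G) (metis inner_zero_left suppK)
  have intf: "integrable lborel f" using suppK by (intro intK cf) auto
  have bound: "\<bar>\<integral>x. G x \<bullet> b \<partial>lborel\<bar> \<le> e * norm b * measure lborel K" if e: "e > 0" for e
  proof -
    obtain d where d: "d > 0" "\<And>x y. x \<in> K \<Longrightarrow> y \<in> K \<Longrightarrow> dist y x < d \<Longrightarrow> dist (G y) (G x) < e"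
      using ucG e unfolding uniformly_continuous_on_def by meson
    define h where "h = min 1 (d / (2 * (norm b + 1)))"
    have h: "h > 0" "h \<le> 1" "h * norm b < d"
    proof -
      have nb: "0 < norm b + 1" using norm_ge_zero[of b] by linarith
      show "h > 0" "h \<le> 1" using d nb unfolding h_def by simp_all
      have "h * (norm b + 1) \<le> d / (2 * (norm b + 1)) * (norm b + 1)"
        using nb by (intro mult_right_mono) (auto simp: h_def)
      also have "\<dots> = d / 2" using nb by (simp add: field_simps)
      finally show "h * norm b < d" using d(1) \<open>h > 0\<close> by (simp add: distrib_left)
    qed
    \<comment> \<open>If \<open>x\<close> is in \<open>K\<close> and the segment from
      \<open>x\<close> to \<open>x + h b\<close> meets the ball of radius \<open>R\<close>, the mean
      value theorem applies; otherwise all three terms vanish. The indicator makes the bound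
      integrable.\<close>
    have ptw: "\<bar>f (x + h *\<^sub>R b) - f x - h * (G x \<bullet> b)\<bar> \<le> h * (e * norm b) * indicator K x" for x
    proof (cases "x \<in> K \<and> (\<exists>s\<in>{0..h}. norm (x + s *\<^sub>R b) \<le> R)")
      case True
      have der: "((\<lambda>s. f (x + s *\<^sub>R b) - s * (G x \<bullet> b)) has_real_derivative (G (x + s *\<^sub>R b) \<bullet> b - G x \<bullet> b)) (at s)" for s
      proof -
        have "((\<lambda>s. x + s *\<^sub>R b) has_derivative (\<lambda>t. t *\<^sub>R b)) (at s)" by (auto intro!: derivative_eq_intros)
        from diff_chain_at[OF this df]
        have "((\<lambda>s. f (x + s *\<^sub>R b)) has_real_derivative (G (x + s *\<^sub>R b) \<bullet> b)) (at s)"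
          by (simp add: o_def has_field_derivative_def) (simp add: mult.commute[of _ "_ \<bullet> _"] inner_scaleR_right)
        then show ?thesis by (auto intro!: derivative_eq_intros)
      qed
      obtain s where s: "0 < s" "s < h" "(f (x + h *\<^sub>R b) - h * (G x \<bullet> b)) - (f (x + 0 *\<^sub>R b) - 0 * (G x \<bullet> b))
          = (h - 0) * (G (x + s *\<^sub>R b) \<bullet> b - G x \<bullet> b)"
        using MVT2[of 0 h "\<lambda>s. f (x + s *\<^sub>R b) - s * (G x \<bullet> b)" "\<lambda>s. G (x + s *\<^sub>R b) \<bullet> b - G x \<bullet> b"] der h(1) by blast
      have sb: "norm (s *\<^sub>R b) < d" "norm (s *\<^sub>R b) \<le> norm b"
        using s h mult_right_mono[of s h "norm b"] mult_right_mono[of s 1 "norm b"] by auto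
      have nb: "norm (G (x + s *\<^sub>R b) - G x) \<le> e"
      proof (cases "x + s *\<^sub>R b \<in> K")
        case True
        then show ?thesis using d(2)[of x "x + s *\<^sub>R b"] \<open>x \<in> K \<and> _\<close> sb by (simp add: dist_norm)
      next
        case False
        then have g0: "G (x + s *\<^sub>R b) = 0" using suppK by blast
        have "R + norm b < norm (x + s *\<^sub>R b)" using False by (simp add: K_def)
        also have "\<dots> \<le> norm x + norm b" using norm_triangle_ineq[of x "s *\<^sub>R b"] sb(2) by simp
        finally have "G x = 0" using supp[of x] by force
        then show ?thesis using g0 e by simp
      qed
      have "f (x + h *\<^sub>R b) - f x - h * (G x \<bullet> b) = h * ((G (x + s *\<^sub>R b) - G x) \<bullet> b)"
        using s(3) by (simp add: inner_diff_left)
      then have "\<bar>f (x + h *\<^sub>R b) - f x - h * (G x \<bullet> b)\<bar> = h * \<bar>(G (x + s *\<^sub>R b) - G x) \<bullet> b\<bar>"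
        using h(1) by (simp add: abs_mult)
      also have "\<dots> \<le> h * (norm (G (x + s *\<^sub>R b) - G x) * norm b)"
        using h by (intro mult_left_mono Cauchy_Schwarz_ineq2) auto
      also have "\<dots> \<le> h * (e * norm b)" using h nb by (intro mult_left_mono mult_right_mono) auto
      finally show ?thesis using True by simp
    next
      case False
      have "f x = 0 \<and> G x = 0 \<and> f (x + h *\<^sub>R b) = 0"
      proof (cases "x \<in> K")
        case True
        then have no: "\<not> norm (x + s *\<^sub>R b) \<le> R" if "s \<in> {0..h}" for s using False that by blast
        show ?thesis using no[of 0] no[of h] h supp[of x] supp[of "x + h *\<^sub>R b"] by auto
      next
        case F: False
        have "norm (h *\<^sub>R b) \<le> norm b" using h mult_right_mono[of h 1 "norm b"] by simp
        then have "norm x \<le> norm (x + h *\<^sub>R b) + norm b"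
          using norm_triangle_ineq4[of "x + h *\<^sub>R b" "h *\<^sub>R b"] by simp
        then have "\<not> norm (x + h *\<^sub>R b) \<le> R" using F by (auto simp: K_def)
        then show ?thesis using suppK[of x] F supp[of "x + h *\<^sub>R b"] by auto
      qed
      then show ?thesis using h e by (simp add: indicator_def)
    qed
    have shift: "integrable lborel (\<lambda>x. f (x + h *\<^sub>R b))" "(\<integral>x. f (x + h *\<^sub>R b) \<partial>lborel) = (\<integral>x. f x \<partial>lborel)"
    proof -
      have d: "distr lborel borel (\<lambda>x. h *\<^sub>R b + x) = lborel" using lborel_distr_plus[of "h *\<^sub>R b"] .
      have m: "f \<in> borel_measurable borel" using cf by (rule borel_measurable_continuous_onI)
      have "integrable (distr lborel borel (\<lambda>x. h *\<^sub>R b + x)) f" unfolding d by (rule intf)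
      then show "integrable lborel (\<lambda>x. f (x + h *\<^sub>R b))"
        using m by (subst (asm) integrable_distr_eq) (auto simp: add.commute)
      have "(\<integral>x. f x \<partial>lborel) = (\<integral>x. f x \<partial>distr lborel borel (\<lambda>x. h *\<^sub>R b + x))" unfolding d ..
      also have "\<dots> = (\<integral>x. f (h *\<^sub>R b + x) \<partial>lborel)" using m by (intro integral_distr) auto
      finally show "(\<integral>x. f (x + h *\<^sub>R b) \<partial>lborel) = (\<integral>x. f x \<partial>lborel)" by (simp add: add.commute)
    qed
    have "h * (\<integral>x. G x \<bullet> b \<partial>lborel) = - (\<integral>x. f (x + h *\<^sub>R b) - f x - h * (G x \<bullet> b) \<partial>lborel)"
      using shift intf intGb by simp
    then have "h * \<bar>\<integral>x. G x \<bullet> b \<partial>lborel\<bar> = \<bar>\<integral>x. f (x + h *\<^sub>R b) - f x - h * (G x \<bullet> b) \<partial>lborel\<bar>"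
      using h(1) abs_mult[of h "\<integral>x. G x \<bullet> b \<partial>lborel"] by simp
    also have "\<dots> \<le> (\<integral>x. \<bar>f (x + h *\<^sub>R b) - f x - h * (G x \<bullet> b)\<bar> \<partial>lborel)" by (rule integral_abs_bound)
    also have "\<dots> \<le> (\<integral>x. h * (e * norm b) * indicator K x \<partial>lborel)"
    proof (rule integral_mono)
      show "integrable lborel (\<lambda>x. \<bar>f (x + h *\<^sub>R b) - f x - h * (G x \<bullet> b)\<bar>)"
        using shift intf intGb by (intro integrable_abs Bochner_Integration.integrable_diff integrable_mult_right)
      show "integrable lborel (\<lambda>x. h * (e * norm b) * indicator K x)"
        using K emeasure_compact_finite[OF K] by (intro integrable_mult_right integrable_real_indicator) (auto simp: borel_compact)
    qed (rule ptw)
    also have "\<dots> = h * (e * norm b * measure lborel K)" using K by (simp add: borel_compact)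
    finally show ?thesis using h(1) by (simp add: mult_le_cancel_left)
  qed
  show ?thesis
  proof (rule ccontr)
    assume n: "(\<integral>x. G x \<bullet> b \<partial>lborel) \<noteq> 0"
    define X where "X = norm b * measure lborel K"
    have X: "X \<ge> 0" by (simp add: X_def)
    define I where "I = \<bar>\<integral>x. G x \<bullet> b \<partial>lborel\<bar>"
    have I: "I > 0" using n by (simp add: I_def)
    have "I / (2 * (X + 1)) > 0" using I X by simp
    from bound[OF this] have "I \<le> I / (2 * (X + 1)) * X" by (simp add: X_def I_def mult.assoc)
    also have "\<dots> \<le> I / (2 * (X + 1)) * (X + 1)" using I X by (intro mult_left_mono) auto
    also have "\<dots> = I / 2" using X by (simp add: field_simps)
    finally show False using I by simp
  qed
qed

lemma nn_integral_lborel_shift: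
  fixes f :: "'a::euclidean_space \<Rightarrow> ennreal"
  assumes [measurable]: "f \<in> borel_measurable borel"
  shows "(\<integral>\<^sup>+x. f (x + z) \<partial>lborel) = (\<integral>\<^sup>+x. f x \<partial>lborel)"
proof -
  have "(\<integral>\<^sup>+x. f x \<partial>lborel) = (\<integral>\<^sup>+x. f x \<partial>distr lborel borel (\<lambda>x. z + x))"
    using lborel_distr_plus[of z] by simp
  also have "\<dots> = (\<integral>\<^sup>+x. f (z + x) \<partial>lborel)" by (rule nn_integral_distr) auto
  finally show ?thesis by (simp add: add.commute)
qed

lemma nn_integral_lborel_reflect:
  fixes f :: "'a::euclidean_space \<Rightarrow> ennreal"
  assumes [measurable]: "f \<in> borel_measurable borel"
  shows "(\<integral>\<^sup>+x. f (z - x) \<partial>lborel) = (\<integral>\<^sup>+x. f x \<partial>lborel)"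
proof -
  have "lborel = density (distr lborel borel (\<lambda>x. z + (-1) *\<^sub>R x)) (\<lambda>_. ennreal (\<bar>-1\<bar>^DIM('a)))"
    by (rule lborel_affine) simp
  then have d: "lborel = distr lborel borel (\<lambda>x. z - x :: 'a)" by (simp add: density_1)
  have "(\<integral>\<^sup>+x. f x \<partial>lborel) = (\<integral>\<^sup>+x. f x \<partial>distr lborel borel (\<lambda>x. z - x))" using d by simp
  also have "\<dots> = (\<integral>\<^sup>+x. f (z - x) \<partial>lborel)" by (rule nn_integral_distr) auto
  finally show ?thesis by simp
qed

text \<open>Regularity of the measure encloses \<open>A\<close> between a compact \<open>K\<close>
  and an open \<open>U\<close> of nearly equal measure. A shift smaller than the distance from
  \<open>K\<close> to the complement of \<open>U\<close> can change the indicator only where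
  \<open>x\<close> or \<open>x + z\<close> lies in \<open>U - K\<close>.\<close>

lemma indicator_translation_L1:
  fixes A :: "'a::euclidean_space set"
  assumes A: "A \<in> sets borel" "emeasure lborel A < \<infinity>" and e: "e > 0"
  shows "\<exists>d>0. \<forall>z. norm z < d \<longrightarrow> (\<integral>\<^sup>+x. ennreal \<bar>indicator A (x + z) - indicator A x\<bar> \<partial>lborel) \<le> ennreal e"
proof -
  have Al: "A \<in> sets lebesgue" using A by simp
  obtain U where U: "open U" "A \<subseteq> U" "emeasure lebesgue (U - A) < ennreal (e/4)"
    by (rule sets_lebesgue_outer_open[OF Al, of "e/4"]) (use e in simp, rule that)
  obtain F where F: "closed F" "F \<subseteq> A" "emeasure lebesgue (A - F) < ennreal (e/8)"
    by (rule sets_lebesgue_inner_closed[OF Al, of "e/8"]) (use e in simp, rule that)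
  have sb [measurable]: "U \<in> sets borel" "F \<in> sets borel" "A \<in> sets borel" using U F A by auto
  \<comment> \<open>Intersecting the closed set with growing balls makes it compact; continuity from
    above controls the part of \<open>A\<close> that is lost.\<close>
  define E where "E n = A - (F \<inter> cball 0 (real n))" for n :: nat
  have Em: "E n \<in> sets lborel" for n unfolding E_def by simp
  have "(\<lambda>n. emeasure lborel (E n)) \<longlonglongrightarrow> emeasure lborel (\<Inter>n. E n)"
  proof (rule Lim_emeasure_decseq)
    show "range E \<subseteq> sets lborel" using Em by blast
    show "decseq E" unfolding decseq_def E_def by auto
    show "emeasure lborel (E i) \<noteq> \<infinity>" for i
      using emeasure_mono[of "E i" A lborel] A by (auto simp: E_def top_unique)
  qed
  moreover have "(\<Inter>n. E n) = A - F"
  proof -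
    have "\<exists>n. norm x \<le> real n" for x :: 'a by (rule real_arch_simple)
    then show ?thesis unfolding E_def by auto
  qed
  moreover have "emeasure lborel (A - F) < ennreal (e/4)"
  proof -
    have "emeasure lborel (A - F) < ennreal (e/8)" using F(3) by (simp add: emeasure_completion[symmetric] main_part_sets)
    also have "\<dots> \<le> ennreal (e/4)" using e by (intro ennreal_leI) auto
    finally show ?thesis .
  qed
  ultimately have "\<forall>\<^sub>F n in sequentially. emeasure lborel (E n) < ennreal (e/4)"
    using order_tendstoD(2) by metis
  then obtain n where n: "emeasure lborel (E n) < ennreal (e/4)" by (auto simp: eventually_sequentially)
  define K where "K = F \<inter> cball 0 (real n)"
  have K: "compact K" unfolding K_def using F(1) by (metis compact_Int_closed compact_cball inf_commute)
  have KA: "K \<subseteq> A" "K \<subseteq> U" using F(2) U(2) by (auto simp: K_def)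
  have Kb [measurable]: "K \<in> sets borel" using K by (simp add: borel_compact)
  define D where "D = U - K"
  have Db [measurable]: "D \<in> sets borel" by (simp add: D_def)
  have "emeasure lborel D \<le> emeasure lborel (U - A) + emeasure lborel (E n)"
  proof -
    have "D \<subseteq> (U - A) \<union> E n" by (auto simp: D_def E_def K_def)
    then have "emeasure lborel D \<le> emeasure lborel ((U - A) \<union> E n)" by (intro emeasure_mono) (auto simp: E_def)
    also have "\<dots> \<le> emeasure lborel (U - A) + emeasure lborel (E n)" by (intro emeasure_subadditive) (auto simp: E_def)
    finally show ?thesis .
  qed
  also have "\<dots> \<le> ennreal (e/4) + ennreal (e/4)"
    using U(3) n by (intro add_mono) (auto simp: emeasure_completion[symmetric] main_part_sets)
  also have "\<dots> = ennreal (e/2)" using e by (subst ennreal_plus[symmetric]) auto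
  finally have mD: "emeasure lborel D \<le> ennreal (e/2)" .
  obtain d where d: "d > 0" "(\<Union>x\<in>K. ball x d) \<subseteq> U"
    using compact_subset_open_imp_ball_epsilon_subset[OF K U(1) KA(2)] by metis
  show ?thesis
  proof (intro exI[of _ d] conjI allI impI)
    fix z :: 'a assume z: "norm z < d"
    have KU: "x + z \<in> U" "x - z \<in> U" if "x \<in> K" for x
    proof -
      have "x + z \<in> ball x d" "x - z \<in> ball x d" using z by (auto simp: dist_norm)
      then show "x + z \<in> U" "x - z \<in> U" using d(2) that by blast+
    qed
    have "(\<integral>\<^sup>+x. ennreal \<bar>indicator A (x + z) - indicator A x\<bar> \<partial>lborel)
       \<le> (\<integral>\<^sup>+x. indicator D (x + z) + indicator D x \<partial>lborel)"
    proof (rule nn_integral_mono)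
      fix x
      \<comment> \<open>The one of the two points that lies in \<open>A\<close> is either outside
        \<open>K\<close>, or its partner is still in \<open>U\<close> but not in
        \<open>A\<close>.\<close>
      have "x + z \<in> D \<or> x \<in> D" if "(x + z \<in> A) \<noteq> (x \<in> A)"
        using that KU(1)[of x] KU(2)[of "x + z"] KA U(2) by (auto simp: D_def)
      then show "ennreal \<bar>indicator A (x + z) - indicator A x\<bar> \<le> indicator D (x + z) + indicator D x"
        by (auto simp: indicator_def)
    qed
    also have "\<dots> = (\<integral>\<^sup>+x. indicator D (x + z) \<partial>lborel) + (\<integral>\<^sup>+x. indicator D x \<partial>lborel)"
      by (intro nn_integral_add) auto
    also have "(\<integral>\<^sup>+x. indicator D (x + z) \<partial>lborel) = (\<integral>\<^sup>+x. indicator D x \<partial>lborel)"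
      by (rule nn_integral_lborel_shift) simp
    also have "(\<integral>\<^sup>+x. indicator D x \<partial>lborel) + (\<integral>\<^sup>+x. indicator D x \<partial>lborel) \<le> ennreal (e/2) + ennreal (e/2)"
      using mD by (intro add_mono) auto
    also have "\<dots> = ennreal e" using e by (subst ennreal_plus[symmetric]) auto
    finally show "(\<integral>\<^sup>+x. ennreal \<bar>indicator A (x + z) - indicator A x\<bar> \<partial>lborel) \<le> ennreal e" .
  qed (fact d)
qed

lemma ennreal_le_add: "a \<le> b + c \<Longrightarrow> 0 \<le> b \<Longrightarrow> 0 \<le> c \<Longrightarrow> ennreal a \<le> ennreal b + ennreal c"
  by (simp flip: ennreal_plus add: ennreal_leI)

text \<open>The property holds for indicators and passes to sums and to dominated limits, the latter
  because shifting both functions leaves their L1 distance unchanged.\<close>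

lemma translation_L1_continuous:
  fixes f :: "'a::euclidean_space \<Rightarrow> real"
  assumes "integrable lborel f" "e > 0"
  shows "\<exists>d>0. \<forall>z. norm z < d \<longrightarrow> (\<integral>\<^sup>+x. ennreal \<bar>f (x + z) - f x\<bar> \<partial>lborel) \<le> ennreal e"
  using assms
proof (induction arbitrary: e rule: integrable_induct)
  case (base A c)
  have A: "A \<in> sets borel" "emeasure lborel A < \<infinity>" using base by auto
  have "e / (\<bar>c\<bar> + 1) > 0" using base by (simp add: add_nonneg_pos)
  from indicator_translation_L1[OF A this] obtain d where d: "d > 0"
    "\<And>z. norm z < d \<Longrightarrow> (\<integral>\<^sup>+x. ennreal \<bar>indicator A (x + z) - indicator A x\<bar> \<partial>lborel) \<le> ennreal (e / (\<bar>c\<bar> + 1))"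
    by blast
  note [measurable] = A(1)
  show ?case
  proof (intro exI[of _ d] conjI allI impI)
    fix z :: 'a assume z: "norm z < d"
    have "(\<integral>\<^sup>+x. ennreal \<bar>indicat_real A (x + z) *\<^sub>R c - indicat_real A x *\<^sub>R c\<bar> \<partial>lborel)
       = (\<integral>\<^sup>+x. ennreal \<bar>c\<bar> * ennreal \<bar>indicator A (x + z) - indicator A x\<bar> \<partial>lborel)"
    proof (intro nn_integral_cong)
      fix x
      have "\<bar>indicat_real A (x + z) *\<^sub>R c - indicat_real A x *\<^sub>R c\<bar> = \<bar>c\<bar> * \<bar>indicator A (x + z) - indicator A x\<bar>"
        by (auto simp: indicator_def)
      then show "ennreal \<bar>indicat_real A (x + z) *\<^sub>R c - indicat_real A x *\<^sub>R c\<bar> = ennreal \<bar>c\<bar> * ennreal \<bar>indicator A (x + z) - indicator A x\<bar>"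
        by (simp only: ennreal_mult abs_ge_zero)
    qed
    also have "\<dots> = ennreal \<bar>c\<bar> * (\<integral>\<^sup>+x. ennreal \<bar>indicator A (x + z) - indicator A x\<bar> \<partial>lborel)"
      by (intro nn_integral_cmult) measurable
    also have "\<dots> \<le> ennreal \<bar>c\<bar> * ennreal (e / (\<bar>c\<bar> + 1))" by (intro mult_left_mono d z) simp
    also have "\<dots> = ennreal (\<bar>c\<bar> * (e / (\<bar>c\<bar> + 1)))" using base by (subst ennreal_mult) (auto simp: add_nonneg_pos)
    also have "\<dots> \<le> ennreal e"
    proof (rule ennreal_leI)
      have "\<bar>c\<bar> * e \<le> (\<bar>c\<bar> + 1) * e" using base by (intro mult_right_mono) auto
      then show "\<bar>c\<bar> * (e / (\<bar>c\<bar> + 1)) \<le> e" by (simp add: pos_divide_le_eq add_nonneg_pos mult.commute)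
    qed
    finally show "(\<integral>\<^sup>+x. ennreal \<bar>indicat_real A (x + z) *\<^sub>R c - indicat_real A x *\<^sub>R c\<bar> \<partial>lborel) \<le> ennreal e" .
  qed (fact d)
next
  case (add f g)
  have e2: "e / 2 > 0" using add.prems by simp
  from add.IH(1)[OF e2] obtain d1 where d1: "d1 > 0" "\<And>z. norm z < d1 \<Longrightarrow> (\<integral>\<^sup>+x. ennreal \<bar>f (x + z) - f x\<bar> \<partial>lborel) \<le> ennreal (e/2)"
    by blast
  from add.IH(2)[OF e2] obtain d2 where d2: "d2 > 0" "\<And>z. norm z < d2 \<Longrightarrow> (\<integral>\<^sup>+x. ennreal \<bar>g (x + z) - g x\<bar> \<partial>lborel) \<le> ennreal (e/2)"
    by blast
  have [measurable]: "f \<in> borel_measurable borel" "g \<in> borel_measurable borel"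
    using borel_measurable_integrable[OF add(1)] borel_measurable_integrable[OF add(2)] by auto
  show ?case
  proof (intro exI[of _ "min d1 d2"] conjI allI impI)
    fix z :: 'a assume z: "norm z < min d1 d2"
    have "(\<integral>\<^sup>+x. ennreal \<bar>f (x + z) + g (x + z) - (f x + g x)\<bar> \<partial>lborel)
       \<le> (\<integral>\<^sup>+x. ennreal \<bar>f (x + z) - f x\<bar> + ennreal \<bar>g (x + z) - g x\<bar> \<partial>lborel)"
      by (intro nn_integral_mono ennreal_le_add) auto
    also have "\<dots> = (\<integral>\<^sup>+x. ennreal \<bar>f (x + z) - f x\<bar> \<partial>lborel) + (\<integral>\<^sup>+x. ennreal \<bar>g (x + z) - g x\<bar> \<partial>lborel)"
      by (intro nn_integral_add) measurable
    also have "\<dots> \<le> ennreal (e/2) + ennreal (e/2)" using z by (intro add_mono d1 d2) auto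
    also have "\<dots> = ennreal e" using add.prems by (subst ennreal_plus[symmetric]) auto
    finally show "(\<integral>\<^sup>+x. ennreal \<bar>f (x + z) + g (x + z) - (f x + g x)\<bar> \<partial>lborel) \<le> ennreal e" .
  qed (use d1 d2 in auto)
next
  case (lim f s)
  have [measurable]: "f \<in> borel_measurable borel" "s i \<in> borel_measurable borel" for i
    using borel_measurable_integrable[OF lim(1)] borel_measurable_integrable[OF lim(4)] by auto
  have "(\<lambda>i. \<integral>\<^sup>+x. ennreal (norm (f x - s i x)) \<partial>lborel) \<longlonglongrightarrow> 0"
  proof (rule nn_integral_dominated_convergence_norm)
    show "AE x in lborel. norm (s j x) \<le> 2 * norm (f x)" for j using lim by auto
    have "integrable lborel (\<lambda>x. 2 * norm (f x))" using lim(4) by auto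
    from nn_integral_eq_integral[OF this]
    show "(\<integral>\<^sup>+x. ennreal (2 * norm (f x)) \<partial>lborel) < \<infinity>" by simp
    show "AE x in lborel. (\<lambda>i. s i x) \<longlonglongrightarrow> f x" using lim by auto
  qed auto
  from order_tendstoD(2)[OF this, of "ennreal (e/3)"] obtain i where
    i: "(\<integral>\<^sup>+x. ennreal (norm (f x - s i x)) \<partial>lborel) < ennreal (e/3)"
    using lim.prems by (auto simp: eventually_sequentially)
  have "e / 3 > 0" using lim.prems by simp
  from lim.IH[OF this, of i] obtain d where d: "d > 0"
    "\<And>z. norm z < d \<Longrightarrow> (\<integral>\<^sup>+x. ennreal \<bar>s i (x + z) - s i x\<bar> \<partial>lborel) \<le> ennreal (e/3)" by blast
  show ?case
  proof (intro exI[of _ d] conjI allI impI)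
    fix z :: 'a assume z: "norm z < d"
    have "(\<integral>\<^sup>+x. ennreal \<bar>f (x + z) - f x\<bar> \<partial>lborel)
       \<le> (\<integral>\<^sup>+x. ennreal (norm (f (x + z) - s i (x + z))) + (ennreal \<bar>s i (x + z) - s i x\<bar> + ennreal (norm (f x - s i x))) \<partial>lborel)"
    proof (rule nn_integral_mono)
      fix x
      have "ennreal \<bar>f (x + z) - f x\<bar> \<le> ennreal (norm (f (x + z) - s i (x + z))) + ennreal (\<bar>s i (x + z) - s i x\<bar> + norm (f x - s i x))"
        by (intro ennreal_le_add) auto
      then show "ennreal \<bar>f (x + z) - f x\<bar> \<le> ennreal (norm (f (x + z) - s i (x + z))) + (ennreal \<bar>s i (x + z) - s i x\<bar> + ennreal (norm (f x - s i x)))"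
        by (simp add: ennreal_plus)
    qed
    also have "\<dots> = (\<integral>\<^sup>+x. ennreal (norm (f (x + z) - s i (x + z))) \<partial>lborel) +
       ((\<integral>\<^sup>+x. ennreal \<bar>s i (x + z) - s i x\<bar> \<partial>lborel) + (\<integral>\<^sup>+x. ennreal (norm (f x - s i x)) \<partial>lborel))"
      by (subst nn_integral_add, measurable, subst nn_integral_add, measurable)
    also have "(\<integral>\<^sup>+x. ennreal (norm (f (x + z) - s i (x + z))) \<partial>lborel) = (\<integral>\<^sup>+x. ennreal (norm (f x - s i x)) \<partial>lborel)"
      by (rule nn_integral_lborel_shift) measurable
    also have "(\<integral>\<^sup>+x. ennreal (norm (f x - s i x)) \<partial>lborel) +
       ((\<integral>\<^sup>+x. ennreal \<bar>s i (x + z) - s i x\<bar> \<partial>lborel) + (\<integral>\<^sup>+x. ennreal (norm (f x - s i x)) \<partial>lborel))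
       \<le> ennreal (e/3) + (ennreal (e/3) + ennreal (e/3))"
      using i d(2)[OF z] by (intro add_mono) auto
    also have "\<dots> = ennreal e" using lim.prems by (simp flip: ennreal_plus)
    finally show "(\<integral>\<^sup>+x. ennreal \<bar>f (x + z) - f x\<bar> \<partial>lborel) \<le> ennreal e" .
  qed (fact d)
qed

section \<open>Convolution with compactly supported kernels\<close>

text \<open>The ball is enlarged by 1 and the distance kept below 1: if one point leaves the
  enlarged ball, both are outside the support.\<close>

lemma uniformly_continuous_compact_support:
  fixes \<Gamma> :: "'a::euclidean_space \<Rightarrow> 'b::real_normed_vector"
  assumes cont: "continuous_on UNIV \<Gamma>" and supp: "\<And>x. \<Gamma> x \<noteq> 0 \<Longrightarrow> norm x \<le> R" and e: "e > 0"
  shows "\<exists>d>0. \<forall>x y. norm (x - y) < d \<longrightarrow> norm (\<Gamma> x - \<Gamma> y) < e"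
proof -
  have "uniformly_continuous_on (cball 0 (R + 1)) \<Gamma>"
    by (intro compact_uniformly_continuous continuous_on_subset[OF cont]) auto
  then obtain d where d: "d > 0" "\<And>x y. x \<in> cball 0 (R + 1) \<Longrightarrow> y \<in> cball 0 (R + 1) \<Longrightarrow> dist y x < d \<Longrightarrow> dist (\<Gamma> y) (\<Gamma> x) < e"
    using e unfolding uniformly_continuous_on_def by meson
  show ?thesis
  proof (intro exI[of _ "min d 1"] conjI allI impI)
    fix x y :: 'a assume xy: "norm (x - y) < min d 1"
    show "norm (\<Gamma> x - \<Gamma> y) < e"
    proof (cases "x \<in> cball 0 (R + 1) \<and> y \<in> cball 0 (R + 1)")
      case True
      then show ?thesis using d(2)[of y x] xy by (simp add: dist_norm)
    next
      case False
      have "norm x \<le> norm y + norm (x - y)" "norm y \<le> norm x + norm (x - y)"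
        using norm_triangle_sub[of x y] norm_triangle_sub[of y x] by (auto simp: norm_minus_commute)
      then have "\<not> norm x \<le> R" "\<not> norm y \<le> R" using False xy by auto
      then have "\<Gamma> x = 0" "\<Gamma> y = 0" using supp by blast+
      then show ?thesis using e by simp
    qed
  qed (use d in auto)
qed

lemma integrable_mult_bounded:
  fixes u :: "'a::euclidean_space \<Rightarrow> real" and \<Gamma> :: "'a \<Rightarrow> 'b::euclidean_space"
  assumes u: "integrable lborel u" and G: "continuous_on UNIV \<Gamma>" and b: "\<And>x. norm (\<Gamma> x) \<le> B"
  shows "integrable lborel (\<lambda>x. u x *\<^sub>R \<Gamma> x)"
proof (rule Bochner_Integration.integrable_bound)
  have [measurable]: "u \<in> borel_measurable borel" "\<Gamma> \<in> borel_measurable borel"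
    using borel_measurable_integrable[OF u] borel_measurable_continuous_onI[OF G] by auto
  show "integrable lborel (\<lambda>x. \<bar>u x\<bar> * B)" using u by auto
  show "(\<lambda>x. u x *\<^sub>R \<Gamma> x) \<in> borel_measurable lborel" by measurable
  show "AE x in lborel. norm (u x *\<^sub>R \<Gamma> x) \<le> norm (\<bar>u x\<bar> * B)"
  proof (rule AE_I2)
    fix x
    have "0 \<le> B" using b[of x] norm_ge_zero[of "\<Gamma> x"] by linarith
    then show "norm (u x *\<^sub>R \<Gamma> x) \<le> norm (\<bar>u x\<bar> * B)" using b[of x] by (simp add: mult_left_mono abs_mult)
  qed
qed

lemma bounded_compact_support:
  fixes \<Gamma> :: "'a::euclidean_space \<Rightarrow> 'b::real_normed_vector"
  assumes cont: "continuous_on UNIV \<Gamma>" and supp: "\<And>x. \<Gamma> x \<noteq> 0 \<Longrightarrow> norm x \<le> R"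
  obtains B where "\<And>x. norm (\<Gamma> x) \<le> B" "0 \<le> B"
proof -
  have "compact (\<Gamma> ` cball 0 R)" by (intro compact_continuous_image continuous_on_subset[OF cont]) auto
  from compact_imp_bounded[OF this] obtain B where B: "\<And>x. x \<in> cball 0 R \<Longrightarrow> norm (\<Gamma> x) \<le> B"
    unfolding bounded_iff by blast
  have "norm (\<Gamma> x) \<le> max 0 B" for x
    using B[of x] supp[of x] by (cases "\<Gamma> x = 0") (auto simp: le_max_iff_disj)
  then show ?thesis using that[of "max 0 B"] by auto
qed

lemma convolution_continuous:
  fixes u :: "'a::euclidean_space \<Rightarrow> real" and \<Gamma> :: "'a \<Rightarrow> 'b::euclidean_space"
  assumes u: "integrable lborel u" and cont: "continuous_on UNIV \<Gamma>" and supp: "\<And>x. \<Gamma> x \<noteq> 0 \<Longrightarrow> norm x \<le> R"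
  shows "continuous_on UNIV (\<lambda>x. \<integral>y. u y *\<^sub>R \<Gamma> (y - x) \<partial>lborel)"
  unfolding continuous_on_iff
proof (intro ballI allI impI)
  fix x :: 'a and e :: real assume e: "e > 0"
  obtain B where B: "\<And>x. norm (\<Gamma> x) \<le> B" "0 \<le> B" using bounded_compact_support[OF cont supp] by metis
  define I where "I = (\<integral>y. \<bar>u y\<bar> \<partial>lborel)"
  have I: "I \<ge> 0" by (simp add: I_def)
  \<comment> \<open>The summand 1 keeps the tolerance meaningful when \<open>I = 0\<close>.\<close>
  obtain d where d: "d > 0" "\<And>x y. norm (x - y) < d \<Longrightarrow> norm (\<Gamma> x - \<Gamma> y) < e / (I + 1)"
    using uniformly_continuous_compact_support[OF cont supp, of "e / (I + 1)"] e I by auto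
  have cs: "continuous_on UNIV (\<lambda>y. \<Gamma> (y - x))" for x by (intro continuous_on_compose2[OF cont] continuous_intros) auto
  have int: "integrable lborel (\<lambda>y. u y *\<^sub>R \<Gamma> (y - x))" for x
    by (rule integrable_mult_bounded[OF u cs B(1)])
  show "\<exists>d>0. \<forall>x'\<in>UNIV. dist x' x < d \<longrightarrow> dist (\<integral>y. u y *\<^sub>R \<Gamma> (y - x') \<partial>lborel) (\<integral>y. u y *\<^sub>R \<Gamma> (y - x) \<partial>lborel) < e"
  proof (intro exI[of _ d] conjI ballI impI)
    fix x' assume x': "dist x' x < d"
    have "dist (\<integral>y. u y *\<^sub>R \<Gamma> (y - x') \<partial>lborel) (\<integral>y. u y *\<^sub>R \<Gamma> (y - x) \<partial>lborel)
       = norm (\<integral>y. u y *\<^sub>R \<Gamma> (y - x') - u y *\<^sub>R \<Gamma> (y - x) \<partial>lborel)"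
      using int by (simp add: dist_norm)
    also have "\<dots> \<le> (\<integral>y. norm (u y *\<^sub>R \<Gamma> (y - x') - u y *\<^sub>R \<Gamma> (y - x)) \<partial>lborel)" by (rule integral_norm_bound)
    also have "\<dots> \<le> (\<integral>y. \<bar>u y\<bar> * (e / (I + 1)) \<partial>lborel)"
    proof (rule integral_mono)
      show "integrable lborel (\<lambda>y. norm (u y *\<^sub>R \<Gamma> (y - x') - u y *\<^sub>R \<Gamma> (y - x)))" using int by auto
      show "integrable lborel (\<lambda>y. \<bar>u y\<bar> * (e / (I + 1)))" using u by auto
      fix y
      have "norm (\<Gamma> (y - x') - \<Gamma> (y - x)) \<le> e / (I + 1)"
        using d(2)[of "y - x'" "y - x"] x' by (simp add: dist_norm norm_minus_commute)
      then have "\<bar>u y\<bar> * norm (\<Gamma> (y - x') - \<Gamma> (y - x)) \<le> \<bar>u y\<bar> * (e / (I + 1))" by (rule mult_left_mono) simp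
      then show "norm (u y *\<^sub>R \<Gamma> (y - x') - u y *\<^sub>R \<Gamma> (y - x)) \<le> \<bar>u y\<bar> * (e / (I + 1))"
        by (simp only: scaleR_diff_right[symmetric] norm_scaleR)
    qed
    also have "\<dots> = I * (e / (I + 1))" by (simp add: I_def)
    also have "\<dots> < e" using e I by (simp add: field_simps)
    finally show "dist (\<integral>y. u y *\<^sub>R \<Gamma> (y - x') \<partial>lborel) (\<integral>y. u y *\<^sub>R \<Gamma> (y - x) \<partial>lborel) < e" .
  qed (fact d)
qed

text \<open>The derivative falls on the kernel, and its sign comes from evaluating the kernel at
  \<open>y - x\<close>. Uniform continuity of \<open>\<Gamma>\<close> makes the remainder of the
  kernel uniform in the integration variable, so it can be integrated against an integrable
  \<open>u\<close>.\<close>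

lemma convolution_has_derivative:
  fixes u \<phi> :: "'a::euclidean_space \<Rightarrow> real" and \<Gamma> :: "'a \<Rightarrow> 'a"
  assumes u: "integrable lborel u" and d\<phi>: "\<And>z. (\<phi> has_derivative (\<lambda>v. \<Gamma> z \<bullet> v)) (at z)"
    and cont: "continuous_on UNIV \<Gamma>" and supp: "\<And>x. \<Gamma> x \<noteq> 0 \<or> \<phi> x \<noteq> 0 \<Longrightarrow> norm x \<le> R"
  shows "((\<lambda>x. \<integral>y. u y * \<phi> (y - x) \<partial>lborel) has_derivative (\<lambda>v. (- (\<integral>y. u y *\<^sub>R \<Gamma> (y - x) \<partial>lborel)) \<bullet> v)) (at x)"
  unfolding has_derivative_at_alt
proof (intro conjI allI impI)
  show "bounded_linear (\<lambda>v. (- (\<integral>y. u y *\<^sub>R \<Gamma> (y - x) \<partial>lborel)) \<bullet> v)" by (rule bounded_linear_inner_right)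
  fix e :: real assume e: "e > 0"
  have suppG: "\<And>x. \<Gamma> x \<noteq> 0 \<Longrightarrow> norm x \<le> R" and supp\<phi>: "\<And>x. \<phi> x \<noteq> 0 \<Longrightarrow> norm x \<le> R" using supp by blast+
  have c\<phi>: "continuous_on UNIV \<phi>"
    using d\<phi> by (meson has_derivative_continuous continuous_at_imp_continuous_on)
  obtain B where B: "\<And>x. norm (\<Gamma> x) \<le> B" "0 \<le> B" using bounded_compact_support[OF cont suppG] by metis
  obtain B' where B': "\<And>x. norm (\<phi> x) \<le> B'" "0 \<le> B'" using bounded_compact_support[OF c\<phi> supp\<phi>] by metis
  define I where "I = (\<integral>y. \<bar>u y\<bar> \<partial>lborel)"
  have I: "I \<ge> 0" by (simp add: I_def)
  obtain d where d: "d > 0" "\<And>x y. norm (x - y) < d \<Longrightarrow> norm (\<Gamma> x - \<Gamma> y) < e / (I + 1)"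
    using uniformly_continuous_compact_support[OF cont suppG, of "e / (I + 1)"] e I by auto
  have cs: "continuous_on UNIV (\<lambda>y. \<Gamma> (y - x))" for x by (intro continuous_on_compose2[OF cont] continuous_intros) auto
  have cs': "continuous_on UNIV (\<lambda>y. \<phi> (y - x))" for x by (intro continuous_on_compose2[OF c\<phi>] continuous_intros) auto
  have int: "integrable lborel (\<lambda>y. u y *\<^sub>R \<Gamma> (y - x))" for x
    by (rule integrable_mult_bounded[OF u cs B(1)])
  have int': "integrable lborel (\<lambda>y. u y * \<phi> (y - x))" for x
    using integrable_mult_bounded[OF u cs' B'(1)] by simp
  have rem: "\<bar>\<phi> (z - h) - \<phi> z + \<Gamma> z \<bullet> h\<bar> \<le> e / (I + 1) * norm h" if h: "norm h < d" for z h
  proof -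
    have der: "((\<lambda>s. \<phi> (z - s *\<^sub>R h) + s * (\<Gamma> z \<bullet> h)) has_real_derivative (- (\<Gamma> (z - s *\<^sub>R h) \<bullet> h) + \<Gamma> z \<bullet> h)) (at s)" for s
    proof -
      have "((\<lambda>s. z - s *\<^sub>R h) has_derivative (\<lambda>t. - (t *\<^sub>R h))) (at s)" by (auto intro!: derivative_eq_intros)
      from diff_chain_at[OF this d\<phi>]
      have "((\<lambda>s. \<phi> (z - s *\<^sub>R h)) has_derivative (\<lambda>t. \<Gamma> (z - s *\<^sub>R h) \<bullet> - (t *\<^sub>R h))) (at s)" by (simp add: o_def)
      moreover have "(\<lambda>t. \<Gamma> (z - s *\<^sub>R h) \<bullet> - (t *\<^sub>R h)) = (*) (- (\<Gamma> (z - s *\<^sub>R h) \<bullet> h))"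
        by (auto simp: fun_eq_iff)
      ultimately have "((\<lambda>s. \<phi> (z - s *\<^sub>R h)) has_real_derivative (- (\<Gamma> (z - s *\<^sub>R h) \<bullet> h))) (at s)"
        by (simp add: has_field_derivative_def)
      then show ?thesis by (auto intro!: derivative_eq_intros)
    qed
    obtain s where s: "0 < s" "s < 1" "(\<phi> (z - 1 *\<^sub>R h) + 1 * (\<Gamma> z \<bullet> h)) - (\<phi> (z - 0 *\<^sub>R h) + 0 * (\<Gamma> z \<bullet> h))
         = (1 - 0) * (- (\<Gamma> (z - s *\<^sub>R h) \<bullet> h) + \<Gamma> z \<bullet> h)"
      using MVT2[of 0 1 "\<lambda>s. \<phi> (z - s *\<^sub>R h) + s * (\<Gamma> z \<bullet> h)" "\<lambda>s. - (\<Gamma> (z - s *\<^sub>R h) \<bullet> h) + \<Gamma> z \<bullet> h"] der by auto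
    have "norm (s *\<^sub>R h) \<le> norm h" using s(1,2) mult_right_mono[of s 1 "norm h"] by simp
    then have G: "norm (\<Gamma> z - \<Gamma> (z - s *\<^sub>R h)) \<le> e / (I + 1)" using d(2)[of z "z - s *\<^sub>R h"] h by simp
    have "\<phi> (z - h) - \<phi> z + \<Gamma> z \<bullet> h = (\<Gamma> z - \<Gamma> (z - s *\<^sub>R h)) \<bullet> h" using s(3) by (simp add: inner_diff_left)
    then have "\<bar>\<phi> (z - h) - \<phi> z + \<Gamma> z \<bullet> h\<bar> \<le> norm (\<Gamma> z - \<Gamma> (z - s *\<^sub>R h)) * norm h"
      using Cauchy_Schwarz_ineq2 by metis
    also have "\<dots> \<le> e / (I + 1) * norm h" using G by (intro mult_right_mono) auto
    finally show ?thesis .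
  qed
  show "\<exists>d>0. \<forall>y. norm (y - x) < d \<longrightarrow> norm ((\<integral>z. u z * \<phi> (z - y) \<partial>lborel) - (\<integral>z. u z * \<phi> (z - x) \<partial>lborel)
      - (- (\<integral>z. u z *\<^sub>R \<Gamma> (z - x) \<partial>lborel)) \<bullet> (y - x)) \<le> e * norm (y - x)"
  proof (intro exI[of _ d] conjI allI impI)
    fix y assume y: "norm (y - x) < d"
    let ?h = "y - x"
    have inn: "integrable lborel (\<lambda>z. (u z *\<^sub>R \<Gamma> (z - x)) \<bullet> ?h)" using int by (rule integrable_inner_left)
    have "(\<integral>z. u z * \<phi> (z - y) \<partial>lborel) - (\<integral>z. u z * \<phi> (z - x) \<partial>lborel) - (- (\<integral>z. u z *\<^sub>R \<Gamma> (z - x) \<partial>lborel)) \<bullet> ?h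
      = (\<integral>z. u z * \<phi> (z - y) \<partial>lborel) - (\<integral>z. u z * \<phi> (z - x) \<partial>lborel) + (\<integral>z. (u z *\<^sub>R \<Gamma> (z - x)) \<bullet> ?h \<partial>lborel)"
      using integral_inner_left[OF int, of x ?h] by (simp del: inner_scaleR_left)
    also have "\<dots> = (\<integral>z. u z * \<phi> (z - y) - u z * \<phi> (z - x) + (u z *\<^sub>R \<Gamma> (z - x)) \<bullet> ?h \<partial>lborel)"
      using int' inn by (simp del: inner_scaleR_left)
    finally have eq: "(\<integral>z. u z * \<phi> (z - y) \<partial>lborel) - (\<integral>z. u z * \<phi> (z - x) \<partial>lborel) - (- (\<integral>z. u z *\<^sub>R \<Gamma> (z - x) \<partial>lborel)) \<bullet> ?h
      = (\<integral>z. u z * \<phi> (z - y) - u z * \<phi> (z - x) + (u z *\<^sub>R \<Gamma> (z - x)) \<bullet> ?h \<partial>lborel)" .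
    have "norm (\<integral>z. u z * \<phi> (z - y) - u z * \<phi> (z - x) + (u z *\<^sub>R \<Gamma> (z - x)) \<bullet> ?h \<partial>lborel)
       \<le> (\<integral>z. norm (u z * \<phi> (z - y) - u z * \<phi> (z - x) + (u z *\<^sub>R \<Gamma> (z - x)) \<bullet> ?h) \<partial>lborel)"
      by (rule integral_norm_bound)
    also have "\<dots> \<le> (\<integral>z. \<bar>u z\<bar> * (e / (I + 1) * norm ?h) \<partial>lborel)"
    proof (rule integral_mono)
      show "integrable lborel (\<lambda>z. norm (u z * \<phi> (z - y) - u z * \<phi> (z - x) + (u z *\<^sub>R \<Gamma> (z - x)) \<bullet> ?h))"
        using int' inn by (intro integrable_norm Bochner_Integration.integrable_add Bochner_Integration.integrable_diff)
      show "integrable lborel (\<lambda>z. \<bar>u z\<bar> * (e / (I + 1) * norm ?h))" using u by auto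
      fix z
      have "u z * \<phi> (z - y) - u z * \<phi> (z - x) + (u z *\<^sub>R \<Gamma> (z - x)) \<bullet> ?h = u z * (\<phi> ((z - x) - ?h) - \<phi> (z - x) + \<Gamma> (z - x) \<bullet> ?h)"
        by (simp add: algebra_simps)
      then show "norm (u z * \<phi> (z - y) - u z * \<phi> (z - x) + (u z *\<^sub>R \<Gamma> (z - x)) \<bullet> ?h) \<le> \<bar>u z\<bar> * (e / (I + 1) * norm ?h)"
        using rem[OF y, of "z - x"] by (simp only: real_norm_def abs_mult mult_left_mono abs_ge_zero)
    qed
    also have "\<dots> = (I / (I + 1)) * (e * norm ?h)" by (simp add: I_def)
    also have "\<dots> \<le> 1 * (e * norm ?h)" using e I by (intro mult_right_mono) auto
    finally show "norm ((\<integral>z. u z * \<phi> (z - y) \<partial>lborel) - (\<integral>z. u z * \<phi> (z - x) \<partial>lborel)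
      - (- (\<integral>z. u z *\<^sub>R \<Gamma> (z - x) \<partial>lborel)) \<bullet> (y - x)) \<le> e * norm (y - x)" using eq by simp
  qed (fact d)
qed

declare bump_nonneg [simp]

section \<open>Mollification\<close>

text \<open>With the centre fixed at 0 the value refers to the space through its type alone, hence
  the \<open>itself\<close> argument.\<close>

definition bump_mass :: "real \<Rightarrow> 'a::euclidean_space itself \<Rightarrow> real" where
  "bump_mass \<epsilon> _ = (\<integral>y. bump 0 \<epsilon> (0::'a) y \<partial>lborel)"

definition mollify :: "real \<Rightarrow> ('a::euclidean_space \<Rightarrow> real) \<Rightarrow> 'a \<Rightarrow> real" where
  "mollify \<epsilon> u x = (\<integral>y. u y * bump 0 \<epsilon> x y \<partial>lborel) / bump_mass \<epsilon> TYPE('a)"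

lemma bump_shift: "bump m \<epsilon> x y = bump m \<epsilon> 0 (y - x)" "bump_grad \<epsilon> x y = bump_grad \<epsilon> 0 (y - x)"
  by (auto simp: bump_def bump_grad_def)

lemma bump_support_norm:
  assumes "\<epsilon> > 0" "bump m \<epsilon> 0 x \<noteq> 0 \<or> bump_grad \<epsilon> 0 x \<noteq> 0" shows "norm x \<le> \<epsilon>"
proof -
  have "bump m \<epsilon> 0 x \<noteq> 0 \<or> bump 2 \<epsilon> 0 x \<noteq> 0" using assms(2) by (auto simp: bump_grad_def)
  then show ?thesis using bump_support[of m \<epsilon> 0 x] bump_support[of 2 \<epsilon> 0 x] assms(1) by auto
qed

lemma integrable_continuous_compact_support:
  fixes g :: "'a::euclidean_space \<Rightarrow> 'b::euclidean_space"
  assumes "continuous_on UNIV g" "\<And>x. g x \<noteq> 0 \<Longrightarrow> x \<in> K" "compact K"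
  shows "integrable lborel g"
proof -
  have "integrable lborel (\<lambda>x. indicator K x *\<^sub>R g x)"
    using borel_integrable_compact[OF assms(3)] assms(1) continuous_on_subset by blast
  also have "(\<lambda>x. indicator K x *\<^sub>R g x) = g" using assms(2) by (auto simp: indicator_def fun_eq_iff)
  finally show ?thesis .
qed

lemma integrable_bump: "\<epsilon> > 0 \<Longrightarrow> integrable lborel (bump m \<epsilon> x)"
  by (rule integrable_continuous_compact_support[OF continuous_bump _ compact_cball[of x \<epsilon>]])
     (use bump_support in fastforce)

lemma bump_mass_pos: "\<epsilon> > 0 \<Longrightarrow> bump_mass \<epsilon> TYPE('a::euclidean_space) > 0"
proof -
  assume e: "\<epsilon> > 0"
  have "bump_mass \<epsilon> TYPE('a) \<ge> 0" unfolding bump_mass_def by simp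
  moreover have "bump_mass \<epsilon> TYPE('a) \<noteq> 0"
  proof
    assume "bump_mass \<epsilon> TYPE('a) = 0"
    then have "AE y in lborel. bump 0 \<epsilon> (0::'a) y = 0"
      unfolding bump_mass_def using integrable_bump[OF e, of 0 "0::'a"] bump_nonneg
      by (subst (asm) integral_nonneg_eq_0_iff_AE) auto
    then have "AE y in lborel. y \<notin> ball (0::'a) \<epsilon>"
    proof (rule eventually_mono)
      fix y :: 'a assume "bump 0 \<epsilon> 0 y = 0"
      then have "\<epsilon>\<^sup>2 \<le> (norm y)\<^sup>2" by (auto simp: bump_def flat_exp_def power2_norm_eq_inner split: if_splits)
      then show "y \<notin> ball 0 \<epsilon>" using e power2_le_imp_le[of \<epsilon> "norm y"] by auto
    qed
    then have "ball (0::'a) \<epsilon> \<in> null_sets lborel" by (subst AE_iff_null_sets) auto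
    then have "emeasure lborel (ball (0::'a) \<epsilon>) = 0" by auto
    moreover have "emeasure lborel (ball (0::'a) \<epsilon>) \<noteq> 0"
      using e open_not_negligible[of "ball (0::'a) \<epsilon>"] by (auto simp: negligible_iff_emeasure0)
    ultimately show False by simp
  qed
  ultimately show ?thesis by simp
qed

lemma nn_integral_bump:
  assumes "\<epsilon> > 0"
  shows "(\<integral>\<^sup>+y. ennreal (bump 0 \<epsilon> (x::'a::euclidean_space) y) \<partial>lborel) = ennreal (bump_mass \<epsilon> TYPE('a))"
    and "(\<integral>\<^sup>+x. ennreal (bump 0 \<epsilon> (x::'a::euclidean_space) y) \<partial>lborel) = ennreal (bump_mass \<epsilon> TYPE('a))"
proof -
  have [measurable]: "bump 0 \<epsilon> (0::'a) \<in> borel_measurable borel"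
    using continuous_bump by (rule borel_measurable_continuous_onI)
  have 0: "(\<integral>\<^sup>+y. ennreal (bump 0 \<epsilon> (0::'a) y) \<partial>lborel) = ennreal (bump_mass \<epsilon> TYPE('a))"
    unfolding bump_mass_def using integrable_bump[OF assms] bump_nonneg by (intro nn_integral_eq_integral) auto
  show "(\<integral>\<^sup>+y. ennreal (bump 0 \<epsilon> x y) \<partial>lborel) = ennreal (bump_mass \<epsilon> TYPE('a))"
    using nn_integral_lborel_shift[of "\<lambda>y. ennreal (bump 0 \<epsilon> (0::'a) y)" "-x"] 0 by (simp add: bump_shift(1)[of 0 \<epsilon> x])
  have "bump 0 \<epsilon> x y = bump 0 \<epsilon> 0 (y - x)" for x :: 'a by (rule bump_shift)
  then show "(\<integral>\<^sup>+x. ennreal (bump 0 \<epsilon> x y) \<partial>lborel) = ennreal (bump_mass \<epsilon> TYPE('a))"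
    using nn_integral_lborel_reflect[of "\<lambda>y. ennreal (bump 0 \<epsilon> (0::'a) y)" y] 0 by simp
qed

lemma measurable_bump2 [measurable]:
  "(\<lambda>(x, y). bump 0 \<epsilon> (x::'a::euclidean_space) y) \<in> borel_measurable (borel \<Otimes>\<^sub>M borel)"
proof -
  have [measurable]: "bump 0 \<epsilon> (0::'a) \<in> borel_measurable borel"
    using continuous_bump by (rule borel_measurable_continuous_onI)
  have "(\<lambda>(x, y). bump 0 \<epsilon> (0::'a) (y - x)) \<in> borel_measurable (borel \<Otimes>\<^sub>M borel)" by measurable
  then show ?thesis by (simp add: bump_shift(1)[symmetric])
qed

lemma integrable_mult_bump:
  assumes "integrable lborel u" "\<epsilon> > 0"
  shows "integrable lborel (\<lambda>y. u y * bump 0 \<epsilon> (x::'a::euclidean_space) y)"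
proof -
  obtain B where B: "\<And>y. norm (bump 0 \<epsilon> (0::'a) y) \<le> B"
    using bounded_compact_support[OF continuous_bump[of 0 \<epsilon> 0], of \<epsilon>] bump_support_norm[OF assms(2)] by metis
  then have "norm (bump 0 \<epsilon> x y) \<le> B" for y using bump_shift(1)[of 0 \<epsilon> x y] by simp
  from integrable_mult_bounded[OF assms(1) continuous_bump this] show ?thesis by simp
qed

text \<open>The error at \<open>x\<close> is at most the average of \<open>|u (x + z) - u x|\<close>
  over shifts \<open>z\<close> shorter than \<open>\<epsilon>\<close>; by Fubini its integral is at
  most the same average of the translation errors.\<close>

lemma mollify_L1:
  fixes u :: "'a::euclidean_space \<Rightarrow> real"
  assumes u: "integrable lborel u" and e: "e > 0"
  shows "\<exists>d>0. \<forall>\<epsilon>. 0 < \<epsilon> \<longrightarrow> \<epsilon> < d \<longrightarrow> (\<integral>\<^sup>+x. ennreal \<bar>mollify \<epsilon> u x - u x\<bar> \<partial>lborel) \<le> ennreal e"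
proof -
  obtain d where d: "d > 0" "\<And>z. norm z < d \<Longrightarrow> (\<integral>\<^sup>+x. ennreal \<bar>u (x + z) - u x\<bar> \<partial>lborel) \<le> ennreal e"
    using translation_L1_continuous[OF u e] by blast
  have [measurable]: "u \<in> borel_measurable borel" using borel_measurable_integrable[OF u] by simp
  show ?thesis
  proof (intro exI[of _ d] conjI allI impI)
    fix \<epsilon> :: real assume \<epsilon>: "0 < \<epsilon>" "\<epsilon> < d"
    define c where "c = bump_mass \<epsilon> TYPE('a)"
    have c: "c > 0" unfolding c_def by (rule bump_mass_pos[OF \<epsilon>(1)])
    have [measurable]: "bump 0 \<epsilon> a \<in> borel_measurable borel" for a :: 'a
      using continuous_bump by (rule borel_measurable_continuous_onI)
    have pt: "ennreal \<bar>mollify \<epsilon> u x - u x\<bar> \<le> (\<integral>\<^sup>+z. ennreal (bump 0 \<epsilon> 0 z / c) * ennreal \<bar>u (x + z) - u x\<bar> \<partial>lborel)" for x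
    proof -
      have mass: "(\<integral>y. bump 0 \<epsilon> x y \<partial>lborel) = c"
        using nn_integral_bump(1)[OF \<epsilon>(1), of x] integrable_bump[OF \<epsilon>(1), of 0 x] bump_nonneg[of 0 \<epsilon> x] c
        by (subst (asm) nn_integral_eq_integral) (auto simp: c_def)
      have i1: "integrable lborel (\<lambda>y. u y * bump 0 \<epsilon> x y)" "integrable lborel (\<lambda>y. u x * bump 0 \<epsilon> x y)"
        using integrable_mult_bump[OF u \<epsilon>(1)] integrable_bump[OF \<epsilon>(1)] by auto
      have i2: "integrable lborel (\<lambda>y. (u y - u x) * bump 0 \<epsilon> x y)"
        using Bochner_Integration.integrable_diff[OF i1] by (simp add: left_diff_distrib)
      have "(\<integral>y. (u y - u x) * bump 0 \<epsilon> x y \<partial>lborel) = (\<integral>y. u y * bump 0 \<epsilon> x y \<partial>lborel) - u x * c"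
        using Bochner_Integration.integral_diff[OF i1] mass by (simp add: left_diff_distrib)
      then have "mollify \<epsilon> u x - u x = (\<integral>y. (u y - u x) * bump 0 \<epsilon> x y \<partial>lborel) / c"
        using c by (simp add: mollify_def c_def[symmetric] field_simps)
      also have "\<dots> = (\<integral>y. (u y - u x) * bump 0 \<epsilon> x y / c \<partial>lborel)" by simp
      finally have "\<bar>mollify \<epsilon> u x - u x\<bar> \<le> (\<integral>y. \<bar>(u y - u x) * bump 0 \<epsilon> x y / c\<bar> \<partial>lborel)"
        by (simp only: integral_abs_bound)
      then have "ennreal \<bar>mollify \<epsilon> u x - u x\<bar> \<le> ennreal (\<integral>y. \<bar>(u y - u x) * bump 0 \<epsilon> x y / c\<bar> \<partial>lborel)"
        by (rule ennreal_leI)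
      also have "\<dots> = (\<integral>\<^sup>+y. ennreal \<bar>(u y - u x) * bump 0 \<epsilon> x y / c\<bar> \<partial>lborel)"
        using i2 by (intro nn_integral_eq_integral[symmetric]) auto
      also have "\<dots> = (\<integral>\<^sup>+z. ennreal \<bar>(u (z + x) - u x) * bump 0 \<epsilon> x (z + x) / c\<bar> \<partial>lborel)"
        by (rule nn_integral_lborel_shift[symmetric]) measurable
      also have "\<dots> = (\<integral>\<^sup>+z. ennreal (bump 0 \<epsilon> 0 z / c) * ennreal \<bar>u (x + z) - u x\<bar> \<partial>lborel)"
      proof (rule nn_integral_cong)
        fix z
        have "\<bar>(u (z + x) - u x) * bump 0 \<epsilon> x (z + x) / c\<bar> = (bump 0 \<epsilon> 0 z / c) * \<bar>u (x + z) - u x\<bar>"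
          using c bump_nonneg[of 0 \<epsilon> 0 z] by (simp add: abs_mult bump_shift(1)[of 0 \<epsilon> x] add.commute)
        then show "ennreal \<bar>(u (z + x) - u x) * bump 0 \<epsilon> x (z + x) / c\<bar> = ennreal (bump 0 \<epsilon> 0 z / c) * ennreal \<bar>u (x + z) - u x\<bar>"
          using c by (simp flip: ennreal_mult)
      qed
      finally show ?thesis .
    qed
    have "(\<integral>\<^sup>+x. ennreal \<bar>mollify \<epsilon> u x - u x\<bar> \<partial>lborel)
       \<le> (\<integral>\<^sup>+x. (\<integral>\<^sup>+z. ennreal (bump 0 \<epsilon> 0 z / c) * ennreal \<bar>u (x + z) - u x\<bar> \<partial>lborel) \<partial>lborel)"
      by (intro nn_integral_mono pt)
    also have "\<dots> = (\<integral>\<^sup>+z. (\<integral>\<^sup>+x. ennreal (bump 0 \<epsilon> 0 z / c) * ennreal \<bar>u (x + z) - u x\<bar> \<partial>lborel) \<partial>lborel)"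
      by (rule lborel_pair.Fubini') measurable
    also have "\<dots> \<le> (\<integral>\<^sup>+z. ennreal (bump 0 \<epsilon> (0::'a) z) * ennreal (e / c) \<partial>lborel)"
    proof (rule nn_integral_mono)
      fix z :: 'a
      have "(\<integral>\<^sup>+x. ennreal (bump 0 \<epsilon> 0 z / c) * ennreal \<bar>u (x + z) - u x\<bar> \<partial>lborel)
         = ennreal (bump 0 \<epsilon> 0 z / c) * (\<integral>\<^sup>+x. ennreal \<bar>u (x + z) - u x\<bar> \<partial>lborel)"
        by (rule nn_integral_cmult) measurable
      also have "\<dots> \<le> ennreal (bump 0 \<epsilon> 0 z / c) * ennreal e"
      proof (cases "bump 0 \<epsilon> 0 z = 0")
        case False
        then have "norm z < d" using bump_support[OF False \<epsilon>(1)] \<epsilon>(2) by simp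
        then show ?thesis by (intro mult_left_mono d) auto
      qed simp
      also have "\<dots> = ennreal (bump 0 \<epsilon> 0 z) * ennreal (e / c)"
        using c e bump_nonneg[of 0 \<epsilon> 0 z] by (simp flip: ennreal_mult)
      finally show "(\<integral>\<^sup>+x. ennreal (bump 0 \<epsilon> 0 z / c) * ennreal \<bar>u (x + z) - u x\<bar> \<partial>lborel)
        \<le> ennreal (bump 0 \<epsilon> 0 z) * ennreal (e / c)" .
    qed
    also have "\<dots> = ennreal c * ennreal (e / c)"
      using nn_integral_bump(1)[OF \<epsilon>(1), of "0::'a"] by (subst nn_integral_multc) (auto simp: c_def)
    also have "\<dots> = ennreal e" using c e by (simp flip: ennreal_mult)
    finally show "(\<integral>\<^sup>+x. ennreal \<bar>mollify \<epsilon> u x - u x\<bar> \<partial>lborel) \<le> ennreal e" .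
  qed (fact d)
qed

lemma mollify_has_derivative:
  fixes u :: "'a::euclidean_space \<Rightarrow> real"
  assumes u: "integrable lborel u" and \<epsilon>: "\<epsilon> > 0"
  defines "Gr \<equiv> \<lambda>x. (- 1 / bump_mass \<epsilon> TYPE('a)) *\<^sub>R (\<integral>y. u y *\<^sub>R bump_grad \<epsilon> x y \<partial>lborel)"
  shows "(mollify \<epsilon> u has_derivative (\<lambda>v. Gr x \<bullet> v)) (at x)" and "continuous_on UNIV Gr"
proof -
  have d: "((\<lambda>x. \<integral>y. u y * bump 0 \<epsilon> 0 (y - x) \<partial>lborel) has_derivative (\<lambda>v. (- (\<integral>y. u y *\<^sub>R bump_grad \<epsilon> 0 (y - x) \<partial>lborel)) \<bullet> v)) (at x)"
    by (rule convolution_has_derivative[OF u bump_grad_derivative continuous_bump_grad, where R = \<epsilon>])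
       (use bump_support_norm[OF \<epsilon>] in blast)
  have "((\<lambda>x. (\<integral>y. u y * bump 0 \<epsilon> 0 (y - x) \<partial>lborel) * (1 / bump_mass \<epsilon> TYPE('a))) has_derivative
      (\<lambda>v. ((- (\<integral>y. u y *\<^sub>R bump_grad \<epsilon> 0 (y - x) \<partial>lborel)) \<bullet> v) * (1 / bump_mass \<epsilon> TYPE('a)))) (at x)"
    by (rule has_derivative_mult_left[OF d])
  moreover have "(\<lambda>x. (\<integral>y. u y * bump 0 \<epsilon> 0 (y - x) \<partial>lborel) * (1 / bump_mass \<epsilon> TYPE('a))) = mollify \<epsilon> u"
    by (auto simp: mollify_def fun_eq_iff bump_shift(1)[of 0 \<epsilon> "_::'a", symmetric])
  moreover have "((- (\<integral>y. u y *\<^sub>R bump_grad \<epsilon> 0 (y - x) \<partial>lborel)) \<bullet> v) * (1 / bump_mass \<epsilon> TYPE('a)) = Gr x \<bullet> v" for v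
    by (simp add: Gr_def bump_shift(2)[of \<epsilon> x])
  ultimately show "(mollify \<epsilon> u has_derivative (\<lambda>v. Gr x \<bullet> v)) (at x)" by simp
  have "continuous_on UNIV (\<lambda>x. \<integral>y. u y *\<^sub>R bump_grad \<epsilon> 0 (y - x) \<partial>lborel)"
    by (rule convolution_continuous[OF u continuous_bump_grad, where R = \<epsilon>]) (use bump_support_norm[OF \<epsilon>] in blast)
  moreover have "Gr = (\<lambda>x. (- 1 / bump_mass \<epsilon> TYPE('a)) *\<^sub>R (\<integral>y. u y *\<^sub>R bump_grad \<epsilon> 0 (y - x) \<partial>lborel))"
    by (simp add: Gr_def fun_eq_iff flip: bump_shift(2))
  ultimately show "continuous_on UNIV Gr" by (simp only:) (intro continuous_intros)
qed

text \<open>The kernel is a probability density in each of its two variables. Splitting it into two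
  square roots, Cauchy-Schwarz uses its mass in \<open>y\<close>; after exchanging the integrals its
  mass in \<open>x\<close> is used. The constant is exactly 1, as the sharp Poincare constant
  requires.\<close>

lemma mollify_L2_contraction:
  fixes w :: "'a::euclidean_space \<Rightarrow> real"
  assumes [measurable]: "w \<in> borel_measurable borel" and nn: "\<And>x. 0 \<le> w x" and \<epsilon>: "\<epsilon> > 0"
  shows "(\<integral>\<^sup>+x. (\<integral>\<^sup>+y. ennreal (w y * (bump 0 \<epsilon> x y / bump_mass \<epsilon> TYPE('a))) \<partial>lborel)\<^sup>2 \<partial>lborel) \<le> (\<integral>\<^sup>+y. ennreal ((w y)\<^sup>2) \<partial>lborel)"
proof -
  define c where "c = bump_mass \<epsilon> TYPE('a)"
  have c: "c > 0" unfolding c_def by (rule bump_mass_pos[OF \<epsilon>])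
  have [measurable]: "bump 0 \<epsilon> a \<in> borel_measurable borel" for a :: 'a
    using continuous_bump by (rule borel_measurable_continuous_onI)
  define k where "k x y = bump 0 \<epsilon> x y / c" for x y :: 'a
  have k: "0 \<le> k x y" for x y using c by (simp add: k_def)
  have km [measurable]: "(\<lambda>(x, y). k x y) \<in> borel_measurable (borel \<Otimes>\<^sub>M borel)" unfolding k_def by measurable
  have [measurable]: "k x \<in> borel_measurable borel" for x unfolding k_def[abs_def] by measurable
  have k1: "(\<integral>\<^sup>+y. ennreal (k x y) \<partial>lborel) = 1" for x
  proof -
    have "(\<integral>\<^sup>+y. ennreal (k x y) \<partial>lborel) = (\<integral>\<^sup>+y. ennreal (1/c) * ennreal (bump 0 \<epsilon> x y) \<partial>lborel)"
      using c by (intro nn_integral_cong) (simp add: k_def flip: ennreal_mult)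
    also have "\<dots> = ennreal (1/c) * ennreal c"
      by (subst nn_integral_cmult) (auto simp: nn_integral_bump(1)[OF \<epsilon>] c_def)
    also have "\<dots> = 1" using c by (simp flip: ennreal_mult)
    finally show ?thesis .
  qed
  have k2: "(\<integral>\<^sup>+x. ennreal (k x y) \<partial>lborel) = 1" for y
  proof -
    have [measurable]: "(\<lambda>x. bump 0 \<epsilon> x y) \<in> borel_measurable borel"
      using measurable_bump2[of \<epsilon>, where 'a='a] by measurable
    have "(\<integral>\<^sup>+x. ennreal (k x y) \<partial>lborel) = (\<integral>\<^sup>+x. ennreal (1/c) * ennreal (bump 0 \<epsilon> x y) \<partial>lborel)"
      using c by (intro nn_integral_cong) (simp add: k_def flip: ennreal_mult)
    also have "\<dots> = ennreal (1/c) * ennreal c"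
      by (subst nn_integral_cmult) (auto simp: nn_integral_bump(2)[OF \<epsilon>] c_def)
    also have "\<dots> = 1" using c by (simp flip: ennreal_mult)
    finally show ?thesis .
  qed
  have pt: "(\<integral>\<^sup>+y. ennreal (w y * k x y) \<partial>lborel)\<^sup>2 \<le> (\<integral>\<^sup>+y. ennreal ((w y)\<^sup>2) * ennreal (k x y) \<partial>lborel)" for x
  proof -
    have "(\<integral>\<^sup>+y. ennreal (w y * k x y) \<partial>lborel) = (\<integral>\<^sup>+y. ennreal (w y * sqrt (k x y)) * ennreal (sqrt (k x y)) \<partial>lborel)"
      using nn k by (intro nn_integral_cong) (simp flip: ennreal_mult add: mult.assoc)
    then have "(\<integral>\<^sup>+y. ennreal (w y * k x y) \<partial>lborel)\<^sup>2
       \<le> (\<integral>\<^sup>+y. (ennreal (w y * sqrt (k x y)))^2 \<partial>lborel) * (\<integral>\<^sup>+y. (ennreal (sqrt (k x y)))^2 \<partial>lborel)"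
      by (simp only:) (rule Cauchy_Schwarz_nn_integral; measurable)
    also have "(\<integral>\<^sup>+y. (ennreal (sqrt (k x y)))^2 \<partial>lborel) = 1"
      using k k1[of x] by (simp add: ennreal_power)
    also have "(\<integral>\<^sup>+y. (ennreal (w y * sqrt (k x y)))^2 \<partial>lborel) = (\<integral>\<^sup>+y. ennreal ((w y)\<^sup>2) * ennreal (k x y) \<partial>lborel)"
      using nn k by (intro nn_integral_cong) (simp add: ennreal_power power_mult_distrib flip: ennreal_mult)
    finally show ?thesis by simp
  qed
  have "(\<integral>\<^sup>+x. (\<integral>\<^sup>+y. ennreal (w y * k x y) \<partial>lborel)\<^sup>2 \<partial>lborel)
     \<le> (\<integral>\<^sup>+x. (\<integral>\<^sup>+y. ennreal ((w y)\<^sup>2) * ennreal (k x y) \<partial>lborel) \<partial>lborel)"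
    by (intro nn_integral_mono pt)
  also have "\<dots> = (\<integral>\<^sup>+y. (\<integral>\<^sup>+x. ennreal ((w y)\<^sup>2) * ennreal (k x y) \<partial>lborel) \<partial>lborel)"
    by (rule lborel_pair.Fubini') measurable
  also have "\<dots> = (\<integral>\<^sup>+y. ennreal ((w y)\<^sup>2) \<partial>lborel)"
  proof (rule nn_integral_cong)
    fix y
    have [measurable]: "(\<lambda>x. k x y) \<in> borel_measurable borel" using km by measurable
    show "(\<integral>\<^sup>+x. ennreal ((w y)\<^sup>2) * ennreal (k x y) \<partial>lborel) = ennreal ((w y)\<^sup>2)"
      by (subst nn_integral_cmult) (auto simp: k2)
  qed
  finally show ?thesis by (simp add: k_def c_def)
qed

section \<open>The Poincare inequality for weak gradients\<close>

text \<open>The weak identity is available for bumps inside \<open>T\<close> only, so mollified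
  functions are considered on copies \<open>K n\<close> of \<open>T\<close> shrunk towards an
  interior point. These are convex with no larger diameter, the mollified gradient on them is an
  average of \<open>g\<close> and has no larger norm, and they exhaust \<open>T\<close> up to a null
  set. Fatou's lemma passes to the limit.\<close>

lemma weak_gradient_Poincare:
  fixes T :: "'a::euclidean_space set" and u :: "'a \<Rightarrow> real" and g :: "'a \<Rightarrow> 'a"
  assumes T: "compact T" "convex T" "interior T \<noteq> {}" and d: "diameter T \<le> d" "0 < d"
    and um [measurable]: "u \<in> borel_measurable borel" and gm [measurable]: "g \<in> borel_measurable borel"
    and u2: "integrable lborel (\<lambda>x. (u x)\<^sup>2)" and g2: "integrable lborel (\<lambda>x. (norm (g x))\<^sup>2)"
    and supp: "\<And>x. x \<notin> T \<Longrightarrow> u x = 0" "\<And>x. x \<notin> T \<Longrightarrow> g x = 0"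
    and weak: "\<And>x \<epsilon> b. \<epsilon> > 0 \<Longrightarrow> cball x \<epsilon> \<subseteq> interior T \<Longrightarrow> b \<in> Basis \<Longrightarrow>
       (\<integral>y. u y * (bump_grad \<epsilon> x y \<bullet> b) \<partial>lborel) = - (\<integral>y. (g y \<bullet> b) * bump 0 \<epsilon> x y \<partial>lborel)"
  shows "\<exists>m. pi\<^sup>2 * (LINT x:T|lborel. (u x - m)\<^sup>2) \<le> d\<^sup>2 * (\<integral>x. (norm (g x))\<^sup>2 \<partial>lborel)"
proof -
  have Tm [measurable]: "T \<in> sets borel" using T(1) by (simp add: borel_compact)
  have Tfin: "emeasure lborel T < \<infinity>" using emeasure_compact_finite[OF T(1)] by simp
  have indT: "integrable lborel (indicat_real T)" using Tfin by (intro integrable_real_indicator) auto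
  have bound1: "\<bar>a\<bar> \<le> 1 + a\<^sup>2" for a :: real
  proof -
    have "0 \<le> (\<bar>a\<bar> - 1)\<^sup>2" by simp
    then have "2 * \<bar>a\<bar> \<le> 1 + a\<^sup>2" by (simp add: power2_eq_square algebra_simps)
    then show ?thesis using abs_ge_zero[of a] by linarith
  qed
  have iu: "integrable lborel u"
  proof (rule Bochner_Integration.integrable_bound[OF Bochner_Integration.integrable_add[OF indT u2]])
    show "AE x in lborel. norm (u x) \<le> norm (indicat_real T x + (u x)\<^sup>2)"
      using bound1 supp(1) by (intro AE_I2) (auto simp: indicator_def)
  qed simp
  have ing: "integrable lborel (\<lambda>x. norm (g x))"
  proof (rule Bochner_Integration.integrable_bound[OF Bochner_Integration.integrable_add[OF indT g2]])
    show "AE x in lborel. norm (norm (g x)) \<le> norm (indicat_real T x + (norm (g x))\<^sup>2)"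
      using bound1[of "norm (g _)"] supp(2) by (intro AE_I2) (auto simp: indicator_def)
  qed simp
  then have ig: "integrable lborel g" by (rule integrable_norm_cancel) simp
  define R' where "R' = (\<integral>x. (norm (g x))\<^sup>2 \<partial>lborel)"
  have R': "R' \<ge> 0" by (simp add: R'_def)
  define V where "V = measure lborel T"
  have V: "V > 0"
  proof -
    have "\<not> negligible T" using T(3) by (meson negligible_subset interior_subset open_interior open_not_negligible)
    then have "emeasure lborel T \<noteq> 0" by (auto simp: negligible_iff_emeasure0)
    then show ?thesis unfolding V_def using Tfin by (simp add: measure_def enn2real_positive_iff top.not_eq_extremum zero_less_iff_neq_zero)
  qed
  define m where "m = (LINT x:T|lborel. u x) / V"
  obtain x0 where x0: "x0 \<in> interior T" using T(3) by blast
  \<comment> \<open>The shift by two in the denominator makes the first factor 1/2 instead of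
    0.\<close>
  define s where "s n = 1 - inverse (real (Suc (Suc n)))" for n
  have s: "0 < s n" "s n < 1" for n by (auto simp: s_def field_simps)
  have slim: "s \<longlonglongrightarrow> 1"
  proof -
    have "(\<lambda>n. 1 - inverse (real (Suc (Suc n)))) \<longlonglongrightarrow> 1 - 0"
      by (intro tendsto_diff tendsto_const LIMSEQ_Suc[OF LIMSEQ_inverse_real_of_nat])
    then show ?thesis by (simp add: s_def[abs_def])
  qed
  define K where "K n = (\<lambda>x. x0 + s n *\<^sub>R (x - x0)) ` T" for n
  have K: "compact (K n)" "convex (K n)" for n
  proof -
    show "compact (K n)" unfolding K_def by (intro compact_continuous_image continuous_intros T)
    have "K n = (\<lambda>y. (x0 - s n *\<^sub>R x0) + y) ` ((\<lambda>x. s n *\<^sub>R x) ` T)"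
      unfolding K_def image_image by (intro image_cong) (auto simp: algebra_simps)
    then show "convex (K n)" using T(2) by (simp add: convex_scaling convex_translation)
  qed
  have Kint: "K n \<subseteq> interior T" for n
  proof
    fix y assume "y \<in> K n"
    then obtain x where x: "x \<in> T" "y = x0 + s n *\<^sub>R (x - x0)" by (auto simp: K_def)
    have "x - (1 - s n) *\<^sub>R (x - x0) \<in> interior T"
      using s[of n] by (intro mem_interior_convex_shrink T(2) x0 x) auto
    moreover have "x - (1 - s n) *\<^sub>R (x - x0) = y" unfolding x(2) by (simp add: algebra_simps)
    ultimately show "y \<in> interior T" by simp
  qed
  have KT: "K n \<subseteq> T" for n using Kint interior_subset by blast
  have Km [measurable]: "K n \<in> sets borel" for n using K(1) by (simp add: borel_compact)
  have Kdiam: "diameter (K n) \<le> d" for n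
  proof (rule diameter_le)
    show "K n \<noteq> {} \<or> 0 \<le> d" using d by simp
    fix y z assume "y \<in> K n" "z \<in> K n"
    then obtain p q where pq: "p \<in> T" "q \<in> T" "y = x0 + s n *\<^sub>R (p - x0)" "z = x0 + s n *\<^sub>R (q - x0)"
      by (auto simp: K_def)
    have "norm (y - z) = s n * norm (p - q)"
      using s[of n] by (simp add: pq(3,4) flip: scaleR_diff_right)
    also have "\<dots> \<le> 1 * norm (p - q)" using s[of n] by (intro mult_right_mono) auto
    also have "\<dots> \<le> diameter T" using diameter_bounded_bound[OF compact_imp_bounded[OF T(1)] pq(1,2)] by (simp add: dist_norm)
    finally show "norm (y - z) \<le> d" using d by simp
  qed
  \<comment> \<open>The inverse dilations of an interior point converge to it, hence eventually lie
    in \<open>T\<close>.\<close>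
  have Kev: "\<forall>\<^sub>F n in sequentially. x \<in> K n" if x: "x \<in> interior T" for x
  proof -
    have "(\<lambda>n. x0 + (1 / s n) *\<^sub>R (x - x0)) \<longlonglongrightarrow> x0 + (1 / 1) *\<^sub>R (x - x0)"
      by (intro tendsto_intros slim) simp
    then have "(\<lambda>n. x0 + (1 / s n) *\<^sub>R (x - x0)) \<longlonglongrightarrow> x" by simp
    then have "\<forall>\<^sub>F n in sequentially. x0 + (1 / s n) *\<^sub>R (x - x0) \<in> interior T"
      using x by (intro topological_tendstoD) auto
    then show ?thesis
    proof (rule eventually_mono)
      fix n assume "x0 + (1 / s n) *\<^sub>R (x - x0) \<in> interior T"
      then have "x0 + (1 / s n) *\<^sub>R (x - x0) \<in> T" using interior_subset by blast
      moreover have "x = x0 + s n *\<^sub>R ((x0 + (1 / s n) *\<^sub>R (x - x0)) - x0)" using s(1)[of n] by simp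
      ultimately show "x \<in> K n" unfolding K_def by (rule rev_image_eqI)
    qed
  qed
  \<comment> \<open>One radius has to serve both purposes: the balls around \<open>K n\<close> stay
    inside the cell, and the L1 error of mollification tends to zero.\<close>
  have "\<exists>\<epsilon>>0. (\<forall>x\<in>K n. cball x \<epsilon> \<subseteq> interior T) \<and> (\<integral>\<^sup>+x. ennreal \<bar>mollify \<epsilon> u x - u x\<bar> \<partial>lborel) \<le> ennreal (inverse (real (Suc n)))" for n
  proof -
    obtain d1 where d1: "d1 > 0" "\<And>\<epsilon>. 0 < \<epsilon> \<Longrightarrow> \<epsilon> < d1 \<Longrightarrow> (\<integral>\<^sup>+x. ennreal \<bar>mollify \<epsilon> u x - u x\<bar> \<partial>lborel) \<le> ennreal (inverse (real (Suc n)))"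
      using mollify_L1[OF iu, of "inverse (real (Suc n))"] by auto
    obtain d2 where d2: "d2 > 0" "(\<Union>x\<in>K n. ball x d2) \<subseteq> interior T"
      using compact_subset_open_imp_ball_epsilon_subset[OF K(1) open_interior Kint] by metis
    show ?thesis
    proof (intro exI[of _ "min d1 d2 / 2"] conjI ballI)
      show "cball x (min d1 d2 / 2) \<subseteq> interior T" if "x \<in> K n" for x
      proof -
        have "cball x (min d1 d2 / 2) \<subseteq> ball x d2" using d1 d2 by auto
        then show ?thesis using d2(2) that by blast
      qed
    qed (use d1 d2 in auto)
  qed
  then obtain \<epsilon> where \<epsilon>: "\<And>n. \<epsilon> n > 0" "\<And>n x. x \<in> K n \<Longrightarrow> cball x (\<epsilon> n) \<subseteq> interior T"
    "\<And>n. (\<integral>\<^sup>+x. ennreal \<bar>mollify (\<epsilon> n) u x - u x\<bar> \<partial>lborel) \<le> ennreal (inverse (real (Suc n)))" by metis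
  define w where "w n = mollify (\<epsilon> n) u" for n
  define Gr where "Gr n x = (- 1 / bump_mass (\<epsilon> n) TYPE('a)) *\<^sub>R (\<integral>y. u y *\<^sub>R bump_grad (\<epsilon> n) x y \<partial>lborel)" for n and x :: 'a
  have dw: "(w n has_derivative (\<lambda>v. Gr n x \<bullet> v)) (at x)" and cGr: "continuous_on UNIV (Gr n)" for n x
    using mollify_has_derivative[OF iu \<epsilon>(1)[of n]] unfolding w_def Gr_def by auto
  have cw: "continuous_on UNIV (w n)" for n
    using dw by (meson has_derivative_continuous continuous_at_imp_continuous_on)
  have [measurable]: "w n \<in> borel_measurable borel" "Gr n \<in> borel_measurable borel" for n
    using cw cGr by (auto intro: borel_measurable_continuous_onI)
  \<comment> \<open>At points of \<open>K n\<close> the weak identity moves the derivative from the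
    bump to \<open>g\<close>, so the gradient of the mollified function is the mollification of
    \<open>g\<close>. The bound is kept as a nonnegative integral, the form used by the L2
    contraction.\<close>
  have Gr_bound: "ennreal (norm (Gr n x)) \<le> (\<integral>\<^sup>+y. ennreal (norm (g y) * (bump 0 (\<epsilon> n) x y / bump_mass (\<epsilon> n) TYPE('a))) \<partial>lborel)"
    if x: "x \<in> K n" for n x
  proof -
    let ?c = "bump_mass (\<epsilon> n) TYPE('a)"
    have c: "?c > 0" by (rule bump_mass_pos[OF \<epsilon>(1)])
    obtain B where B: "\<And>y. norm (bump_grad (\<epsilon> n) (0::'a) y) \<le> B"
      using bounded_compact_support[OF continuous_bump_grad[of "\<epsilon> n" 0], of "\<epsilon> n"] bump_support_norm[OF \<epsilon>(1)] by metis
    have B': "norm (bump_grad (\<epsilon> n) x y) \<le> B" for y unfolding bump_shift(2)[of "\<epsilon> n" x y] by (rule B)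
    have i1: "integrable lborel (\<lambda>y. u y *\<^sub>R bump_grad (\<epsilon> n) x y)"
      by (rule integrable_mult_bounded[OF iu continuous_bump_grad B'])
    have i2': "integrable lborel (\<lambda>y. norm (g y) * bump 0 (\<epsilon> n) x y)"
      by (rule integrable_mult_bump[OF ing \<epsilon>(1)])
    have [measurable]: "bump 0 (\<epsilon> n) x \<in> borel_measurable borel"
      using continuous_bump by (rule borel_measurable_continuous_onI)
    have i2: "integrable lborel (\<lambda>y. bump 0 (\<epsilon> n) x y *\<^sub>R g y)"
      by (rule Bochner_Integration.integrable_bound[OF i2']) (auto simp: mult.commute)
    have "Gr n x = (1 / ?c) *\<^sub>R (\<integral>y. bump 0 (\<epsilon> n) x y *\<^sub>R g y \<partial>lborel)"
    proof (rule euclidean_eqI)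
      fix b :: 'a assume b: "b \<in> Basis"
      have "Gr n x \<bullet> b = (- 1 / ?c) * (\<integral>y. u y * (bump_grad (\<epsilon> n) x y \<bullet> b) \<partial>lborel)"
        unfolding Gr_def using integral_inner_left[OF i1, of b] by simp
      also have "\<dots> = (1 / ?c) * (\<integral>y. (g y \<bullet> b) * bump 0 (\<epsilon> n) x y \<partial>lborel)"
        using weak[OF \<epsilon>(1) \<epsilon>(2)[OF x] b] by simp
      also have "\<dots> = ((1 / ?c) *\<^sub>R (\<integral>y. bump 0 (\<epsilon> n) x y *\<^sub>R g y \<partial>lborel)) \<bullet> b"
        using integral_inner_left[OF i2, of b] by (simp add: mult.commute)
      finally show "Gr n x \<bullet> b = ((1 / ?c) *\<^sub>R (\<integral>y. bump 0 (\<epsilon> n) x y *\<^sub>R g y \<partial>lborel)) \<bullet> b" .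
    qed
    then have "norm (Gr n x) \<le> (1 / ?c) * (\<integral>y. norm (bump 0 (\<epsilon> n) x y *\<^sub>R g y) \<partial>lborel)"
      using c integral_norm_bound[of lborel "\<lambda>y. bump 0 (\<epsilon> n) x y *\<^sub>R g y"] by (simp add: divide_right_mono)
    also have "\<dots> = (\<integral>y. norm (g y) * (bump 0 (\<epsilon> n) x y / ?c) \<partial>lborel)"
      by (simp add: mult.commute)
    finally have "ennreal (norm (Gr n x)) \<le> ennreal (\<integral>y. norm (g y) * (bump 0 (\<epsilon> n) x y / ?c) \<partial>lborel)"
      by (rule ennreal_leI)
    also have "\<dots> = (\<integral>\<^sup>+y. ennreal (norm (g y) * (bump 0 (\<epsilon> n) x y / ?c)) \<partial>lborel)"
      using i2' c by (intro nn_integral_eq_integral[symmetric]) auto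
    finally show ?thesis .
  qed
  have GrL2: "(LINT x:K n|lborel. (norm (Gr n x))\<^sup>2) \<le> R'" for n
  proof -
    have "integrable lborel (\<lambda>x. indicator (K n) x *\<^sub>R (norm (Gr n x))\<^sup>2)"
      by (rule borel_integrable_compact[OF K(1)]) (intro continuous_intros continuous_on_subset[OF cGr], auto)
    then have "ennreal (LINT x:K n|lborel. (norm (Gr n x))\<^sup>2) = (\<integral>\<^sup>+x. ennreal (indicator (K n) x *\<^sub>R (norm (Gr n x))\<^sup>2) \<partial>lborel)"
      unfolding set_lebesgue_integral_def by (intro nn_integral_eq_integral[symmetric]) auto
    also have "\<dots> \<le> (\<integral>\<^sup>+x. (\<integral>\<^sup>+y. ennreal (norm (g y) * (bump 0 (\<epsilon> n) x y / bump_mass (\<epsilon> n) TYPE('a))) \<partial>lborel)\<^sup>2 \<partial>lborel)"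
    proof (rule nn_integral_mono)
      fix x :: 'a
      show "ennreal (indicator (K n) x *\<^sub>R (norm (Gr n x))\<^sup>2) \<le> (\<integral>\<^sup>+y. ennreal (norm (g y) * (bump 0 (\<epsilon> n) x y / bump_mass (\<epsilon> n) TYPE('a))) \<partial>lborel)\<^sup>2"
      proof (cases "x \<in> K n")
        case True
        then show ?thesis using power_mono[OF Gr_bound[OF True], of 2] by (simp add: ennreal_power)
      qed simp
    qed
    also have "\<dots> \<le> (\<integral>\<^sup>+y. ennreal ((norm (g y))\<^sup>2) \<partial>lborel)"
      by (rule mollify_L2_contraction[OF _ _ \<epsilon>(1)]) auto
    also have "\<dots> = ennreal R'" unfolding R'_def using g2 by (intro nn_integral_eq_integral) auto
    finally show ?thesis using R' by simp
  qed
  \<comment> \<open>The Poincare inequality on \<open>K n\<close> refers to the mean over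
    \<open>K n\<close>; L1 convergence and convergence of the volumes carry it to the mean
    \<open>m\<close> over \<open>T\<close>.\<close>
  define mn where "mn n = (LINT x:K n|lborel. w n x) / measure lborel (K n)" for n
  have VK: "measure lborel (K n) > 0" for n
  proof -
    have "K n = (\<lambda>y. (x0 - s n *\<^sub>R x0) + y) ` ((\<lambda>x. s n *\<^sub>R x) ` T)"
      unfolding K_def image_image by (intro image_cong) (auto simp: algebra_simps)
    moreover have "interior ((\<lambda>y. (x0 - s n *\<^sub>R x0) + y) ` ((\<lambda>x. s n *\<^sub>R x) ` T)) \<noteq> {}"
      using T(3) s(1)[of n] by (simp add: interior_translation interior_injective_linear_image linear_scaleR inj_on_def)
    ultimately have "interior (K n) \<noteq> {}" by simp
    then have "\<not> negligible (K n)" by (meson negligible_subset interior_subset open_interior open_not_negligible)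
    then have "emeasure lborel (K n) \<noteq> 0" by (auto simp: negligible_iff_emeasure0)
    then show ?thesis using emeasure_compact_finite[OF K(1), of n]
      by (simp add: measure_def enn2real_positive_iff top.not_eq_extremum zero_less_iff_neq_zero)
  qed
  have PW: "pi\<^sup>2 * (LINT x:K n|lborel. (w n x - mn n)\<^sup>2) \<le> d\<^sup>2 * R'" for n
  proof -
    have "pi\<^sup>2 * (LINT x:K n|lborel. (w n x - mn n)\<^sup>2) \<le> d\<^sup>2 * (LINT x:K n|lborel. (norm (Gr n x))\<^sup>2)"
      by (rule Poincare_convex_C1[OF K dw cGr Kdiam d(2)]) (use VK[of n] in \<open>simp add: mn_def\<close>)
    also have "\<dots> \<le> d\<^sup>2 * R'" by (intro mult_left_mono GrL2) simp
    finally show ?thesis .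
  qed
  have Tint: "AE x in lborel. x \<in> T \<longrightarrow> x \<in> interior T"
  proof -
    have "negligible (frontier T)" by (rule negligible_convex_frontier[OF T(2)])
    then have "frontier T \<in> null_sets lborel"
      by (simp add: negligible_iff_null_sets null_sets_completion_iff borel_closed)
    then have "AE x in lborel. x \<notin> frontier T" by (rule AE_not_in)
    then show ?thesis
      by (rule eventually_mono) (use closure_subset in \<open>auto simp: frontier_def\<close>)
  qed
  have ind_lim: "AE x in lborel. (\<lambda>n. indicat_real (K n) x) \<longlonglongrightarrow> indicat_real T x"
    using Tint
  proof (rule eventually_mono)
    fix x assume x: "x \<in> T \<longrightarrow> x \<in> interior T"
    show "(\<lambda>n. indicat_real (K n) x) \<longlonglongrightarrow> indicat_real T x"
    proof (cases "x \<in> T")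
      case True
      then have "x \<in> interior T" using x by simp
      from Kev[OF this] have "\<forall>\<^sub>F n in sequentially. indicat_real T x = indicat_real (K n) x"
        by (rule eventually_mono) (use True in simp)
      then show ?thesis by (rule Lim_transform_eventually[OF tendsto_const])
    next
      case False
      then have "x \<notin> K n" for n using KT by blast
      then show ?thesis using False by simp
    qed
  qed
  have lim_vol: "(\<lambda>n. measure lborel (K n)) \<longlonglongrightarrow> V"
  proof -
    have "(\<lambda>n. \<integral>x. indicat_real (K n) x \<partial>lborel) \<longlonglongrightarrow> (\<integral>x. indicat_real T x \<partial>lborel)"
      by (rule integral_dominated_convergence[OF _ _ indT ind_lim])
         (use KT in \<open>auto simp: indicator_def intro!: AE_I2\<close>)
    then show ?thesis by (simp add: V_def)
  qed
  have intw: "integrable lborel (\<lambda>x. indicat_real (K n) x * w n x)" for n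
    using borel_integrable_compact[OF K(1) continuous_on_subset[OF cw]] by simp
  have intu: "integrable lborel (\<lambda>x. indicat_real (K n) x * u x)" for n
    using integrable_mult_indicator[of "K n" lborel u] iu by simp
  have lim_int: "(\<lambda>n. LINT x:K n|lborel. w n x) \<longlonglongrightarrow> (LINT x:T|lborel. u x)"
  proof -
    have a: "(\<lambda>n. \<integral>x. indicat_real (K n) x * u x \<partial>lborel) \<longlonglongrightarrow> (\<integral>x. indicat_real T x * u x \<partial>lborel)"
    proof (rule integral_dominated_convergence[where w = "\<lambda>x. \<bar>u x\<bar>"])
      show "AE x in lborel. (\<lambda>n. indicat_real (K n) x * u x) \<longlonglongrightarrow> indicat_real T x * u x"
        using ind_lim by (rule eventually_mono) (intro tendsto_intros)
    qed (use iu in \<open>auto simp: indicator_def intro!: AE_I2\<close>)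
    have "\<bar>(\<integral>x. indicat_real (K n) x * w n x \<partial>lborel) - (\<integral>x. indicat_real (K n) x * u x \<partial>lborel)\<bar> \<le> inverse (real (Suc n))" for n
    proof -
      have i: "integrable lborel (\<lambda>x. indicat_real (K n) x * w n x - indicat_real (K n) x * u x)"
        by (rule Bochner_Integration.integrable_diff[OF intw intu])
      have "\<bar>(\<integral>x. indicat_real (K n) x * w n x \<partial>lborel) - (\<integral>x. indicat_real (K n) x * u x \<partial>lborel)\<bar>
        \<le> (\<integral>x. \<bar>indicat_real (K n) x * w n x - indicat_real (K n) x * u x\<bar> \<partial>lborel)"
        using Bochner_Integration.integral_diff[OF intw intu, of n n] integral_abs_bound[of lborel "\<lambda>x. indicat_real (K n) x * w n x - indicat_real (K n) x * u x"] by simp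
      then have "ennreal \<bar>(\<integral>x. indicat_real (K n) x * w n x \<partial>lborel) - (\<integral>x. indicat_real (K n) x * u x \<partial>lborel)\<bar>
        \<le> ennreal (\<integral>x. \<bar>indicat_real (K n) x * w n x - indicat_real (K n) x * u x\<bar> \<partial>lborel)" by (rule ennreal_leI)
      also have "\<dots> = (\<integral>\<^sup>+x. ennreal \<bar>indicat_real (K n) x * w n x - indicat_real (K n) x * u x\<bar> \<partial>lborel)"
        using i by (intro nn_integral_eq_integral[symmetric]) auto
      also have "\<dots> \<le> (\<integral>\<^sup>+x. ennreal \<bar>mollify (\<epsilon> n) u x - u x\<bar> \<partial>lborel)"
        by (intro nn_integral_mono ennreal_leI) (auto simp: indicator_def w_def)
      also note \<epsilon>(3)[of n]
      finally show ?thesis by simp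
    qed
    then have "(\<lambda>n. (\<integral>x. indicat_real (K n) x * w n x \<partial>lborel) - (\<integral>x. indicat_real (K n) x * u x \<partial>lborel)) \<longlonglongrightarrow> 0"
      by (intro Lim_null_comparison[OF _ LIMSEQ_inverse_real_of_nat]) auto
    from tendsto_add[OF this a] show ?thesis by (simp add: set_lebesgue_integral_def)
  qed
  have mlim: "mn \<longlonglongrightarrow> m"
    unfolding mn_def[abs_def] m_def using V by (intro tendsto_divide lim_int lim_vol) simp
  have iwu: "integrable lborel (\<lambda>x. indicat_real (K n) x * (w n x - u x))" for n
    using Bochner_Integration.integrable_diff[OF intw[of n] intu[of n]] by (simp add: algebra_simps)
  have "(\<lambda>n. \<integral>x. norm (indicat_real (K n) x * (w n x - u x)) \<partial>lborel) \<longlonglongrightarrow> 0"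
  proof (rule Lim_null_comparison[OF _ LIMSEQ_inverse_real_of_nat])
    have "(\<integral>x. norm (indicat_real (K n) x * (w n x - u x)) \<partial>lborel) \<le> inverse (real (Suc n))" for n
    proof -
      have "ennreal (\<integral>x. norm (indicat_real (K n) x * (w n x - u x)) \<partial>lborel) = (\<integral>\<^sup>+x. ennreal (norm (indicat_real (K n) x * (w n x - u x))) \<partial>lborel)"
        using iwu[of n] by (intro nn_integral_eq_integral[symmetric]) auto
      also have "\<dots> \<le> (\<integral>\<^sup>+x. ennreal \<bar>mollify (\<epsilon> n) u x - u x\<bar> \<partial>lborel)"
        by (intro nn_integral_mono ennreal_leI) (auto simp: indicator_def w_def)
      also note \<epsilon>(3)[of n]
      finally show ?thesis by simp
    qed
    then show "\<forall>\<^sub>F n in sequentially. norm (\<integral>x. norm (indicat_real (K n) x * (w n x - u x)) \<partial>lborel) \<le> inverse (real (Suc n))"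
      by simp
  qed
  \<comment> \<open>Fatou's lemma needs pointwise convergence, which L1 convergence gives along a
    subsequence.\<close>
  from tendsto_L1_AE_subseq[OF iwu this] obtain r :: "nat \<Rightarrow> nat" where r: "strict_mono r"
    "AE x in lborel. (\<lambda>n. indicat_real (K (r n)) x * (w (r n) x - u x)) \<longlonglongrightarrow> 0" by blast
  define Q where "Q n x = ennreal (pi\<^sup>2 * (indicat_real (K (r n)) x * (w (r n) x - mn (r n))\<^sup>2))" for n x
  have Qm: "Q n \<in> borel_measurable lborel" for n unfolding Q_def[abs_def] by measurable
  have Qint: "(\<integral>\<^sup>+x. Q n x \<partial>lborel) \<le> ennreal (d\<^sup>2 * R')" for n
  proof -
    have "integrable lborel (\<lambda>x. indicator (K (r n)) x *\<^sub>R (w (r n) x - mn (r n))\<^sup>2)"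
      by (rule borel_integrable_compact[OF K(1)]) (intro continuous_intros continuous_on_subset[OF cw], auto)
    then have "(\<integral>\<^sup>+x. Q n x \<partial>lborel) = ennreal (\<integral>x. pi\<^sup>2 * (indicat_real (K (r n)) x * (w (r n) x - mn (r n))\<^sup>2) \<partial>lborel)"
      unfolding Q_def by (intro nn_integral_eq_integral integrable_mult_right) auto
    also have "\<dots> \<le> ennreal (d\<^sup>2 * R')"
      using PW[of "r n"] by (intro ennreal_leI) (simp add: set_lebesgue_integral_def)
    finally show ?thesis .
  qed
  have Qlim: "AE x in lborel. ennreal (pi\<^sup>2 * (indicat_real T x * (u x - m)\<^sup>2)) = liminf (\<lambda>n. Q n x)"
    using r(2) ind_lim
  proof eventually_elim
    case (elim x)
    have ir: "(\<lambda>n. indicat_real (K (r n)) x) \<longlonglongrightarrow> indicat_real T x"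
      using LIMSEQ_subseq_LIMSEQ[OF elim(2) r(1)] by (simp add: o_def)
    have mr: "(\<lambda>n. mn (r n)) \<longlonglongrightarrow> m" using LIMSEQ_subseq_LIMSEQ[OF mlim r(1)] by (simp add: o_def)
    have "(\<lambda>n. (indicat_real (K (r n)) x * (w (r n) x - u x) + indicat_real (K (r n)) x * (u x - mn (r n)))\<^sup>2)
       \<longlonglongrightarrow> (0 + indicat_real T x * (u x - m))\<^sup>2"
      by (intro tendsto_intros elim(1) ir mr)
    moreover have "(indicat_real (K (r n)) x * (w (r n) x - u x) + indicat_real (K (r n)) x * (u x - mn (r n)))\<^sup>2
       = indicat_real (K (r n)) x * (w (r n) x - mn (r n))\<^sup>2" for n by (auto simp: indicator_def)
    moreover have "(0 + indicat_real T x * (u x - m))\<^sup>2 = indicat_real T x * (u x - m)\<^sup>2" by (auto simp: indicator_def)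
    ultimately have l: "(\<lambda>n. indicat_real (K (r n)) x * (w (r n) x - mn (r n))\<^sup>2) \<longlonglongrightarrow> indicat_real T x * (u x - m)\<^sup>2" by simp
    have "(\<lambda>n. Q n x) \<longlonglongrightarrow> ennreal (pi\<^sup>2 * (indicat_real T x * (u x - m)\<^sup>2))"
      unfolding Q_def by (intro tendsto_ennrealI tendsto_mult_left l)
    from lim_imp_Liminf[OF _ this] show ?case by simp
  qed
  have "(\<integral>\<^sup>+x. ennreal (pi\<^sup>2 * (indicat_real T x * (u x - m)\<^sup>2)) \<partial>lborel) = (\<integral>\<^sup>+x. liminf (\<lambda>n. Q n x) \<partial>lborel)"
    by (rule nn_integral_cong_AE[OF Qlim])
  also have "\<dots> \<le> liminf (\<lambda>n. \<integral>\<^sup>+x. Q n x \<partial>lborel)" by (rule nn_integral_liminf[OF Qm])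
  also have "\<dots> \<le> liminf (\<lambda>n. ennreal (d\<^sup>2 * R'))" by (intro Liminf_mono) (use Qint in auto)
  also have "\<dots> = ennreal (d\<^sup>2 * R')" by (simp add: Liminf_const)
  finally have fin: "(\<integral>\<^sup>+x. ennreal (pi\<^sup>2 * (indicat_real T x * (u x - m)\<^sup>2)) \<partial>lborel) \<le> ennreal (d\<^sup>2 * R')" .
  then have "enn2real (\<integral>\<^sup>+x. ennreal (pi\<^sup>2 * (indicat_real T x * (u x - m)\<^sup>2)) \<partial>lborel) \<le> d\<^sup>2 * R'"
    using R' by (simp add: enn2real_leI)
  moreover have "enn2real (\<integral>\<^sup>+x. ennreal (pi\<^sup>2 * (indicat_real T x * (u x - m)\<^sup>2)) \<partial>lborel)
      = (\<integral>x. pi\<^sup>2 * (indicat_real T x * (u x - m)\<^sup>2) \<partial>lborel)"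
    by (rule integral_eq_nn_integral[symmetric]) auto
  ultimately show ?thesis
    by (intro exI[of _ m]) (simp add: set_lebesgue_integral_def R'_def)
qed

section \<open>Representatives and the weak divergence\<close>

lemma sq_integrable_rep: "sq_integrable (rep_lsq X)"
  using Quotient3_rep_reflp[OF Quotient3_lsq, of X] by simp

lemma AE_rep_abs:
  assumes "sq_integrable f" shows "AE x in lebesgue. rep_lsq (abs_lsq f) x = f x"
  using Quotient3_rep_abs[OF Quotient3_lsq, of f] assms by simp

lemma lsq_eqI: "(AE x in lebesgue. rep_lsq X x = rep_lsq Y x) \<Longrightarrow> X = Y"
  using Quotient3_rel_rep[OF Quotient3_lsq, of X Y] by (simp add: sq_integrable_rep)

lemma AE_rep_add: "AE x in lebesgue. rep_lsq (X + Y) x = rep_lsq X x + rep_lsq Y x"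
  unfolding plus_lsq_def by (simp add: AE_rep_abs sq_integrable_add sq_integrable_rep)

lemma AE_rep_scaleR: "AE x in lebesgue. rep_lsq (c *\<^sub>R X) x = c *\<^sub>R rep_lsq X x"
  unfolding scaleR_lsq_def by (simp add: AE_rep_abs sq_integrable_scaleR sq_integrable_rep)

lemma AE_rep_0: "AE x in lebesgue. rep_lsq 0 x = 0"
  unfolding zero_lsq_def by (simp add: AE_rep_abs sq_integrable_0)

lemma AE_rep_diff: "AE x in lebesgue. rep_lsq (X - Y) x = rep_lsq X x - rep_lsq Y x"
proof -
  have "X - Y = X + (-1) *\<^sub>R Y" by simp
  then show ?thesis using AE_rep_add[of X "(-1) *\<^sub>R Y"] AE_rep_scaleR[of "-1" Y] by auto
qed

lemma inner_lsq_eq: "X \<bullet> Y = (LINT x|lebesgue. rep_lsq X x \<bullet> rep_lsq Y x)"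
  unfolding inner_lsq_def by simp

lemma norm_lsq_eq: "(norm X)\<^sup>2 = (LINT x|lebesgue. (norm (rep_lsq X x))\<^sup>2)"
  by (simp add: power2_norm_eq_inner inner_lsq_eq)

lemma inner_lsq_cong:
  assumes "AE x in lebesgue. rep_lsq X x \<bullet> rep_lsq Y x = rep_lsq X' x \<bullet> rep_lsq Y' x"
  shows "X \<bullet> Y = X' \<bullet> Y'"
  unfolding inner_lsq_eq
  by (rule integral_cong_AE) (use assms in \<open>auto intro!: borel_measurable_integrable sq_integrable_inner sq_integrable_rep\<close>)

lemma AE_rep_sum: "finite I \<Longrightarrow> AE x in lebesgue. rep_lsq (\<Sum>i\<in>I. X i) x = (\<Sum>i\<in>I. rep_lsq (X i) x)"
proof (induction I rule: finite_induct)
  case empty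
  then show ?case using AE_rep_0 by simp
next
  case (insert i I)
  then show ?case using AE_rep_add[of "X i" "\<Sum>i\<in>I. X i"] by auto
qed

lemma subspace_L2_on: "subspace (L2_on S)"
proof (rule subspaceI)
  show "0 \<in> L2_on S" unfolding L2_on_def using AE_rep_0 by auto
  show "X + Y \<in> L2_on S" if "X \<in> L2_on S" "Y \<in> L2_on S" for X Y :: "('a, 'b) lsq"
    using that AE_rep_add[of X Y] unfolding L2_on_def by auto
  show "c *\<^sub>R X \<in> L2_on S" if "X \<in> L2_on S" for c and X :: "('a, 'b) lsq"
    using that AE_rep_scaleR[of c X] unfolding L2_on_def by auto
qed

text \<open>Coordinatewise modification on null sets. It connects classes of Lebesgue measurable
  functions with the arguments on \<open>lborel\<close>, where Fubini and translations are
  used.\<close>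

lemma borel_representative:
  fixes f :: "'a::euclidean_space \<Rightarrow> 'b::euclidean_space"
  assumes f: "f \<in> borel_measurable lebesgue"
  obtains f' where "f' \<in> borel_measurable borel" "AE x in lebesgue. f x = f' x"
proof -
  have "\<exists>f'\<in>borel_measurable lborel. AE x in lborel. f x \<bullet> b = f' x" for b
    by (rule completion_ex_borel_measurable_real) (use f in measurable)
  then obtain F where F: "\<And>b. F b \<in> borel_measurable lborel" "\<And>b. AE x in lborel. f x \<bullet> b = F b x" by metis
  show ?thesis
  proof (rule that[of "\<lambda>x. \<Sum>b\<in>Basis. F b x *\<^sub>R b"])
    show "(\<lambda>x. \<Sum>b\<in>Basis. F b x *\<^sub>R b) \<in> borel_measurable borel" using F(1) by simp
    have "AE x in lborel. \<forall>b\<in>Basis. f x \<bullet> b = F b x" using F(2) by (intro AE_finite_allI) auto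
    then have "AE x in lborel. f x = (\<Sum>b\<in>Basis. F b x *\<^sub>R b)"
      by (rule eventually_mono) (metis (no_types, lifting) euclidean_representation sum.cong)
    then show "AE x in lebesgue. f x = (\<Sum>b\<in>Basis. F b x *\<^sub>R b)" by (rule AE_completion)
  qed
qed

lemma sq_integrable_borel:
  assumes "sq_integrable f" "f' \<in> borel_measurable borel" "AE x in lebesgue. f x = f' x"
  shows "integrable lborel (\<lambda>x. (norm (f' x))\<^sup>2)"
    and "(LINT x|lebesgue. (norm (f x))\<^sup>2) = (\<integral>x. (norm (f' x))\<^sup>2 \<partial>lborel)"
proof -
  have m: "(\<lambda>x. (norm (f' x))\<^sup>2) \<in> borel_measurable lborel" using assms(2) by simp
  have m': "(\<lambda>x. (norm (f' x))\<^sup>2) \<in> borel_measurable lebesgue" by (rule measurable_completion[OF m])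
  have f: "(\<lambda>x. (norm (f x))\<^sup>2) \<in> borel_measurable lebesgue" "integrable lebesgue (\<lambda>x. (norm (f x))\<^sup>2)"
    using assms(1) by (auto simp: sq_integrable_def)
  have ae: "AE x in lebesgue. (norm (f x))\<^sup>2 = (norm (f' x))\<^sup>2" using assms(3) by auto
  have "integrable lebesgue (\<lambda>x. (norm (f' x))\<^sup>2)"
    using f(2) integrable_cong_AE[OF f(1) m' ae] by simp
  then show "integrable lborel (\<lambda>x. (norm (f' x))\<^sup>2)" using integrable_completion[OF m] by simp
  show "(LINT x|lebesgue. (norm (f x))\<^sup>2) = (\<integral>x. (norm (f' x))\<^sup>2 \<partial>lborel)"
    using integral_cong_AE[OF f(1) m' ae] integral_completion[OF m] by simp
qed

lemma integral_lebesgue_borel: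
  fixes f f' :: "'a::euclidean_space \<Rightarrow> 'b::euclidean_space"
  assumes "f \<in> borel_measurable lebesgue" "f' \<in> borel_measurable borel" "AE x in lebesgue. f x = f' x"
  shows "(LINT x|lebesgue. f x) = (\<integral>x. f' x \<partial>lborel)"
proof -
  have m: "f' \<in> borel_measurable lborel" using assms(2) by simp
  show ?thesis using integral_cong_AE[OF assms(1) measurable_completion[OF m] assms(3)] integral_completion[OF m] by simp
qed

lemma sq_integrable_continuous:
  fixes f :: "'a::euclidean_space \<Rightarrow> 'b::euclidean_space"
  assumes "continuous_on UNIV f" "\<And>x. f x \<noteq> 0 \<Longrightarrow> x \<in> K" "compact K"
  shows "sq_integrable f"
proof -
  have m: "f \<in> borel_measurable borel" using assms(1) by (rule borel_measurable_continuous_onI)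
  have "integrable lborel (\<lambda>x. (norm (f x))\<^sup>2)"
    by (rule integrable_continuous_compact_support[OF _ _ assms(3)]) (use assms(2) in \<open>auto intro!: continuous_intros assms(1)\<close>)
  then have "integrable lebesgue (\<lambda>x. (norm (f x))\<^sup>2)" using m by (subst integrable_completion) auto
  moreover have "f \<in> borel_measurable lborel" using m by simp
  then have "f \<in> borel_measurable lebesgue" by (rule measurable_completion)
  ultimately show ?thesis by (simp add: sq_integrable_def)
qed

lemma test_function_grad:
  fixes \<Omega> :: "'a::euclidean_space set"
  assumes "test_function \<Omega> \<phi>"
  shows "(\<phi> has_derivative (\<lambda>v. grad \<phi> x \<bullet> v)) (at x)" "continuous_on UNIV (grad \<phi>)" "continuous_on UNIV \<phi>"
    "x \<notin> closure {x. \<phi> x \<noteq> 0} \<Longrightarrow> grad \<phi> x = 0" "x \<notin> closure {x. \<phi> x \<noteq> 0} \<Longrightarrow> \<phi> x = 0"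
proof -
  have C: "C_k (Suc 0) \<phi>" "C_k 0 \<phi>" using assms unfolding test_function_def by blast+
  have d: "(\<phi> has_derivative frechet_derivative \<phi> (at x)) (at x)" for x using C_k_deriv(1)[OF C(1)] .
  have eq: "frechet_derivative \<phi> (at x) v = grad \<phi> x \<bullet> v" for x v
  proof -
    interpret bounded_linear "frechet_derivative \<phi> (at x)" using d by (rule has_derivative_bounded_linear)
    have "frechet_derivative \<phi> (at x) v = frechet_derivative \<phi> (at x) (\<Sum>b\<in>Basis. (v \<bullet> b) *\<^sub>R b)"
      by (simp add: euclidean_representation)
    also have "\<dots> = (\<Sum>b\<in>Basis. (v \<bullet> b) * frechet_derivative \<phi> (at x) b)" by (simp add: sum scaleR)
    also have "\<dots> = grad \<phi> x \<bullet> v"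
      unfolding grad_def inner_sum_left by (intro sum.cong) (auto simp: inner_commute)
    finally show ?thesis .
  qed
  show dx: "(\<phi> has_derivative (\<lambda>v. grad \<phi> x \<bullet> v)) (at x)" for x using d[of x] by (simp add: eq[symmetric, abs_def])
  show "continuous_on UNIV (grad \<phi>)"
    unfolding grad_def using C_k_deriv(2)[OF C(1)] by (intro continuous_intros) simp
  show "continuous_on UNIV \<phi>" using C by simp
  have out: "\<phi> y = 0" if "y \<notin> closure {x. \<phi> x \<noteq> 0}" for y
  proof (rule ccontr)
    assume "\<phi> y \<noteq> 0"
    then have "y \<in> {x. \<phi> x \<noteq> 0}" by simp
    with closure_subset have "y \<in> closure {x. \<phi> x \<noteq> 0}" by (rule subsetD)
    then show False using that by simp
  qed
  show "\<phi> x = 0" if "x \<notin> closure {x. \<phi> x \<noteq> 0}" using out[OF that] .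
  show "grad \<phi> x = 0" if x: "x \<notin> closure {x. \<phi> x \<noteq> 0}"
  proof -
    have "((\<lambda>_. 0) has_derivative (\<lambda>v. grad \<phi> x \<bullet> v)) (at x)"
    proof (rule has_derivative_transform_within_open[OF dx])
      show "open (- closure {x. \<phi> x \<noteq> 0})" by (intro open_Compl closed_closure)
      show "x \<in> - closure {x. \<phi> x \<noteq> 0}" using x by simp
      show "\<phi> y = 0" if "y \<in> - closure {x. \<phi> x \<noteq> 0}" for y
        by (rule out, rule ComplD) (rule that)
    qed
    then have "(\<lambda>v. grad \<phi> x \<bullet> v) = (\<lambda>v. 0)" by (rule has_derivative_unique) simp
    then have "grad \<phi> x \<bullet> grad \<phi> x = 0" by (rule fun_cong)
    then show ?thesis by simp
  qed
qed

lemma test_function_sq_integrable: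
  assumes "test_function \<Omega> \<phi>"
  shows "sq_integrable \<phi>" "sq_integrable (grad \<phi>)"
proof -
  have K: "compact (closure {x. \<phi> x \<noteq> 0})" using assms by (simp add: test_function_def)
  show "sq_integrable \<phi>"
    by (rule sq_integrable_continuous[OF test_function_grad(3)[OF assms] _ K]) (use test_function_grad(5)[OF assms] in blast)
  show "sq_integrable (grad \<phi>)"
    by (rule sq_integrable_continuous[OF test_function_grad(2)[OF assms] _ K]) (use test_function_grad(4)[OF assms] in blast)
qed

section \<open>Linearity and uniqueness of the weak divergence\<close>

text \<open>Test functions and their gradients vanish outside the domain, so the restricted
  integrals extend to the whole space, where the inner products live.\<close>

lemma has_weak_div_iff:
  fixes \<Omega> :: "'a::euclidean_space set"
  assumes "open \<Omega>"
  shows "has_weak_div \<Omega> \<tau> w \<longleftrightarrow> w \<in> L2_on \<Omega> \<and> (\<forall>\<phi>. test_function \<Omega> \<phi> \<longrightarrow>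
     (LINT x|lebesgue. rep_lsq \<tau> x \<bullet> grad \<phi> x) = - (LINT x|lebesgue. rep_lsq w x * \<phi> x))"
proof -
  have \<Omega>: "\<Omega> \<in> sets lebesgue" using assms by auto
  have "(LINT x|lebesgue_on \<Omega>. rep_lsq \<tau> x \<bullet> grad \<phi> x) = (LINT x|lebesgue. rep_lsq \<tau> x \<bullet> grad \<phi> x)"
    "(LINT x|lebesgue_on \<Omega>. rep_lsq w x * \<phi> x) = (LINT x|lebesgue. rep_lsq w x * \<phi> x)" if t: "test_function \<Omega> \<phi>" for \<phi>
  proof -
    have sub: "closure {x. \<phi> x \<noteq> 0} \<subseteq> \<Omega>" using t by (simp add: test_function_def)
    have out: "grad \<phi> x = 0" "\<phi> x = 0" if "x \<notin> \<Omega>" for x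
      using test_function_grad(4,5)[OF t contra_subsetD[OF sub that]] by auto
    have "(\<lambda>x. indicat_real \<Omega> x *\<^sub>R (rep_lsq \<tau> x \<bullet> grad \<phi> x)) = (\<lambda>x. rep_lsq \<tau> x \<bullet> grad \<phi> x)"
      using out(1) by (auto simp: indicator_def fun_eq_iff)
    then show "(LINT x|lebesgue_on \<Omega>. rep_lsq \<tau> x \<bullet> grad \<phi> x) = (LINT x|lebesgue. rep_lsq \<tau> x \<bullet> grad \<phi> x)"
      using \<Omega> by (subst integral_restrict_space) auto
    have "(\<lambda>x. indicat_real \<Omega> x *\<^sub>R (rep_lsq w x * \<phi> x)) = (\<lambda>x. rep_lsq w x * \<phi> x)"
      using out(2) by (auto simp: indicator_def fun_eq_iff)
    then show "(LINT x|lebesgue_on \<Omega>. rep_lsq w x * \<phi> x) = (LINT x|lebesgue. rep_lsq w x * \<phi> x)"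
      using \<Omega> by (subst integral_restrict_space) auto
  qed
  then show ?thesis unfolding has_weak_div_def by auto
qed

text \<open>The fundamental lemma of the calculus of variations. At distance more than
  \<open>1 / (k + 1)\<close> from the complement all mollifications of small radius vanish, while
  they converge to \<open>v\<close> in L1; the sets \<open>S k\<close> exhaust
  \<open>O1\<close>.\<close>

lemma vanishing_bump_averages:
  fixes v :: "'a::euclidean_space \<Rightarrow> real"
  assumes O: "open O1" "bounded O1" and v: "integrable lborel v"
    and z: "\<And>x \<epsilon>. \<epsilon> > 0 \<Longrightarrow> cball x \<epsilon> \<subseteq> O1 \<Longrightarrow> (\<integral>y. v y * bump 0 \<epsilon> x y \<partial>lborel) = 0"
  shows "AE x in lborel. x \<in> O1 \<longrightarrow> v x = 0"
proof -
  \<comment> \<open>By convention \<open>infdist\<close> to the empty set is 0, which would make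
    every \<open>S k\<close> empty; boundedness guarantees a nonempty complement.\<close>
  have ne: "- O1 \<noteq> {}" using O(2) not_bounded_UNIV by (metis Compl_UNIV_eq compl_bot_eq double_compl)
  have [measurable]: "v \<in> borel_measurable borel" using borel_measurable_integrable[OF v] by simp
  define S where "S k = {x. inverse (real (Suc k)) < infdist x (- O1)}" for k
  have S [measurable]: "S k \<in> sets borel" for k
    unfolding S_def by (intro borel_open open_Collect_less continuous_intros)
  have zero: "AE x in lborel. x \<in> S k \<longrightarrow> v x = 0" for k
  proof -
    have le: "(\<integral>\<^sup>+x. ennreal (indicator (S k) x * \<bar>v x\<bar>) \<partial>lborel) \<le> ennreal e" if e: "e > 0" for e
    proof -
      obtain d where d: "d > 0" "\<And>\<epsilon>. 0 < \<epsilon> \<Longrightarrow> \<epsilon> < d \<Longrightarrow> (\<integral>\<^sup>+x. ennreal \<bar>mollify \<epsilon> v x - v x\<bar> \<partial>lborel) \<le> ennreal e"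
        using mollify_L1[OF v e] by blast
      define \<epsilon> where "\<epsilon> = min (d / 2) (inverse (real (Suc k)))"
      have \<epsilon>: "0 < \<epsilon>" "\<epsilon> < d" "\<epsilon> \<le> inverse (real (Suc k))" using d by (auto simp: \<epsilon>_def)
      have m0: "mollify \<epsilon> v x = 0" if x: "x \<in> S k" for x
      proof -
        have "cball x \<epsilon> \<subseteq> O1"
        proof
          fix y assume y: "y \<in> cball x \<epsilon>"
          show "y \<in> O1"
          proof (rule ccontr)
            assume "y \<notin> O1"
            then have "infdist x (- O1) \<le> dist x y" by (intro infdist_le) simp
            then show False using y x \<epsilon>(3) by (simp add: S_def)
          qed
        qed
        then show ?thesis using z[OF \<epsilon>(1)] by (simp add: mollify_def)
      qed
      have "(\<integral>\<^sup>+x. ennreal (indicator (S k) x * \<bar>v x\<bar>) \<partial>lborel) \<le> (\<integral>\<^sup>+x. ennreal \<bar>mollify \<epsilon> v x - v x\<bar> \<partial>lborel)"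
        by (intro nn_integral_mono ennreal_leI) (auto simp: indicator_def m0)
      also have "\<dots> \<le> ennreal e" by (rule d(2)[OF \<epsilon>(1,2)])
      finally show ?thesis .
    qed
    have "(\<integral>\<^sup>+x. ennreal (indicator (S k) x * \<bar>v x\<bar>) \<partial>lborel) \<le> 0"
      by (rule ennreal_le_epsilon) (use le in auto)
    then have "(\<integral>\<^sup>+x. ennreal (indicator (S k) x * \<bar>v x\<bar>) \<partial>lborel) = 0" by simp
    then have "AE x in lborel. ennreal (indicator (S k) x * \<bar>v x\<bar>) = 0"
      by (subst (asm) nn_integral_0_iff_AE) auto
    then show ?thesis by (rule eventually_mono) (auto simp: indicator_def ennreal_eq_0_iff split: if_splits)
  qed
  have "AE x in lborel. \<forall>k. x \<in> S k \<longrightarrow> v x = 0" by (subst AE_all_countable) (use zero in blast)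
  then show ?thesis
  proof (rule eventually_mono, intro impI)
    fix x assume a: "\<forall>k. x \<in> S k \<longrightarrow> v x = 0" and x: "x \<in> O1"
    have "infdist x (- O1) \<noteq> 0" using in_closed_iff_infdist_zero[of "- O1" x] O(1) ne x by auto
    then have "infdist x (- O1) > 0" using infdist_nonneg[of x "- O1"] by linarith
    then obtain k where "inverse (real (Suc k)) < infdist x (- O1)" using reals_Archimedean by blast
    then show "v x = 0" using a by (auto simp: S_def)
  qed
qed

text \<open>Bumps are test functions, so the difference of two weak divergences has vanishing
  averages inside the domain. This gives \<open>weak_div\<close>, a definite description, its
  meaning.\<close>

lemma has_weak_div_unique:
  fixes \<Omega> :: "'a::euclidean_space set"
  assumes \<Omega>: "open \<Omega>" "bounded \<Omega>" and w: "has_weak_div \<Omega> \<tau> w1" "has_weak_div \<Omega> \<tau> w2"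
  shows "w1 = w2"
proof -
  define W where "W = w1 - w2"
  have L2: "w1 \<in> L2_on \<Omega>" "w2 \<in> L2_on \<Omega>" using w by (auto simp: has_weak_div_def)
  then have WL2: "W \<in> L2_on \<Omega>" unfolding W_def using subspace_L2_on by (rule subspace_diff[rotated])
  have Wm: "rep_lsq W \<in> borel_measurable lebesgue" using sq_integrable_rep[of W] by (simp add: sq_integrable_def)
  obtain v0 where v0: "v0 \<in> borel_measurable borel" "AE x in lebesgue. rep_lsq W x = v0 x"
    by (rule borel_representative[OF Wm])
  define v where "v x = indicator \<Omega> x * v0 x" for x
  have \<Omega>b [measurable]: "\<Omega> \<in> sets borel" using \<Omega> by simp
  have vm [measurable]: "v \<in> borel_measurable borel" unfolding v_def using v0(1) by measurable
  have Wv: "AE x in lebesgue. rep_lsq W x = v x"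
    using v0(2) WL2 unfolding L2_on_def by (auto simp: v_def indicator_def)
  have v2: "integrable lborel (\<lambda>x. (norm (v x))\<^sup>2)"
    by (rule sq_integrable_borel(1)[OF sq_integrable_rep vm Wv])
  have vi: "integrable lborel v"
  proof (rule Bochner_Integration.integrable_bound)
    have "integrable lborel (indicat_real \<Omega>)"
      using emeasure_bounded_finite[OF \<Omega>(2)] by (intro integrable_real_indicator) auto
    then show "integrable lborel (\<lambda>x. indicat_real \<Omega> x + (norm (v x))\<^sup>2)" using v2 by (rule Bochner_Integration.integrable_add)
    show "AE x in lborel. norm (v x) \<le> norm (indicat_real \<Omega> x + (norm (v x))\<^sup>2)"
    proof (rule AE_I2)
      fix x
      have "0 \<le> (\<bar>v x\<bar> - 1)\<^sup>2" by simp
      then have "2 * \<bar>v x\<bar> \<le> 1 + (v x)\<^sup>2" by (simp add: power2_eq_square algebra_simps)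
      then have "\<bar>v x\<bar> \<le> 1 + (v x)\<^sup>2" using abs_ge_zero[of "v x"] by linarith
      then show "norm (v x) \<le> norm (indicat_real \<Omega> x + (norm (v x))\<^sup>2)"
        by (cases "x \<in> \<Omega>") (auto simp: v_def)
    qed
  qed simp
  have "AE x in lborel. x \<in> \<Omega> \<longrightarrow> v x = 0"
  proof (rule vanishing_bump_averages[OF \<Omega> vi])
    fix x :: 'a and \<epsilon> :: real assume e: "\<epsilon> > 0" "cball x \<epsilon> \<subseteq> \<Omega>"
    have t: "test_function \<Omega> (bump 0 \<epsilon> x)" by (rule test_function_bump[OF e])
    have m: "bump 0 \<epsilon> x \<in> borel_measurable borel" using continuous_bump by (rule borel_measurable_continuous_onI)
    have int: "integrable lebesgue (\<lambda>y. rep_lsq w y * bump 0 \<epsilon> x y)" for w :: "('a, real) lsq"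
      using sq_integrable_inner[OF sq_integrable_rep[of w] test_function_sq_integrable(1)[OF t]] by simp
    have "(LINT y|lebesgue. rep_lsq w1 y * bump 0 \<epsilon> x y) = (LINT y|lebesgue. rep_lsq w2 y * bump 0 \<epsilon> x y)"
      using w t unfolding has_weak_div_iff[OF \<Omega>(1)] by auto
    then have "0 = (LINT y|lebesgue. rep_lsq w1 y * bump 0 \<epsilon> x y - rep_lsq w2 y * bump 0 \<epsilon> x y)"
      using int by simp
    also have "\<dots> = (\<integral>y. v y * bump 0 \<epsilon> x y \<partial>lborel)"
    proof (rule integral_lebesgue_borel)
      show "(\<lambda>y. rep_lsq w1 y * bump 0 \<epsilon> x y - rep_lsq w2 y * bump 0 \<epsilon> x y) \<in> borel_measurable lebesgue"
        using int by (intro borel_measurable_diff borel_measurable_integrable)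
      show "(\<lambda>y. v y * bump 0 \<epsilon> x y) \<in> borel_measurable borel" using m by measurable
      show "AE y in lebesgue. rep_lsq w1 y * bump 0 \<epsilon> x y - rep_lsq w2 y * bump 0 \<epsilon> x y = v y * bump 0 \<epsilon> x y"
        using Wv AE_rep_diff[of w1 w2] unfolding W_def by eventually_elim (simp add: left_diff_distrib[symmetric])
    qed
    finally show "(\<integral>y. v y * bump 0 \<epsilon> x y \<partial>lborel) = 0" by simp
  qed
  then have "AE x in lebesgue. x \<in> \<Omega> \<longrightarrow> v x = 0" by (rule AE_completion)
  then have "AE x in lebesgue. rep_lsq W x = rep_lsq 0 x"
    using Wv AE_rep_0 by eventually_elim (auto simp: v_def indicator_def split: if_splits)
  then have "W = 0" by (rule lsq_eqI)
  then show ?thesis by (simp add: W_def)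
qed

lemma weak_div_eqI:
  assumes "open \<Omega>" "bounded \<Omega>" "has_weak_div \<Omega> \<tau> w"
  shows "weak_div \<Omega> \<tau> = w"
  unfolding weak_div_def using assms has_weak_div_unique by blast

lemma has_weak_div_weak_div:
  assumes "open \<Omega>" "bounded \<Omega>" "\<tau> \<in> Hdiv \<Omega>"
  shows "has_weak_div \<Omega> \<tau> (weak_div \<Omega> \<tau>)"
  using assms weak_div_eqI by (auto simp: Hdiv_def)

lemma has_weak_div_linear:
  fixes \<Omega> :: "'a::euclidean_space set"
  assumes \<Omega>: "open \<Omega>"
  shows "has_weak_div \<Omega> \<tau> w \<Longrightarrow> has_weak_div \<Omega> \<tau>' w' \<Longrightarrow> has_weak_div \<Omega> (\<tau> + \<tau>') (w + w')"
    and "has_weak_div \<Omega> \<tau> w \<Longrightarrow> has_weak_div \<Omega> (c *\<^sub>R \<tau>) (c *\<^sub>R w)"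
proof -
  have intg: "integrable lebesgue (\<lambda>x. rep_lsq \<tau> x \<bullet> grad \<phi> x)"
    and intf: "integrable lebesgue (\<lambda>x. rep_lsq w x * \<phi> x)" if "test_function \<Omega> \<phi>"
    for \<tau> :: "('a, 'a) lsq" and w :: "('a, real) lsq" and \<phi>
    using sq_integrable_inner[OF sq_integrable_rep[of \<tau>] test_function_sq_integrable(2)[OF that]]
      sq_integrable_inner[OF sq_integrable_rep[of w] test_function_sq_integrable(1)[OF that]] by auto
  have cg: "(LINT x|lebesgue. rep_lsq \<tau> x \<bullet> grad \<phi> x) = (LINT x|lebesgue. f x \<bullet> grad \<phi> x)"
    if "test_function \<Omega> \<phi>" "AE x in lebesgue. rep_lsq \<tau> x = f x" "integrable lebesgue (\<lambda>x. f x \<bullet> grad \<phi> x)"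
    for \<tau> :: "('a, 'a) lsq" and f \<phi>
    using that by (intro integral_cong_AE borel_measurable_integrable intg) auto
  have cf: "(LINT x|lebesgue. rep_lsq w x * \<phi> x) = (LINT x|lebesgue. f x * \<phi> x)"
    if "test_function \<Omega> \<phi>" "AE x in lebesgue. rep_lsq w x = f x" "integrable lebesgue (\<lambda>x. f x * \<phi> x)"
    for w :: "('a, real) lsq" and f \<phi>
    using that by (intro integral_cong_AE borel_measurable_integrable intf) auto
  show "has_weak_div \<Omega> (\<tau> + \<tau>') (w + w')" if h: "has_weak_div \<Omega> \<tau> w" "has_weak_div \<Omega> \<tau>' w'"
    unfolding has_weak_div_iff[OF \<Omega>]
  proof (intro conjI allI impI)
    show "w + w' \<in> L2_on \<Omega>" using h unfolding has_weak_div_def by (auto intro: subspace_add[OF subspace_L2_on])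
    fix \<phi> assume t: "test_function \<Omega> \<phi>"
    have "(LINT x|lebesgue. rep_lsq (\<tau> + \<tau>') x \<bullet> grad \<phi> x) = (LINT x|lebesgue. (rep_lsq \<tau> x + rep_lsq \<tau>' x) \<bullet> grad \<phi> x)"
      using intg[OF t] by (intro cg[OF t AE_rep_add]) (simp add: inner_add_left)
    also have "\<dots> = (LINT x|lebesgue. rep_lsq \<tau> x \<bullet> grad \<phi> x) + (LINT x|lebesgue. rep_lsq \<tau>' x \<bullet> grad \<phi> x)"
      using intg[OF t] by (simp add: inner_add_left)
    also have "\<dots> = - ((LINT x|lebesgue. rep_lsq w x * \<phi> x) + (LINT x|lebesgue. rep_lsq w' x * \<phi> x))"
      using h t unfolding has_weak_div_iff[OF \<Omega>] by simp
    also have "\<dots> = - (LINT x|lebesgue. (rep_lsq w x + rep_lsq w' x) * \<phi> x)"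
      using intf[OF t] by (simp add: distrib_right)
    also have "\<dots> = - (LINT x|lebesgue. rep_lsq (w + w') x * \<phi> x)"
      using intf[OF t] by (subst cf[OF t AE_rep_add]) (simp_all add: distrib_right)
    finally show "(LINT x|lebesgue. rep_lsq (\<tau> + \<tau>') x \<bullet> grad \<phi> x) = - (LINT x|lebesgue. rep_lsq (w + w') x * \<phi> x)" .
  qed
  show "has_weak_div \<Omega> (c *\<^sub>R \<tau>) (c *\<^sub>R w)" if h: "has_weak_div \<Omega> \<tau> w"
    unfolding has_weak_div_iff[OF \<Omega>]
  proof (intro conjI allI impI)
    show "c *\<^sub>R w \<in> L2_on \<Omega>" using h unfolding has_weak_div_def by (auto intro: subspace_scale[OF subspace_L2_on])
    fix \<phi> assume t: "test_function \<Omega> \<phi>"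
    have "(LINT x|lebesgue. rep_lsq (c *\<^sub>R \<tau>) x \<bullet> grad \<phi> x) = (LINT x|lebesgue. (c *\<^sub>R rep_lsq \<tau> x) \<bullet> grad \<phi> x)"
      using intg[OF t] by (intro cg[OF t AE_rep_scaleR]) simp
    also have "\<dots> = c * (LINT x|lebesgue. rep_lsq \<tau> x \<bullet> grad \<phi> x)" by simp
    also have "\<dots> = - (LINT x|lebesgue. (c *\<^sub>R rep_lsq w x) * \<phi> x)"
      using h t unfolding has_weak_div_iff[OF \<Omega>] by (simp add: mult.assoc)
    also have "\<dots> = - (LINT x|lebesgue. rep_lsq (c *\<^sub>R w) x * \<phi> x)"
      using intf[OF t, of w] by (subst cf[OF t AE_rep_scaleR]) (simp_all add: mult.assoc)
    finally show "(LINT x|lebesgue. rep_lsq (c *\<^sub>R \<tau>) x \<bullet> grad \<phi> x) = - (LINT x|lebesgue. rep_lsq (c *\<^sub>R w) x * \<phi> x)" .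
  qed
qed

lemma Hdiv_linear:
  fixes \<Omega> :: "'a::euclidean_space set"
  assumes \<Omega>: "open \<Omega>" "bounded \<Omega>"
  shows "subspace (Hdiv \<Omega>)"
    and "\<tau> \<in> Hdiv \<Omega> \<Longrightarrow> \<tau>' \<in> Hdiv \<Omega> \<Longrightarrow> weak_div \<Omega> (\<tau> + \<tau>') = weak_div \<Omega> \<tau> + weak_div \<Omega> \<tau>'"
    and "\<tau> \<in> Hdiv \<Omega> \<Longrightarrow> weak_div \<Omega> (c *\<^sub>R \<tau>) = c *\<^sub>R weak_div \<Omega> \<tau>"
proof -
  note lin = has_weak_div_linear[OF \<Omega>(1)] and wd = has_weak_div_weak_div[OF \<Omega>]
  show "subspace (Hdiv \<Omega>)"
  proof (rule subspaceI)
    have "has_weak_div \<Omega> 0 0"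
      unfolding has_weak_div_iff[OF \<Omega>(1)]
    proof (intro conjI allI impI)
      show "0 \<in> L2_on \<Omega>" by (rule subspace_0[OF subspace_L2_on])
      fix \<phi> :: "'a \<Rightarrow> real" assume "test_function \<Omega> \<phi>"
      have z: "AE x in lebesgue. rep_lsq (0 :: ('a, 'a) lsq) x = 0" "AE x in lebesgue. rep_lsq (0 :: ('a, real) lsq) x = 0"
        by (rule AE_rep_0)+
      have "(LINT x|lebesgue. rep_lsq 0 x \<bullet> grad \<phi> x) = 0"
        by (intro integral_eq_zero_AE eventually_mono[OF z(1)]) simp
      moreover have "(LINT x|lebesgue. rep_lsq 0 x * \<phi> x) = 0"
        by (intro integral_eq_zero_AE eventually_mono[OF z(2)]) simp
      ultimately show "(LINT x|lebesgue. rep_lsq 0 x \<bullet> grad \<phi> x) = - (LINT x|lebesgue. rep_lsq 0 x * \<phi> x)" by simp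
    qed
    then show "0 \<in> Hdiv \<Omega>" unfolding Hdiv_def using subspace_0[OF subspace_L2_on] by blast
    show "x + y \<in> Hdiv \<Omega>" if "x \<in> Hdiv \<Omega>" "y \<in> Hdiv \<Omega>" for x y
      using that lin(1) subspace_add[OF subspace_L2_on] unfolding Hdiv_def by blast
    show "c *\<^sub>R x \<in> Hdiv \<Omega>" if "x \<in> Hdiv \<Omega>" for c x
      using that lin(2) subspace_scale[OF subspace_L2_on] unfolding Hdiv_def by blast
  qed
  show "weak_div \<Omega> (\<tau> + \<tau>') = weak_div \<Omega> \<tau> + weak_div \<Omega> \<tau>'" if "\<tau> \<in> Hdiv \<Omega>" "\<tau>' \<in> Hdiv \<Omega>"
    by (rule weak_div_eqI[OF \<Omega> lin(1)[OF wd[OF that(1)] wd[OF that(2)]]])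
  show "weak_div \<Omega> (c *\<^sub>R \<tau>) = c *\<^sub>R weak_div \<Omega> \<tau>" if "\<tau> \<in> Hdiv \<Omega>"
    by (rule weak_div_eqI[OF \<Omega> lin(2)[OF wd[OF that]]])
qed

text \<open>These are the fields with which the flux equation is tested in order to read off the
  weak gradient of \<open>u\<close>: the divergence of a bump times a fixed vector is the
  directional derivative of the bump.\<close>

lemma bump_field_weak_div:
  fixes \<Omega> :: "'a::euclidean_space set" and b :: 'a
  assumes \<Omega>: "open \<Omega>" "bounded \<Omega>" and e: "\<epsilon> > 0" "cball x \<epsilon> \<subseteq> \<Omega>"
  defines "\<tau> \<equiv> abs_lsq (\<lambda>y. bump 0 \<epsilon> x y *\<^sub>R b)"
  shows "\<tau> \<in> Hdiv \<Omega>" "weak_div \<Omega> \<tau> = abs_lsq (\<lambda>y. bump_grad \<epsilon> x y \<bullet> b)"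
    "AE y in lebesgue. rep_lsq \<tau> y = bump 0 \<epsilon> x y *\<^sub>R b"
    "AE y in lebesgue. rep_lsq (weak_div \<Omega> \<tau>) y = bump_grad \<epsilon> x y \<bullet> b"
proof -
  let ?w = "abs_lsq (\<lambda>y. bump_grad \<epsilon> x y \<bullet> b)"
  have supp: "bump m \<epsilon> x y = 0" "bump_grad \<epsilon> x y = 0" if "y \<notin> cball x \<epsilon>" for m y
    using bump_support[of m \<epsilon> x y] bump_support[of 2 \<epsilon> x y] e(1) that by (auto simp: bump_grad_def)
  have s1: "sq_integrable (\<lambda>y. bump 0 \<epsilon> x y *\<^sub>R b)"
    by (rule sq_integrable_continuous[OF _ _ compact_cball[of x \<epsilon>]])
       (use supp in \<open>auto intro!: continuous_intros continuous_bump\<close>)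
  have s2: "sq_integrable (\<lambda>y. bump_grad \<epsilon> x y \<bullet> b)"
    by (rule sq_integrable_continuous[OF _ _ compact_cball[of x \<epsilon>]])
       (auto intro!: continuous_intros continuous_bump_grad, metis inner_zero_left mem_cball supp(2))
  show r1: "AE y in lebesgue. rep_lsq \<tau> y = bump 0 \<epsilon> x y *\<^sub>R b" unfolding \<tau>_def by (rule AE_rep_abs[OF s1])
  have r2: "AE y in lebesgue. rep_lsq ?w y = bump_grad \<epsilon> x y \<bullet> b" by (rule AE_rep_abs[OF s2])
  have out: "y \<notin> \<Omega> \<Longrightarrow> y \<notin> cball x \<epsilon>" for y using e(2) by blast
  have tL2: "\<tau> \<in> L2_on \<Omega>" unfolding L2_on_def using r1 supp out by (auto elim!: eventually_mono)
  have hw: "has_weak_div \<Omega> \<tau> ?w"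
    unfolding has_weak_div_iff[OF \<Omega>(1)]
  proof (intro conjI allI impI)
    show "?w \<in> L2_on \<Omega>" unfolding L2_on_def using r2 supp out by (auto elim!: eventually_mono)
    fix \<phi> assume t: "test_function \<Omega> \<phi>"
    note tg = test_function_grad[OF t] and ts = test_function_sq_integrable[OF t]
    let ?G = "\<lambda>y. bump 0 \<epsilon> x y *\<^sub>R grad \<phi> y + \<phi> y *\<^sub>R bump_grad \<epsilon> x y"
    \<comment> \<open>The product of bump and test function has compact support, so its derivative
      in direction \<open>b\<close> integrates to zero; the product rule splits this into the two
      sides of the definition.\<close>
    have "((\<lambda>y. bump 0 \<epsilon> x y * \<phi> y) has_derivative (\<lambda>v. ?G y \<bullet> v)) (at y)" for y
      using has_derivative_mult[OF bump_grad_derivative tg(1)] by (simp add: inner_add_left algebra_simps)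
    moreover have "continuous_on UNIV ?G" by (intro continuous_intros continuous_bump continuous_bump_grad tg)
    moreover have "norm y \<le> norm x + \<epsilon>" if "bump 0 \<epsilon> x y * \<phi> y \<noteq> 0 \<or> ?G y \<noteq> 0" for y
    proof -
      have "y \<in> cball x \<epsilon>" using that supp[of y] by force
      then show ?thesis using norm_triangle_ineq2[of y x] by (simp add: dist_norm norm_minus_commute)
    qed
    ultimately have "(\<integral>y. ?G y \<bullet> b \<partial>lborel) = 0" by (rule integral_deriv_compact_support)
    moreover have "continuous_on UNIV (\<lambda>y. ?G y \<bullet> b)" by (intro continuous_intros continuous_bump continuous_bump_grad tg)
    ultimately have z: "(LINT y|lebesgue. ?G y \<bullet> b) = 0"
      by (subst integral_completion) (auto intro: borel_measurable_continuous_onI)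
    have i1: "integrable lebesgue (\<lambda>y. (bump 0 \<epsilon> x y *\<^sub>R b) \<bullet> grad \<phi> y)" using sq_integrable_inner[OF s1 ts(2)] .
    have i2: "integrable lebesgue (\<lambda>y. (bump_grad \<epsilon> x y \<bullet> b) * \<phi> y)" using sq_integrable_inner[OF s2 ts(1)] by simp
    have "(\<lambda>y. ?G y \<bullet> b) = (\<lambda>y. (bump 0 \<epsilon> x y *\<^sub>R b) \<bullet> grad \<phi> y + (bump_grad \<epsilon> x y \<bullet> b) * \<phi> y)"
      by (rule ext) (simp add: inner_add_left inner_commute[of b "grad \<phi> _"] mult.commute)
    then have "(LINT y|lebesgue. (bump 0 \<epsilon> x y *\<^sub>R b) \<bullet> grad \<phi> y) + (LINT y|lebesgue. (bump_grad \<epsilon> x y \<bullet> b) * \<phi> y) = 0"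
      using z Bochner_Integration.integral_add[OF i1 i2] by simp
    moreover have "(LINT y|lebesgue. rep_lsq \<tau> y \<bullet> grad \<phi> y) = (LINT y|lebesgue. (bump 0 \<epsilon> x y *\<^sub>R b) \<bullet> grad \<phi> y)"
      using r1 i1 sq_integrable_inner[OF sq_integrable_rep ts(2)]
      by (intro integral_cong_AE) (auto intro!: borel_measurable_integrable elim!: eventually_mono)
    moreover have "(LINT y|lebesgue. rep_lsq ?w y * \<phi> y) = (LINT y|lebesgue. (bump_grad \<epsilon> x y \<bullet> b) * \<phi> y)"
      using r2 i2 sq_integrable_inner[OF sq_integrable_rep[of ?w] ts(1)]
      by (intro integral_cong_AE) (auto intro!: borel_measurable_integrable elim!: eventually_mono)
    ultimately show "(LINT y|lebesgue. rep_lsq \<tau> y \<bullet> grad \<phi> y) = - (LINT y|lebesgue. rep_lsq ?w y * \<phi> y)" by simp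
  qed
  show "\<tau> \<in> Hdiv \<Omega>" unfolding Hdiv_def using hw tL2 by blast
  show wd: "weak_div \<Omega> \<tau> = ?w" by (rule weak_div_eqI[OF \<Omega> hw])
  show "AE y in lebesgue. rep_lsq (weak_div \<Omega> \<tau>) y = bump_grad \<epsilon> x y \<bullet> b" unfolding wd by (rule r2)
qed

section \<open>Cellwise operators and the eigenvalue bound\<close>

text \<open>Near a boundary point the domain lies strictly on one side of a graph, so points just
  beyond the graph have a neighbourhood free of the domain and the boundary point cannot be interior
  to the closure. This excludes slits: the cells cover the closure, and their interiors must lie in
  the domain itself for fields supported in a cell to be admissible.\<close>

lemma interior_closure_lipschitz_boundary:
  fixes \<Omega> :: "'a::euclidean_space set"
  assumes "open \<Omega>" "lipschitz_boundary \<Omega>"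
  shows "interior (closure \<Omega>) \<subseteq> \<Omega>"
proof
  fix z assume z: "z \<in> interior (closure \<Omega>)"
  show "z \<in> \<Omega>"
  proof (rule ccontr)
    assume nz: "z \<notin> \<Omega>"
    have "z \<in> closure \<Omega>" using z interior_subset by blast
    then have "z \<in> frontier \<Omega>" using nz assms(1) by (simp add: frontier_def interior_open)
    from bspec[OF assms(2)[unfolded lipschitz_boundary_def] this]
    obtain e g L N where e: "norm e = 1" and g: "L-lipschitz_on {y. y \<bullet> e = 0} g" and N: "open N" "z \<in> N"
      "\<Omega> \<inter> N = {y \<in> N. g (y - (y \<bullet> e) *\<^sub>R e) < y \<bullet> e}"
      by (elim exE conjE)
    have ee: "e \<bullet> e = 1" using e by (simp add: norm_eq_1)
    define G where "G y = g (y - (y \<bullet> e) *\<^sub>R e) - y \<bullet> e" for y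
    have "continuous_on {y. y \<bullet> e = 0} g" using g by (rule lipschitz_on_continuous_on)
    then have cG: "continuous_on UNIV G" unfolding G_def
      by (intro continuous_intros continuous_on_compose2[where s = UNIV and f = "\<lambda>y. y - (y \<bullet> e) *\<^sub>R e"])
         (auto simp: inner_diff_left ee)
    have Gz: "G z \<ge> 0"
    proof (rule ccontr)
      assume "\<not> ?thesis"
      then have "z \<in> \<Omega> \<inter> N" unfolding N(3) using N(2) by (simp add: G_def)
      then show False using nz by simp
    qed
    have "open (interior (closure \<Omega>) \<inter> N)" using N(1) by auto
    then obtain r where r: "r > 0" "ball z r \<subseteq> interior (closure \<Omega>) \<inter> N"
      using z N(2) open_contains_ball by blast
    \<comment> \<open>Moving down along \<open>e\<close> keeps the projection to the hyperplane and
      raises \<open>G\<close> by \<open>r / 2\<close>, which makes it positive.\<close>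
    define y where "y = z - (r / 2) *\<^sub>R e"
    have "y \<in> ball z r" using r(1) e by (simp add: y_def dist_norm)
    then have yI: "y \<in> interior (closure \<Omega>)" and yN: "y \<in> N" using r(2) by auto
    have "y \<in> closure \<Omega>" by (rule subsetD[OF interior_subset yI])
    note y = this yN
    have ye: "y \<bullet> e = z \<bullet> e - r / 2" by (simp add: y_def inner_diff_left ee)
    have "y - (y \<bullet> e) *\<^sub>R e = z - (z \<bullet> e) *\<^sub>R e"
      unfolding ye unfolding y_def by (simp add: scaleR_diff_left)
    with ye have "G y > 0" using Gz r(1) by (simp add: G_def)
    define W where "W = {x. 0 < G x} \<inter> N"
    have "open W" unfolding W_def using cG N(1) by (intro open_Int open_Collect_less) auto
    moreover have "y \<in> W" using \<open>G y > 0\<close> y(2) by (simp add: W_def)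
    moreover have "W \<inter> \<Omega> = {}"
    proof (rule ccontr)
      assume "W \<inter> \<Omega> \<noteq> {}"
      then obtain x where x: "x \<in> N" "0 < G x" "x \<in> \<Omega>" by (auto simp: W_def)
      then have "x \<in> {y \<in> N. g (y - (y \<bullet> e) *\<^sub>R e) < y \<bullet> e}" using N(3) by blast
      then show False using x(2) by (simp add: G_def)
    qed
    ultimately show False using y(1) open_Int_closure_eq_empty[of W \<Omega>] by blast
  qed
qed

lemma sq_integrable_bounded_linear:
  assumes "bounded_linear L" "sq_integrable f"
  shows "sq_integrable (\<lambda>x. L (f x))"
proof -
  obtain K where K: "\<And>v. norm (L v) \<le> norm v * K" "K \<ge> 0" using bounded_linear.nonneg_bounded[OF assms(1)] by blast
  have f [measurable]: "f \<in> borel_measurable lebesgue" using assms(2) by (simp add: sq_integrable_def)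
  have "L \<in> borel_measurable borel"
    using assms(1) by (intro borel_measurable_continuous_onI linear_continuous_on)
  from measurable_compose[OF f this] have m [measurable]: "(\<lambda>x. L (f x)) \<in> borel_measurable lebesgue" .
  have "integrable lebesgue (\<lambda>x. (norm (L (f x)))\<^sup>2)"
  proof (rule Bochner_Integration.integrable_bound)
    show "integrable lebesgue (\<lambda>x. K\<^sup>2 * (norm (f x))\<^sup>2)" using assms(2) by (simp add: sq_integrable_def)
    have "(norm (L v))\<^sup>2 \<le> K\<^sup>2 * (norm v)\<^sup>2" for v
      using power_mono[OF K(1)[of v], of 2] by (simp add: power_mult_distrib mult.commute)
    then show "AE x in lebesgue. norm ((norm (L (f x)))\<^sup>2) \<le> norm (K\<^sup>2 * (norm (f x))\<^sup>2)" by (intro AE_I2) simp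
  qed measurable
  then show ?thesis using m by (simp add: sq_integrable_def)
qed

lemma sq_integrable_indicator:
  assumes "S \<in> sets lebesgue" "sq_integrable f"
  shows "sq_integrable (\<lambda>x. indicat_real S x *\<^sub>R f x)"
proof -
  have f [measurable]: "f \<in> borel_measurable lebesgue" using assms(2) by (simp add: sq_integrable_def)
  have [measurable]: "S \<in> sets lebesgue" by fact
  have m: "(\<lambda>x. indicat_real S x *\<^sub>R f x) \<in> borel_measurable lebesgue" by measurable
  have "integrable lebesgue (\<lambda>x. (norm (indicat_real S x *\<^sub>R f x))\<^sup>2)"
    by (rule Bochner_Integration.integrable_bound[of _ "\<lambda>x. (norm (f x))\<^sup>2"])
       (use assms(2) in \<open>auto simp: sq_integrable_def indicator_def intro!: AE_I2\<close>)
  then show ?thesis using m by (simp add: sq_integrable_def)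
qed

lemma sq_integrable_sum:
  assumes "\<And>i. i \<in> I \<Longrightarrow> sq_integrable (f i)"
  shows "sq_integrable (\<lambda>x. \<Sum>i\<in>I. f i x)"
proof (cases "finite I")
  case True
  then show ?thesis using assms
    by (induction I rule: finite_induct) (auto intro: sq_integrable_0 sq_integrable_add)
qed (simp add: sq_integrable_0)

section \<open>Operators acting cell by cell\<close>

text \<open>The Lipschitz boundary enters through the last assumption.\<close>

locale partitioned_domain =
  fixes \<Omega> :: "'a::euclidean_space set" and \<T> :: "'a set set"
  assumes \<Omega>_open: "open \<Omega>" and \<Omega>_bounded: "bounded \<Omega>" and partition: "polytopal_partition \<T> (closure \<Omega>)"
    and interior_cell: "\<And>T. T \<in> \<T> \<Longrightarrow> interior T \<subseteq> \<Omega>"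
begin

lemma cells: "finite \<T>" "T \<in> \<T> \<Longrightarrow> compact T" "T \<in> \<T> \<Longrightarrow> convex T" "T \<in> \<T> \<Longrightarrow> interior T \<noteq> {}"
  "T \<in> \<T> \<Longrightarrow> T' \<in> \<T> \<Longrightarrow> T \<noteq> T' \<Longrightarrow> interior T \<inter> interior T' = {}" "\<Union>\<T> = closure \<Omega>"
  using partition unfolding polytopal_partition_def by (auto intro: polytope_imp_compact polytope_imp_convex)

lemma AE_interior_cell: "AE x in lebesgue. \<forall>T\<in>\<T>. x \<in> T \<longrightarrow> x \<in> interior T"
proof (rule AE_finite_allI[OF cells(1)])
  fix T assume T: "T \<in> \<T>"
  have "negligible (frontier T)" by (rule negligible_convex_frontier[OF cells(3)[OF T]])
  then have "AE x in lebesgue. x \<notin> frontier T" by (intro AE_not_in) (simp add: negligible_iff_null_sets)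
  then show "AE x in lebesgue. x \<in> T \<longrightarrow> x \<in> interior T"
    by (rule eventually_mono) (use closure_subset in \<open>auto simp: frontier_def\<close>)
qed

lemma AE_cell: "AE x in lebesgue. x \<in> \<Omega> \<longrightarrow> (\<exists>T\<in>\<T>. x \<in> interior T)"
  using AE_interior_cell
proof (rule eventually_mono, intro impI)
  fix x assume "\<forall>T\<in>\<T>. x \<in> T \<longrightarrow> x \<in> interior T" "x \<in> \<Omega>"
  moreover have "x \<in> \<Union>\<T>" using \<open>x \<in> \<Omega>\<close> cells(6) closure_subset by blast
  ultimately show "\<exists>T\<in>\<T>. x \<in> interior T" by blast
qed

lemma sum_indicator_cells:
  fixes f :: "'a set \<Rightarrow> 'b::real_vector"
  assumes "T \<in> \<T>" "x \<in> interior T"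
  shows "(\<Sum>T'\<in>\<T>. indicat_real (interior T') x *\<^sub>R f T') = f T"
proof -
  have "(\<Sum>T'\<in>\<T>. indicat_real (interior T') x *\<^sub>R f T') = (\<Sum>T'\<in>\<T>. if T' = T then f T else 0)"
    using assms cells(5) by (intro sum.cong) (auto simp: indicator_def)
  then show ?thesis using assms(1) cells(1) by simp
qed

lemma sum_indicator_outside:
  fixes f :: "'a set \<Rightarrow> 'b::real_vector"
  assumes "x \<notin> \<Omega>"
  shows "(\<Sum>T'\<in>\<T>. indicat_real (interior T') x *\<^sub>R f T') = 0"
proof (rule sum.neutral, intro ballI)
  fix T assume "T \<in> \<T>"
  then have "x \<notin> interior T" using interior_cell assms by blast
  then show "indicat_real (interior T) x *\<^sub>R f T = 0" by simp
qed

text \<open>Turns multiplication by piecewise constant coefficients into an operator on classes of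
  functions, so that both weighted forms become plain inner products. Interiors of cells are used
  because the closed cells overlap in their boundaries, where terms would be counted twice.\<close>

definition cellwise :: "('a set \<Rightarrow> 'b \<Rightarrow> 'b) \<Rightarrow> ('a, 'b::euclidean_space) lsq \<Rightarrow> ('a, 'b) lsq" where
  "cellwise L X = abs_lsq (\<lambda>x. \<Sum>T\<in>\<T>. indicat_real (interior T) x *\<^sub>R L T (rep_lsq X x))"

lemma cellwise_sq:
  assumes "\<forall>T\<in>\<T>. bounded_linear (L T)"
  shows "sq_integrable (\<lambda>x. \<Sum>T\<in>\<T>. indicat_real (interior T) x *\<^sub>R L T (rep_lsq X x))"
proof (rule sq_integrable_sum)
  fix T assume T: "T \<in> \<T>"
  show "sq_integrable (\<lambda>x. indicat_real (interior T) x *\<^sub>R L T (rep_lsq X x))"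
    by (rule sq_integrable_indicator[OF _ sq_integrable_bounded_linear[OF bspec[OF assms T] sq_integrable_rep]]) auto
qed

lemma AE_cellwise:
  assumes "\<forall>T\<in>\<T>. bounded_linear (L T)"
  shows "AE x in lebesgue. rep_lsq (cellwise L X) x = (\<Sum>T\<in>\<T>. indicat_real (interior T) x *\<^sub>R L T (rep_lsq X x))"
  unfolding cellwise_def by (rule AE_rep_abs[OF cellwise_sq[where L = L, OF assms]])

lemma AE_cellwise_cell:
  assumes "\<forall>T\<in>\<T>. bounded_linear (L T)"
  shows "AE x in lebesgue. (\<forall>T\<in>\<T>. x \<in> interior T \<longrightarrow> rep_lsq (cellwise L X) x = L T (rep_lsq X x)) \<and>
     (x \<notin> \<Omega> \<longrightarrow> rep_lsq (cellwise L X) x = 0)"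
  using AE_cellwise[where L = L and X = X, OF assms]
  by (rule eventually_mono) (auto simp: sum_indicator_cells sum_indicator_outside)

lemma cellwise_L2_on:
  assumes "\<forall>T\<in>\<T>. bounded_linear (L T)" shows "cellwise L X \<in> L2_on \<Omega>"
  unfolding L2_on_def using AE_cellwise_cell[where L = L and X = X, OF assms] by (auto elim: eventually_mono)

lemma cellwise_eqI:
  assumes "\<forall>T\<in>\<T>. bounded_linear (L T)" "Y \<in> L2_on \<Omega>"
    and "AE x in lebesgue. \<forall>T\<in>\<T>. x \<in> interior T \<longrightarrow> rep_lsq Y x = L T (rep_lsq X x)"
  shows "cellwise L X = Y"
proof (rule lsq_eqI)
  have "AE x in lebesgue. x \<notin> \<Omega> \<longrightarrow> rep_lsq Y x = 0" using assms(2) by (simp add: L2_on_def)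
  with AE_cellwise_cell[where L = L and X = X, OF assms(1)] assms(3) AE_cell
  show "AE x in lebesgue. rep_lsq (cellwise L X) x = rep_lsq Y x"
    by eventually_elim metis
qed

lemma cellwise_add:
  assumes "\<forall>T\<in>\<T>. bounded_linear (L T)"
  shows "cellwise L (X + Y) = cellwise L X + cellwise L Y"
proof (rule cellwise_eqI[where L = L, OF assms])
  show "cellwise L X + cellwise L Y \<in> L2_on \<Omega>"
    by (intro subspace_add[OF subspace_L2_on] cellwise_L2_on assms)
  show "AE x in lebesgue. \<forall>T\<in>\<T>. x \<in> interior T \<longrightarrow> rep_lsq (cellwise L X + cellwise L Y) x = L T (rep_lsq (X + Y) x)"
    using AE_cellwise_cell[where L = L and X = X, OF assms] AE_cellwise_cell[where L = L and X = Y, OF assms] AE_rep_add[of X Y]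
      AE_rep_add[of "cellwise L X" "cellwise L Y"]
    by eventually_elim (auto simp: linear_add bounded_linear.linear assms[rule_format])
qed

lemma cellwise_inner_cong:
  assumes bl: "\<forall>T\<in>\<T>. bounded_linear (L T)" "\<forall>T\<in>\<T>. bounded_linear (L' T)"
    and eq: "\<And>T v w. T \<in> \<T> \<Longrightarrow> v \<bullet> L T w = L' T v \<bullet> w"
  shows "X \<bullet> cellwise L Y = cellwise L' X \<bullet> Y"
proof (rule inner_lsq_cong)
  show "AE x in lebesgue. rep_lsq X x \<bullet> rep_lsq (cellwise L Y) x = rep_lsq (cellwise L' X) x \<bullet> rep_lsq Y x"
    using AE_cellwise_cell[where L = L and X = Y, OF bl(1)] AE_cellwise_cell[where L = L' and X = X, OF bl(2)] AE_cell
    by eventually_elim (metis eq inner_zero_left inner_zero_right)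
qed

text \<open>With \<open>k = a0\<close> this gives the coercivity of the form of the inverse of
  \<open>A\<close>, with \<open>k = 0\<close> the nonnegativity of the form of \<gamma>.\<close>

lemma cellwise_inner_mono:
  assumes bl: "\<forall>T\<in>\<T>. bounded_linear (L T)" "\<forall>T\<in>\<T>. bounded_linear (L' T)"
    and le: "\<And>T v. T \<in> \<T> \<Longrightarrow> k * (norm (L' T v))\<^sup>2 \<le> v \<bullet> L T v"
  shows "k * (norm (cellwise L' X))\<^sup>2 \<le> X \<bullet> cellwise L X"
proof -
  have "k * (norm (cellwise L' X))\<^sup>2 = (LINT x|lebesgue. k * (norm (rep_lsq (cellwise L' X) x))\<^sup>2)"
    by (simp add: norm_lsq_eq)
  also have "\<dots> \<le> (LINT x|lebesgue. rep_lsq X x \<bullet> rep_lsq (cellwise L X) x)"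
  proof (rule integral_mono_AE)
    show "integrable lebesgue (\<lambda>x. k * (norm (rep_lsq (cellwise L' X) x))\<^sup>2)"
      using sq_integrable_rep[of "cellwise L' X"] by (auto simp: sq_integrable_def)
    show "integrable lebesgue (\<lambda>x. rep_lsq X x \<bullet> rep_lsq (cellwise L X) x)"
      by (intro sq_integrable_inner sq_integrable_rep)
    show "AE x in lebesgue. k * (norm (rep_lsq (cellwise L' X) x))\<^sup>2 \<le> rep_lsq X x \<bullet> rep_lsq (cellwise L X) x"
      using AE_cellwise_cell[where L = L and X = X, OF bl(1)] AE_cellwise_cell[where L = L' and X = X, OF bl(2)] AE_cell
    proof eventually_elim
      case (elim x)
      show ?case
      proof (cases "x \<in> \<Omega>")
        case True
        then obtain T where "T \<in> \<T>" "x \<in> interior T" using elim(3) by blast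
        then show ?thesis using elim(1,2) le[of T "rep_lsq X x"] by simp
      next
        case False
        then show ?thesis using elim(1,2) by simp
      qed
    qed
  qed
  also have "\<dots> = X \<bullet> cellwise L X" by (simp add: inner_lsq_eq)
  finally show ?thesis .
qed

lemma integral_cellwise:
  assumes bl: "\<forall>T\<in>\<T>. bounded_linear (L T)" and X: "X \<in> L2_on \<Omega>"
    and eq: "AE x in lebesgue. \<forall>T\<in>\<T>. x \<in> interior T \<longrightarrow> f x = rep_lsq X x \<bullet> L T (rep_lsq Y x)"
  shows "(LINT x|lebesgue_on \<Omega>. f x) = X \<bullet> cellwise L Y"
proof -
  have \<Omega>: "\<Omega> \<in> sets lebesgue" using \<Omega>_open by auto
  have ae: "AE x in lebesgue. indicat_real \<Omega> x *\<^sub>R f x = rep_lsq X x \<bullet> rep_lsq (cellwise L Y) x"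
    using AE_cellwise_cell[where L = L and X = Y, OF bl] eq AE_cell by eventually_elim (auto simp: indicator_def)
  have m: "(\<lambda>x. rep_lsq X x \<bullet> rep_lsq (cellwise L Y) x) \<in> borel_measurable lebesgue"
    by (intro borel_measurable_integrable sq_integrable_inner sq_integrable_rep)
  have "(LINT x|lebesgue_on \<Omega>. f x) = (LINT x|lebesgue. indicat_real \<Omega> x *\<^sub>R f x)"
    using \<Omega> by (subst integral_restrict_space) auto
  also have "\<dots> = (LINT x|lebesgue. rep_lsq X x \<bullet> rep_lsq (cellwise L Y) x)"
  proof (rule integral_cong_AE[OF _ m ae])
    \<comment> \<open>In use \<open>f\<close> contains pointwise inverses of the coefficient matrix.
      Its measurability is inherited from the almost everywhere equal cellwise expression, as
      Lebesgue measure is complete.\<close>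
    have "AE x in lebesgue. rep_lsq X x \<bullet> rep_lsq (cellwise L Y) x = indicat_real \<Omega> x *\<^sub>R f x"
      using ae by (rule eventually_mono) simp
    then show "(\<lambda>x. indicat_real \<Omega> x *\<^sub>R f x) \<in> borel_measurable lebesgue"
      by (rule borel_measurable_AE[OF m])
  qed
  also have "\<dots> = X \<bullet> cellwise L Y" by (simp add: inner_lsq_eq)
  finally show ?thesis .
qed

end

section \<open>Coefficients and piecewise constant approximation\<close>

text \<open>Carries almost everywhere bounds on the coefficients over to their constant values on
  the cells, by evaluation at one good point.\<close>

lemma AE_open_nonempty:
  assumes "AE x in lebesgue. P x" "open S" "S \<noteq> {}"
  obtains x where "x \<in> S" "P x"
proof -
  have "\<not> negligible S" using assms(2,3) by (rule open_not_negligible)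
  then have S: "S \<notin> null_sets lebesgue" by (simp add: negligible_iff_null_sets)
  show ?thesis
  proof (rule ccontr)
    assume no: "\<not> thesis"
    then have "\<And>x. x \<in> S \<Longrightarrow> \<not> P x" using that by blast
    then have "AE x in lebesgue. x \<notin> S" using assms(1) by (auto elim: eventually_mono)
    then show False using S assms(2) by (subst (asm) AE_iff_null_sets[symmetric]) auto
  qed
qed

text \<open>The last claim is the lower bound at the vector \<open>matrix_inv M *v v\<close>.
  Keeping the norm of this vector on the left, rather than that of \<open>v\<close>, makes the
  factor \<open>1 / a0\<close> appear in the final constant.\<close>

lemma inverse_coercive:
  fixes M :: "real^'n^'n"
  assumes sym: "transpose M = M" and a0: "0 < a0" and low: "\<And>\<xi>. a0 * (norm \<xi>)\<^sup>2 \<le> \<xi> \<bullet> (M *v \<xi>)"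
  shows "M *v (matrix_inv M *v v) = v" "v \<bullet> (matrix_inv M *v w) = (matrix_inv M *v v) \<bullet> w"
    "a0 * (norm (matrix_inv M *v v))\<^sup>2 \<le> v \<bullet> (matrix_inv M *v v)"
proof -
  have "M *v x \<noteq> 0" if "x \<noteq> 0" for x
  proof
    assume "M *v x = 0"
    then have "a0 * (norm x)\<^sup>2 \<le> 0" using low[of x] by simp
    moreover have "a0 * (norm x)\<^sup>2 > 0" using a0 that by simp
    ultimately show False by simp
  qed
  then have "\<exists>B. B ** M = mat 1" unfolding matrix_left_invertible_ker by blast
  then have "invertible M" using invertible_left_inverse by blast
  then have r: "M ** matrix_inv M = mat 1"
    unfolding invertible_def matrix_inv_def by (rule someI2_ex) blast
  show 1: "M *v (matrix_inv M *v v) = v" for v by (simp add: matrix_vector_mul_assoc r)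
  have Ms: "(M *v x) \<bullet> y = x \<bullet> (M *v y)" for x y
    using dot_lmul_matrix[of x M y] sym by (metis transpose_matrix_vector)
  show 2: "v \<bullet> (matrix_inv M *v w) = (matrix_inv M *v v) \<bullet> w" for v w
    using Ms[of "matrix_inv M *v v" "matrix_inv M *v w"] by (simp add: 1)
  show "a0 * (norm (matrix_inv M *v v))\<^sup>2 \<le> v \<bullet> (matrix_inv M *v v)"
    using low[of "matrix_inv M *v v"] by (simp add: 1 inner_commute)
qed

lemma sq_integrable_indicator_const:
  fixes m :: "'b::euclidean_space"
  assumes "S \<in> sets lebesgue" "bounded S"
  shows "sq_integrable (\<lambda>x. indicat_real S x *\<^sub>R m)"
proof -
  have "S \<in> lmeasurable" using assms by (intro bounded_set_imp_lmeasurable)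
  then have i: "integrable lebesgue (indicat_real S)" by (intro integrable_real_indicator) (auto simp: fmeasurable_def)
  have "(\<lambda>x. (norm (indicat_real S x *\<^sub>R m))\<^sup>2) = (\<lambda>x. indicat_real S x * (norm m)\<^sup>2)"
    by (auto simp: indicator_def fun_eq_iff)
  then have "integrable lebesgue (\<lambda>x. (norm (indicat_real S x *\<^sub>R m))\<^sup>2)" using i by simp
  moreover have "(\<lambda>x. indicat_real S x *\<^sub>R m) \<in> borel_measurable lebesgue"
    using assms(1) by measurable
  ultimately show ?thesis by (simp add: sq_integrable_def)
qed

text \<open>Testing with bump fields inside one cell identifies the restriction of \<open>g\<close>
  as the weak gradient of \<open>u\<close> there. The Poincare inequality then applies to each cell
  separately, and the squares add up because the cells overlap in null sets only.\<close>

lemma (in partitioned_domain) piecewise_constant_approximation: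
  assumes g: "g \<in> L2_on \<Omega>"
    and weak: "\<And>\<tau>. \<tau> \<in> Hdiv \<Omega> \<Longrightarrow> g \<bullet> \<tau> + weak_div \<Omega> \<tau> \<bullet> u = 0"
    and u: "u \<in> L2_on \<Omega>" and h: "\<And>T. T \<in> \<T> \<Longrightarrow> diameter T \<le> h" "0 < h"
  shows "\<exists>w\<in>P0 \<Omega> \<T>. pi\<^sup>2 * (norm (u - w))\<^sup>2 \<le> h\<^sup>2 * (norm g)\<^sup>2"
proof -
  have "rep_lsq u \<in> borel_measurable lebesgue" "rep_lsq g \<in> borel_measurable lebesgue"
    using sq_integrable_rep[of u] sq_integrable_rep[of g] by (auto simp: sq_integrable_def)
  then obtain u0 g0 where u0 [measurable]: "u0 \<in> borel_measurable borel" and au: "AE x in lebesgue. rep_lsq u x = u0 x"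
    and g0 [measurable]: "g0 \<in> borel_measurable borel" and ag: "AE x in lebesgue. rep_lsq g x = g0 x"
    using borel_representative by metis
  have u2: "integrable lborel (\<lambda>x. (norm (u0 x))\<^sup>2)" and g2: "integrable lborel (\<lambda>x. (norm (g0 x))\<^sup>2)"
    using sq_integrable_borel(1)[OF sq_integrable_rep u0 au] sq_integrable_borel(1)[OF sq_integrable_rep g0 ag] by auto
  \<comment> \<open>Extension by zero from the cell may destroy the weak gradient across its
    boundary, but bumps supported inside the cell do not notice.\<close>
  define uT where "uT T x = indicat_real T x * u0 x" for T x
  define gT where "gT T x = indicat_real T x *\<^sub>R g0 x" for T x
  have Tb [measurable]: "T \<in> sets borel" if "T \<in> \<T>" for T using cells(2)[OF that] by (simp add: borel_compact)
  have uT2: "integrable lborel (\<lambda>x. (uT T x)\<^sup>2)" and gT2: "integrable lborel (\<lambda>x. (norm (gT T x))\<^sup>2)" if "T \<in> \<T>" for T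
  proof -
    note [measurable] = Tb[OF that]
    show "integrable lborel (\<lambda>x. (uT T x)\<^sup>2)"
      by (rule Bochner_Integration.integrable_bound[OF u2]) (auto simp: uT_def indicator_def)
    show "integrable lborel (\<lambda>x. (norm (gT T x))\<^sup>2)"
      by (rule Bochner_Integration.integrable_bound[OF g2]) (auto simp: gT_def indicator_def)
  qed
  have "\<exists>m. pi\<^sup>2 * (LINT x:T|lborel. (uT T x - m)\<^sup>2) \<le> h\<^sup>2 * (\<integral>x. (norm (gT T x))\<^sup>2 \<partial>lborel)" if T: "T \<in> \<T>" for T
  proof (rule weak_gradient_Poincare[OF cells(2,3,4)[OF T] h(1)[OF T] h(2)])
    note [measurable] = Tb[OF T]
    show "uT T \<in> borel_measurable borel" "gT T \<in> borel_measurable borel"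
      unfolding uT_def[abs_def] gT_def[abs_def] by measurable
    show "integrable lborel (\<lambda>x. (uT T x)\<^sup>2)" "integrable lborel (\<lambda>x. (norm (gT T x))\<^sup>2)"
      using uT2 gT2 T by auto
    show "uT T x = 0" "gT T x = 0" if "x \<notin> T" for x using that by (auto simp: uT_def gT_def)
    fix x \<epsilon> and b :: 'a assume e: "\<epsilon> > 0" "cball x \<epsilon> \<subseteq> interior T" and b: "b \<in> Basis"
    have eO: "cball x \<epsilon> \<subseteq> \<Omega>" using e(2) interior_cell[OF T] by blast
    have inT: "y \<in> T" if "y \<in> cball x \<epsilon>" for y using that e(2) interior_subset by blast
    have supp: "bump 0 \<epsilon> x y = 0" "bump_grad \<epsilon> x y = 0" if "y \<notin> T" for y
    proof -
      have "y \<notin> ball x \<epsilon>" using inT[of y] that by auto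
      then show "bump 0 \<epsilon> x y = 0" "bump_grad \<epsilon> x y = 0"
        using bump_support[of 0 \<epsilon> x y] bump_support[of 2 \<epsilon> x y] e(1) by (auto simp: bump_grad_def)
    qed
    define \<tau> where "\<tau> = abs_lsq (\<lambda>y. bump 0 \<epsilon> x y *\<^sub>R b)"
    note bf = bump_field_weak_div[OF \<Omega>_open \<Omega>_bounded e(1) eO, of b, folded \<tau>_def]
    have [measurable]: "bump 0 \<epsilon> x \<in> borel_measurable borel" "bump_grad \<epsilon> x \<in> borel_measurable borel"
      by (rule borel_measurable_continuous_onI[OF continuous_bump] borel_measurable_continuous_onI[OF continuous_bump_grad])+
    have "g \<bullet> \<tau> = (\<integral>y. (gT T y \<bullet> b) * bump 0 \<epsilon> x y \<partial>lborel)"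
      unfolding inner_lsq_eq
    proof (rule integral_lebesgue_borel)
      show "(\<lambda>y. rep_lsq g y \<bullet> rep_lsq \<tau> y) \<in> borel_measurable lebesgue"
        by (intro borel_measurable_integrable sq_integrable_inner sq_integrable_rep)
      show "(\<lambda>y. (gT T y \<bullet> b) * bump 0 \<epsilon> x y) \<in> borel_measurable borel" unfolding gT_def by measurable
      show "AE y in lebesgue. rep_lsq g y \<bullet> rep_lsq \<tau> y = (gT T y \<bullet> b) * bump 0 \<epsilon> x y"
        using ag bf(3) by eventually_elim (auto simp: gT_def indicator_def supp)
    qed
    moreover have "weak_div \<Omega> \<tau> \<bullet> u = (\<integral>y. uT T y * (bump_grad \<epsilon> x y \<bullet> b) \<partial>lborel)"
      unfolding inner_lsq_eq
    proof (rule integral_lebesgue_borel)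
      show "(\<lambda>y. rep_lsq (weak_div \<Omega> \<tau>) y \<bullet> rep_lsq u y) \<in> borel_measurable lebesgue"
        by (intro borel_measurable_integrable sq_integrable_inner sq_integrable_rep)
      show "(\<lambda>y. uT T y * (bump_grad \<epsilon> x y \<bullet> b)) \<in> borel_measurable borel" unfolding uT_def by measurable
      show "AE y in lebesgue. rep_lsq (weak_div \<Omega> \<tau>) y \<bullet> rep_lsq u y = uT T y * (bump_grad \<epsilon> x y \<bullet> b)"
        using au bf(4) by eventually_elim (auto simp: uT_def indicator_def supp)
    qed
    ultimately show "(\<integral>y. uT T y * (bump_grad \<epsilon> x y \<bullet> b) \<partial>lborel) = - (\<integral>y. (gT T y \<bullet> b) * bump 0 \<epsilon> x y \<partial>lborel)"
      using weak[OF bf(1)] by simp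
  qed
  then obtain m where m: "\<And>T. T \<in> \<T> \<Longrightarrow> pi\<^sup>2 * (LINT x:T|lborel. (uT T x - m T)\<^sup>2) \<le> h\<^sup>2 * (\<integral>x. (norm (gT T x))\<^sup>2 \<partial>lborel)"
    by metis
  \<comment> \<open>Interiors again prevent double values on common boundaries, and keep
    \<open>w\<close> zero outside the domain.\<close>
  define w where "w = abs_lsq (\<lambda>x. \<Sum>T\<in>\<T>. indicat_real (interior T) x *\<^sub>R m T)"
  have "sq_integrable (\<lambda>x. \<Sum>T\<in>\<T>. indicat_real (interior T) x *\<^sub>R m T)"
  proof (rule sq_integrable_sum)
    fix T assume "T \<in> \<T>"
    then have "bounded (interior T)" using cells(2) by (meson bounded_interior compact_imp_bounded)
    then show "sq_integrable (\<lambda>x. indicat_real (interior T) x *\<^sub>R m T)" by (intro sq_integrable_indicator_const) auto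
  qed
  then have aw: "AE x in lebesgue. rep_lsq w x = (\<Sum>T\<in>\<T>. indicat_real (interior T) x *\<^sub>R m T)"
    unfolding w_def by (rule AE_rep_abs)
  have wL2: "w \<in> L2_on \<Omega>"
    unfolding L2_on_def mem_Collect_eq using aw by (rule eventually_mono) (use sum_indicator_outside[of _ m] in auto)
  have "w \<in> P0 \<Omega> \<T>"
    unfolding P0_def piecewise_const_def
  proof (intro CollectI conjI ballI wL2)
    fix T assume T: "T \<in> \<T>"
    have "AE x in lebesgue. x \<in> \<Omega> \<longrightarrow> x \<in> T \<longrightarrow> rep_lsq w x = m T"
      using aw AE_interior_cell by eventually_elim (use T sum_indicator_cells[OF T, of _ m] in auto)
    then have "AE x in lebesgue_on \<Omega>. x \<in> T \<longrightarrow> rep_lsq w x = m T"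
      using \<Omega>_open by (subst AE_restrict_space_iff) auto
    then show "\<exists>c. AE x in lebesgue_on \<Omega>. x \<in> T \<longrightarrow> rep_lsq w x = c" by blast
  qed
  moreover have "pi\<^sup>2 * (norm (u - w))\<^sup>2 \<le> h\<^sup>2 * (norm g)\<^sup>2"
  proof -
    have auO: "AE x in lebesgue. x \<notin> \<Omega> \<longrightarrow> rep_lsq u x = 0" "AE x in lebesgue. x \<notin> \<Omega> \<longrightarrow> rep_lsq g x = 0"
      using u g by (auto simp: L2_on_def)
    have cellsum: "(\<Sum>T\<in>\<T>. indicat_real T x * f T) = f T'"
      if "T' \<in> \<T>" "x \<in> interior T'" "\<forall>T\<in>\<T>. x \<in> T \<longrightarrow> x \<in> interior T" for f T' x
    proof -
      have "(\<Sum>T\<in>\<T>. indicat_real T x * f T) = (\<Sum>T\<in>\<T>. indicat_real (interior T) x *\<^sub>R f T)"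
        using that(3) interior_subset by (intro sum.cong) (auto simp: indicator_def)
      then show ?thesis using sum_indicator_cells[OF that(1,2), of f] by simp
    qed
    have iu: "integrable lborel (\<lambda>x. indicat_real T x * (uT T x - m T)\<^sup>2)" if T: "T \<in> \<T>" for T
    proof (rule Bochner_Integration.integrable_bound)
      note [measurable] = Tb[OF T]
      have "integrable lborel (indicat_real T)"
        using emeasure_compact_finite[OF cells(2)[OF T]] by (intro integrable_real_indicator) auto
      then show "integrable lborel (\<lambda>x. 2 * (uT T x)\<^sup>2 + 2 * (m T)\<^sup>2 * indicat_real T x)" using uT2[OF T] by auto
      show "(\<lambda>x. indicat_real T x * (uT T x - m T)\<^sup>2) \<in> borel_measurable lborel" unfolding uT_def by measurable
      have "(a - b)\<^sup>2 \<le> 2 * a\<^sup>2 + 2 * b\<^sup>2" for a b :: real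
        using zero_le_power2[of "a + b"] by (simp add: power2_eq_square algebra_simps)
      then show "AE x in lborel. norm (indicat_real T x * (uT T x - m T)\<^sup>2) \<le> norm (2 * (uT T x)\<^sup>2 + 2 * (m T)\<^sup>2 * indicat_real T x)"
        by (intro AE_I2) (auto simp: indicator_def)
    qed
    have "(norm (u - w))\<^sup>2 = (\<integral>x. (\<Sum>T\<in>\<T>. indicat_real T x * (uT T x - m T)\<^sup>2) \<partial>lborel)"
      unfolding norm_lsq_eq
    proof (rule integral_lebesgue_borel)
      show "(\<lambda>x. (norm (rep_lsq (u - w) x))\<^sup>2) \<in> borel_measurable lebesgue"
        using sq_integrable_rep[of "u - w"] by (auto simp: sq_integrable_def)
      show "(\<lambda>x. \<Sum>T\<in>\<T>. indicat_real T x * (uT T x - m T)\<^sup>2) \<in> borel_measurable borel"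
        using iu by (auto intro!: borel_measurable_sum dest: borel_measurable_integrable)
      show "AE x in lebesgue. (norm (rep_lsq (u - w) x))\<^sup>2 = (\<Sum>T\<in>\<T>. indicat_real T x * (uT T x - m T)\<^sup>2)"
        using AE_rep_diff[of u w] au aw auO(1) AE_interior_cell AE_cell
      proof eventually_elim
        case (elim x)
        show ?case
        proof (cases "x \<in> \<Omega>")
          case True
          then obtain T where T: "T \<in> \<T>" "x \<in> interior T" using elim(6) by blast
          have "x \<in> T" using T(2) interior_subset by blast
          then have "uT T x = u0 x" by (simp add: uT_def)
          then show ?thesis
            using elim cellsum[OF T elim(5), of "\<lambda>T. (uT T x - m T)\<^sup>2"] sum_indicator_cells[OF T, of m] by simp
        next
          case False
          have "x \<notin> T" if "T \<in> \<T>" for T using elim(5) that False interior_cell by blast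
          then have "(\<Sum>T\<in>\<T>. indicat_real T x * (uT T x - m T)\<^sup>2) = 0" by (intro sum.neutral) auto
          then show ?thesis using elim False sum_indicator_outside[OF False, of m] by simp
        qed
      qed
    qed
    also have "\<dots> = (\<Sum>T\<in>\<T>. LINT x:T|lborel. (uT T x - m T)\<^sup>2)"
      using iu by (subst Bochner_Integration.integral_sum) (auto simp: set_lebesgue_integral_def)
    finally have 1: "(norm (u - w))\<^sup>2 = (\<Sum>T\<in>\<T>. LINT x:T|lborel. (uT T x - m T)\<^sup>2)" .
    have "(norm g)\<^sup>2 = (\<integral>x. (\<Sum>T\<in>\<T>. (norm (gT T x))\<^sup>2) \<partial>lborel)"
      unfolding norm_lsq_eq
    proof (rule integral_lebesgue_borel)
      show "(\<lambda>x. (norm (rep_lsq g x))\<^sup>2) \<in> borel_measurable lebesgue"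
        using sq_integrable_rep[of g] by (auto simp: sq_integrable_def)
      show "(\<lambda>x. \<Sum>T\<in>\<T>. (norm (gT T x))\<^sup>2) \<in> borel_measurable borel"
        using gT2 by (auto intro!: borel_measurable_sum dest: borel_measurable_integrable)
      show "AE x in lebesgue. (norm (rep_lsq g x))\<^sup>2 = (\<Sum>T\<in>\<T>. (norm (gT T x))\<^sup>2)"
        using ag auO(2) AE_interior_cell AE_cell
      proof eventually_elim
        case (elim x)
        have eq: "(\<Sum>T\<in>\<T>. (norm (gT T x))\<^sup>2) = (\<Sum>T\<in>\<T>. indicat_real T x * (norm (g0 x))\<^sup>2)"
          by (intro sum.cong) (auto simp: gT_def indicator_def)
        show ?case
        proof (cases "x \<in> \<Omega>")
          case True
          then obtain T where T: "T \<in> \<T>" "x \<in> interior T" using elim(4) by blast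
          then show ?thesis using eq elim(1) cellsum[OF T elim(3), of "\<lambda>T. (norm (g0 x))\<^sup>2"] by simp
        next
          case False
          have "x \<notin> T" if "T \<in> \<T>" for T using elim(3) that False interior_cell by blast
          then have "(\<Sum>T\<in>\<T>. (norm (gT T x))\<^sup>2) = 0" unfolding eq by (intro sum.neutral) auto
          then show ?thesis using elim(2) False by simp
        qed
      qed
    qed
    also have "\<dots> = (\<Sum>T\<in>\<T>. \<integral>x. (norm (gT T x))\<^sup>2 \<partial>lborel)"
      using gT2 by (subst Bochner_Integration.integral_sum) auto
    finally have 2: "(norm g)\<^sup>2 = (\<Sum>T\<in>\<T>. \<integral>x. (norm (gT T x))\<^sup>2 \<partial>lborel)" .
    show ?thesis unfolding 1 2 sum_distrib_left by (intro sum_mono m)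
  qed
  ultimately show ?thesis by blast
qed

section \<open>From coefficients and spaces to the abstract bound\<close>

theorem corollary5p1:
  fixes \<Omega> :: "(real^'n) set" and \<T> :: "(real^'n) set set"
    and A :: "real^'n \<Rightarrow> real^'n^'n" and \<gamma> :: "real^'n \<Rightarrow> real"
    and a0 a1 \<gamma>0 \<gamma>1 h :: real
    and \<Sigma>\<^sub>h :: "(real^'n, real^'n) lsq set" and U\<^sub>h :: "(real^'n, real) lsq set"
    and V :: "(real^'n) set \<Rightarrow> (real^'n, real) lsq set"
    and lam lam\<^sub>h :: "nat \<Rightarrow> real" and J :: nat
  assumes domain: "polytopal_lipschitz_domain \<Omega>"
    and partition: "polytopal_partition \<T> (closure \<Omega>)"
    and h: "h = mesh_size \<T>"
    and A_Linf: "\<forall>i j. Linf_on \<Omega> (\<lambda>x. A x $ i $ j)"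
    and A_sym: "AE x in lebesgue_on \<Omega>. transpose (A x) = A x"
    and A_pw: "piecewise_const \<Omega> \<T> A"
    and \<gamma>_Linf: "Linf_on \<Omega> \<gamma>"
    and \<gamma>_pw: "piecewise_const \<Omega> \<T> \<gamma>"
    and a0: "0 < a0" and a1: "a0 \<le> a1"
    and A_bounds: "AE x in lebesgue_on \<Omega>. \<forall>\<xi>.
        a0 * (norm \<xi>)\<^sup>2 \<le> \<xi> \<bullet> (A x *v \<xi>) \<and> \<xi> \<bullet> (A x *v \<xi>) \<le> a1 * (norm \<xi>)\<^sup>2"
    and \<gamma>0: "0 \<le> \<gamma>0"
    and \<gamma>_bounds: "AE x in lebesgue_on \<Omega>. \<gamma>0 \<le> \<gamma> x \<and> \<gamma> x \<le> \<gamma>1"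
    and \<Sigma>\<^sub>h: "subspace \<Sigma>\<^sub>h" "fin_dim \<Sigma>\<^sub>h" "\<Sigma>\<^sub>h \<subseteq> Hdiv \<Omega>"
    and U\<^sub>h: "subspace U\<^sub>h" "fin_dim U\<^sub>h" "U\<^sub>h \<subseteq> L2_on \<Omega>"
    and stable: "inf_sup_stable \<Omega> \<Sigma>\<^sub>h U\<^sub>h"
    and P0: "P0 \<Omega> \<T> \<subseteq> U\<^sub>h"
    and div: "weak_div \<Omega> ` \<Sigma>\<^sub>h \<subseteq> U\<^sub>h"
    and V: "\<forall>T\<in>\<T>. subspace (V T) \<and> V T \<subseteq> L2_on T"
    and U\<^sub>h_product: "U\<^sub>h = broken_product \<T> V"
    and lam: "enumerates_eigenvalues {1..} (mixed_eigenspace \<Omega> A \<gamma> (Hdiv \<Omega>) (L2_on \<Omega>)) lam"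
    and lam\<^sub>h: "enumerates_eigenvalues {1..dim U\<^sub>h} (mixed_eigenspace \<Omega> A \<gamma> \<Sigma>\<^sub>h U\<^sub>h) lam\<^sub>h"
    and J: "J \<in> {1..dim U\<^sub>h}"
  shows "lam\<^sub>h J / (1 + lam\<^sub>h J * h\<^sup>2 / (a0 * pi\<^sup>2)) \<le> lam J"
proof -
  have \<Omega>: "open \<Omega>" "bounded \<Omega>" "\<Omega> \<noteq> {}" "lipschitz_boundary \<Omega>"
    using domain by (auto simp: polytopal_lipschitz_domain_def)
  interpret partitioned_domain \<Omega> \<T>
  proof
    show "interior T \<subseteq> \<Omega>" if "T \<in> \<T>" for T
    proof -
      have "T \<subseteq> closure \<Omega>" using partition that unfolding polytopal_partition_def by blast
      then show ?thesis
        using interior_mono interior_closure_lipschitz_boundary[OF \<Omega>(1,4)] by blast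
    qed
  qed (fact \<Omega> partition)+
  have on\<Omega>: "AE x in lebesgue. x \<in> \<Omega> \<longrightarrow> P x" if "AE x in lebesgue_on \<Omega>. P x" for P
    using that \<Omega>(1) by (subst (asm) AE_restrict_space_iff) auto
  have "\<exists>c. AE x in lebesgue_on \<Omega>. x \<in> T \<longrightarrow> A x = c" if "T \<in> \<T>" for T
    using A_pw that by (auto simp: piecewise_const_def)
  then obtain M where M: "\<And>T. T \<in> \<T> \<Longrightarrow> AE x in lebesgue_on \<Omega>. x \<in> T \<longrightarrow> A x = M T" by metis
  have "\<exists>c. AE x in lebesgue_on \<Omega>. x \<in> T \<longrightarrow> \<gamma> x = c" if "T \<in> \<T>" for T
    using \<gamma>_pw that by (auto simp: piecewise_const_def)
  then obtain \<gamma>T where \<gamma>T: "\<And>T. T \<in> \<T> \<Longrightarrow> AE x in lebesgue_on \<Omega>. x \<in> T \<longrightarrow> \<gamma> x = \<gamma>T T" by metis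
  \<comment> \<open>The hypotheses hold almost everywhere, hence at some interior point of each
    cell, where they become statements about the constants \<open>M T\<close> and
    \<open>\<gamma>T T\<close>.\<close>
  have coeff: "transpose (M T) = M T \<and> (\<forall>\<xi>. a0 * (norm \<xi>)\<^sup>2 \<le> \<xi> \<bullet> (M T *v \<xi>)) \<and> 0 \<le> \<gamma>T T" if T: "T \<in> \<T>" for T
  proof -
    have "AE x in lebesgue. x \<in> \<Omega> \<longrightarrow> x \<in> T \<longrightarrow> A x = M T \<and> \<gamma> x = \<gamma>T T \<and> transpose (A x) = A x \<and>
        (\<forall>\<xi>. a0 * (norm \<xi>)\<^sup>2 \<le> \<xi> \<bullet> (A x *v \<xi>)) \<and> \<gamma>0 \<le> \<gamma> x"
      using on\<Omega>[OF M[OF T]] on\<Omega>[OF \<gamma>T[OF T]] on\<Omega>[OF A_sym] on\<Omega>[OF A_bounds] on\<Omega>[OF \<gamma>_bounds]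
      by eventually_elim auto
    then obtain x where "x \<in> interior T" "x \<in> \<Omega> \<longrightarrow> x \<in> T \<longrightarrow> A x = M T \<and> \<gamma> x = \<gamma>T T \<and> transpose (A x) = A x \<and>
        (\<forall>\<xi>. a0 * (norm \<xi>)\<^sup>2 \<le> \<xi> \<bullet> (A x *v \<xi>)) \<and> \<gamma>0 \<le> \<gamma> x"
      by (rule AE_open_nonempty[OF _ open_interior cells(4)[OF T]])
    moreover have "x \<in> \<Omega>" "x \<in> T" using \<open>x \<in> interior T\<close> interior_cell[OF T] interior_subset by blast+
    ultimately show ?thesis using \<gamma>0 by force
  qed
  have inv: "M T *v (matrix_inv (M T) *v v) = v" "v \<bullet> (matrix_inv (M T) *v w) = (matrix_inv (M T) *v v) \<bullet> w"
    "a0 * (norm (matrix_inv (M T) *v v))\<^sup>2 \<le> v \<bullet> (matrix_inv (M T) *v v)" if "T \<in> \<T>" for T v w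
    using coeff[OF that] a0 by (intro inverse_coercive[of "M T" a0]; simp)+
  define BL where "BL T v = matrix_inv (M T) *v v" for T v
  define CL where "CL T v = \<gamma>T T * v" for T v
  have bBL: "\<forall>T\<in>\<T>. bounded_linear (BL T)"
    unfolding BL_def[abs_def] by (simp add: linear_conv_bounded_linear[symmetric])
  have bCL: "\<forall>T\<in>\<T>. bounded_linear (CL T)"
    unfolding CL_def[abs_def] by (simp add: bounded_linear_mult_right)
  define a where "a \<sigma> \<tau> = (LINT x|lebesgue_on \<Omega>. rep_lsq \<sigma> x \<bullet> (matrix_inv (A x) *v rep_lsq \<tau> x))" for \<sigma> \<tau>
  define c where "c u v = (LINT x|lebesgue_on \<Omega>. rep_lsq u x * (\<gamma> x * rep_lsq v x))" for u v
  have a_eq: "a \<sigma> \<tau> = \<sigma> \<bullet> cellwise BL \<tau>" if "\<sigma> \<in> L2_on \<Omega>" for \<sigma> \<tau>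
    unfolding a_def
  proof (rule integral_cellwise[OF bBL that])
    have "AE x in lebesgue. \<forall>T\<in>\<T>. x \<in> \<Omega> \<longrightarrow> x \<in> T \<longrightarrow> A x = M T"
      using on\<Omega>[OF M] by (intro AE_finite_allI cells(1))
    then show "AE x in lebesgue. \<forall>T\<in>\<T>. x \<in> interior T \<longrightarrow>
        rep_lsq \<sigma> x \<bullet> (matrix_inv (A x) *v rep_lsq \<tau> x) = rep_lsq \<sigma> x \<bullet> BL T (rep_lsq \<tau> x)"
      by (rule eventually_mono) (metis BL_def interior_cell interior_subset subsetD)
  qed
  have c_eq: "c u v = u \<bullet> cellwise CL v" if "u \<in> L2_on \<Omega>" for u v
    unfolding c_def
  proof (rule integral_cellwise[OF bCL that])
    have "AE x in lebesgue. \<forall>T\<in>\<T>. x \<in> \<Omega> \<longrightarrow> x \<in> T \<longrightarrow> \<gamma> x = \<gamma>T T"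
      using on\<Omega>[OF \<gamma>T] by (intro AE_finite_allI cells(1))
    then show "AE x in lebesgue. \<forall>T\<in>\<T>. x \<in> interior T \<longrightarrow>
        rep_lsq u x * (\<gamma> x * rep_lsq v x) = rep_lsq u x \<bullet> CL T (rep_lsq v x)"
      by (rule eventually_mono) (metis CL_def inner_real_def interior_cell interior_subset subsetD)
  qed
  have HL: "Hdiv \<Omega> \<subseteq> L2_on \<Omega>" by (auto simp: Hdiv_def)
  have Bsym: "x \<bullet> cellwise BL y = y \<bullet> cellwise BL x" for x y
  proof -
    have "x \<bullet> cellwise BL y = cellwise BL x \<bullet> y"
      by (rule cellwise_inner_cong[OF bBL bBL]) (unfold BL_def, rule inv(2))
    then show ?thesis by (simp add: inner_commute)
  qed
  have Csym: "x \<bullet> cellwise CL y = y \<bullet> cellwise CL x" for x y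
    using cellwise_inner_cong[OF bCL bCL, of x y] by (simp add: CL_def inner_commute)
  have Bcoer: "a0 * (norm (cellwise BL x))\<^sup>2 \<le> x \<bullet> cellwise BL x" for x
    by (rule cellwise_inner_mono[OF bBL bBL]) (use inv(3) in \<open>auto simp: BL_def\<close>)
  have Cnonneg: "0 \<le> x \<bullet> cellwise CL x" for x
  proof -
    have "0 * (norm (cellwise CL x))\<^sup>2 \<le> x \<bullet> cellwise CL x"
    proof (rule cellwise_inner_mono[OF bCL bCL])
      fix T and v :: real assume "T \<in> \<T>"
      then have "0 \<le> \<gamma>T T * v\<^sup>2" using coeff by simp
      then show "0 * (norm (CL T v))\<^sup>2 \<le> v \<bullet> CL T v" by (simp add: CL_def power2_eq_square mult_ac)
    qed
    then show ?thesis by simp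
  qed
  \<comment> \<open>The forms \<open>a\<close> and \<open>c\<close> do not depend on the spaces, so
    one unfolding covers the continuous and the discrete eigenspaces.\<close>
  have eig: "mixed_eigenspace \<Omega> A \<gamma> S U = mixed_eig a (weak_div \<Omega>) c S U" for S U
    unfolding mixed_eigenspace_def[abs_def] mixed_eig_def[abs_def] a_def c_def by simp
  interpret mixed_form a "weak_div \<Omega>" c "Hdiv \<Omega>" "L2_on \<Omega>"
  proof
    show "subspace (Hdiv \<Omega>)" by (rule Hdiv_linear(1)[OF \<Omega>(1,2)])
    show "subspace (L2_on \<Omega> :: (real^'n, real) lsq set)" by (rule subspace_L2_on)
    show "weak_div \<Omega> (x + y) = weak_div \<Omega> x + weak_div \<Omega> y" if "x \<in> Hdiv \<Omega>" "y \<in> Hdiv \<Omega>" for x y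
      by (rule Hdiv_linear(2)[OF \<Omega>(1,2) that])
    show "weak_div \<Omega> (r *\<^sub>R x) = r *\<^sub>R weak_div \<Omega> x" if "x \<in> Hdiv \<Omega>" for r x
      by (rule Hdiv_linear(3)[OF \<Omega>(1,2) that])
    show "a (x + y) z = a x z + a y z" if "x \<in> Hdiv \<Omega>" "y \<in> Hdiv \<Omega>" for x y z
      using that HL subspace_add[OF subspace_L2_on, of x \<Omega> y] by (auto simp: a_eq inner_add_left subsetD)
    show "a (r *\<^sub>R x) z = r * a x z" if "x \<in> Hdiv \<Omega>" for r x z
      using that HL subspace_scale[OF subspace_L2_on, of x \<Omega> r] by (auto simp: a_eq subsetD)
    show "a x y = a y x" if "x \<in> Hdiv \<Omega>" "y \<in> Hdiv \<Omega>" for x y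
      using that HL Bsym by (auto simp: a_eq subsetD)
    have an: "a0 * (norm (cellwise BL x))\<^sup>2 \<le> a x x" if "x \<in> Hdiv \<Omega>" for x
      using that HL Bcoer by (auto simp: a_eq subsetD)
    show "0 \<le> a x x" if "x \<in> Hdiv \<Omega>" for x
    proof -
      have "0 \<le> a0 * (norm (cellwise BL x))\<^sup>2" using a0 by simp
      then show ?thesis using an[OF that] by simp
    qed
    \<comment> \<open>Coercivity forces the inverse coefficient applied to \<open>x\<close> to
      vanish; multiplying back by \<open>M T\<close> on each cell recovers
      \<open>x = 0\<close>.\<close>
    show "x = 0" if x: "x \<in> Hdiv \<Omega>" and z: "a x x = 0" for x
    proof -
      have "a0 * (norm (cellwise BL x))\<^sup>2 \<le> 0" using an[OF x] z by simp
      then have B0: "cellwise BL x = 0" using a0 by (simp add: mult_le_0_iff)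
      have "AE y in lebesgue. y \<notin> \<Omega> \<longrightarrow> rep_lsq x y = 0" using x HL by (auto simp: L2_on_def)
      then have "AE y in lebesgue. rep_lsq x y = rep_lsq 0 y"
        using AE_cellwise_cell[OF bBL, of x] AE_cell AE_rep_0[where 'b = "real^'n"]
      proof eventually_elim
        case (elim y)
        show ?case
        proof (cases "y \<in> \<Omega>")
          case True
          then obtain T where T: "T \<in> \<T>" "y \<in> interior T" using elim(3) by blast
          then have "BL T (rep_lsq x y) = 0" using elim(2,4) B0 by simp
          then show ?thesis using inv(1)[OF T(1), of "rep_lsq x y"] elim(4) by (simp add: BL_def)
        next
          case False then show ?thesis using elim by simp
        qed
      qed
      then show ?thesis by (rule lsq_eqI)
    qed
    show "c (x + y) z = c x z + c y z" if "x \<in> L2_on \<Omega>" "y \<in> L2_on \<Omega>" for x y z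
      using that subspace_add[OF subspace_L2_on, of x \<Omega> y] by (auto simp: c_eq inner_add_left)
    show "c (r *\<^sub>R x) z = r * c x z" if "x \<in> L2_on \<Omega>" for r x z
      using that subspace_scale[OF subspace_L2_on, of x \<Omega> r] by (auto simp: c_eq)
    show "c x y = c y x" if "x \<in> L2_on \<Omega>" "y \<in> L2_on \<Omega>" for x y
      using that Csym by (auto simp: c_eq)
    show "0 \<le> c x x" if "x \<in> L2_on \<Omega>" for x using that Cnonneg by (auto simp: c_eq)
  qed
  \<comment> \<open>Here the product structure is used: \<gamma> is constant on each cell, so
    multiplication by it rescales the local components of \<open>v\<close> and stays in the discrete
    space. Projection errors are therefore orthogonal to \<gamma> times \<open>v\<close>.\<close>
  have CLU: "cellwise CL v \<in> U\<^sub>h" if v: "v \<in> U\<^sub>h" for v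
  proof -
    obtain w where w: "\<forall>T\<in>\<T>. w T \<in> V T" "v = (\<Sum>T\<in>\<T>. w T)"
      using v unfolding U\<^sub>h_product broken_product_def by blast
    define y where "y = (\<Sum>T\<in>\<T>. \<gamma>T T *\<^sub>R w T)"
    have yU: "y \<in> U\<^sub>h"
      unfolding U\<^sub>h_product broken_product_def y_def
      using w(1) V by (auto intro!: exI[of _ "\<lambda>T. \<gamma>T T *\<^sub>R w T"] subspace_scale)
    have "cellwise CL v = y"
    proof (rule cellwise_eqI[OF bCL])
      show "y \<in> L2_on \<Omega>" using yU U\<^sub>h(3) by blast
      have out: "AE x in lebesgue. \<forall>T\<in>\<T>. x \<notin> T \<longrightarrow> rep_lsq (w T) x = 0"
        using w(1) V by (intro AE_finite_allI cells(1)) (auto simp: L2_on_def)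
      have sc: "AE x in lebesgue. \<forall>T\<in>\<T>. rep_lsq (\<gamma>T T *\<^sub>R w T) x = \<gamma>T T *\<^sub>R rep_lsq (w T) x"
        by (intro AE_finite_allI cells(1) AE_rep_scaleR)
      show "AE x in lebesgue. \<forall>T\<in>\<T>. x \<in> interior T \<longrightarrow> rep_lsq y x = CL T (rep_lsq v x)"
        using AE_rep_sum[OF cells(1), of w] AE_rep_sum[OF cells(1), of "\<lambda>T. \<gamma>T T *\<^sub>R w T"] out sc AE_interior_cell
      proof eventually_elim
        case (elim x)
        show ?case
        proof (intro ballI impI)
          fix T assume T: "T \<in> \<T>" "x \<in> interior T"
          have z: "rep_lsq (w T') x = 0" if "T' \<in> \<T>" "T' \<noteq> T" for T'
          proof -
            have "x \<notin> interior T'" using cells(5)[OF T(1) that(1)] that(2) T(2) by blast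
            then show ?thesis using elim(3,5) that(1) by blast
          qed
          have "rep_lsq v x = (\<Sum>T'\<in>\<T>. if T' = T then rep_lsq (w T) x else 0)"
            unfolding w(2) elim(1) using z by (intro sum.cong) auto
          moreover have "rep_lsq y x = (\<Sum>T'\<in>\<T>. if T' = T then \<gamma>T T * rep_lsq (w T) x else 0)"
            unfolding y_def elim(2) using z elim(4) by (intro sum.cong) auto
          ultimately show "rep_lsq y x = CL T (rep_lsq v x)" using T(1) cells(1) by (simp add: CL_def)
        qed
      qed
    qed
    then show ?thesis using yU by simp
  qed
  have Tne: "\<T> \<noteq> {}" using cells(6) \<Omega>(3) by (metis Union_empty closure_eq_empty)
  have hT: "diameter T \<le> h" if "T \<in> \<T>" for T
    unfolding h mesh_size_def using that cells(1) by (intro Max_ge) auto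
  \<comment> \<open>Every cell contains a ball, whose diameter bounds \<open>h\<close> from
    below.\<close>
  have h0: "0 < h"
  proof -
    obtain T where T: "T \<in> \<T>" using Tne by blast
    obtain x r where xr: "r > 0" "ball x r \<subseteq> T" using cells(4)[OF T] by (auto simp: mem_interior)
    have "diameter (ball x r) \<le> diameter T" using xr(2) cells(2)[OF T] by (intro diameter_subset compact_imp_bounded)
    moreover have "diameter (ball x r) = 2 * r" using xr(1) by (simp add: diameter_ball)
    ultimately show ?thesis using hT[OF T] xr(1) by simp
  qed
  \<comment> \<open>The square of \<open>h / pi\<close> from the Poincare inequality, divided by the
    coercivity constant of the flux form.\<close>
  define \<kappa> where "\<kappa> = h\<^sup>2 / (a0 * pi\<^sup>2)"
  have "lam\<^sub>h J / (1 + lam\<^sub>h J * \<kappa>) \<le> lam J"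
  proof (rule abstract_lower_bound[OF \<Sigma>\<^sub>h U\<^sub>h div _ _ _ lam[unfolded eig] lam\<^sub>h[unfolded eig] J])
    show "0 \<le> \<kappa>" using a0 by (simp add: \<kappa>_def)
    fix u v assume u: "u \<in> L2_on \<Omega>" and v: "v \<in> U\<^sub>h" and orth: "\<And>w. w \<in> U\<^sub>h \<Longrightarrow> (u - v) \<bullet> w = 0"
    define e where "e = u - v"
    have ue: "u = v + e" by (simp add: e_def)
    have vL: "v \<in> L2_on \<Omega>" using v U\<^sub>h(3) by blast
    \<comment> \<open>With \<open>u = v + e\<close> the mixed term vanishes, and the remaining term
      in \<open>e\<close> is nonnegative.\<close>
    have "c u u = v \<bullet> cellwise CL v + 2 * (e \<bullet> cellwise CL v) + e \<bullet> cellwise CL e"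
      unfolding c_eq[OF u] unfolding ue cellwise_add[OF bCL] using Csym[of v e]
      by (simp add: inner_add_left inner_add_right)
    also have "e \<bullet> cellwise CL v = 0" unfolding e_def by (rule orth[OF CLU[OF v]])
    finally show "c v v \<le> c u u" using Cnonneg[of e] c_eq[OF vL] by simp
  next
    fix u \<sigma> assume u: "u \<in> L2_on \<Omega>" and \<sigma>: "\<sigma> \<in> Hdiv \<Omega>"
      and eq: "\<And>\<tau>. \<tau> \<in> Hdiv \<Omega> \<Longrightarrow> a \<sigma> \<tau> + weak_div \<Omega> \<tau> \<bullet> u = 0"
    let ?g = "cellwise BL \<sigma>"
    have \<sigma>L: "\<sigma> \<in> L2_on \<Omega>" using \<sigma> HL by blast
    \<comment> \<open>The flux equation says that the inverse of \<open>A\<close> applied to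
      \<open>\<sigma>\<close> is the weak gradient of \<open>u\<close>.\<close>
    have "?g \<bullet> \<tau> + weak_div \<Omega> \<tau> \<bullet> u = 0" if "\<tau> \<in> Hdiv \<Omega>" for \<tau>
      using eq[OF that] Bsym[of \<sigma> \<tau>] by (simp add: a_eq[OF \<sigma>L] inner_commute)
    from piecewise_constant_approximation[OF cellwise_L2_on[OF bBL] this u hT h0]
    obtain w where w: "w \<in> P0 \<Omega> \<T>" "pi\<^sup>2 * (norm (u - w))\<^sup>2 \<le> h\<^sup>2 * (norm ?g)\<^sup>2" by blast
    have "a0 * (pi\<^sup>2 * (norm (u - w))\<^sup>2) \<le> a0 * (h\<^sup>2 * (norm ?g)\<^sup>2)"
      using w(2) a0 by (intro mult_left_mono) auto
    also have "\<dots> = h\<^sup>2 * (a0 * (norm ?g)\<^sup>2)" by simp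
    also have "\<dots> \<le> h\<^sup>2 * a \<sigma> \<sigma>" using Bcoer[of \<sigma>] by (intro mult_left_mono) (auto simp: a_eq[OF \<sigma>L])
    finally have "(norm (u - w))\<^sup>2 \<le> \<kappa> * a \<sigma> \<sigma>"
      using a0 by (simp add: \<kappa>_def field_simps)
    then show "\<exists>w\<in>U\<^sub>h. (norm (u - w))\<^sup>2 \<le> \<kappa> * a \<sigma> \<sigma>" using w(1) P0 by blast
  qed
  then show ?thesis by (simp add: \<kappa>_def)
qed

end
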